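(* Let $X\subseteq\mathbb{A}^n$ be an $\mathbb{F}_q$-variety of dimension $r$ and degree $d<q$, with decomposition $X=X_1\cup\dots\cup X_m$ and integers $0\le\sigma\le\rho\le m$ as described in the context, and let $U\subseteq\mathbb{F}_q^n$ be nonempty. Then: (i) $$\Delta\le \#U\cdot\Big(\sum_{0\neq u\in U-U}\ \sum_{1\le i,j\le\sigma}\#\big(X_i(\mathbb{F}_q)\cap X_j^{(u)}(\mathbb{F}_q)\big)+2\big(\#(U-U)-1\big)\sum_{\sigma<i\le m}\#X_i(\mathbb{F}_q)\Big).$$ (ii) If moreover $X$ is essentially $(U-U)$-shift-free, then $$\Delta\le \#U\,\big(\#(U-U)-1\big)\, d^2 q^{r-1}.$$
   Context: Let $p$ be a prime, $q$ a power of $p$, $\overline{\mathbb{F}_q}$ an algebraic closure of $\mathbb{F}_q$ and $\mathbb{A}^n=\overline{\mathbb{F}_q}^{\,n}$. An $\mathbb{F}_q$-variety is the common zero set in $\mathbb{A}^n$ of a set of polynomials in $\mathbb{F}_q[x_1,\dots,x_n]$; $X(\mathbb{F}_q)=X\cap\mathbb{F}_q^n$. The degree of an $\mathbb{F}_q$-irreducible variety $X$ is the maximum number of points in $X\cap L$ over affine linear subspaces $L$ of codimension $\dim X$ with $X\cap L$ finite; the degree of an arbitrary $\mathbb{F}_q$-variety is the sum of the degrees of its $\mathbb{F}_q$-irreducible components. Decomposition: write $X=X_1\cup\dots\cup X_m$ as the non-redundant union of its $\mathbb{F}_q$-irreducible components, numbered so that $X_1,\dots,X_\sigma$ are absolutely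 irreducible of dimension $r=\dim X$, $X_{\sigma+1},\dots,X_\rho$ are absolutely irreducible of dimension less than $r$, and $X_{\rho+1},\dots,X_m$ are not absolutely irreducible ($0\le\sigma\le\rho\le m$). For $u\in\mathbb{A}^n$, $X^{(u)}=\{a+u:a\in X\}$. For $U\subseteq\mathbb{F}_q^n$, $X$ is essentially $U$-shift-free if $X_i\neq X_j^{(u)}$ for all nonzero $u\in U$ and all $1\le i,j\le\sigma$ (vacuous if $\sigma=0$). For nonempty $U\subseteq\mathbb{F}_q^n$, $X(\mathbb{F}_q)+U=\{a+u: a\in X(\mathbb{F}_q),u\in U\}$, $U-U=\{v-w:v,w\in U\}$, and $\Delta=\#X(\mathbb{F}_q)\cdot\#U-\#(X(\mathbb{F}_q)+U)$. *)

theory Defs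
  imports "HOL-Algebra.Algebraic_Closure_Type" "HOL-Library.Poly_Mapping"
begin

text \<open>Polynomials in the variables indexed by the finite type 'n with coefficients in 'a:
  finitely supported maps from monomials (exponent vectors) to coefficients.
  Points of affine n-space over the algebraic closure are functions 'n => 'k alg_closure.\<close>

type_synonym ('n, 'a) mpoly = "('n \<Rightarrow>\<^sub>0 nat) \<Rightarrow>\<^sub>0 'a"

definition peval :: "('a \<Rightarrow> 'b::comm_ring_1) \<Rightarrow> ('n::finite, 'a::zero) mpoly \<Rightarrow> ('n \<Rightarrow> 'b) \<Rightarrow> 'b" where
  "peval \<phi> f x = (\<Sum>m\<in>Poly_Mapping.keys f. \<phi> (Poly_Mapping.lookup f m) * (\<Prod>i\<in>UNIV. x i ^ Poly_Mapping.lookup m i))"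

definition Fq_zero_set :: "('n::finite, 'k::{finite,field}) mpoly set \<Rightarrow> ('n \<Rightarrow> 'k alg_closure) set" where
  "Fq_zero_set S = {x. \<forall>f\<in>S. peval to_ac f x = 0}"

definition alg_zero_set :: "('n::finite, 'k::{finite,field} alg_closure) mpoly set \<Rightarrow> ('n \<Rightarrow> 'k alg_closure) set" where
  "alg_zero_set S = {x. \<forall>f\<in>S. peval id f x = 0}"

definition Fq_variety :: "('n::finite \<Rightarrow> 'k::{finite,field} alg_closure) set \<Rightarrow> bool" where
  "Fq_variety XX \<longleftrightarrow> (\<exists>P. XX = Fq_zero_set P)"

definition alg_variety :: "('n::finite \<Rightarrow> 'k::{finite,field} alg_closure) set \<Rightarrow> bool" where
  "alg_variety XX \<longleftrightarrow> (\<exists>P. XX = alg_zero_set P)"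

definition Fq_irreducible :: "('n::finite \<Rightarrow> 'k::{finite,field} alg_closure) set \<Rightarrow> bool" where
  "Fq_irreducible XX \<longleftrightarrow> Fq_variety XX \<and> XX \<noteq> {} \<and>
     (\<forall>Y Z. Fq_variety Y \<and> Fq_variety Z \<and> XX = Y \<union> Z \<longrightarrow> XX = Y \<or> XX = Z)"

definition abs_irreducible :: "('n::finite \<Rightarrow> 'k::{finite,field} alg_closure) set \<Rightarrow> bool" where
  "abs_irreducible XX \<longleftrightarrow> alg_variety XX \<and> XX \<noteq> {} \<and>
     (\<forall>Y Z. alg_variety Y \<and> alg_variety Z \<and> XX = Y \<union> Z \<longrightarrow> XX = Y \<or> XX = Z)"

definition Fq_components :: "('n::finite \<Rightarrow> 'k::{finite,field} alg_closure) set \<Rightarrow> ('n \<Rightarrow> 'k alg_closure) set set" where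
  "Fq_components XX = {Y. Y \<subseteq> XX \<and> Fq_irreducible Y \<and>
     (\<forall>Z. Fq_irreducible Z \<and> Y \<subseteq> Z \<and> Z \<subseteq> XX \<longrightarrow> Z = Y)}"

definition var_dim :: "('n::finite \<Rightarrow> 'k::{finite,field} alg_closure) set \<Rightarrow> int" where
  "var_dim XX = (if XX = {} then -1 else int (Sup {k. \<exists>Y :: nat \<Rightarrow> ('n \<Rightarrow> 'k alg_closure) set.
       (\<forall>i\<le>k. abs_irreducible (Y i) \<and> Y i \<subseteq> XX) \<and> (\<forall>i<k. Y i \<subset> Y (Suc i))}))"

definition affine_subspace_codim :: "nat \<Rightarrow> ('n::finite \<Rightarrow> 'k::{finite,field} alg_closure) set \<Rightarrow> bool" where
  "affine_subspace_codim c L \<longleftrightarrow> (\<exists>(a :: nat \<Rightarrow> 'n \<Rightarrow> 'k alg_closure) (b :: nat \<Rightarrow> 'k alg_closure).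
     (\<forall>lam :: nat \<Rightarrow> 'k alg_closure. (\<forall>j. (\<Sum>i<c. lam i * a i j) = 0) \<longrightarrow> (\<forall>i<c. lam i = 0)) \<and>
     L = {x. \<forall>i<c. (\<Sum>j\<in>UNIV. a i j * x j) = b i})"

definition irr_degree :: "('n::finite \<Rightarrow> 'k::{finite,field} alg_closure) set \<Rightarrow> nat" where
  "irr_degree XX = Sup {card (XX \<inter> L) | L. affine_subspace_codim (nat (var_dim XX)) L \<and> finite (XX \<inter> L)}"

definition var_degree :: "('n::finite \<Rightarrow> 'k::{finite,field} alg_closure) set \<Rightarrow> nat" where
  "var_degree XX = (\<Sum>Y\<in>Fq_components XX. irr_degree Y)"

definition Fq_points :: "('n::finite \<Rightarrow> 'k::{finite,field} alg_closure) set" where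
  "Fq_points = {x. \<forall>i. x i \<in> range to_ac}"

definition shift :: "('n \<Rightarrow> 'a::plus) \<Rightarrow> ('n \<Rightarrow> 'a) set \<Rightarrow> ('n \<Rightarrow> 'a) set" where
  "shift u XX = (\<lambda>a. \<lambda>i. a i + u i) ` XX"

definition sumset :: "('n \<Rightarrow> 'a::plus) set \<Rightarrow> ('n \<Rightarrow> 'a) set \<Rightarrow> ('n \<Rightarrow> 'a) set" where
  "sumset A B = {(\<lambda>i. a i + b i) | a b. a \<in> A \<and> b \<in> B}"

definition diffset :: "('n \<Rightarrow> 'a::minus) set \<Rightarrow> ('n \<Rightarrow> 'a) set" where
  "diffset U = {(\<lambda>i. v i - w i) | v w. v \<in> U \<and> w \<in> U}"

definition top_abs_components :: "('n::finite \<Rightarrow> 'k::{finite,field} alg_closure) set \<Rightarrow> ('n \<Rightarrow> 'k alg_closure) set set" where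
  "top_abs_components XX = {Y \<in> Fq_components XX. abs_irreducible Y \<and> var_dim Y = var_dim XX}"

definition ess_shift_free :: "('n::finite \<Rightarrow> 'k::{finite,field} alg_closure) set \<Rightarrow> ('n \<Rightarrow> 'k alg_closure) set \<Rightarrow> bool" where
  "ess_shift_free XX V \<longleftrightarrow> (\<forall>u\<in>V. u \<noteq> (\<lambda>i. 0) \<longrightarrow>
     (\<forall>Yi\<in>top_abs_components XX. \<forall>Yj\<in>top_abs_components XX. Yi \<noteq> shift u Yj))"

end

theory Submission
  imports Defs "HOL-Library.Function_Algebras"
begin

text \<open>Double counting the representations of the points of \<open>X(F\<^sub>q) + U\<close> bounds twice \<open>\<Delta>\<close> by \<open>#U\<close> times the sum of
 \<open>#(X(F\<^sub>q) \<inter> (X(F\<^sub>q) + w))\<close> over \<open>0 \<noteq> w \<in> U - U\<close>; splitting \<open>X\<close> into components gives (i). For (ii), \<open>X\<^sub>i \<inter> X\<^sub>j\<^sup>(\<^sup>w\<^sup>)\<close> is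
 cut out of \<open>X\<^sub>i\<close> by a hypersurface of degree at most \<open>deg X\<^sub>j\<close> not containing \<open>X\<^sub>i\<close>, and the rational points of a component
 that is not absolutely irreducible lie on two distinct conjugates. Rational points are the common zeros of the
 \<open>x\<^sub>i\<^sup>q - x\<^sub>i\<close>, so both counts follow from a Bezout inequality, obtained by comparing the Hilbert function of \<open>X\<^sub>i\<close> with the
 dimensions of spaces of jets at the points counted. Polynomials are represented as functions on affine space.\<close>

section \<open>Polynomial functions\<close>

text \<open>The degree is defined by counting points on linear sections, without multiplicities,
  whereas the Bezout estimates need it as a bound for the leading coefficient of the Hilbert
  function. This forces a Noether normalization that stays separable in characteristic
  \<open>p\<close>: then some fibre is reduced, and its cardinality both controls the Hilbert
  function and is attained by a linear section. The other half of a Bezout estimate is a lower bound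
  for jets, needed at every rational point, singular or not: locally everywhere the dimension must
  be at least that of the variety. A hypersurface section has to gain a factor \<open>M / q\<close>
  over all rational points; since it may be reducible, its jets are compared with increments of the
  Hilbert function instead of splitting it. Its equation is adjoined to the
  \<open>x ^ q - x\<close>, as one of degree at most \<open>q\<close>; this is where
  \<open>d < q\<close> enters. Twice \<open>Delta\<close> is bounded because the degrees
  \<open>a\<close> and \<open>b\<close> carried by the two kinds of components enter as
  \<open>a ^ 2 + 2 * b ^ 2\<close>, which is at most \<open>2 * (a + b) ^ 2\<close> but not always
  at most \<open>(a + b) ^ 2\<close>.\<close>

lemma sum_fun_apply [simp]: "(\<Sum>i\<in>A. f i) x = (\<Sum>i\<in>A. f i x)"
 by (induction A rule: infinite_finite_induct) auto

lemma prod_fun_apply [simp]: "(\<Prod>i\<in>A. f i) x = (\<Prod>i\<in>A. f i x)"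
 by (induction A rule: infinite_finite_induct) auto

lemma power_fun_apply [simp]: "(f ^ n) x = (f x :: 'a::comm_ring_1) ^ n"
 by (induction n) auto

type_synonym ('i, 'a) fn = "('i => 'a) => 'a"

definition cfun :: "'a => 'x => 'a" where "cfun c = (%_. c)"

definition coord :: "'i => ('i, 'a) fn" where "coord i = (%x. x i)"

text \<open>Substitution is composition of functions, hence a ring homomorphism by pointwise
  evaluation, whatever the target space \<open>'x\<close>.\<close>

definition sub :: "('i => 'x => 'a) => (('i => 'a) => 'b) => 'x => 'b" where
 "sub v f = (%p. f (%i. v i p))"

lemma cfun_apply [simp]: "cfun c x = c" by (simp add: cfun_def)
lemma coord_apply [simp]: "coord i x = x i" by (simp add: coord_def)
lemma sub_apply: "sub v f p = f (%i. v i p)" by (simp add: sub_def)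

text \<open>Pointwise evaluation is kept out of the simpset: induction rules instantiated with functions
 produce eta-expanded goals, which these equations would turn into unfolded lambda terms.\<close>
lemmas ev = plus_fun_apply zero_fun_apply one_fun_apply times_fun_apply uminus_apply minus_apply
 sum_fun_apply prod_fun_apply power_fun_apply cfun_apply coord_apply sub_apply
declare ev [simp del]

lemma cfun_simps:
 "cfun (a + b :: 'a::comm_ring_1) = cfun a + cfun b" "cfun (a * b :: 'a::comm_ring_1) = cfun a * cfun b"
 "cfun (a - b :: 'a::comm_ring_1) = cfun a - cfun b"
 "cfun (- a :: 'a::comm_ring_1) = - cfun a" "cfun (0::'a::comm_ring_1) = 0" "cfun (1::'a::comm_ring_1) = 1"
 "cfun (c ^ k) = cfun (c::'a::comm_ring_1) ^ k"
 by (auto simp: fun_eq_iff ev)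

lemma sub_simps [simp]:
 "sub v (f + g) = sub v f + sub v g" "sub v (f * g) = sub v f * sub v g"
 "sub v (f - g) = sub v f - (sub v g :: 'x => 'a::comm_ring_1)" "sub v (- f) = - (sub v f :: 'x => 'a::comm_ring_1)"
 "sub v 0 = (0 :: 'x => 'a::comm_ring_1)" "sub v 1 = (1 :: 'x => 'a::comm_ring_1)"
 "sub v (cfun c) = cfun c" "sub v (coord i) = v i"
 "sub v (f ^ k) = (sub v f :: 'x => 'a::comm_ring_1) ^ k"
 by (auto simp: fun_eq_iff ev)

lemma sub_sum [simp]: "sub v (\<Sum>i\<in>A. f i) = (\<Sum>i\<in>A. sub v (f i) :: 'x => 'a::comm_ring_1)"
 by (auto simp: fun_eq_iff ev)

inductive monomial_fun :: "'i set => nat => ('i, 'a::comm_ring_1) fn => bool" for I where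
 monomial_one: "monomial_fun I 0 1"
| monomial_step: "monomial_fun I d m ==> i : I ==> monomial_fun I (Suc d) (coord i * m)"

text \<open>The degrees form a set so that one development serves four purposes:
  \<open>{..t}\<close> bounds the degree, \<open>{t}\<close> gives forms, \<open>{t..}\<close> gives
  functions vanishing at the origin to order \<open>t\<close>, \<open>UNIV\<close> gives all
  polynomials. Degrees belong to a representation; that the function determines them is shown only
  for lowest and highest forms (\<open>pfun_lowest_unique\<close>,
  \<open>pfun_top_unique\<close>).\<close>

inductive is_pfun :: "'i set => nat set => ('i, 'a::comm_ring_1) fn => bool" for I D where
 is_pfun_zero: "is_pfun I D 0"
| is_pfun_step: "is_pfun I D f ==> d : D ==> monomial_fun I d m ==> is_pfun I D (cfun c * m + f)"

definition pfun :: "'i set => nat set => ('i, 'a::comm_ring_1) fn set" where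
 "pfun I D = {f. is_pfun I D f}"

lemma pfun_zero: "0 : pfun I D"
 by (simp add: pfun_def is_pfun_zero)

lemma pfun_step: "f : pfun I D ==> d : D ==> monomial_fun I d m ==> cfun c * m + f : pfun I D"
 by (simp add: pfun_def is_pfun_step)

lemma pfun_induct [consumes 1, case_names zero step]:
 assumes "f : pfun I D" "P 0"
  "!!f d m c. f : pfun I D ==> P f ==> d : D ==> monomial_fun I d m ==> P (cfun c * m + f)"
 shows "P f"
proof -
 have "is_pfun I D f" using assms(1) by (simp add: pfun_def)
 then have "is_pfun I D f \<and> P f"
  by (rule is_pfun.induct) (use assms(2,3) in "simp_all add: pfun_def is_pfun.intros")
 then show ?thesis by simp
qed

abbreviation polys where "polys I == pfun I UNIV"

lemma pfun_add: "f : pfun I D ==> g : pfun I D ==> f + g : pfun I D"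
 by (induction rule: pfun_induct) (auto simp: add.assoc intro: pfun_zero pfun_step)

lemma pfun_monomial: "monomial_fun I d m ==> d : D ==> m : pfun I D"
 using pfun_step[OF pfun_zero, of d D I m "1"] by (simp add: cfun_simps)

lemma pfun_scale: "f : pfun I D ==> cfun c * f : pfun I D"
proof (induction rule: pfun_induct)
 case zero
 have "cfun c * 0 : pfun I D" by (simp add: pfun_zero)
 then show ?case .
next
 case (step f d m c')
 have "cfun c * (cfun c' * m + f) = cfun (c * c') * m + cfun c * f"
  by (simp add: cfun_simps algebra_simps)
 then show ?case using step by (metis pfun_step)
qed

lemma pfun_uminus: "f : pfun I D ==> - f : pfun I D"
 using pfun_scale[of f I D "-1"] by (simp add: cfun_simps)

lemma pfun_diff: "f : pfun I D ==> g : pfun I D ==> f - g : pfun I D"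
 using pfun_add[OF _ pfun_uminus, of f I D g] by simp

lemma pfun_sum: "(!!i. i : A ==> f i : pfun I D) ==> (\<Sum>i\<in>A. f i) : pfun I D"
 by (induction A rule: infinite_finite_induct) (auto intro: pfun_zero pfun_add)

lemma monomial_mono: "monomial_fun I d m ==> I <= J ==> monomial_fun J d m"
 by (induction rule: monomial_fun.induct) (auto intro: monomial_fun.intros)

lemma pfun_mono: "f : pfun I D ==> I <= J ==> D <= E ==> f : pfun J E"
 by (induction rule: pfun_induct) (auto intro: pfun_zero pfun_step monomial_mono)

lemma pfun_polys: "f : pfun I D ==> f : polys I"
 by (erule pfun_mono) auto

lemma pfun_const: "0 : D ==> cfun c : pfun I D"
 using pfun_step[OF pfun_zero _ monomial_one, of D c I] by simp

lemma pfun_one: "0 : D ==> 1 : pfun I D"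
 using pfun_const[of D 1 I] by (simp add: cfun_simps)

lemma pfun_coord: "1 : D ==> i : I ==> coord i : pfun I D"
 using pfun_monomial[OF monomial_step[OF monomial_one]] by auto

lemma monomial_mult: "monomial_fun I d m ==> monomial_fun I e m' ==> monomial_fun I (d + e) (m * m')"
 by (induction rule: monomial_fun.induct) (auto simp: mult.assoc intro: monomial_fun.intros)

lemma pfun_mult_monomial:
 "f : pfun I D ==> monomial_fun I e m ==> (!!a. a : D ==> a + e : E) ==> f * m : pfun I E"
proof (induction rule: pfun_induct)
 case (step f d m' c')
 have "(cfun c' * m' + f) * m = cfun c' * (m' * m) + f * m"
  by (simp add: algebra_simps)
 then show ?case using step by (metis pfun_step monomial_mult)
qed (auto intro: pfun_zero)

lemma pfun_mult:
 assumes "f : pfun I D" "g : pfun I D'" "!!a b. a : D ==> b : D' ==> a + b : E"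
 shows "f * g : pfun I E"
 using assms(2,1,3)
proof (induction rule: pfun_induct)
 case (step g d m c)
 have "f * (cfun c * m + g) = cfun c * (f * m) + f * g" by (simp add: algebra_simps)
 moreover have "f * m : pfun I E" using step by (intro pfun_mult_monomial) auto
 ultimately show ?case using step by (metis pfun_add pfun_scale)
qed (auto intro: pfun_zero)

lemma pfun_mult_le: "f : pfun I {..s} ==> g : pfun I {..t} ==> f * g : pfun I {..s+t}"
 by (erule pfun_mult) auto

lemma pfun_mult_eq: "f : pfun I {s} ==> g : pfun I {t} ==> f * g : pfun I {s+t}"
 by (erule pfun_mult) auto

lemma pfun_mult_ge: "f : pfun I {s..} ==> g : pfun I {t..} ==> f * g : pfun I {s+t..}"
 by (erule pfun_mult) auto

lemma polys_mult: "f : polys I ==> g : polys I ==> f * g : polys I"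
 by (erule pfun_mult) auto

lemma polys_power: "f : polys I ==> f ^ k : polys I"
 by (induction k) (auto intro: pfun_one polys_mult)

lemma polys_prod: "(!!i. i : A ==> f i : polys I) ==> (\<Prod>i\<in>A. f i) : polys I"
 by (induction A rule: infinite_finite_induct) (auto intro: pfun_one polys_mult)

lemma pfun_power_le: "f : pfun I {..s} ==> f ^ k : pfun I {..k*s}"
 by (induction k) (auto intro: pfun_one pfun_mult_le)

lemma pfun_power_eq: "f : pfun I {s} ==> f ^ k : pfun I {k*s}"
 by (induction k) (auto intro: pfun_one pfun_mult_eq)

lemma pfun_power_ge: "f : pfun I {s..} ==> f ^ k : pfun I {k*s..}"
 by (induction k) (auto intro: pfun_one pfun_mult_ge)

lemma pfun_Un:
 assumes "f : pfun I (D \<union> E)"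
 obtains g h where "g : pfun I D" "h : pfun I E" "f = g + h"
proof -
 have "\<exists>g\<in>pfun I D. \<exists>h\<in>pfun I E. f = g + h"
  using assms
 proof (induction rule: pfun_induct)
  case (step f d m c)
  then obtain g h where gh: "g : pfun I D" "h : pfun I E" "f = g + h" by blast
  show ?case
  proof (cases "d : D")
   case True
   then have "cfun c * m + g : pfun I D" using gh step by (auto intro: pfun_step)
   then show ?thesis using gh by (metis add.assoc)
  next
   case False
   then have "cfun c * m + h : pfun I E" using gh step by (auto intro: pfun_step)
   then show ?thesis using gh by (metis add.left_commute)
  qed
 qed (auto intro!: bexI[of _ 0] pfun_zero)
 then show ?thesis using that by auto
qed

lemma pfun_bounded:
 assumes "f : pfun I D" obtains t where "f : pfun I (D \<inter> {..t})"
proof -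
 have "\<exists>t. f : pfun I (D \<inter> {..t})" using assms
 proof (induction rule: pfun_induct)
  case (step f d m c)
  then obtain t where t: "f : pfun I (D \<inter> {..t})" by blast
  have "f : pfun I (D \<inter> {..max t d})" using t by (rule pfun_mono) auto
  then have "cfun c * m + f : pfun I (D \<inter> {..max t d})"
   using step by (intro pfun_step) auto
  then show ?case by blast
 qed (use pfun_zero in blast)
 then show ?thesis using that by auto
qed

lemma polys_bounded:
 assumes "f : polys I" obtains t where "f : pfun I {..t}"
 using pfun_bounded[OF assms] by auto

lemma pfun_empty_degrees: "f : pfun I {} ==> f = 0"
 by (induction rule: pfun_induct) auto

lemma monomial_scale: "monomial_fun I d m ==> m (%i. t * x i) = t ^ d * m x"
 by (induction rule: monomial_fun.induct) (auto simp: ev algebra_simps)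

lemma pfun_hom: "f : pfun I {d} ==> f (%i. t * x i) = t ^ d * f x"
 by (induction rule: pfun_induct) (auto simp: ev monomial_scale algebra_simps)

lemma monomial_cong: "monomial_fun I d m ==> (!!i. i : I ==> x i = y i) ==> m x = m y"
 by (induction rule: monomial_fun.induct) (auto simp: ev)

lemma pfun_cong: "f : pfun I D ==> (!!i. i : I ==> x i = y i) ==> f x = f y"
proof (induction rule: pfun_induct)
 case (step f d m c)
 then show ?case using monomial_cong[of I d m x y] by (simp add: ev)
qed (simp add: ev)

lemma sub_monomial:
 assumes "monomial_fun I d m" "!!i. i : I ==> v i : pfun J E" "0 : G 0"
  "!!d a b. a : E ==> b : G d ==> a + b : G (Suc d)"
 shows "sub v m : pfun J (G d)"
 using assms(1)
proof (induction rule: monomial_fun.induct)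
 case monomial_one
 then show ?case using assms(3) by (simp add: pfun_one)
next
 case (monomial_step d m i)
 then show ?case using assms(2,4) by (auto intro!: pfun_mult)
qed

text \<open>\<open>G d\<close> collects the degrees that can arise from a monomial of degree
  \<open>d\<close>, each of whose \<open>d\<close> factors contributes a degree from
  \<open>E\<close>.\<close>

lemma sub_pfun:
 assumes "f : pfun I D" "!!i. i : I ==> v i : pfun J E" "0 : G 0"
  "!!d a b. a : E ==> b : G d ==> a + b : G (Suc d)" "!!d. d : D ==> G d <= F"
 shows "sub v f : pfun J F"
 using assms(1)
proof (induction rule: pfun_induct)
 case zero then show ?case by (simp add: pfun_zero)
next
 case (step f d m c)
 have "sub v m : pfun J (G d)" using sub_monomial[OF step(3) assms(2-4)] .
 then have "sub v m : pfun J F" by (rule pfun_mono) (use step assms(5) in auto)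
 then show ?case using step by (auto intro: pfun_add pfun_scale)
qed

lemma sub_pfun_le:
 assumes "f : pfun I {..t}" "!!i. i : I ==> v i : pfun J {..e}"
 shows "sub v f : pfun J {..t * e}"
proof (rule sub_pfun[OF assms, where G = "%d. {..d * e}"])
 fix d assume "d : {..t}" then have "d * e <= t * e" by simp
 then show "{..d * e} <= {..t * e}" by simp
qed auto

lemma sub_pfun_le1:
 assumes "f : pfun I {..t}" "!!i. i : I ==> v i : pfun J {..1}"
 shows "sub v f : pfun J {..t}"
 using sub_pfun_le[OF assms] by simp

lemma sub_pfun_eq:
 assumes "f : pfun I {t}" "!!i. i : I ==> v i : pfun J {1}"
 shows "sub v f : pfun J {t}"
 by (rule sub_pfun[OF assms, where G = "%d. {d}"]) auto

lemma sub_pfun_ge: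
 assumes "f : pfun I {t..}" "!!i. i : I ==> v i : pfun J {1..}"
 shows "sub v f : pfun J {t..}"
 by (rule sub_pfun[OF assms, where G = "%d. {d..}"]) auto

lemma sub_polys:
 assumes "f : polys I" "!!i. i : I ==> v i : polys J"
 shows "sub v f : polys J"
 by (rule sub_pfun[OF assms, where G = "%_. UNIV"]) auto

lemma monomial_line:
 "monomial_fun I d m ==> \<exists>p. degree p <= d \<and> (\<forall>t. m (%i. x i + t * v i) = poly p t)"
proof (induction rule: monomial_fun.induct)
 case monomial_one
 then show ?case by (intro exI[of _ 1]) (auto simp: ev)
next
 case (monomial_step d m i)
 then obtain p where p: "degree p <= d" "\<forall>t. m (%i. x i + t * v i) = poly p t" by auto
 have "degree ([:x i, v i:] * p) <= 1 + d"
  by (rule order.trans[OF degree_mult_le add_mono]) (use p in auto)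
 then show ?case using p(2)
  by (intro exI[of _ "[:x i, v i:] * p"] conjI) (auto simp: ev algebra_simps)
qed

text \<open>A function has no coefficients to compare, but the univariate polynomials obtained on
  lines do; many identities between polynomial functions are derived from them.\<close>

lemma pfun_line:
 assumes "f : pfun I {..n}"
 obtains p where "degree p <= n" "!!t. f (%i. x i + t * v i) = poly p t"
proof -
 have "\<exists>p. degree p <= n \<and> (\<forall>t. f (%i. x i + t * v i) = poly p t)"
  using assms
 proof (induction rule: pfun_induct)
  case zero then show ?case by (intro exI[of _ 0]) (auto simp: ev)
 next
  case (step f d m c)
  then obtain p where p: "degree p <= n" "\<forall>t. f (%i. x i + t * v i) = poly p t" by auto
  obtain q where q: "degree q <= d" "\<forall>t. m (%i. x i + t * v i) = poly q t"
   using monomial_line[OF step(3)] by blast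
  have "degree (smult c q + p) <= n"
   using p q step(2) by (auto intro!: degree_add_le order.trans[OF degree_smult_le])
  then show ?case using p q by (intro exI[of _ "smult c q + p"]) (auto simp: ev)
 qed
 then show ?thesis using that by blast
qed

text \<open>Euclid's argument: over a finite field the product of all \<open>X - a\<close>, plus 1,
  would have positive degree and no root.\<close>

lemma infinite_alg_closed: "infinite (UNIV :: 'a::alg_closed_field set)"
proof
 assume fin: "finite (UNIV :: 'a set)"
 define p :: "'a poly" where "p = (\<Prod>a\<in>UNIV. [:-a, 1:]) + 1"
 have "degree (\<Prod>a\<in>(UNIV::'a set). [:-a, 1:]) = (\<Sum>a\<in>(UNIV::'a set). degree [:-a, 1:])"
  by (rule degree_prod_eq_sum_degree) auto
 moreover have "... = card (UNIV :: 'a set)" by simp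
 moreover have "card (UNIV :: 'a set) > 0" using fin by (simp add: card_gt_0_iff)
 ultimately have "degree p > 0" unfolding p_def
  by (metis degree_1 degree_add_eq_left)
 then obtain x where "poly p x = 0" using alg_closed_imp_poly_has_root by blast
 moreover have "poly (\<Prod>a\<in>(UNIV::'a set). [:-a, 1:]) x = 0"
  unfolding poly_prod using fin by (intro prod_zero) (auto intro!: bexI[of _ x])
 ultimately show False by (simp add: p_def)
qed

lemma poly_zero_if_all_roots:
 "(!!t. poly p t = 0) ==> p = (0 :: 'a::alg_closed_field poly)"
 by (metis (mono_tags, lifting) Collect_mono_iff UNIV_def finite_subset infinite_alg_closed poly_roots_finite)

text \<open>On the line joining a point with \<open>f x ~= 0\<close> to a point with
  \<open>g y ~= 0\<close> both factors become nonzero univariate polynomials.\<close>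

lemma polys_domain:
 assumes "f : polys I" "g : polys I" "f * g = (0 :: ('i, 'a::alg_closed_field) fn)"
 shows "f = 0 \<or> g = 0"
proof (rule ccontr)
 assume "\<not> ?thesis"
 then obtain x y where xy: "f x ~= 0" "g y ~= 0" by (auto simp: fun_eq_iff ev)
 obtain s where "f : pfun I {..s}" using assms(1) by (rule polys_bounded)
 then obtain p where p: "!!t. f (%i. x i + t * (y i - x i)) = poly p t"
  using pfun_line[of f I s x "%i. y i - x i"] by metis
 obtain s' where "g : pfun I {..s'}" using assms(2) by (rule polys_bounded)
 then obtain q where q: "!!t. g (%i. x i + t * (y i - x i)) = poly q t"
  using pfun_line[of g I s' x "%i. y i - x i"] by metis
 have "poly (p * q) t = 0" for t
  using fun_cong[OF assms(3), of "%i. x i + t * (y i - x i)"] p q by (simp add: ev)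
 then have "p * q = 0" by (rule poly_zero_if_all_roots)
 moreover have "p ~= 0" using p[of 0] xy by auto
 moreover have "q ~= 0" using q[of 1] xy by auto
 ultimately show False by simp
qed

lemma polys_power_zero:
 assumes "f : polys I" "f ^ k = (0 :: ('i, 'a::alg_closed_field) fn)" shows "f = 0"
 using assms(2) by (auto simp: fun_eq_iff ev)

lemma polys_prod_nonzero:
 assumes "finite A" "!!j. j : A ==> f j : polys I" "!!j. j : A ==> f j ~= (0 :: ('i, 'a::alg_closed_field) fn)"
 shows "(\<Prod>j\<in>A. f j) ~= 0"
 using assms
proof (induction rule: finite_induct)
 case (insert a A)
 then show ?case using polys_domain[of "f a" I "\<Prod>j\<in>A. f j"] polys_prod[of A f I] by auto
qed auto

text \<open>The source of the generic choices below: finitely many open conditions are met at one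
  point because the product of their equations is nonzero.\<close>

lemma polys_common_nonzero:
 assumes "finite A" "!!j. j : A ==> f j : polys I" "!!j. j : A ==> f j ~= (0 :: ('i, 'a::alg_closed_field) fn)"
 obtains x where "!!j. j : A ==> f j x ~= 0"
proof -
 have "(\<Prod>j\<in>A. f j) ~= 0" using polys_prod_nonzero[OF assms] by auto
 then obtain x where "(\<Prod>j\<in>A. f j) x ~= 0" by (auto simp: fun_eq_iff ev)
 then show ?thesis using that assms(1) by (auto simp: ev)
qed

section \<open>Expansion in one variable, lowest and highest forms\<close>

lemma monomial_split:
 "monomial_fun I d m ==> \<exists>k m'. k <= d \<and> monomial_fun (I - {i}) (d - k) m' \<and> m = m' * coord i ^ k"
proof (induction rule: monomial_fun.induct)
 case monomial_one
 show ?case by (intro exI[of _ 0] exI[of _ 1]) (auto intro: monomial_fun.intros)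
next
 case (monomial_step d m j)
 then obtain k m' where km: "k <= d" "monomial_fun (I - {i}) (d - k) m'" "m = m' * coord i ^ k" by auto
 show ?case
 proof (cases "j = i")
  case True
  then show ?thesis using km by (intro exI[of _ "Suc k"] exI[of _ m']) (auto simp: algebra_simps)
 next
  case False
  then show ?thesis using km monomial_step
   by (intro exI[of _ k] exI[of _ "coord j * m'"])
     (auto simp: mult.assoc Suc_diff_le intro: monomial_fun.intros)
 qed
qed

text \<open>A term of degree \<open>d\<close> contributes degree \<open>d - k\<close> to the
  coefficient of the \<open>k\<close>-th power; the intersection with \<open>{k..}\<close> excludes
  truncated subtraction. In this form the lemma covers forms and bounded degrees alike.\<close>

lemma pfun_split:
 assumes "f : pfun I D" "D <= {..t}"
 obtains a where "!!k. a k : pfun (I - {i}) ((%d. d - k) ` (D \<inter> {k..}))"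
  "f = (\<Sum>k\<le>t. a k * coord i ^ k)"
proof -
 have "\<exists>a. (\<forall>k. a k : pfun (I - {i}) ((%d. d - k) ` (D \<inter> {k..}))) \<and> f = (\<Sum>k\<le>t. a k * coord i ^ k)"
  using assms(1)
 proof (induction rule: pfun_induct)
  case zero
  then show ?case by (intro exI[of _ "%_. 0"]) (auto intro: pfun_zero)
 next
  case (step f d m c)
  then obtain a where a: "!!k. a k : pfun (I - {i}) ((%d. d - k) ` (D \<inter> {k..}))"
   "f = (\<Sum>k\<le>t. a k * coord i ^ k)" by blast
  obtain k0 m' where km: "k0 <= d" "monomial_fun (I - {i}) (d - k0) m'" "m = m' * coord i ^ k0"
   using monomial_split[OF step(3)] by blast
  have "k0 <= t" using km step assms by auto
  define b where "b = (%k. (if k = k0 then cfun c * m' else 0) + a k)"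
  have "b k : pfun (I - {i}) ((%d. d - k) ` (D \<inter> {k..}))" for k
   using a(1)[of k] km step(2) by (auto simp: b_def intro!: pfun_step)
  moreover have "cfun c * m + f = (\<Sum>k\<le>t. b k * coord i ^ k)"
  proof -
   have "(\<Sum>k\<le>t. b k * coord i ^ k)
    = (\<Sum>k\<le>t. (if k = k0 then cfun c * m' * coord i ^ k0 else 0) + a k * coord i ^ k)"
    by (rule sum.cong) (auto simp: b_def distrib_right)
   also have "... = cfun c * m' * coord i ^ k0 + f"
    using `k0 <= t` by (simp add: sum.distrib a(2))
   finally show ?thesis by (simp add: km(3) mult.assoc)
  qed
  ultimately show ?case by blast
 qed
 then show ?thesis using that by blast
qed

lemma pfun_split_le:
 assumes "f : pfun I {..t}"
 obtains a where "!!k. a k : pfun (I - {i}) {..t - k}" "f = (\<Sum>k\<le>t. a k * coord i ^ k)"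
proof -
 obtain a where a: "!!k. a k : pfun (I - {i}) ((%d. d - k) ` ({..t} \<inter> {k..}))" "f = (\<Sum>k\<le>t. a k * coord i ^ k)"
  using pfun_split[OF assms order.refl, of i] by blast
 show ?thesis by (rule that[of a]) (use a in "auto intro!: pfun_mono[OF a(1)]")
qed

lemma pfun_no_vars: "f : pfun {} D ==> \<exists>c. f = cfun c"
proof (induction rule: pfun_induct)
 case zero then show ?case by (intro exI[of _ 0]) (simp add: cfun_simps)
next
 case (step f d m c)
 from step(3) have "m = 1" by (cases rule: monomial_fun.cases) auto
 then show ?case using step by (metis cfun_simps(1) mult.right_neutral)
qed

text \<open>Homogeneous parts are split off from below until a nonzero one appears; the degree bound
  \<open>t\<close> makes this stop, since a function without terms is zero.\<close>

lemma pfun_lowest: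
 assumes "f : pfun I D" "f ~= 0"
 obtains d g where "d : D" "g : pfun I {d}" "g ~= 0" "f - g : pfun I (D \<inter> {Suc d..})"
proof -
 obtain t where t: "f : pfun I (D \<inter> {..t})" using assms(1) by (rule pfun_bounded)
 have main: "\<exists>d g. d : D \<and> g : pfun I {d} \<and> g ~= 0 \<and> f - g : pfun I (D \<inter> {Suc d..})"
  if "f : pfun I (D \<inter> {k..t})" for k
  using that
 proof (induction "Suc t - k" arbitrary: k)
  case 0
  then have "D \<inter> {k..t} = {}" by auto
  then show ?case using 0 assms(2) pfun_empty_degrees by fastforce
 next
  case (Suc n)
  have "D \<inter> {k..t} <= (D \<inter> {k}) \<union> (D \<inter> {Suc k..t})" by auto
  then have "f : pfun I ((D \<inter> {k}) \<union> (D \<inter> {Suc k..t}))" using Suc.prems by (auto intro: pfun_mono)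
  then obtain g h where gh: "g : pfun I (D \<inter> {k})" "h : pfun I (D \<inter> {Suc k..t})" "f = g + h"
   by (rule pfun_Un)
  show ?case
  proof (cases "g = 0")
   case True
   then show ?thesis using Suc.hyps(1)[of "Suc k"] Suc.hyps(2) gh by simp
  next
   case False
   then have "k : D" using gh(1) pfun_empty_degrees[of g I] by (cases "k : D") auto
   moreover have "g : pfun I {k}" using gh(1) by (rule pfun_mono) auto
   moreover have "f - g : pfun I (D \<inter> {Suc k..})" using gh by (auto intro: pfun_mono)
   ultimately show ?thesis using False by blast
  qed
 qed
 have "f : pfun I (D \<inter> {0..t})" using t by (rule pfun_mono) auto
 from main[OF this] show ?thesis using that by auto
qed

lemma pfun_highest:
 assumes "f : pfun I {..t}" "f ~: pfun I {..<t}"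
 obtains g where "g : pfun I {t}" "g ~= 0" "f - g : pfun I {..<t}"
proof -
 have "f : pfun I ({t} \<union> {..<t})" using assms(1) by (rule pfun_mono) auto
 then obtain g h where gh: "g : pfun I {t}" "h : pfun I {..<t}" "f = g + h" by (rule pfun_Un)
 then show ?thesis using assms(2) by (intro that[of g]) auto
qed

section \<open>Elimination and the Nullstellensatz\<close>

text \<open>The determinant trick behind Cayley-Hamilton and Nakayama's lemma, by elimination
  without division. \<open>P1 i\<close> and \<open>P0 i\<close> are classes for diagonal and
  off-diagonal entries: monic against lower degree, value 1 against value 0 at a point, a prescribed
  lowest part against higher order. The index doubles with each eliminated row because entries
  become differences of products of two entries. The element \<open>g\<close> plays the role of the
  determinant.\<close>

lemma elimination:
 fixes ph :: "'c::comm_ring_1 => 'r::comm_ring_1" and b :: "nat => nat => 'c"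
 assumes hom: "!!x y. ph (x * y) = ph x * ph y" "!!x y. ph (x - y) = ph x - ph y"
  and one: "1 : P1 0"
  and P11: "!!i k x y. x : P1 i ==> y : P1 k ==> x * y : P1 (i + k)"
  and P1: "!!i x y u v. x : P1 i ==> y : P1 i ==> u : P0 i ==> v : P0 i ==> x * y - u * v : P1 (i + i)"
  and P0: "!!i x y u v. x : P1 i ==> y : P0 i ==> u : P0 i ==> v : P0 i ==> x * y - u * v : P0 (i + i)"
  and J: "!!x y. x : J ==> y : J ==> x - y : J"
   "!!i c x. c : P1 i \<union> P0 i ==> x : J ==> ph c * x : J"
  and b: "!!j. j < n ==> b j j : P1 i" "!!j l. j < n ==> l < n ==> j ~= l ==> b j l : P0 i"
  and rows: "!!j. j < n ==> (\<Sum>l<n. ph (b j l) * w l) : J"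
 shows "\<exists>k. \<exists>g\<in>P1 k. \<forall>l<n. ph g * w l : J"
 using b rows
proof (induction n arbitrary: b i)
 case 0
 then show ?case using one by auto
next
 case (Suc n)
 \<comment> \<open>Row \<open>j\<close> times the pivot minus row \<open>n\<close> times
   \<open>b j n\<close>: this clears column \<open>n\<close>, keeps diagonal entries in
   \<open>P1\<close> and the others in \<open>P0\<close>.\<close>
 define b' where "b' = (%j l. b n n * b j l - b j n * b n l)"
 have row: "(\<Sum>l<n. ph (b' j l) * w l) : J" if "j < n" for j
 proof -
  have "ph (b n n) * (\<Sum>l<Suc n. ph (b j l) * w l) - ph (b j n) * (\<Sum>l<Suc n. ph (b n l) * w l)
   = (\<Sum>l<Suc n. ph (b' j l) * w l)"
  proof -
   have "ph (b' j l) * w l = ph (b n n) * (ph (b j l) * w l) - ph (b j n) * (ph (b n l) * w l)" for l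
    by (simp only: b'_def hom left_diff_distrib mult.assoc)
   then show ?thesis by (simp only: sum_distrib_left sum_subtractf)
  qed
  also have "... = (\<Sum>l<n. ph (b' j l) * w l)"
  proof -
   have "b' j n = 0 - 0" by (simp add: b'_def mult.commute)
   then have "ph (b' j n) = 0" using hom(2)[of 0 0] by simp
   then show ?thesis by simp
  qed
  finally have eq: "ph (b n n) * (\<Sum>l<Suc n. ph (b j l) * w l) - ph (b j n) * (\<Sum>l<Suc n. ph (b n l) * w l)
   = (\<Sum>l<n. ph (b' j l) * w l)" .
  have "ph (b n n) * (\<Sum>l<Suc n. ph (b j l) * w l) : J"
   by (rule J(2)[of _ i]) (use Suc.prems that in auto)
  moreover have "ph (b j n) * (\<Sum>l<Suc n. ph (b n l) * w l) : J"
   by (rule J(2)[of _ i]) (use Suc.prems that in auto)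
  ultimately show ?thesis using J(1) eq by metis
 qed
 have "\<exists>k. \<exists>g\<in>P1 k. \<forall>l<n. ph g * w l : J"
  by (rule Suc.IH[of b' "i + i"]) (use Suc.prems row in "auto simp: b'_def intro!: P1 P0")
 then obtain k g where g: "g : P1 k" "!!l. l < n ==> ph g * w l : J" by auto
 have bn: "b n n : P1 i" using Suc.prems by auto
 have 1: "ph (g * b n n) * w l : J" if "l < n" for l
 proof -
  have "ph (b n n) * (ph g * w l) : J" using J(2)[of "b n n" i] bn g(2)[OF that] by auto
  then show ?thesis by (simp add: hom algebra_simps)
 qed
 \<comment> \<open>The last row expresses the pivot times \<open>w n\<close> by the other
   \<open>w l\<close>, which \<open>g\<close> already takes into \<open>J\<close>.\<close>
 have "ph (g * b n n) * w n = ph g * (\<Sum>l<Suc n. ph (b n l) * w l) - (\<Sum>l<n. ph (b n l) * (ph g * w l))"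
  by (simp add: hom algebra_simps sum_distrib_left)
 moreover have "ph g * (\<Sum>l<Suc n. ph (b n l) * w l) : J"
  using J(2)[of g k] g(1) Suc.prems(3)[of n] by auto
 moreover have zero: "0 : J" using J(1)[OF Suc.prems(3)[of n] Suc.prems(3)[of n]] by simp
 have "(\<Sum>l\<in>A. ph (b n l) * (ph g * w l)) : J" if "finite A" "A <= {..<n}" for A
  using that
 proof (induction rule: finite_induct)
  case empty then show ?case using zero by simp
 next
  case (insert x F)
  have "ph (b n x) * (ph g * w x) : J"
   using J(2)[of "b n x" i] Suc.prems(2)[of n x] g(2)[of x] insert by auto
  moreover have "(\<Sum>l\<in>F. ph (b n l) * (ph g * w l)) : J" using insert by auto
  ultimately have "ph (b n x) * (ph g * w x) - (0 - (\<Sum>l\<in>F. ph (b n l) * (ph g * w l))) : J"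
   using J(1) zero by blast
  then show ?case using insert by simp
 qed
 then have "(\<Sum>l<n. ph (b n l) * (ph g * w l)) : J" by auto
 ultimately have 2: "ph (g * b n n) * w n : J" using J(1) by metis
 have "\<forall>l<Suc n. ph (g * b n n) * w l : J" using 1 2 less_Suc_eq by auto
 then show ?case using P11[OF g(1) bn] by blast
qed

text \<open>\<open>A\<close> is merely a subset of a ring and \<open>T\<close> an element, so that
  the coefficients may be polynomials in the other variables and \<open>T\<close> a coordinate. The
  bound is strict: \<open>n = 0\<close> leaves only zero.\<close>

definition plt :: "'r::comm_ring_1 set => 'r => nat => 'r set" where
 "plt A T n = {(\<Sum>k<n. a k * T ^ k) | a. \<forall>k. a k : A}"

lemma pltI: "(!!k. k < n ==> a k : A) ==> 0 : A ==> (\<Sum>k<n. a k * T ^ k) : plt A T n"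
 unfolding plt_def
 by (intro CollectI exI[of _ "%k. if k < n then a k else 0"]) auto

lemma plt_mono:
 assumes "f : plt A T n" "n <= m" "0 : A" shows "f : plt A T m"
proof -
 obtain a where a: "f = (\<Sum>k<n. a k * T ^ k)" "!!k. a k : A" using assms(1) by (auto simp: plt_def)
 have "f = (\<Sum>k<m. (if k < n then a k else 0) * T ^ k)"
  unfolding a(1) by (rule sum.mono_neutral_cong_left) (use assms in auto)
 then show ?thesis using a assms by (auto simp: plt_def intro!: exI[of _ "%k. if k < n then a k else 0"])
qed

lemma plt_add:
 assumes "!!x y. x : A ==> y : A ==> x + y : A" "f : plt A T n" "g : plt A T n"
 shows "f + g : plt A T n"
proof -
 obtain a where "f = (\<Sum>k<n. a k * T ^ k)" "!!k. a k : A" using assms(2) by (auto simp: plt_def)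
 moreover obtain b where "g = (\<Sum>k<n. b k * T ^ k)" "!!k. b k : A" using assms(3) by (auto simp: plt_def)
 ultimately show ?thesis using assms(1) unfolding plt_def
  by (intro CollectI exI[of _ "%k. a k + b k"]) (auto simp: sum.distrib distrib_right)
qed

lemma plt_scale:
 assumes "!!x y. x : A ==> y : A ==> x * y : A" "f : plt A T n" "c : A"
 shows "c * f : plt A T n"
proof -
 obtain a where "f = (\<Sum>k<n. a k * T ^ k)" "!!k. a k : A" using assms(2) by (auto simp: plt_def)
 then show ?thesis using assms unfolding plt_def
  by (intro CollectI exI[of _ "%k. c * a k"]) (auto simp: sum_distrib_left mult.assoc)
qed

lemma plt_shift:
 assumes "0 : A" "f : plt A T n" shows "T ^ m * f : plt A T (m + n)"
proof -
 obtain a where a: "f = (\<Sum>k<n. a k * T ^ k)" "!!k. a k : A" using assms(2) by (auto simp: plt_def)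
 have "T ^ m * f = (\<Sum>k\<in>{m..<m+n}. a (k - m) * T ^ k)"
  unfolding a(1) sum_distrib_left
  by (rule sum.reindex_bij_witness[of _ "%k. k - m" "%k. k + m"]) (auto simp: power_add algebra_simps)
 also have "... = (\<Sum>k<m+n. (if m <= k then a (k - m) else 0) * T ^ k)"
  by (rule sum.mono_neutral_cong_left) auto
 finally show ?thesis using a assms by (auto simp: plt_def intro!: exI[of _ "%k. if m <= k then a (k - m) else 0"])
qed

lemma plt_mult:
 assumes A: "!!x y. x : A ==> y : A ==> x + y : A" "!!x y. x : A ==> y : A ==> x * y : A" "0 : A"
  and f: "f : plt A T n" and g: "g : plt A T m"
 shows "f * g : plt A T (n + m)"
proof -
 obtain a where a: "f = (\<Sum>k<n. a k * T ^ k)" "!!k. a k : A" using f by (auto simp: plt_def)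
 have "(\<Sum>k\<in>B. a k * T ^ k * g) : plt A T (n + m)" if "finite B" "B <= {..<n}" for B
  using that
 proof (induction rule: finite_induct)
  case empty
  have "(\<Sum>k<n+m. 0 * T ^ k) : plt A T (n + m)" by (rule pltI) (use A in auto)
  then show ?case by simp
 next
  case (insert x F)
  have "T ^ x * (a x * g) : plt A T (x + m)" by (intro plt_shift plt_scale A g a)
  then have "a x * T ^ x * g : plt A T (n + m)"
   using insert A(3) by (auto simp: algebra_simps intro: plt_mono)
  then show ?case using insert by (auto intro!: plt_add A)
 qed
 from this[of "{..<n}"] show ?thesis unfolding a(1) sum_distrib_right by simp
qed

text \<open>Pseudo-division by a polynomial with leading coefficient \<open>c\<close>: each of the
  at most \<open>n\<close> reductions costs one factor \<open>c\<close>.\<close>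

lemma plt_division:
 assumes A: "!!x y. x : A ==> y : A ==> x + y : A" "!!x y. x : A ==> y : A ==> x * y : A" "0 : A"
   "!!x. x : A ==> - x : A" "c ^ n : A"
  and c: "c : A" and L: "L : plt A T e" and f: "f : plt A T n"
 shows "\<exists>q\<in>plt A T n. \<exists>r\<in>plt A T e. c ^ n * f = q * (c * T ^ e + L) + r"
 using f A(5)
proof (induction n arbitrary: f)
 case 0
 have "0 : plt A T e" using pltI[of e "%_. 0" A T] A by auto
 then show ?case using 0 by (auto simp: plt_def)
next
 case (Suc n)
 have zero: "0 : plt A T k" for k using pltI[of k "%_. 0" A T] A by auto
 obtain a where a: "f = (\<Sum>k<Suc n. a k * T ^ k)" "!!k. a k : A" using Suc.prems by (auto simp: plt_def)
 define g where "g = (\<Sum>k<n. a k * T ^ k)"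
 have g: "g : plt A T n" using a by (auto simp: g_def plt_def)
 have cpow: "c ^ k : A" if "k > 0" for k using that
  by (induction k rule: nat_induct_non_zero) (auto intro: A c)
 show ?case
 proof (cases "n < e")
  case True
  then have "f : plt A T e" using Suc.prems A plt_mono[of f A T "Suc n" e] by auto
  then have "c ^ Suc n * f : plt A T e" using plt_scale[OF A(2), of f T e "c ^ Suc n"] cpow by blast
  then show ?thesis using zero by (intro bexI[of _ 0] bexI[of _ "c ^ Suc n * f"]) auto
 next
  case False
  \<comment> \<open>Multiplying by \<open>c\<close> and subtracting \<open>a n * T ^ (n - e)\<close>
    times the divisor cancels the leading term of \<open>f\<close>.\<close>
  define h where "h = c * g - a n * T ^ (n - e) * L"
  have "T ^ (n - e) * ((- a n) * L) : plt A T (n - e + e)"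
   by (intro plt_shift plt_scale A L a)
  then have "T ^ (n - e) * ((- a n) * L) : plt A T n" using False by simp
  moreover have "c * g : plt A T n" by (intro plt_scale A c g)
  ultimately have "c * g + T ^ (n - e) * ((- a n) * L) : plt A T n" by (intro plt_add A)
  then have h: "h : plt A T n" by (simp add: h_def algebra_simps)
  have cn: "c ^ n : A" if "n > 0" using cpow that by auto
  obtain q r where qr: "q : plt A T n" "r : plt A T e" "c ^ n * h = q * (c * T ^ e + L) + r"
  proof (cases "n = 0")
   case True
   then have "h = 0" using h by (auto simp: plt_def)
   then show ?thesis using that[of 0 0] zero by auto
  next
   case False
   then show ?thesis using Suc.IH[OF h cn] that by auto
  qed
  have cf: "c * f = a n * T ^ (n - e) * (c * T ^ e + L) + h"
  proof -
   have "T ^ n = T ^ (n - e) * T ^ e" using False by (simp flip: power_add)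
   then show ?thesis by (simp add: a(1) h_def g_def algebra_simps)
  qed
  have "c ^ Suc n * f = c ^ n * (c * f)" by (simp add: algebra_simps)
  also have "... = (c ^ n * a n * T ^ (n - e) + q) * (c * T ^ e + L) + r"
   unfolding cf distrib_left qr(3) by (simp add: algebra_simps)
  finally have eq: "c ^ Suc n * f = (c ^ n * a n * T ^ (n - e) + q) * (c * T ^ e + L) + r" .
  have ca: "c ^ n * a n : A" using a cn A(2) by (cases "n = 0") auto
  have "(\<Sum>k<Suc n. (if k = n - e then c ^ n * a n else 0) * T ^ k) : plt A T (Suc n)"
   by (rule pltI) (use ca A in auto)
  also have "(\<Sum>k<Suc n. (if k = n - e then c ^ n * a n else 0) * T ^ k) = c ^ n * a n * T ^ (n - e)"
   by (subst sum.mono_neutral_right[of _ "{n - e}"]) auto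
  finally have "c ^ n * a n * T ^ (n - e) + q : plt A T (Suc n)"
   by (intro plt_add A plt_mono[OF qr(1)]) auto
  then show ?thesis using eq qr(2) by blast
 qed
qed

text \<open>The substitution \<open>x\<^sub>j \<mapsto> x\<^sub>j + \<xi>\<^sub>j x\<^sub>i\<close> of Noether normalization.\<close>
definition tilt :: "('i => 'a::comm_ring_1) => 'i => 'i => ('i, 'a) fn" where
 "tilt xi i j = (if j = i then coord i else coord j + cfun (xi j) * coord i)"

lemma tilt_pfun: "i : I ==> j : I ==> tilt xi i j : pfun I {1}"
 by (auto simp: tilt_def intro!: pfun_add pfun_scale pfun_coord)

lemma sub_tilt_pfun: "f : pfun I D ==> i : I ==> sub (tilt xi i) f : pfun I D"
 by (rule sub_pfun[where E = "{1}" and G = "%d. {d}"]) (auto intro: tilt_pfun simp del: One_nat_def)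

lemma sub_tilt_inverse: "sub (tilt xi i) (sub (tilt (%j. - xi j) i) f) = f"
proof -
 have "(%j. tilt (%j. - xi j) i j (%k. tilt xi i k x)) = x" for x
  by (auto simp: fun_eq_iff tilt_def ev)
 then show ?thesis by (simp add: fun_eq_iff sub_apply)
qed

text \<open>On the \<open>i\<close>-th axis the tilted function takes the values of \<open>f\<close>
  on the line through the origin in direction \<open>xi\<close>, so its \<open>e\<close>-th
  coefficient there is the value of the top form \<open>g\<close> at \<open>xi\<close>. The
  coefficient of \<open>coord i ^ e\<close> has degree 0 and is therefore this constant.\<close>

lemma tilt_monic:
 fixes f :: "('i, 'a::alg_closed_field) fn"
 assumes f: "f : pfun I D" "D <= {..e}" and g: "g : pfun I {e}" "f - g : pfun I {..<e}"
  and xi: "g xi ~= 0" "xi i = 1" and i: "i : I"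
 obtains a where "!!k. k < e ==> a k : pfun (I - {i}) ((%d. d - k) ` (D \<inter> {k..}))"
  "sub (tilt xi i) f = cfun (g xi) * coord i ^ e + (\<Sum>k<e. a k * coord i ^ k)"
proof -
 let ?F = "sub (tilt xi i) f"
 have "?F : pfun I D" using f i by (intro sub_tilt_pfun)
 then obtain a where a: "!!k. a k : pfun (I - {i}) ((%d. d - k) ` (D \<inter> {k..}))"
  "?F = (\<Sum>k\<le>e. a k * coord i ^ k)" using f(2) by (rule pfun_split[where i = i]) blast
 have "a e : pfun (I - {i}) {0}" using a(1)[of e] by (rule pfun_mono) (use f(2) in auto)
 then have "a e x = a e (%i. 0 * x i)" for x
  using pfun_hom[of "a e" _ 0 0 x] by simp
 then have ae: "a e = cfun (a e (%_. 0))" by (simp add: fun_eq_iff ev)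
 let ?z = "%t j. if j = i then t else (0::'a)"
 have z: "(%j. tilt xi i j (?z t)) = (%j. 0 + t * xi j)" for t
  by (auto simp: fun_eq_iff tilt_def ev xi)
 have az: "a k (?z t) = a k (%_. 0)" for k t using a(1)[of k] by (rule pfun_cong) auto
 have 1: "?F (?z t) = poly (\<Sum>k\<le>e. Polynomial.monom (a k (%_. 0)) k) t" for t
  unfolding a(2) by (simp add: ev az poly_sum poly_monom)
 have "f - g : pfun I {..e-1}" if "e > 0" using g(2) by (rule pfun_mono) (use that in auto)
 moreover have "f - g = 0" if "e = 0" using g(2) that pfun_empty_degrees[of "f - g" I] by auto
 ultimately obtain p where p: "e > 0 --> degree p < e" "e = 0 --> p = 0" "!!t. (f - g) (%j. 0 + t * xi j) = poly p t"
 proof (cases "e = 0")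
  case False
  then obtain p where "degree p <= e - 1" "!!t. (f - g) (%i. 0 + t * xi i) = poly p t"
   using pfun_line[of "f - g" I "e - 1" "%_. 0" xi] `e > 0 ==> f - g : pfun I {..e-1}` by auto
  then show ?thesis using that[of p] False by auto
 qed (use that[of 0] in "auto simp: ev")
 have 2: "?F (?z t) = poly (Polynomial.monom (g xi) e + p) t" for t
 proof -
  have "?F (?z t) = g (%j. t * xi j) + (f - g) (%j. 0 + t * xi j)"
   by (simp add: sub_apply z ev)
  then show ?thesis using p(3)[of t] pfun_hom[OF g(1), of t xi] by (simp add: poly_monom)
 qed
 have "poly ((\<Sum>k\<le>e. Polynomial.monom (a k (%_. 0)) k) - (Polynomial.monom (g xi) e + p)) t = 0" for t
  using 1[of t] 2[of t] by simp
 then have "(\<Sum>k\<le>e. Polynomial.monom (a k (%_. 0)) k) = Polynomial.monom (g xi) e + p"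
  using poly_zero_if_all_roots by (metis eq_iff_diff_eq_0)
 then have "poly.coeff (\<Sum>k\<le>e. Polynomial.monom (a k (%_. 0)) k) e = poly.coeff (Polynomial.monom (g xi) e + p) e"
  by simp
 then have "a e (%_. 0) = g xi"
  using p(1,2) by (cases "e = 0") (auto simp: coeff_sum coeff_eq_0)
 then have "a e = cfun (g xi)" using ae by simp
 then show ?thesis using a by (intro that[of a]) (auto simp: lessThan_Suc_atMost[symmetric])
qed

text \<open>The coordinate \<open>i\<close> joins the family; a common nonzero can then be rescaled
  to \<open>xi i = 1\<close>, which multiplies the value of each form by a nonzero power.\<close>

lemma hom_common_nonzero:
 fixes F :: "('i, 'a::alg_closed_field) fn set"
 assumes "finite F" "!!f. f : F ==> \<exists>d. f : pfun I {d}" "!!f. f : F ==> f ~= 0" "i : I"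
 obtains xi where "xi i = 1" "!!f. f : F ==> f xi ~= 0"
proof -
 let ?c = "coord i :: ('i, 'a) fn"
 have "?c (%_. 1) ~= 0 (%_. 1)" by (simp add: ev)
 then have c: "?c ~= 0" by metis
 have fin: "finite (insert ?c F)" using assms(1) by simp
 have "f : polys I" if "f : insert ?c F" for f
  using assms(2)[of f] assms(4) that by (auto intro: pfun_polys pfun_coord)
 moreover have "f ~= 0" if "f : insert ?c F" for f using that assms(3)[of f] c by (elim insertE) simp_all
 ultimately obtain et where et: "!!f. f : insert ?c F ==> f et ~= 0"
  using polys_common_nonzero[OF fin, of "%f. f" I] by blast
 show ?thesis
 proof (rule that[of "%j. inverse (et i) * et j"])
  have "et i ~= 0" using et[of ?c] by (simp add: ev)
  then show "inverse (et i) * et i = 1" by simp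
  fix f assume f: "f : F"
  then obtain d where "f : pfun I {d}" using assms(2) by blast
  then show "f (%j. inverse (et i) * et j) ~= 0"
   using pfun_hom[of f I d "inverse (et i)" et] et[of f] f `et i ~= 0` by auto
 qed
qed

section \<open>Hilbert's Nullstellensatz\<close>

definition ideal_in :: "'i set => ('i, 'a::comm_ring_1) fn set => bool" where
 "ideal_in I J \<longleftrightarrow> J <= polys I \<and> 0 : J \<and> (\<forall>f\<in>J. \<forall>g\<in>J. f + g : J) \<and> (\<forall>f\<in>polys I. \<forall>g\<in>J. f * g : J)"

lemma ideal_in_diff:
 assumes "ideal_in I J" "f : J" "g : J" shows "f - g : J"
proof -
 have "cfun (-1) * g : J" using assms by (auto simp: ideal_in_def intro!: pfun_const)
 then have "f + cfun (-1) * g : J" using assms by (auto simp: ideal_in_def)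
 then show ?thesis by (simp add: cfun_simps)
qed

lemma polys_plt:
 assumes "f : polys I"
 obtains n where "f : plt (polys (I - {i})) (coord i) n"
proof -
 obtain t where "f : pfun I {..t}" using assms by (rule polys_bounded)
 then obtain a where a: "!!k. a k : pfun (I - {i}) {..t - k}" "f = (\<Sum>k\<le>t. a k * coord i ^ k)"
  by (rule pfun_split_le[where i = i]) blast
 then have "f : plt (polys (I - {i})) (coord i) (Suc t)"
  by (auto simp: plt_def lessThan_Suc_atMost intro!: exI[of _ a] intro: pfun_polys)
 then show ?thesis by (rule that)
qed

lemma plt_poly:
 assumes "f : plt (polys (I - {i})) (coord i) n"
 obtains p where "n > 0 ==> degree p < n" "n = 0 ==> p = 0" "!!t. f (x(i := t)) = poly p t"
proof -
 obtain a where a: "f = (\<Sum>k<n. a k * coord i ^ k)" "!!k. a k : polys (I - {i})"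
  using assms by (auto simp: plt_def)
 have "a k (x(i := t)) = a k x" for k t using a(2)[of k] by (rule pfun_cong) auto
 then have "f (x(i := t)) = poly (\<Sum>k<n. Polynomial.monom (a k x) k) t" for t
  by (simp add: a ev poly_sum poly_monom)
 moreover have "degree (\<Sum>k<n. Polynomial.monom (a k x) k) < n" if "n > 0"
  by (rule le_less_trans[OF degree_sum_le[of _ _ "n - 1"]]) (use that in "auto intro!: order.trans[OF degree_monom_le]")
 ultimately show ?thesis by (intro that[of "\<Sum>k<n. Polynomial.monom (a k x) k"]) auto
qed

text \<open>Restricting \<open>J\<close> to the line \<open>x(i := t)\<close> gives an ideal
  \<open>P\<close> of univariate polynomials. If it is proper, a root of its generator extends
  \<open>x\<close>. Otherwise some \<open>f1\<close> in \<open>J\<close> is 1 on the line; the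
  remainders of \<open>coord i ^ j * f1\<close> modulo the monic \<open>F\<close> form a matrix over
  the smaller ring that is the identity at \<open>x\<close>, and its determinant is an element of
  \<open>J\<close> in the smaller ring with value 1 at \<open>x\<close>.\<close>

lemma weak_nullstellensatz_step:
 fixes J :: "('i, 'a::alg_closed_field) fn set"
 assumes J: "ideal_in I J" "1 ~: J" and i: "i : I"
  and F: "F : J" "F = coord i ^ e + L" "L : plt (polys (I - {i})) (coord i) e"
  and x: "!!f. f : J ==> f : polys (I - {i}) ==> f x = 0"
 shows "\<exists>t. \<forall>f\<in>J. f (x(i := t)) = 0"
proof (rule ccontr)
 assume neg: "\<not> ?thesis"
 let ?A = "polys (I - {i}) :: ('i, 'a) fn set"
 have sub: "?A <= polys I" by (auto intro: pfun_mono)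
 have Jm: "f * g : J" if "f : polys I" "g : J" for f g using J that by (auto simp: ideal_in_def)
 have Jp: "f : polys I" if "f : J" for f using J that by (auto simp: ideal_in_def)
 have pl: "\<exists>p. \<forall>t. f (x(i := t)) = poly p t" if "f : polys I" for f
 proof -
  obtain n where "f : plt ?A (coord i) n" using polys_plt[OF `f : polys I`, of i] by blast
  then show ?thesis by (rule plt_poly[where x = x]) blast
 qed
 define P where "P = {p. \<exists>f\<in>J. \<forall>t. f (x(i := t)) = poly p t}"
 have e: "e > 0"
 proof (rule ccontr)
  assume "\<not> e > 0"
  then have "F = 1" using F by (auto simp: plt_def)
  then show False using F J by auto
 qed
 obtain pL where pL: "degree pL < e" "!!t. L (x(i := t)) = poly pL t"
  using plt_poly[OF F(3), of x] e by metis
 define pF where "pF = Polynomial.monom 1 e + pL"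
 have pF1: "F (x(i := t)) = poly pF t" for t
  using pL by (simp add: pF_def F ev poly_monom)
 have pF2: "degree pF = e"
  using pL by (simp add: pF_def degree_add_eq_left degree_monom_eq)
 have pF3: "pF ~= 0" using pF2 e by auto
 note pF = pF1 pF2 pF3
 have "pF : P" using F pF by (auto simp: P_def)
 then obtain p where p: "p : P" "p ~= 0" "!!q. q : P ==> q ~= 0 ==> degree p <= degree q"
  using ex_has_least_nat[of "%p. p : P \<and> p ~= 0" pF degree] pF by auto
 have qfun: "\<exists>f\<in>polys I. \<forall>t. f (x(i := t)) = poly q t" for q
  by (rule bexI[of _ "\<Sum>k\<le>degree q. cfun (poly.coeff q k) * coord i ^ k"])
    (auto simp: ev poly_altdef intro!: pfun_sum pfun_scale polys_power pfun_coord i)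
 have dvd: "p dvd q" if qP: "q : P" for q
 proof (rule ccontr)
  assume "\<not> p dvd q"
  then have r: "q mod p ~= 0" "degree (q mod p) < degree p"
   using p degree_mod_less'[of p q] by (auto simp: dvd_eq_mod_eq_0)
  obtain f where f: "f : J" "!!t. f (x(i := t)) = poly q t" using qP by (auto simp: P_def)
  obtain g where g: "g : J" "!!t. g (x(i := t)) = poly p t" using p by (auto simp: P_def)
  obtain h where h: "h : polys I" "!!t. h (x(i := t)) = poly (q div p) t" using qfun by blast
  have "f - h * g : J" using f g h Jm J ideal_in_diff by blast
  moreover have "(f - h * g) (x(i := t)) = poly (q mod p) t" for t
   by (simp add: ev f g h minus_div_mult_eq_mod[symmetric])
  ultimately have "q mod p : P" by (auto simp: P_def)
  then show False using p(3) r by fastforce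
 qed
 have "degree p = 0"
 proof (rule ccontr)
  assume "degree p ~= 0"
  then obtain t where "poly p t = 0" using alg_closed_imp_poly_has_root by blast
  moreover obtain f where "f : J" "f (x(i := t)) ~= 0" using neg by auto
  moreover obtain q where "!!t. f (x(i := t)) = poly q t" using pl Jp `f : J` by blast
  moreover have "q : P" using calculation by (auto simp: P_def)
  then have "p dvd q" by (rule dvd)
  ultimately show False by (auto simp: dvd_def)
 qed
 then obtain c where c: "p = [:c:]" "c ~= 0" using p(2) by (metis degree_eq_zeroE pCons_0_0)
 obtain f0 where f0: "f0 : J" "!!t. f0 (x(i := t)) = c" using p(1) c by (auto simp: P_def)
 define f1 where "f1 = cfun (inverse c) * f0"
 have f1: "f1 : J" "!!t. f1 (x(i := t)) = 1"
  using f0 c by (auto simp: f1_def ev intro!: Jm pfun_const)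
 define Q where "Q = (%j b. (\<forall>l. b l : ?A) \<and> (\<Sum>l<e. b l * coord i ^ l) : J \<and>
  (\<forall>l<e. b l x = (if l = j then 1 else 0)))"
 have "\<exists>b. Q j b" if j: "j < e" for j
 proof -
  have jf: "coord i ^ j * f1 : J" by (intro Jm f1 polys_power pfun_coord i) auto
  obtain n where n: "coord i ^ j * f1 : plt ?A (coord i) n" using polys_plt[OF Jp[OF jf], of i] by blast
  obtain q r where qr: "q : plt ?A (coord i) n" "r : plt ?A (coord i) e"
   "1 ^ n * (coord i ^ j * f1) = q * (1 * coord i ^ e + L) + r"
   using plt_division[of ?A 1 n, OF _ _ _ _ _ _ F(3) n]
   by (auto intro: pfun_add polys_mult pfun_zero pfun_uminus pfun_one)
  obtain b where b: "r = (\<Sum>l<e. b l * coord i ^ l)" "!!l. b l : ?A" using qr(2) by (auto simp: plt_def)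
  have "q : polys I" using qr(1) sub
   by (auto simp: plt_def intro!: pfun_sum polys_mult polys_power pfun_coord i)
  then have "coord i ^ j * f1 - q * F : J" using jf Jm F J ideal_in_diff by blast
  then have rJ: "r : J" using qr(3) F(2) by (simp add: algebra_simps)
  obtain Q where Q: "!!t. q (x(i := t)) = poly Q t" using plt_poly[OF qr(1), of x] by metis
  obtain R where R: "degree R < e" "!!t. r (x(i := t)) = poly R t" using plt_poly[OF qr(2), of x] e by metis
  have "poly (Polynomial.monom 1 j - (Q * pF + R)) t = 0" for t
  proof -
   have "(1 ^ n * (coord i ^ j * f1)) (x(i := t)) = (q * (1 * coord i ^ e + L) + r) (x(i := t))"
    using qr(3) by simp
   then show ?thesis using pF(1)[of t] Q[of t] R(2)[of t] f1(2)[of t] F(2)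
    by (simp add: ev poly_monom)
  qed
  then have eq: "Polynomial.monom 1 j = Q * pF + R" using poly_zero_if_all_roots
   by (metis eq_iff_diff_eq_0)
  \<comment> \<open>On the line the dividend is \<open>t ^ j\<close> with \<open>j < e\<close>, so
    division by the monic \<open>pF\<close> of degree \<open>e\<close> leaves it unchanged.\<close>
  have "Q = 0"
  proof (rule ccontr)
   assume "Q ~= 0"
   then have "degree (Q * pF) \<ge> e" using pF by (simp add: degree_mult_eq)
   then have "degree (Q * pF + R) \<ge> e" using R by (simp add: degree_add_eq_left)
   then show False using eq j by (metis degree_monom_le leD order.strict_trans1)
  qed
  then have "R = Polynomial.monom 1 j" using eq by simp
  moreover have "poly R t = poly (\<Sum>l<e. Polynomial.monom (b l x) l) t" for t
  proof -
   have "b l (x(i := t)) = b l x" for l using b(2)[of l] by (rule pfun_cong) auto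
   then show ?thesis unfolding R(2)[symmetric] b(1) by (simp add: ev poly_sum poly_monom)
  qed
  then have "R = (\<Sum>l<e. Polynomial.monom (b l x) l)"
   using poly_zero_if_all_roots[of "R - (\<Sum>l<e. Polynomial.monom (b l x) l)"] by simp
  ultimately have coeffs: "poly.coeff (\<Sum>l<e. Polynomial.monom (b l x) l) k = poly.coeff (Polynomial.monom 1 j) k" for k
   by simp
  have "b l x = (if l = j then 1 else 0)" if "l < e" for l
   using coeffs[of l] that by (auto simp: coeff_sum if_distrib sum.delta cong: if_cong split: if_splits)
  then show ?thesis using b rJ unfolding Q_def by (intro exI[of _ b]) auto
 qed
 then obtain b where "!!j. j < e ==> Q j (b j)" by metis
 then have b: "!!j l. j < e ==> b j l : ?A" "!!j. j < e ==> (\<Sum>l<e. b j l * coord i ^ l) : J"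
  "!!j l. j < e ==> l < e ==> b j l x = (if l = j then 1 else 0)"
  unfolding Q_def by blast+
 have "\<exists>k::nat. \<exists>g\<in>{f : ?A. f x = 1}. \<forall>l<e. id g * coord i ^ l : J"
  by (rule elimination[where ph = id and ?P0.0 = "%_. {f : ?A. f x = 0}" and b = b])
    (use b sub in "auto simp: ev intro!: pfun_one polys_mult pfun_diff Jm intro: ideal_in_diff[OF J(1)]")
 then obtain g where g: "g : ?A" "g x = 1" "!!l. l < e ==> g * coord i ^ l : J" by auto
 have "g : J" using g(3)[of 0] e by simp
 then show False using x[of g] g by auto
qed

text \<open>Induction on the variables: after a tilt a nonzero element of \<open>J\<close> is monic
  in the new variable up to a constant, and a common zero of the elements free of that variable
  extends.\<close>

theorem weak_nullstellensatz:
 fixes J :: "('i, 'a::alg_closed_field) fn set"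
 assumes "finite I" "ideal_in I J" "1 ~: J"
 shows "\<exists>x. \<forall>f\<in>J. f x = 0"
 using assms
proof (induction arbitrary: J rule: finite_induct)
 case (empty J)
 have "f = 0" if fJ: "f : J" for f
 proof -
  obtain c where c: "f = cfun c" using pfun_no_vars[of f UNIV] fJ empty by (auto simp: ideal_in_def)
  have "c = 0"
  proof (rule ccontr)
   assume "c ~= 0"
   have "cfun (inverse c) * f : J" using empty that by (auto simp: ideal_in_def intro!: pfun_const)
   then show False using empty c `c ~= 0` by (simp flip: cfun_simps)
  qed
  then show ?thesis using c by (simp add: cfun_simps)
 qed
 then show ?case by (intro exI[of _ undefined] ballI) (metis zero_fun_apply)
next
 case (insert i I J)
 let ?I = "insert i I"
 show ?case
 proof (cases "J <= {0}")
  case True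
  then show ?thesis by (intro exI[of _ undefined] ballI) (metis subsetD singletonD zero_fun_apply)
 next
  case False
  then obtain f where f: "f : J" "f ~= 0" by auto
  then have "f : polys ?I" using insert by (auto simp: ideal_in_def)
  then obtain t where "f : pfun ?I {..t}" by (rule polys_bounded)
  define e where "e = (LEAST t. f : pfun ?I {..t})"
  have e: "f : pfun ?I {..e}" unfolding e_def using `f : pfun ?I {..t}` by (rule LeastI)
  have "f ~: pfun ?I {..<e}"
  proof
   assume *: "f : pfun ?I {..<e}"
   show False
   proof (cases e)
    case 0 then show ?thesis using * f pfun_empty_degrees[of f ?I] by auto
   next
    case (Suc e')
    then have "f : pfun ?I {..e'}" using * by (auto simp: lessThan_Suc_atMost)
    then have "e <= e'" unfolding e_def by (rule Least_le)
    then show ?thesis using Suc by simp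
   qed
  qed
  then obtain g where g: "g : pfun ?I {e}" "g ~= 0" "f - g : pfun ?I {..<e}"
   using pfun_highest[OF e] by blast
  obtain xi where xi: "xi i = 1" "g xi ~= 0"
   using hom_common_nonzero[of "{g}" ?I i] g by blast
  obtain a where a: "!!k. k < e ==> a k : pfun (?I - {i}) ((%d. d - k) ` ({..e} \<inter> {k..}))"
   "sub (tilt xi i) f = cfun (g xi) * coord i ^ e + (\<Sum>k<e. a k * coord i ^ k)"
   using tilt_monic[OF e order.refl g(1,3) xi(2,1)] by blast
  define J' where "J' = sub (tilt xi i) ` J"
  have J': "ideal_in ?I J'"
   unfolding ideal_in_def
  proof (intro conjI ballI)
   show "J' <= polys ?I" using insert.prems by (auto simp: J'_def ideal_in_def intro: sub_tilt_pfun)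
   show "0 : J'" using insert.prems by (auto simp: J'_def ideal_in_def intro!: image_eqI[of _ _ 0])
  next
   fix f g assume "f : J'" "g : J'"
   then show "f + g : J'" using insert.prems
    by (auto simp: J'_def ideal_in_def simp flip: sub_simps(1))
  next
   fix h f :: "('i, 'a) fn" assume h: "h : polys ?I" and "f : J'"
   then obtain f' where f': "f' : J" "f = sub (tilt xi i) f'" by (auto simp: J'_def)
   have "h * f = sub (tilt xi i) (sub (tilt (%j. - xi j) i) h * f')"
    by (simp add: sub_tilt_inverse f')
   moreover have "sub (tilt (%j. - xi j) i) h * f' : J"
    using insert.prems f' h by (auto simp: ideal_in_def intro: sub_tilt_pfun)
   ultimately show "h * f : J'" unfolding J'_def by (rule image_eqI)
  qed
  have one: "1 ~: J'"
  proof
   assume "1 : J'"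
   then obtain f' where f': "f' : J" "sub (tilt xi i) f' = 1" by (auto simp: J'_def)
   have "f' = sub (tilt (%j. - xi j) i) (sub (tilt (%j. - (- xi j)) i) f')"
    using sub_tilt_inverse[of "%j. - xi j" i f'] by simp
   then have "f' = 1" using f' by simp
   then show False using f' insert.prems by auto
  qed
  have "ideal_in I (J' \<inter> polys I)"
   using J' by (auto simp: ideal_in_def intro: pfun_add polys_mult pfun_zero pfun_mono)
  then obtain x where x: "\<forall>f\<in>J' \<inter> polys I. f x = 0" using insert.IH one by blast
  have I: "?I - {i} = I" using insert by auto
  have "\<exists>t. \<forall>f\<in>J'. f (x(i := t)) = 0"
  proof (rule weak_nullstellensatz_step[OF J' one, of i])
   let ?c = "inverse (g xi)"
   show "cfun ?c * sub (tilt xi i) f : J'"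
   proof -
    have "sub (tilt xi i) f : J'" using f by (simp add: J'_def)
    moreover have "cfun ?c : polys ?I" by (intro pfun_const) simp
    ultimately show ?thesis using J' unfolding ideal_in_def by blast
   qed
   show "cfun ?c * sub (tilt xi i) f = coord i ^ e + (\<Sum>k<e. (cfun ?c * a k) * coord i ^ k)"
   proof -
    have "cfun ?c * cfun (g xi) = (1 :: ('i, 'a) fn)" using xi by (simp add: fun_eq_iff ev)
    then show ?thesis unfolding a(2) by (simp add: distrib_left sum_distrib_left flip: mult.assoc)
   qed
   show "(\<Sum>k<e. (cfun ?c * a k) * coord i ^ k) : plt (polys (?I - {i})) (coord i) e"
    using a(1) by (intro pltI pfun_scale pfun_zero) (auto intro: pfun_polys)
  qed (use x I in auto)
  then obtain t where t: "\<forall>f\<in>J'. f (x(i := t)) = 0" by blast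
  show ?thesis
   by (rule exI[of _ "%j. tilt xi i j (x(i := t))"]) (use t in "auto simp: J'_def sub_apply")
 qed
qed

definition zclosed :: "('n => 'a::comm_ring_1) set => bool" where
 "zclosed Y \<longleftrightarrow> (\<exists>P\<subseteq>polys UNIV. Y = {x. \<forall>f\<in>P. f x = 0})"

text \<open>The ideal of the coordinate ring of \<open>Y\<close> generated by the
  \<open>g i\<close>, pulled back to polynomials; asking for the equation only on \<open>Y\<close>
  builds in the vanishing ideal of \<open>Y\<close>.\<close>

definition idl :: "('n => 'a::comm_ring_1) set => 'j set => ('j => ('n, 'a) fn) => ('n, 'a) fn set" where
 "idl Y A g = {f : polys UNIV. \<exists>h. (\<forall>i\<in>A. h i : polys UNIV) \<and> (\<forall>p\<in>Y. f p = (\<Sum>i\<in>A. h i p * g i p))}"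

lemma idl_ideal:
 fixes Y :: "('n => 'a::comm_ring_1) set"
 shows "ideal_in UNIV (idl Y A g)"
 unfolding ideal_in_def
proof (intro conjI ballI)
 show "idl Y A g <= polys UNIV" by (auto simp: idl_def)
 show "0 : idl Y A g" by (auto simp: idl_def ev pfun_zero intro!: exI[of _ 0])
next
 fix f f' assume "f : idl Y A g" "f' : idl Y A g"
 then obtain h h' where h: "\<forall>i\<in>A. h i : polys UNIV" "\<forall>p\<in>Y. f p = (\<Sum>i\<in>A. h i p * g i p)"
  "\<forall>i\<in>A. h' i : polys UNIV" "\<forall>p\<in>Y. f' p = (\<Sum>i\<in>A. h' i p * g i p)" "f : polys UNIV" "f' : polys UNIV"
  unfolding idl_def by blast
 then show "f + f' : idl Y A g"
  unfolding idl_def by (auto simp: ev sum.distrib distrib_right intro!: pfun_add exI[of _ "%i. h i + h' i"])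
next
 fix k f :: "('n, 'a) fn" assume k: "k : polys UNIV" and "f : idl Y A g"
 then obtain h where h: "\<forall>i\<in>A. h i : polys UNIV" "\<forall>p\<in>Y. f p = (\<Sum>i\<in>A. h i p * g i p)" "f : polys UNIV"
  unfolding idl_def by blast
 then show "k * f : idl Y A g"
  using k unfolding idl_def by (auto simp: ev sum_distrib_left mult.assoc intro!: polys_mult exI[of _ "%i. k * h i"])
qed

lemma idl_polys: "f : idl Y A g ==> f : polys UNIV" by (simp add: idl_def)

lemma idl_add: "f : idl Y A g ==> f' : idl Y A g ==> f + f' : idl Y A g"
 using idl_ideal[of Y A g] by (simp add: ideal_in_def)

lemma idl_mult: "h : polys UNIV ==> f : idl Y A g ==> h * f : idl Y A g"
 using idl_ideal[of Y A g] by (simp add: ideal_in_def)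

lemma idl_diff: "f : idl Y A g ==> f' : idl Y A g ==> f - f' : idl Y A g"
 using ideal_in_diff[OF idl_ideal] .

lemma idl_sum: "(!!j. j : B ==> f j : idl Y A g) ==> (\<Sum>j\<in>B. f j) : idl Y A g"
proof (induction B rule: infinite_finite_induct)
 case (insert x F) then show ?case by (auto intro: idl_add)
qed (use idl_ideal[of Y A g] in "auto simp: ideal_in_def")

lemma idl_vanishing: "f : polys UNIV ==> (!!p. p : Y ==> f p = 0) ==> f : idl Y A g"
 by (auto simp: idl_def ev pfun_zero intro!: exI[of _ 0])

lemma idl_gen:
 assumes "finite A" "i : A" "g i : polys UNIV" shows "g i : idl Y A g"
 using assms unfolding idl_def
 by (auto simp: ev if_distrib[of "%h. h _"] if_distrib[of "%z. z * _"] sum.delta pfun_zero pfun_one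
   intro!: exI[of _ "%j. if j = i then 1 else 0"] cong: if_cong)

text \<open>Rabinowitsch's trick with a variable \<open>None\<close> standing for
  \<open>1 / f\<close>. \<open>J\<close> is the ideal of those \<open>F\<close> whose value at
  \<open>None = 1 / f\<close>, cleared of denominators, agrees with an element of the ideal wherever
  \<open>f\<close> is nonzero. A common zero of \<open>J\<close> would be a zero of all
  \<open>g i\<close> on \<open>Y\<close> at which \<open>f\<close> is invertible, so
  \<open>J\<close> contains 1.\<close>

theorem nullstellensatz:
 fixes Y :: "('n::finite => 'a::alg_closed_field) set"
 assumes Y: "zclosed Y" and A: "finite A" "!!i. i : A ==> g i : polys UNIV" and f: "f : polys UNIV"
  and van: "!!p. p : Y ==> (!!i. i : A ==> g i p = 0) ==> f p = 0"
 shows "\<exists>M. f ^ M : idl Y A g"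
proof -
 obtain P where P: "P <= polys UNIV" "Y = {x. \<forall>f\<in>P. f x = 0}" using Y by (auto simp: zclosed_def)
 let ?z = "%x i. case i of None => inverse (f x) | Some j => x j"
 define J where "J = {F : polys (UNIV::'n option set). \<exists>M. \<exists>k\<in>idl Y A g. \<forall>x. f x ~= 0 --> f x ^ M * F (?z x) = k x}"
 have Jmul: "H * F : J" if H: "H : polys UNIV" and F: "F : J" for H F
 proof -
  obtain M k where k: "k : idl Y A g" "!!x. f x ~= 0 ==> f x ^ M * F (?z x) = k x" "F : polys UNIV"
   using F by (auto simp: J_def)
  obtain t where "H : pfun UNIV {..t}" using H by (rule polys_bounded)
  then obtain a where a: "!!k. a k : pfun (UNIV - {None}) {..t - k}" "H = (\<Sum>k\<le>t. a k * coord None ^ k)"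
   by (rule pfun_split_le[where i = None]) blast
  \<comment> \<open>The coefficients of \<open>H\<close> with respect to \<open>None\<close>, as
    polynomials in the original variables; complementary powers of \<open>f\<close> will clear the
    denominators.\<close>
  define d where "d = (%k. sub (%i. case i of None => 0 | Some j => coord j) (a k))"
  have d: "d k : polys UNIV" for k unfolding d_def
   by (rule sub_polys[OF pfun_polys[OF a(1)]]) (auto split: option.splits intro: pfun_coord)
  have da: "d k x = a k (?z x)" for k x unfolding d_def sub_apply
   by (rule pfun_cong[OF a(1)]) (auto split: option.splits simp: ev)
  have "(\<Sum>k\<le>t. d k * f ^ (t - k)) * k : idl Y A g"
   by (intro idl_mult k pfun_sum polys_mult d polys_power f)
  moreover have "f x ^ (t + M) * (H * F) (?z x) = ((\<Sum>k\<le>t. d k * f ^ (t - k)) * k) x" if "f x ~= 0" for x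
  proof -
   have "f x ^ t * H (?z x) = (\<Sum>k\<le>t. d k * f ^ (t - k)) x"
    unfolding a(2) by (auto simp: ev sum_distrib_left da power_diff that power_inverse divide_simps intro!: sum.cong)
   then have "f x ^ t * H (?z x) * (f x ^ M * F (?z x)) = ((\<Sum>k\<le>t. d k * f ^ (t - k)) * k) x"
    using k(2)[OF that] by (simp add: times_fun_apply)
   then show ?thesis by (simp add: times_fun_apply power_add algebra_simps)
  qed
  ultimately show ?thesis unfolding J_def using H k(3) polys_mult[of H UNIV F] by blast
 qed
 have "ideal_in UNIV J"
  unfolding ideal_in_def
 proof (intro conjI ballI)
  show "J <= polys UNIV" by (auto simp: J_def)
  show "0 : J" using idl_vanishing[of 0 Y A g] by (auto simp: J_def ev pfun_zero intro!: bexI[of _ 0])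
 next
  fix F G assume "F : J" "G : J"
  then obtain M k N l where k: "k : idl Y A g" "!!x. f x ~= 0 ==> f x ^ M * F (?z x) = k x" "F : polys UNIV"
   and l: "l : idl Y A g" "!!x. f x ~= 0 ==> f x ^ N * G (?z x) = l x" "G : polys UNIV"
   unfolding J_def by blast
  have "f ^ N * k + f ^ M * l : idl Y A g" by (intro idl_add idl_mult polys_power f k l)
  moreover have "f x ^ (M + N) * (F + G) (?z x) = (f ^ N * k + f ^ M * l) x" if "f x ~= 0" for x
   using k(2)[OF that, symmetric] l(2)[OF that, symmetric] by (simp add: ev power_add algebra_simps)
  ultimately show "F + G : J" using k l pfun_add[of F UNIV UNIV G] unfolding J_def by blast
 next
  fix H F :: "('n option => 'a) => 'a" assume "H : polys UNIV" "F : J" then show "H * F : J" by (rule Jmul)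
 qed
 have "1 : J"
 proof (rule ccontr)
  assume "1 ~: J"
  then obtain z where z: "!!F. F : J ==> F z = 0"
   using weak_nullstellensatz[OF _ `ideal_in UNIV J`] by auto
  let ?x = "%j. z (Some j)"
  let ?l = "sub (%j. coord (Some j)) :: ('n, 'a) fn => ('n option => 'a) => 'a"
  have lp: "?l p : polys UNIV" if "p : polys UNIV" for p
   by (rule sub_polys[OF that]) (auto intro: pfun_coord)
  have lift: "?l p : J" if "p : idl Y A g" for p
   using that lp[OF idl_polys[OF that]] unfolding J_def
   by (auto simp: sub_apply ev intro!: exI[of _ 0] bexI[of _ p])
  have "p ?x = 0" if "p : P" for p
   using z[OF lift, of p] that P idl_vanishing[of p Y A g] by (auto simp: sub_apply ev)
  then have "?x : Y" using P by auto
  moreover have "g i ?x = 0" if "i : A" for i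
   using z[OF lift[OF idl_gen]] that A by (auto simp: sub_apply ev)
  ultimately have "f ?x = 0" by (rule van)
  have "1 - coord None * ?l f : J"
   using lp[OF f] idl_vanishing[of 0 Y A g] unfolding J_def
   by (auto simp: sub_apply ev pfun_zero intro!: exI[of _ 0] bexI[of _ 0] pfun_diff pfun_one polys_mult pfun_coord)
  from z[OF this] show False using `f ?x = 0` by (simp add: sub_apply ev)
 qed
 then obtain M k where k: "k : idl Y A g" "!!x. f x ~= 0 ==> f x ^ M = k x" by (auto simp: J_def ev)
 \<comment> \<open>One further factor \<open>f\<close> makes the identity hold also where
   \<open>f\<close> vanishes.\<close>
 have "f ^ Suc M = f * k" by (auto simp: fun_eq_iff ev) (metis k(2))
 then show ?thesis using idl_mult[OF f k(1)] by metis
qed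

lemma nullstellensatz_one:
 fixes Y :: "('n::finite => 'a::alg_closed_field) set"
 assumes "zclosed Y" "finite A" "!!i. i : A ==> g i : polys UNIV"
  and "!!p. p : Y ==> \<exists>i\<in>A. g i p ~= 0"
 shows "1 : idl Y A g"
 using nullstellensatz[OF assms(1-3), where f = 1] assms(4) by (force intro: pfun_one)

section \<open>Hilbert functions\<close>

lemma homogeneous_system:
 fixes A :: "'j => nat => 'a::field"
 assumes "finite I" "M < card I"
 shows "\<exists>c. (\<exists>j\<in>I. c j ~= 0) \<and> (\<forall>l<M. (\<Sum>j\<in>I. c j * A j l) = 0)"
 using assms
proof (induction M arbitrary: I A)
 case 0
 then obtain j where "j : I" by (metis card.empty ex_in_conv less_irrefl)
 then show ?case by (intro exI[of _ "%_. 1"]) auto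
next
 case (Suc M)
 show ?case
 proof (cases "\<forall>j\<in>I. A j M = 0")
  case True
  obtain c where "\<exists>j\<in>I. c j ~= 0" "\<forall>l<M. (\<Sum>j\<in>I. c j * A j l) = 0" using Suc.IH[of I A] Suc.prems by auto
  then show ?thesis using True by (intro exI[of _ c]) (auto simp: less_Suc_eq)
 next
  case False
  then obtain i where i: "i : I" "A i M ~= 0" by auto
  define A' where "A' = (%j l. A j l - A j M / A i M * A i l)"
  have "M < card (I - {i})" using Suc.prems i by simp
  then obtain c where c: "\<exists>j\<in>I-{i}. c j ~= 0" "\<forall>l<M. (\<Sum>j\<in>I-{i}. c j * A' j l) = 0"
   using Suc.IH[of "I - {i}" A'] Suc.prems by auto
  define d where "d = (%j. if j = i then - (\<Sum>j\<in>I-{i}. c j * A j M) / A i M else c j)"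
  have sumd: "(\<Sum>j\<in>I. d j * A j l) = (\<Sum>j\<in>I-{i}. c j * A' j l)" for l
  proof -
   have "(\<Sum>j\<in>I. d j * A j l) = d i * A i l + (\<Sum>j\<in>I-{i}. d j * A j l)"
    using Suc.prems i by (simp add: sum.remove)
   also have "(\<Sum>j\<in>I-{i}. d j * A j l) = (\<Sum>j\<in>I-{i}. c j * A j l)"
    by (rule sum.cong) (auto simp: d_def)
   also have "d i * A i l = (\<Sum>j\<in>I-{i}. - (c j * A j M / A i M * A i l))"
    by (simp add: d_def sum_divide_distrib sum_distrib_right sum_negf)
   finally show ?thesis by (simp add: A'_def sum.distrib[symmetric] algebra_simps)
  qed
  have "(\<Sum>j\<in>I-{i}. c j * A' j M) = 0" using i by (simp add: A'_def)
  moreover have "\<exists>j\<in>I. d j ~= 0" using c(1) by (auto simp: d_def)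
  ultimately show ?thesis using c(2) by (intro exI[of _ d]) (auto simp: sumd less_Suc_eq)
 qed
qed

section \<open>Dimensions of images in quotient spaces\<close>

definition lsub :: "('x => 'a::field) set => bool" where
 "lsub W \<longleftrightarrow> 0 : W \<and> (\<forall>f\<in>W. \<forall>g\<in>W. f + g : W) \<and> (\<forall>c. \<forall>f\<in>W. cfun c * f : W)"

lemma lsubI: "0 : W ==> (!!f g. f : W ==> g : W ==> f + g : W) ==> (!!c f. f : W ==> cfun c * f : W) ==> lsub W"
 by (auto simp: lsub_def)

lemma lsub_sum: "lsub W ==> (!!i. i : A ==> f i : W) ==> (\<Sum>i\<in>A. f i) : W"
 by (induction A rule: infinite_finite_induct) (auto simp: lsub_def)

lemma lsub_scale: "lsub W ==> f : W ==> cfun c * f : W" by (auto simp: lsub_def)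
lemma lsub_add: "lsub W ==> f : W ==> g : W ==> f + g : W" by (auto simp: lsub_def)
lemma lsub_zero: "lsub W ==> 0 : W" by (auto simp: lsub_def)

lemma lsub_uminus: "lsub W ==> f : W ==> - f : W"
 using lsub_scale[of W f "-1"] by (simp add: cfun_simps)

lemma lsub_diff: "lsub W ==> f : W ==> g : W ==> f - g : W"
 using lsub_add[of W f "- g"] lsub_uminus by auto

lemma lsub_pfun [intro]: "lsub (pfun I D :: ('i, 'a::field) fn set)"
 by (rule lsubI) (auto intro: pfun_zero pfun_add pfun_scale)

lemma lsub_singleton [intro]: "lsub {0}"
 by (rule lsubI) auto

text \<open>\<open>hge V W N\<close> and \<open>hle V W N\<close> bound the dimension of the image of \<open>V\<close> in the quotient by the
 subspace \<open>W\<close> from below and from above.\<close>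

definition indep_mod :: "('x => 'a::field) set => 'j set => ('j => 'x => 'a) => bool" where
 "indep_mod W I f \<longleftrightarrow> (\<forall>c. (\<Sum>j\<in>I. cfun (c j) * f j) : W --> (\<forall>j\<in>I. c j = 0))"

definition hge :: "('x => 'a::field) set => ('x => 'a) set => nat => bool" where
 "hge V W N \<longleftrightarrow> (\<exists>f. (\<forall>j<N. f j : V) \<and> indep_mod W {..<N} f)"

definition hle :: "('x => 'a::field) set => ('x => 'a) set => nat => bool" where
 "hle V W N \<longleftrightarrow> (\<exists>g. \<forall>f\<in>V. \<exists>c. f - (\<Sum>j<N. cfun (c j) * g j) : W)"

lemma hgeI:
 assumes "finite I" "!!j. j : I ==> f j : V" "indep_mod W I f"
 shows "hge V W (card I)"
proof -
 obtain e where e: "bij_betw e {..<card I} I"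
  using ex_bij_betw_nat_finite[OF assms(1)] by (auto simp: atLeast0LessThan)
 show ?thesis unfolding hge_def
 proof (intro exI conjI)
  show "\<forall>j<card I. (f \<circ> e) j : V" using e assms(2) by (auto simp: bij_betw_def)
  show "indep_mod W {..<card I} (f \<circ> e)"
   unfolding indep_mod_def
  proof (intro allI impI ballI)
   fix c j assume *: "(\<Sum>j<card I. cfun (c j) * (f \<circ> e) j) : W" and j: "j : {..<card I}"
   define d where "d = c \<circ> inv_into {..<card I} e"
   have inv: "inv_into {..<card I} e (e k) = k" if "k < card I" for k
    using e that by (auto simp: bij_betw_def)
   have "(\<Sum>j\<in>I. cfun (d j) * f j) = (\<Sum>j<card I. cfun (d (e j)) * f (e j))"
    using sum.reindex_bij_betw[OF e, of "%j. cfun (d j) * f j"] by simp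
   also have "... = (\<Sum>j<card I. cfun (c j) * (f \<circ> e) j)"
    by (rule sum.cong) (auto simp: d_def inv)
   finally have "\<forall>j\<in>I. d j = 0" using assms(3) * by (auto simp: indep_mod_def)
   then have "d (e j) = 0" using e j by (auto simp: bij_betw_def)
   then show "c j = 0" using inv j by (auto simp: d_def)
  qed
 qed
qed

lemma hleI:
 assumes "finite I" "!!f. f : V ==> \<exists>c. f - (\<Sum>j\<in>I. cfun (c j) * g j) : W"
 shows "hle V W (card I)"
proof -
 obtain e where e: "bij_betw e {..<card I} I"
  using ex_bij_betw_nat_finite[OF assms(1)] by (auto simp: atLeast0LessThan)
 show ?thesis unfolding hle_def
 proof (intro exI[of _ "g \<circ> e"] ballI)
  fix f assume "f : V"
  then obtain c where c: "f - (\<Sum>j\<in>I. cfun (c j) * g j) : W" using assms by blast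
  then have "f - (\<Sum>j<card I. cfun ((c \<circ> e) j) * (g \<circ> e) j) : W"
   using sum.reindex_bij_betw[OF e, of "%j. cfun (c j) * g j"] by simp
  then show "\<exists>c. f - (\<Sum>j<card I. cfun (c j) * (g \<circ> e) j) : W" by (intro exI[of _ "c \<circ> e"])
 qed
qed

lemma hge_mono:
 assumes "hge V W N" "V <= V'" "W' <= W" "N' <= N" shows "hge V' W' N'"
proof -
 obtain f where f: "!!j. j < N ==> f j : V" "indep_mod W {..<N} f" using assms(1) by (auto simp: hge_def)
 have "indep_mod W' {..<N'} f"
  unfolding indep_mod_def
 proof (intro allI impI ballI)
  fix c j assume *: "(\<Sum>j<N'. cfun (c j) * f j) : W'" and j: "j : {..<N'}"
  have "(\<Sum>j<N. cfun (if j < N' then c j else 0) * f j) = (\<Sum>j<N'. cfun (c j) * f j)"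
   by (rule sum.mono_neutral_cong_right) (use assms in "auto simp: cfun_simps")
  then have "(\<Sum>j<N. cfun (if j < N' then c j else 0) * f j) : W" using * assms(3) by auto
  then have "(if j < N' then c j else 0) = 0"
   using f(2)[unfolded indep_mod_def, rule_format, of "%j. if j < N' then c j else 0" j] j assms(4) by auto
  then show "c j = 0" using j by simp
 qed
 then show ?thesis using f assms unfolding hge_def by (intro exI[of _ f]) auto
qed

lemma hle_mono:
 assumes "hle V W N" "V' <= V" "W <= W'" "N <= N'" shows "hle V' W' N'"
proof -
 obtain g where g: "!!f. f : V ==> \<exists>c. f - (\<Sum>j<N. cfun (c j) * g j) : W"
  using assms(1) unfolding hle_def by blast
 show ?thesis unfolding hle_def
 proof (intro exI[of _ g] ballI)
  fix f assume "f : V'"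
  then obtain c where c: "f - (\<Sum>j<N. cfun (c j) * g j) : W" using g assms by blast
  have "(\<Sum>j<N'. cfun (if j < N then c j else 0) * g j) = (\<Sum>j<N. cfun (c j) * g j)"
   by (rule sum.mono_neutral_cong_right) (use assms in "auto simp: cfun_simps")
  then have "f - (\<Sum>j<N'. cfun (if j < N then c j else 0) * g j) : W'" using c assms by auto
  then show "\<exists>c. f - (\<Sum>j<N'. cfun (c j) * g j) : W'"
   by (intro exI[of _ "%j. if j < N then c j else 0"])
 qed
qed

lemma hge_le_hle:
 assumes W: "lsub W" and "hge V W N" "hle V W M" shows "N <= M"
proof (rule ccontr)
 assume "\<not> N <= M"
 obtain f where f: "!!j. j < N ==> f j : V" "indep_mod W {..<N} f" using assms by (auto simp: hge_def)
 obtain g where g: "!!f. f : V ==> \<exists>c. f - (\<Sum>j<M. cfun (c j) * g j) : W" using assms unfolding hle_def by blast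
 have "\<forall>j. \<exists>c. j < N --> f j - (\<Sum>l<M. cfun (c l) * g l) : W" using f g by blast
 then obtain A where A: "!!j. j < N ==> f j - (\<Sum>l<M. cfun (A j l) * g l) : W" by metis
 obtain c where c: "\<exists>j\<in>{..<N}. c j ~= 0" "\<forall>l<M. (\<Sum>j\<in>{..<N}. c j * A j l) = 0"
  using homogeneous_system[of "{..<N}" M A] `\<not> N <= M` by auto
 have "(\<Sum>j<N. cfun (c j) * (f j - (\<Sum>l<M. cfun (A j l) * g l))) : W"
  using A by (intro lsub_sum W lsub_scale) auto
 also have "(\<Sum>j<N. cfun (c j) * (f j - (\<Sum>l<M. cfun (A j l) * g l)))
  = (\<Sum>j<N. cfun (c j) * f j) - (\<Sum>l<M. cfun (\<Sum>j<N. c j * A j l) * g l)"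
 proof -
  have "(\<Sum>j<N. cfun (c j) * (\<Sum>l<M. cfun (A j l) * g l)) = (\<Sum>l<M. cfun (\<Sum>j<N. c j * A j l) * g l)"
   unfolding sum_distrib_left
   by (subst sum.swap) (auto simp: fun_eq_iff ev sum_distrib_right mult.assoc intro!: sum.cong)
  then show ?thesis by (simp add: right_diff_distrib sum_subtractf)
 qed
 also have "(\<Sum>l<M. cfun (\<Sum>j<N. c j * A j l) * g l) = 0" using c(2) by (simp add: cfun_simps)
 finally have "(\<Sum>j<N. cfun (c j) * f j) : W" by simp
 then show False using f(2) c(1) by (auto simp: indep_mod_def)
qed

text \<open>An upper bound makes a largest independent family exist, and by maximality it spans;
  this yields the exact dimension together with generators inside \<open>V\<close>.\<close>

lemma hdim_exists:
 assumes W: "lsub W" and B: "hle V W B"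
 obtains N g where "hge V W N" "!!j. j < N ==> g j : V"
  "!!f. f : V ==> \<exists>c. f - (\<Sum>j<N. cfun (c j) * g j) : W" "hle V W N"
proof -
 have "hge V W 0" by (auto simp: hge_def indep_mod_def)
 moreover have "\<forall>N. hge V W N --> N <= B" using hge_le_hle[OF W _ B] by auto
 ultimately have "hge V W (GREATEST N. hge V W N)" "!!M. hge V W M ==> M <= (GREATEST N. hge V W N)"
  using GreatestI_nat[of "hge V W" 0 B] Greatest_le_nat[of "hge V W" _ B] by auto
 then obtain N where N: "hge V W N" "!!M. hge V W M ==> M <= N" by blast
 obtain f where f: "!!j. j < N ==> f j : V" "indep_mod W {..<N} f" using N by (auto simp: hge_def)
 have span: "\<exists>c. v - (\<Sum>j<N. cfun (c j) * f j) : W" if v: "v : V" for v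
 proof (rule ccontr)
  assume neg: "\<not> ?thesis"
  have "indep_mod W {..<Suc N} (f(N := v))"
   unfolding indep_mod_def
  proof (intro allI impI)
   fix c assume *: "(\<Sum>j<Suc N. cfun (c j) * (f(N := v)) j) : W"
   then have s: "(\<Sum>j<N. cfun (c j) * f j) + cfun (c N) * v : W" by simp
   have "c N = 0"
   proof (rule ccontr)
    assume "c N ~= 0"
    have "cfun (inverse (c N)) * ((\<Sum>j<N. cfun (c j) * f j) + cfun (c N) * v) : W"
     using s W lsub_scale by blast
    also have "cfun (inverse (c N)) * ((\<Sum>j<N. cfun (c j) * f j) + cfun (c N) * v)
     = v - (\<Sum>j<N. cfun (- (inverse (c N) * c j)) * f j)"
     using `c N ~= 0` by (simp add: fun_eq_iff ev distrib_left sum_distrib_left sum_negf mult.assoc flip: mult.assoc)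
    finally have "\<exists>c. v - (\<Sum>j<N. cfun (c j) * f j) : W"
     by (intro exI[of _ "%j. - (inverse (c N) * c j)"])
    then show False using neg by blast
   qed
   then have "\<forall>j<N. c j = 0" using s f(2) by (auto simp: indep_mod_def cfun_simps)
   then show "\<forall>j\<in>{..<Suc N}. c j = 0" using `c N = 0` by (auto simp: less_Suc_eq)
  qed
  then have "hge V W (Suc N)" using f v unfolding hge_def by (intro exI[of _ "f(N := v)"]) auto
  then show False using N(2) by fastforce
 qed
 then have "hle V W N" by (auto simp: hle_def)
 then show ?thesis using that N(1) f(1) span by blast
qed

text \<open>Dimensions add along \<open>W <= W1\<close>: the first family is independent even modulo
  \<open>W1\<close>, which swallows the second.\<close>

lemma hge_add:
 assumes "hge V1 W1 N1" "hge V2 W N2" "lsub W1" "V1 <= V" "V2 <= V" "V2 <= W1" "W <= W1"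
 shows "hge V W (N1 + N2)"
proof -
 obtain f where f: "!!j. j < N1 ==> f j : V1" "indep_mod W1 {..<N1} f" using assms(1) by (auto simp: hge_def)
 obtain g where g: "!!j. j < N2 ==> g j : V2" "indep_mod W {..<N2} g" using assms(2) by (auto simp: hge_def)
 have "hge V W (card ({..<N1} <+> {..<N2}))"
 proof (rule hgeI)
  show "case_sum f g j : V" if "j : {..<N1} <+> {..<N2}" for j
   using that f(1) g(1) assms by (auto split: sum.splits)
  show "indep_mod W ({..<N1} <+> {..<N2}) (case_sum f g)"
   unfolding indep_mod_def
  proof (intro allI impI)
   fix c assume *: "(\<Sum>j\<in>{..<N1} <+> {..<N2}. cfun (c j) * case_sum f g j) : W"
   then have s: "(\<Sum>j<N1. cfun (c (Inl j)) * f j) + (\<Sum>j<N2. cfun (c (Inr j)) * g j) : W"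
    by (simp add: sum.Plus)
   have "(\<Sum>j<N2. cfun (c (Inr j)) * g j) : W1" using g assms by (intro lsub_sum lsub_scale) auto
   then have "(\<Sum>j<N1. cfun (c (Inl j)) * f j) : W1"
    using lsub_diff[OF assms(3), of "(\<Sum>j<N1. cfun (c (Inl j)) * f j) + (\<Sum>j<N2. cfun (c (Inr j)) * g j)"
     "\<Sum>j<N2. cfun (c (Inr j)) * g j"] s assms(7)
    by auto
   then have z: "!!j. j < N1 ==> c (Inl j) = 0"
    using f(2)[unfolded indep_mod_def, rule_format, of "%j. c (Inl j)"] by auto
   then have "(\<Sum>j<N1. cfun (c (Inl j)) * f j) = 0" by (simp add: cfun_simps)
   then have "(\<Sum>j<N2. cfun (c (Inr j)) * g j) : W" using s by simp
   then have "!!j. j < N2 ==> c (Inr j) = 0"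
    using g(2)[unfolded indep_mod_def, rule_format, of "%j. c (Inr j)"] by auto
   then show "\<forall>j\<in>{..<N1} <+> {..<N2}. c j = 0" using z by auto
  qed
 qed auto
 then show ?thesis by (simp add: card_Plus)
qed

lemma hle_add:
 assumes "hle V1 W N1" "hle V2 W N2" "lsub W" "!!f. f : V ==> \<exists>a\<in>V1. \<exists>b\<in>V2. f = a + b"
 shows "hle V W (N1 + N2)"
proof -
 obtain g where g: "!!f. f : V1 ==> \<exists>c. f - (\<Sum>j<N1. cfun (c j) * g j) : W" using assms unfolding hle_def by blast
 obtain h where h: "!!f. f : V2 ==> \<exists>c. f - (\<Sum>j<N2. cfun (c j) * h j) : W" using assms unfolding hle_def by blast
 have "hle V W (card ({..<N1} <+> {..<N2}))"
 proof (rule hleI)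
  fix f assume "f : V"
  then obtain a b where ab: "a : V1" "b : V2" "f = a + b" using assms(4) by blast
  obtain c where c: "a - (\<Sum>j<N1. cfun (c j) * g j) : W" using g ab by blast
  obtain d where d: "b - (\<Sum>j<N2. cfun (d j) * h j) : W" using h ab by blast
  have "(a - (\<Sum>j<N1. cfun (c j) * g j)) + (b - (\<Sum>j<N2. cfun (d j) * h j)) : W"
   using c d assms(3) lsub_add by blast
  then show "\<exists>c. f - (\<Sum>j\<in>{..<N1} <+> {..<N2}. cfun (c j) * case_sum g h j) : W"
   by (intro exI[of _ "case_sum c d"]) (simp add: sum.Plus ab algebra_simps)
 qed auto
 then show ?thesis by (simp add: card_Plus)
qed

text \<open>A multiplication that reflects membership is injective on the quotient; in the
  applications \<open>h\<close> is nonzero in an integral domain.\<close>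

lemma hge_mult:
 assumes "hge V W N" "lsub V" "!!f. f : V ==> h * f : W' ==> f : W"
 shows "hge ((%f. h * f) ` V) W' N"
proof -
 obtain f where f: "!!j. j < N ==> f j : V" "indep_mod W {..<N} f" using assms by (auto simp: hge_def)
 have "indep_mod W' {..<N} (%j. h * f j)"
  unfolding indep_mod_def
 proof (intro allI impI)
  fix c assume "(\<Sum>j<N. cfun (c j) * (h * f j)) : W'"
  then have "h * (\<Sum>j<N. cfun (c j) * f j) : W'" by (simp add: sum_distrib_left mult.left_commute)
  moreover have "(\<Sum>j<N. cfun (c j) * f j) : V" using f assms by (intro lsub_sum lsub_scale) auto
  ultimately have "(\<Sum>j<N. cfun (c j) * f j) : W" using assms by blast
  then show "\<forall>j\<in>{..<N}. c j = 0" using f(2) by (auto simp: indep_mod_def)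
 qed
 then show ?thesis using f unfolding hge_def by (intro exI[of _ "%j. h * f j"]) auto
qed

lemma hge_image:
 assumes "hge V W N" "lsub V" "!!f. f : V ==> ph f : W' ==> f : W"
  "!!f g. ph (f + g) = ph f + ph g" "!!c f. ph (cfun c * f) = cfun c * ph f" "ph 0 = 0"
 shows "hge (ph ` V) W' N"
proof -
 obtain f where f: "!!j. j < N ==> f j : V" "indep_mod W {..<N} f" using assms by (auto simp: hge_def)
 have phsum: "ph (\<Sum>j\<in>A. cfun (c j) * f j) = (\<Sum>j\<in>A. cfun (c j) * ph (f j))" for A c
  by (induction A rule: infinite_finite_induct) (auto simp: assms)
 have "indep_mod W' {..<N} (%j. ph (f j))"
  unfolding indep_mod_def
 proof (intro allI impI)
  fix c assume "(\<Sum>j<N. cfun (c j) * ph (f j)) : W'"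
  then have "ph (\<Sum>j<N. cfun (c j) * f j) : W'" by (simp add: phsum)
  moreover have "(\<Sum>j<N. cfun (c j) * f j) : V" using f assms by (intro lsub_sum lsub_scale) auto
  ultimately have "(\<Sum>j<N. cfun (c j) * f j) : W" using assms by blast
  then show "\<forall>j\<in>{..<N}. c j = 0" using f(2) by (auto simp: indep_mod_def)
 qed
 then show ?thesis using f unfolding hge_def by (intro exI[of _ "%j. ph (f j)"]) auto
qed

lemma hle_image:
 assumes "hle V W N" "!!f. f : W ==> ph f : W'"
  "!!f g. ph (f + g) = ph f + ph g" "!!c f. ph (cfun c * f) = cfun c * ph f" "ph 0 = 0" "!!f g. ph (f - g) = ph f - ph g"
 shows "hle (ph ` V) W' N"
proof -
 obtain g where g: "!!f. f : V ==> \<exists>c. f - (\<Sum>j<N. cfun (c j) * g j) : W" using assms unfolding hle_def by blast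
 have phsum: "ph (\<Sum>j\<in>A. cfun (c j) * g j) = (\<Sum>j\<in>A. cfun (c j) * ph (g j))" for A c
  by (induction A rule: infinite_finite_induct) (auto simp: assms)
 show ?thesis unfolding hle_def
 proof (intro exI[of _ "%j. ph (g j)"] ballI)
  fix f' assume "f' : ph ` V"
  then obtain f where f: "f : V" "f' = ph f" by auto
  then obtain c where "f - (\<Sum>j<N. cfun (c j) * g j) : W" using g by blast
  then have "ph (f - (\<Sum>j<N. cfun (c j) * g j)) : W'" by (rule assms)
  then show "\<exists>c. f' - (\<Sum>j<N. cfun (c j) * ph (g j)) : W'"
   by (intro exI[of _ c]) (simp add: assms phsum f)
 qed
qed

text \<open>Chinese remaindering: every residue at one point is realized inside \<open>V'\<close>
  with zero residue at all others, so the dimensions at the points add up.\<close>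

lemma hge_crt:
 assumes S: "finite S" "!!a. a : S ==> hge V (W a) (N a)" "!!a. a : S ==> lsub (W a)"
  and P: "!!a g. a : S ==> g : V ==> \<exists>P\<in>V'. P - g : W a \<and> (\<forall>a'\<in>S. a' ~= a --> P : W a')"
  and W': "!!a. a : S ==> W' <= W a"
 shows "hge V' W' (\<Sum>a\<in>S. N a)"
proof -
 have "\<forall>a. \<exists>f. a : S --> (\<forall>j<N a. f j : V) \<and> indep_mod (W a) {..<N a} f" using S(2) by (auto simp: hge_def)
 then obtain f where f: "!!a j. a : S ==> j < N a ==> f a j : V" "!!a. a : S ==> indep_mod (W a) {..<N a} (f a)"
  by metis
 define R where "R = (%a j P. P : V' \<and> P - f a j : W a \<and> (\<forall>a'\<in>S. a' ~= a --> P : W a'))"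
 have "\<forall>a j. \<exists>P. a : S --> j < N a --> R a j P" using P f(1) unfolding R_def by meson
 then obtain P where P: "!!a j. a : S ==> j < N a ==> R a j (P a j)" by metis
 have "hge V' W' (card (SIGMA a:S. {..<N a}))"
 proof (rule hgeI)
  show "finite (SIGMA a:S. {..<N a})" using S by auto
  show "(%(a, j). P a j) x : V'" if "x : (SIGMA a:S. {..<N a})" for x using that P by (auto simp: R_def)
  show "indep_mod W' (SIGMA a:S. {..<N a}) (%(a, j). P a j)"
   unfolding indep_mod_def
  proof (intro allI impI)
   fix c assume *: "(\<Sum>x\<in>(SIGMA a:S. {..<N a}). cfun (c x) * (%(a, j). P a j) x) : W'"
   define T where "T = (%a. \<Sum>j<N a. cfun (c (a, j)) * P a j)"
   have "(\<Sum>x\<in>(SIGMA a:S. {..<N a}). cfun (c x) * (%(a, j). P a j) x) = (\<Sum>a\<in>S. T a)"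
    unfolding T_def using S(1) by (subst sum.Sigma) (auto simp: case_prod_beta)
   then have T: "(\<Sum>a\<in>S. T a) : W'" using * by simp
   have "c (a, j) = 0" if a: "a : S" and j: "j < N a" for a j
   proof -
    have "(\<Sum>a'\<in>S - {a}. T a') : W a"
     using P a S(3) by (intro lsub_sum) (auto simp: T_def R_def intro!: lsub_sum lsub_scale)
    moreover have "(\<Sum>a'\<in>S. T a') = T a + (\<Sum>a'\<in>S - {a}. T a')" using a S(1) by (simp add: sum.remove)
    ultimately have "T a : W a"
     using lsub_diff[OF S(3)[OF a], of "\<Sum>a'\<in>S. T a'" "\<Sum>a'\<in>S - {a}. T a'"] T W'[OF a] by auto
    moreover have "(\<Sum>j<N a. cfun (c (a, j)) * (P a j - f a j)) : W a"
     using P a S(3) by (intro lsub_sum lsub_scale) (auto simp: R_def)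
    ultimately have "T a - (\<Sum>j<N a. cfun (c (a, j)) * (P a j - f a j)) : W a"
     using lsub_diff S(3) a by blast
    then have "(\<Sum>j<N a. cfun (c (a, j)) * f a j) : W a"
     by (simp add: T_def right_diff_distrib sum_subtractf)
    then have "\<forall>j\<in>{..<N a}. c (a, j) = 0"
     using f(2)[OF a, unfolded indep_mod_def, rule_format, of "%j. c (a, j)"] by auto
    then show ?thesis using j by auto
   qed
   then show "\<forall>x\<in>(SIGMA a:S. {..<N a}). c x = 0" by auto
  qed
 qed
 then show ?thesis using S(1) by (simp add: card_SigmaI)
qed

section \<open>The Hilbert function of affine space and binomial growth\<close>

lemma pfun_const_iff: "f : pfun I {..0} \<longleftrightarrow> (\<exists>c. f = cfun c)"
proof
 assume f: "f : pfun I {..0}"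
 have "f x = f (%i. 0 * x i)" for x using pfun_hom[of f I 0 0 x] f by (simp add: atMost_0)
 then show "\<exists>c. f = cfun c" by (intro exI[of _ "f (%_. 0)"]) (auto simp: fun_eq_iff ev)
qed (auto intro: pfun_const)

text \<open>Pascal's rule: a polynomial splits into its part free of the last variable and a
  multiple of that variable by a polynomial of degree one less.\<close>

lemma pfun_dim:
 fixes V :: "nat => nat => (nat, 'a::alg_closed_field) fn set"
 defines "V == (%m t. pfun {..<m} {..t})"
 shows "hge (V m t) {0} ((m + t) choose m) \<and> hle (V m t) {0} ((m + t) choose m)"
proof -
 have const: "hge V' {0} 1 \<and> hle V' {0} 1" if "!!f. f : V' \<longleftrightarrow> (\<exists>c::'a. f = cfun c)" for V' :: "(nat, 'a) fn set"
 proof -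
  have "c = 0" if "cfun c = (0 :: (nat, 'a) fn)" for c using fun_cong[OF that, of undefined] by (simp add: ev)
  moreover have "1 : V'" using that[of 1] by (auto intro!: exI[of _ 1] simp: cfun_simps)
  ultimately have "hge V' {0} 1" unfolding hge_def indep_mod_def
   by (intro exI[of _ "%_. 1"]) auto
  moreover have "hle V' {0} 1" unfolding hle_def using that by (intro exI[of _ "%_. 1"]) auto
  ultimately show ?thesis by simp
 qed
 have V: "f : V 0 t \<longleftrightarrow> (\<exists>c. f = cfun c)" for f t
  using pfun_no_vars[of f "{..t}"] by (auto simp: V_def intro: pfun_const)
 show ?thesis
 proof (induction m arbitrary: t)
  case 0 then show ?case using const[OF V] by simp
 next
  case (Suc m)
  note IH = Suc
  show ?case
  proof (induction t)
   case 0 then show ?case using const[of "V (Suc m) 0"] by (simp add: V_def pfun_const_iff del: atMost_0)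
  next
   case (Suc t)
   let ?T = "%f. coord m * f :: (nat, 'a) fn"
   \<comment> \<open>Modulo functions vanishing on this hyperplane the multiples of the coordinate
     disappear, while polynomials free of it stay independent.\<close>
   let ?W = "{f :: (nat => 'a) => 'a. \<forall>x. x m = 0 --> f x = 0}"
   have W: "lsub ?W" by (rule lsubI) (auto simp: ev)
   have sub1: "V m (Suc t) <= V (Suc m) (Suc t)" by (auto simp: V_def intro: pfun_mono)
   have sub2: "?T ` V (Suc m) t <= V (Suc m) (Suc t)"
    unfolding V_def by (auto intro!: pfun_mult[where D = "{1}" and D' = "{..t}"] pfun_coord)
   have ge1: "hge (V m (Suc t)) ?W ((m + Suc t) choose m)"
   proof -
    obtain f where f: "\<forall>j<(m + Suc t) choose m. f j : V m (Suc t)" "indep_mod {0} {..<(m + Suc t) choose m} f"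
     using IH[of "Suc t"] unfolding hge_def by blast
    have "indep_mod ?W {..<(m + Suc t) choose m} f"
     unfolding indep_mod_def
    proof (intro allI impI)
     fix c assume *: "(\<Sum>j<(m + Suc t) choose m. cfun (c j) * f j) : ?W"
     let ?g = "\<Sum>j<(m + Suc t) choose m. cfun (c j) * f j"
     have g: "?g : pfun {..<m} {..Suc t}" using f(1) by (auto simp: V_def intro!: pfun_sum pfun_scale)
     have "?g x = ?g (x(m := 0))" for x using g by (rule pfun_cong) auto
     then have "?g x = 0" for x using * by auto
     then have "?g = 0" by (simp only: fun_eq_iff zero_fun_apply) simp
     then show "\<forall>j\<in>{..<(m + Suc t) choose m}. c j = 0" using f(2) by (auto simp: indep_mod_def)
    qed
    then show ?thesis using f(1) by (auto simp: hge_def)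
   qed
   have ge2: "hge (?T ` V (Suc m) t) {0} ((Suc m + t) choose Suc m)"
   proof (rule hge_mult)
    show "hge (V (Suc m) t) {0} (Suc m + t choose Suc m)" using Suc by simp
    show "lsub (V (Suc m) t)" by (auto simp: V_def)
    fix f assume f: "f : V (Suc m) t" "coord m * f : {0}"
    have "(coord m :: (nat, 'a) fn) (%_. 1) ~= 0 (%_. 1)" by (simp add: ev)
    then have "(coord m :: (nat, 'a) fn) ~= 0" by metis
    then show "f : {0}" using polys_domain[of "coord m" "{..<Suc m}" f] f
     by (auto simp: V_def intro: pfun_polys pfun_coord)
   qed
   have "hge (V (Suc m) (Suc t)) {0} (((m + Suc t) choose m) + ((Suc m + t) choose Suc m))"
    by (rule hge_add[OF ge1 ge2 W sub1 sub2]) (auto simp: ev)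
   moreover have "hle (V (Suc m) (Suc t)) {0} (((m + Suc t) choose m) + ((Suc m + t) choose Suc m))"
   proof (rule hle_add)
    show "hle (V m (Suc t)) {0} ((m + Suc t) choose m)"
     using IH by blast
    show "hle (?T ` V (Suc m) t) {0} ((Suc m + t) choose Suc m)"
     using Suc by (intro hle_image) (auto simp: algebra_simps)
    fix f assume "f : V (Suc m) (Suc t)"
    then have f: "f : pfun {..<Suc m} {..Suc t}" by (simp add: V_def)
    then obtain a where a: "!!k. a k : pfun ({..<Suc m} - {m}) {..Suc t - k}" "f = (\<Sum>k\<le>Suc t. a k * coord m ^ k)"
     by (rule pfun_split_le[where i = m]) blast
    have "f = a 0 + coord m * (\<Sum>k\<le>t. a (Suc k) * coord m ^ k)"
     unfolding a(2) by (subst sum.atMost_Suc_shift) (simp add: sum_distrib_left mult.left_commute)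
    moreover have "a 0 : V m (Suc t)" using a(1)[of 0] unfolding V_def by (rule pfun_mono) auto
    moreover have "(\<Sum>k\<le>t. a (Suc k) * coord m ^ k) : V (Suc m) t"
     unfolding V_def
    proof (rule pfun_sum)
     fix k assume k: "k : {..t}"
     have "coord m ^ k : pfun {..<Suc m} {k * 1}" by (intro pfun_power_eq pfun_coord) auto
     moreover have "a (Suc k) : pfun {..<Suc m} {..t - k}" using a(1)[of "Suc k"] by (rule pfun_mono) auto
     ultimately show "a (Suc k) * coord m ^ k : pfun {..<Suc m} {..t}"
      using k by (auto intro: pfun_mult)
    qed
    ultimately show "\<exists>a\<in>V m (Suc t). \<exists>b\<in>?T ` V (Suc m) t. f = a + b" by blast
   qed auto
   moreover have "((m + Suc t) choose m) + ((Suc m + t) choose Suc m) = (Suc m + Suc t) choose Suc m" by simp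
   ultimately show ?case by metis
  qed
 qed
qed

lemma pfun_finite_dim:
 assumes "finite I"
 obtains B where "hle (pfun I {..t} :: ('i, 'a::alg_closed_field) fn set) {0} B"
proof -
 obtain e where e: "bij_betw e {..<card I} I"
  using ex_bij_betw_nat_finite[OF assms(1)] by (auto simp: atLeast0LessThan)
 let ?d = "inv_into {..<card I} e"
 let ?ph = "sub (%k. coord (e k)) :: (nat, 'a) fn => ('i, 'a) fn"
 have "hle (?ph ` pfun {..<card I} {..t}) {0} ((card I + t) choose card I)"
  using pfun_dim by (intro hle_image) auto
 moreover have "pfun I {..t} <= ?ph ` pfun {..<card I} {..t}"
 proof
  fix f :: "('i, 'a) fn" assume f: "f : pfun I {..t}"
  have 1: "sub (%i. coord (?d i)) f : pfun {..<card I} {..t}"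
   by (rule sub_pfun_le1[OF f]) (use e inv_into_into[of _ e "{..<card I}"] in "auto intro!: pfun_coord simp: bij_betw_def")
  have "f = ?ph (sub (%i. coord (?d i)) f)"
  proof
   fix x
   have "f x = f (%i. x (e (?d i)))"
    by (rule pfun_cong[OF f]) (use e in "auto simp: bij_betw_def f_inv_into_f")
   then show "f x = ?ph (sub (%i. coord (?d i)) f) x" by (simp add: sub_apply coord_apply)
  qed
  with 1 show "f : ?ph ` pfun {..<card I} {..t}" by blast
 qed
 ultimately show ?thesis using that hle_mono by blast
qed

lemma binomial_bounds: "M ^ s <= fact s * ((M + s) choose s)" "fact s * ((M + s) choose s) <= (M + s) ^ s"
proof -
 have eq: "fact (Suc s) * ((M + Suc s) choose Suc s) = (M + Suc s) * (fact s * ((M + s) choose s))" for s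
  using Suc_times_binomial_eq[of "M + s" s] by (simp add: algebra_simps)
 show "M ^ s <= fact s * ((M + s) choose s)"
 proof (induction s)
  case (Suc s)
  have "M * M ^ s <= (M + Suc s) * (fact s * ((M + s) choose s))" by (rule mult_le_mono) (use Suc in auto)
  then show ?case using eq by simp
 qed auto
 show "fact s * ((M + s) choose s) <= (M + s) ^ s"
 proof (induction s)
  case (Suc s)
  have "(M + Suc s) * (fact s * ((M + s) choose s)) <= (M + Suc s) * (M + Suc s) ^ s"
   by (rule mult_le_mono[OF order.refl order.trans[OF Suc power_mono]]) auto
  then show ?case using eq by simp
 qed auto
qed

text \<open>Growth of order \<open>M ^ s\<close> is not dominated by order \<open>M ^ m\<close> with
  \<open>m < s\<close>; \<open>K\<close> gathers all constants, and \<open>M = K + 1\<close> gives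
  the contradiction.\<close>

lemma binomial_growth:
 assumes "!!M. (M + s) choose s <= D * ((j * M + c + m) choose m)"
 shows "s <= m"
proof (rule ccontr)
 assume "\<not> s <= m"
 define K where "K = fact s * D * (j + c + m) ^ m"
 have "M ^ s <= K * M ^ m" if "M > 0" for M
 proof -
  have "((j * M + c + m) choose m) <= fact m * ((j * M + c + m) choose m)" by simp
  also have "... <= (j * M + c + m) ^ m" using binomial_bounds(2)[of m "j * M + c"] by simp
  also have "... <= ((j + c + m) * M) ^ m"
   by (rule power_mono) (use that in "auto simp: algebra_simps intro!: add_mono")
  finally have 1: "((j * M + c + m) choose m) <= (j + c + m) ^ m * M ^ m" by (simp add: power_mult_distrib)
  have "M ^ s <= fact s * ((M + s) choose s)" by (rule binomial_bounds)
  also have "... <= fact s * (D * ((j * M + c + m) choose m))" using assms by simp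
  also have "... <= fact s * (D * ((j + c + m) ^ m * M ^ m))" using 1 by simp
  finally show ?thesis by (simp add: K_def algebra_simps)
 qed
 from this[of "Suc K"] have "Suc K ^ s <= K * Suc K ^ m" by simp
 moreover have "Suc K ^ s \<ge> Suc K ^ Suc m" using `\<not> s <= m` by (intro power_increasing) auto
 moreover have "Suc K ^ m > 0" by simp
 ultimately show False unfolding power_Suc mult_Suc by linarith
qed

text \<open>Dividing by \<open>M ^ s\<close> and letting \<open>M\<close> tend to infinity compares
  leading coefficients; constant shifts of the degree drop out. The Bezout estimates end
  here.\<close>

lemma binomial_limit:
 fixes A B q c s :: nat
 assumes "!!M. A * ((M + s) choose s) <= B * ((q * M + c + s) choose s)"
 shows "A <= B * q ^ s"
proof -
 have le: "real A <= real B * (real q + real (c + s) * inverse (real M)) ^ s" if "M > 0" for M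
 proof -
  have "A * M ^ s <= A * (fact s * ((M + s) choose s))" by (simp add: binomial_bounds)
  also have "... = fact s * (A * ((M + s) choose s))" by simp
  also have "... <= fact s * (B * ((q * M + c + s) choose s))" using assms by simp
  also have "... = B * (fact s * ((q * M + c + s) choose s))" by simp
  also have "... <= B * (q * M + c + s) ^ s" using binomial_bounds(2)[of s "q * M + c"] by simp
  finally have "real (A * M ^ s) <= real (B * (q * M + c + s) ^ s)" by (simp only: of_nat_le_iff)
  also have "real (B * (q * M + c + s) ^ s) = real B * ((real q + real (c + s) * inverse (real M)) * real M) ^ s"
  proof -
   have "real (q * M + c + s) = (real q + real (c + s) * inverse (real M)) * real M"
    using that by (simp add: field_simps)
   then show ?thesis by simp
  qed
  finally show ?thesis using that by (simp add: power_mult_distrib)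
 qed
 have "(%M. real B * (real q + real (c + s) * inverse (real M)) ^ s) \<longlonglongrightarrow> real B * (real q + real (c + s) * 0) ^ s"
  by (intro tendsto_intros lim_inverse_n)
 then have "real A <= real B * (real q + real (c + s) * 0) ^ s"
  by (rule LIMSEQ_le_const) (use le in "auto intro!: exI[of _ 1]")
 then have "real A <= real (B * q ^ s)" by simp
 then show ?thesis by (simp only: of_nat_le_iff)
qed

text \<open>All functions vanishing on \<open>Y\<close>, polynomial or not: the image of the
  polynomials modulo it is still the coordinate ring, and it absorbs multiplication by arbitrary
  functions.\<close>

definition van :: "('n => 'a::comm_ring_1) set => ('n, 'a) fn set" where
 "van Y = {f. \<forall>p\<in>Y. f p = 0}"

text \<open>Irreducibility of a closed \<open>Y\<close> in the form in which it is used: the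
  coordinate ring is an integral domain (see \<open>irr_zclosed_iff\<close>).\<close>

definition zprime :: "('n => 'a::comm_ring_1) set => bool" where
 "zprime Y \<longleftrightarrow> Y ~= {} \<and> (\<forall>f\<in>polys UNIV. \<forall>g\<in>polys UNIV. f * g : van Y --> f : van Y \<or> g : van Y)"

lemma van_lsub [intro]: "lsub (van Y)"
 by (rule lsubI) (auto simp: van_def ev)

lemma van_mult: "f : van Y ==> h * f : van Y"
 by (auto simp: van_def ev)

lemma van_diff_iff: "f - g : van Y \<longleftrightarrow> (\<forall>p\<in>Y. f p = (g p :: 'a::comm_ring_1))"
 by (auto simp: van_def ev)

lemma zprime_mult: "zprime Y ==> f : polys UNIV ==> g : polys UNIV ==> f * g : van Y ==> f ~: van Y ==> g : van Y"
 by (auto simp: zprime_def)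

lemma zprime_power: "f ^ k : van Y ==> f : van (Y :: ('n => 'a::idom) set)"
 by (auto simp: van_def ev)

definition trans :: "('i => 'a::comm_ring_1) => ('i, 'a) fn => ('i, 'a) fn" where
 "trans x = sub (%i. coord i + cfun (x i))"

lemma trans_apply: "trans x f h = f (%i. h i + x i)" by (simp add: trans_def ev)

lemma trans_simps [simp]:
 "trans x (f + g) = trans x f + trans x g" "trans x (f * g) = trans x f * trans x g"
 "trans x (f - g) = trans x f - trans x g" "trans x 0 = 0" "trans x 1 = 1" "trans x (cfun c) = cfun c"
 "trans x (coord i) = coord i + cfun (x i)" "trans x (f ^ k) = trans x f ^ k"
 "trans x (\<Sum>j\<in>A. F j) = (\<Sum>j\<in>A. trans x (F j))"
 by (simp_all add: trans_def)

lemma trans_pfun_le: "f : pfun I {..t} ==> trans x f : pfun I {..t}"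
 unfolding trans_def by (erule sub_pfun_le1) (auto intro!: pfun_add pfun_coord pfun_const)

lemma trans_polys: "f : polys I ==> trans x f : polys I"
 unfolding trans_def by (erule sub_polys) (auto intro!: pfun_add pfun_coord pfun_const)

lemma trans_trans: "trans x (trans y f) = trans (%i. x i + y i) f"
 by (auto simp: fun_eq_iff trans_apply add.assoc)

lemma trans_zero: "trans (%_. 0) f = f"
 by (auto simp: fun_eq_iff trans_apply)

lemma trans_polys_iff: "trans x f : polys I \<longleftrightarrow> f : polys I"
 using trans_polys[of "trans x f" I "%i. - x i"] trans_polys[of f I x] by (auto simp: trans_trans trans_zero)

text \<open>The \<open>k\<close>-th power of the maximal ideal of the point \<open>y\<close>,
  described by the order of vanishing there.\<close>

definition mpow :: "('n => 'a::comm_ring_1) => nat => ('n, 'a) fn set" where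
 "mpow y k = {f. trans y f : pfun UNIV {k..}}"

lemma mpow_polys: "f : mpow y k ==> f : polys UNIV"
 using trans_polys_iff[of y f UNIV] by (auto simp: mpow_def intro: pfun_polys)

lemma mpow_mono: "f : mpow y k ==> l <= k ==> f : mpow y l"
 by (auto simp: mpow_def intro: pfun_mono)

lemma mpow_0: "mpow y 0 = polys UNIV"
 using trans_polys_iff[of y _ UNIV] by (auto simp: mpow_def atLeast_0)

lemma mpow_mult: "f : mpow y k ==> g : mpow y l ==> f * g : mpow y (k + l)"
 by (auto simp: mpow_def intro: pfun_mult_ge)

lemma mpow_power: "f : mpow y k ==> f ^ n : mpow y (n * k)"
 by (auto simp: mpow_def intro: pfun_power_ge)

lemma mpow_ideal: "f : mpow y k ==> g : polys UNIV ==> g * f : mpow y k"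
 using mpow_mult[of g y 0 f k] by (simp add: mpow_0)

lemma mpow_add: "f : mpow y k ==> g : mpow y k ==> f + g : mpow y k"
 by (auto simp: mpow_def intro: pfun_add)

lemma mpow_diff: "f : mpow y k ==> g : mpow y k ==> f - g : mpow y k"
 by (auto simp: mpow_def intro: pfun_diff)

lemma mpow_scale: "f : mpow y k ==> cfun c * f : mpow y k"
 by (auto simp: mpow_def intro: pfun_scale)

lemma mpow_zero: "0 : mpow y k" by (auto simp: mpow_def pfun_zero)

lemma pfun_ge1_zero: "f : pfun I {1..} ==> f (%_. 0) = 0"
proof (induction rule: pfun_induct)
 case (step f d m c)
 have "m (%i. 0) = 0 ^ d * m (%_. 0)" using monomial_scale[OF step(3), of 0 "%_. 0"] by simp
 then show ?case using step by (auto simp: ev zero_power)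
qed (simp add: ev)

lemma mpow_1_iff: "f : mpow y 1 \<longleftrightarrow> f : polys UNIV \<and> f y = 0"
proof
 assume "f : mpow y 1"
 then show "f : polys UNIV \<and> f y = 0"
  using pfun_ge1_zero[of "trans y f" UNIV] mpow_polys by (auto simp: mpow_def trans_apply)
next
 assume f: "f : polys UNIV \<and> f y = 0"
 then have "trans y f : pfun UNIV ({..0} \<union> {1..})" using trans_polys[of f UNIV y] by (auto intro: pfun_mono)
 then obtain g h where gh: "g : pfun UNIV {..0}" "h : pfun UNIV {1..}" "trans y f = g + h" by (rule pfun_Un)
 obtain c where c: "g = cfun c"
 proof -
  have "g : pfun UNIV {0}" using gh(1) by (simp add: atMost_0)
  have "g x = cfun (g (%_. 0)) x" for x
   using pfun_hom[OF `g : pfun UNIV {0}`, of 0 x] by (simp add: cfun_apply)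
  then show ?thesis using that by blast
 qed
 have "trans y f (%_. 0) = 0" using f by (simp add: trans_apply)
 then have "c = 0" using gh c pfun_ge1_zero[OF gh(2)] by (simp add: ev)
 then show "f : mpow y 1" using gh c by (simp add: mpow_def cfun_simps)
qed

lemma coord_mpow: "coord j - cfun (y j) : mpow y 1"
 by (auto simp: mpow_1_iff ev simp del: One_nat_def intro!: pfun_diff pfun_coord pfun_const)

lemma mpow_Suc_decomp:
 fixes f :: "('n::finite, 'a::comm_ring_1) fn"
 assumes "f : mpow y (Suc k)"
 obtains h where "!!j. h j : mpow y k" "f = (\<Sum>j\<in>UNIV. h j * (coord j - cfun (y j)))"
proof -
 have "\<exists>h. (\<forall>j. h j : pfun UNIV {k..}) \<and> g = (\<Sum>j\<in>UNIV. h j * coord j)"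
  if "g : pfun UNIV {Suc k..}" for g :: "('n, 'a) fn"
  using that
 proof (induction rule: pfun_induct)
  case zero
  have "\<exists>h. (\<forall>j. h j : pfun UNIV {k..}) \<and> (0 :: ('n, 'a) fn) = (\<Sum>j\<in>UNIV. h j * coord j)"
   by (intro exI[of _ "%_. 0"]) (auto intro: pfun_zero)
  then show ?case .
 next
  case (step g d m c)
  then obtain h where h: "!!j. h j : pfun UNIV {k..}" "g = (\<Sum>j\<in>UNIV. h j * coord j)" by blast
  from step(3,2) obtain i d' m' where m: "m = coord i * m'" "monomial_fun UNIV d' m'" "d = Suc d'"
   by (cases rule: monomial_fun.cases) auto
  define h' where "h' = (%j. (if j = i then cfun c * m' else 0) + h j)"
  have "h' j : pfun UNIV {k..}" for j
   using h step(2) m by (auto simp: h'_def intro!: pfun_step)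
  moreover have "cfun c * m + g = (\<Sum>j\<in>UNIV. h' j * coord j)"
  proof -
   have "(\<Sum>j\<in>UNIV. h' j * coord j) = (\<Sum>j\<in>UNIV. (if j = i then cfun c * m' * coord i else 0) + h j * coord j)"
    by (rule sum.cong) (auto simp: h'_def distrib_right)
   then show ?thesis by (simp add: sum.distrib h(2) m mult_ac)
  qed
  ultimately show ?case by blast
 qed
 then obtain h where h: "!!j. h j : pfun UNIV {k..}" "trans y f = (\<Sum>j\<in>UNIV. h j * coord j)"
  using assms unfolding mpow_def by blast
 let ?b = "trans (%i. - y i)"
 have "f = ?b (trans y f)" by (simp add: trans_trans trans_zero)
 also have "... = (\<Sum>j\<in>UNIV. ?b (h j) * (coord j - cfun (y j)))"
  unfolding h(2) by (simp add: cfun_simps)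
 finally show ?thesis using h(1) that[of "%j. ?b (h j)"] by (simp add: mpow_def trans_trans trans_zero)
qed

text \<open>\<open>de j\<close> is the partial derivative, characterized by the first-order
  expansion alone; the product rule for \<open>coord i * m\<close> gives the recursion. The strict
  degree bound is what later lets derivatives of a minimal relation escape the relations.\<close>

lemma taylor_monomial:
 assumes "monomial_fun I d m" "finite I"
 shows "\<exists>de. (\<forall>j. de j : pfun I {..<d}) \<and>
  (\<forall>x. trans x m - cfun (m x) - (\<Sum>j\<in>I. cfun (de j x) * coord j) : pfun I {2..})"
 using assms(1)
proof (induction rule: monomial_fun.induct)
 case monomial_one
 have "\<exists>de. (\<forall>j. de j : pfun I {..<0}) \<and>
  (\<forall>x. trans x 1 - cfun (1 x) - (\<Sum>j\<in>I. cfun (de j x) * coord j) : pfun I {2..})"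
  by (intro exI[of _ "%_. 0"]) (auto simp: zero_fun_apply one_fun_apply cfun_simps intro: pfun_zero)
 then show ?case .
next
 case (monomial_step d m i)
 then obtain de where D: "!!j. de j : pfun I {..<d}"
  "!!x. trans x m - cfun (m x) - (\<Sum>j\<in>I. cfun (de j x) * coord j) : pfun I {2..}" by blast
 define de' where "de' = (%j. coord i * de j + (if j = i then m else 0))"
 show ?case
 proof (intro exI[of _ de'] conjI allI)
  fix j
  have "coord i * de j : pfun I {..<Suc d}"
   by (rule pfun_mult[of _ _ "{1}" _ "{..<d}"]) (use monomial_step D in "auto intro: pfun_coord")
  moreover have "m : pfun I {..<Suc d}" using monomial_step by (auto intro: pfun_monomial)
  ultimately show "de' j : pfun I {..<Suc d}" by (auto simp: de'_def intro!: pfun_add)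
 next
  fix x
  define R where "R = trans x m - cfun (m x) - (\<Sum>j\<in>I. cfun (de j x) * coord j)"
  define L where "L = (\<Sum>j\<in>I. cfun (de j x) * coord j)"
  have R: "R : pfun I {2..}" using D(2) by (simp add: R_def)
  have tm: "trans x m = cfun (m x) + L + R" by (simp add: R_def L_def)
  have L': "(\<Sum>j\<in>I. cfun (de' j x) * coord j) = cfun (x i) * L + cfun (m x) * coord i"
  proof -
   have "(\<Sum>j\<in>I. cfun (de' j x) * coord j)
    = (\<Sum>j\<in>I. cfun (x i) * (cfun (de j x) * coord j) + (if j = i then cfun (m x) * coord i else 0))"
    by (rule sum.cong) (auto simp: de'_def ev cfun_simps algebra_simps)
   then show ?thesis using monomial_step assms by (simp add: sum.distrib L_def sum_distrib_left)
  qed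
  have eq: "trans x (coord i * m) - cfun ((coord i * m) x) - (\<Sum>j\<in>I. cfun (de' j x) * coord j)
   = coord i * L + coord i * R + cfun (x i) * R"
   unfolding L' by (simp add: tm ev cfun_simps algebra_simps)
  have Lp: "L : pfun I {1..}" unfolding L_def by (intro pfun_sum pfun_scale pfun_coord) auto
  have ci: "coord i : pfun I {1..}" using monomial_step by (auto intro: pfun_coord)
  have "coord i * L : pfun I {2..}" by (rule pfun_mult[OF ci Lp]) auto
  moreover have "coord i * R : pfun I {2..}" by (rule pfun_mult[OF ci R]) auto
  ultimately show "trans x (coord i * m) - cfun ((coord i * m) x) - (\<Sum>j\<in>I. cfun (de' j x) * coord j) : pfun I {2..}"
   unfolding eq using R by (intro pfun_add pfun_scale)
 qed
qed

lemma taylor: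
 assumes "f : pfun I {..t}" "finite I"
 obtains de where "!!j. de j : pfun I {..<t}"
  "!!x. trans x f - cfun (f x) - (\<Sum>j\<in>I. cfun (de j x) * coord j) : pfun I {2..}"
proof -
 have "\<exists>de. (\<forall>j. de j : pfun I {..<t}) \<and>
  (\<forall>x. trans x f - cfun (f x) - (\<Sum>j\<in>I. cfun (de j x) * coord j) : pfun I {2..})"
  using assms(1)
 proof (induction rule: pfun_induct)
  case zero
  have "\<exists>de. (\<forall>j. de j : pfun I {..<t}) \<and>
   (\<forall>x. trans x 0 - cfun (0 x) - (\<Sum>j\<in>I. cfun (de j x) * coord j) : pfun I {2..})"
   by (intro exI[of _ "%_. 0"]) (auto simp: zero_fun_apply cfun_simps intro: pfun_zero)
  then show ?case .
 next
  case (step f d m c)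
  then obtain de1 where D1: "!!j. de1 j : pfun I {..<t}"
   "!!x. trans x f - cfun (f x) - (\<Sum>j\<in>I. cfun (de1 j x) * coord j) : pfun I {2..}" by blast
  obtain de2 where D2: "!!j. de2 j : pfun I {..<d}"
   "!!x. trans x m - cfun (m x) - (\<Sum>j\<in>I. cfun (de2 j x) * coord j) : pfun I {2..}"
   using taylor_monomial[OF step(3) assms(2)] by blast
  show ?case
  proof (intro exI[of _ "%j. cfun c * de2 j + de1 j"] conjI allI)
   fix j
   have "de2 j : pfun I {..<t}" using D2(1)[of j] by (rule pfun_mono) (use step in auto)
   then show "cfun c * de2 j + de1 j : pfun I {..<t}" using D1 by (intro pfun_add pfun_scale)
  next
   fix x
   have "trans x (cfun c * m + f) - cfun ((cfun c * m + f) x) - (\<Sum>j\<in>I. cfun ((cfun c * de2 j + de1 j) x) * coord j)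
    = cfun c * (trans x m - cfun (m x) - (\<Sum>j\<in>I. cfun (de2 j x) * coord j))
     + (trans x f - cfun (f x) - (\<Sum>j\<in>I. cfun (de1 j x) * coord j))"
    by (simp add: ev cfun_simps algebra_simps sum.distrib sum_distrib_left)
   also have "... : pfun I {2..}" using D1 D2 by (intro pfun_add pfun_scale)
   finally show "trans x (cfun c * m + f) - cfun ((cfun c * m + f) x) - (\<Sum>j\<in>I. cfun ((cfun c * de2 j + de1 j) x) * coord j) : pfun I {2..}" .
  qed
 qed
 then show ?thesis using that by blast
qed

lemma pfun_ge_line:
 assumes "f : pfun I {k..}"
 obtains p where "!!t. f (%i. t * v i) = t ^ k * poly p t"
proof -
 have "\<exists>p. \<forall>t. f (%i. t * v i) = t ^ k * poly p t" using assms
 proof (induction rule: pfun_induct)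
  case zero then show ?case by (intro exI[of _ 0]) (simp add: ev)
 next
  case (step f d m c)
  then obtain p where p: "!!t. f (%i. t * v i) = t ^ k * poly p t" by blast
  have "t ^ d = t ^ k * t ^ (d - k)" for t :: 'b using step by (simp flip: power_add)
  then show ?case using p monomial_scale[OF step(3)]
   by (intro exI[of _ "Polynomial.monom (c * m v) (d - k) + p"]) (simp add: ev poly_monom algebra_simps)
 qed
 then show ?thesis using that by blast
qed

text \<open>Vanishing of the partial derivative in direction \<open>j\<close>, expressed by the
  linear coefficient on every line parallel to that axis.\<close>

definition flat_dir :: "'i => ('i, 'a::comm_ring_1) fn => bool" where
 "flat_dir j G \<longleftrightarrow> (\<forall>x. \<exists>p. (\<forall>t. G (x(j := x j + t)) = poly p t) \<and> poly.coeff p 1 = 0)"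

text \<open>If all partial derivatives vanish, only exponents divisible by the characteristic
  survive; constants have roots because the field is algebraically closed, and taking
  \<open>p\<close>-th powers is additive. One variable is split off at a time. The degree of the
  root is smaller by the factor \<open>p\<close>.\<close>

lemma pth_power:
 fixes G :: "('i, 'a::alg_closed_field) fn"
 assumes "finite I" "Factorial_Ring.prime CHAR('a)" "G : pfun I {..t}" "!!j. j : I ==> flat_dir j G"
 shows "\<exists>H\<in>pfun I {..t div CHAR('a)}. G = H ^ CHAR('a)"
 using assms(1,3,4)
proof (induction arbitrary: G t rule: finite_induct)
 case (empty G t)
 then obtain c where c: "G = cfun c" using pfun_no_vars by blast
 obtain d where "d ^ CHAR('a) = c" using nth_root_exists[of "CHAR('a)" c] prime_gt_0_nat[OF assms(2)] by blast
 then show ?case using c by (intro bexI[of _ "cfun d"]) (auto simp: cfun_simps intro: pfun_const)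
next
 case (insert i I G t)
 let ?p = "CHAR('a)"
 have p: "?p > 0" using assms(2) prime_gt_0_nat by blast
 obtain a where a: "!!k. a k : pfun (insert i I - {i}) {..t - k}" "G = (\<Sum>k\<le>t. a k * coord i ^ k)"
  using insert.prems(1) by (rule pfun_split_le[where i = i]) blast
 have I: "insert i I - {i} = I" using insert by auto
 have ai: "a k (x(i := s)) = a k x" for k x s using a(1)[of k] by (rule pfun_cong) auto
 define P where "P = (%x. \<Sum>k\<le>t. Polynomial.monom (a k x) k)"
 have P: "G (x(i := s)) = poly (P x) s" for x s
  by (simp add: a(2) P_def ev poly_sum poly_monom ai)
 have coeffP: "poly.coeff (P x) k = (if k <= t then a k x else 0)" for x k
  by (simp add: P_def coeff_sum if_distrib sum.delta cong: if_cong)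
 have "pderiv (P x) = 0" for x
 proof (rule poly_zero_if_all_roots)
  fix s
  obtain q where q: "!!r. G ((x(i := s))(i := (x(i := s)) i + r)) = poly q r" "poly.coeff q 1 = 0"
   using insert.prems(2)[of i] unfolding flat_dir_def by (meson insertI1)
  have "poly (q - pcompose (P x) [:s, 1:]) r = 0" for r
   using q(1)[of r] P[of x "s + r"] by (simp add: poly_pcompose)
  then have "q = pcompose (P x) [:s, 1:]" using poly_zero_if_all_roots by (metis eq_iff_diff_eq_0)
  then have "pderiv q = pcompose (pderiv (P x)) [:s, 1:]" by (simp add: pderiv_pcompose pderiv_pCons)
  then have "poly (pderiv q) 0 = poly (pderiv (P x)) s" by (simp add: poly_pcompose)
  moreover have "poly (pderiv q) 0 = 0" using q(2) by (simp add: poly_0_coeff_0 coeff_pderiv)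
  ultimately show "poly (pderiv (P x)) s = 0" by simp
 qed
 then have kz: "of_nat (Suc k) * a (Suc k) x = 0" if "Suc k <= t" for k x
  using coeff_pderiv[of "P x" k] coeffP that by simp
 have az: "a k = 0" if kp: "\<not> ?p dvd k" "k <= t" for k
 proof
  fix x
  obtain k' where k': "k = Suc k'" using kp by (cases k) auto
  have "of_nat k ~= (0 :: 'a)" using kp by (simp add: of_nat_eq_0_iff_char_dvd)
  then show "a k x = 0 x" using kz[of k' x] kp k' by (simp add: ev)
 qed
 \<comment> \<open>As the value \<open>r\<close> of the split variable varies, the vanishing linear
   coefficient of \<open>G\<close> is a polynomial in \<open>r\<close> whose coefficients are the
   linear coefficients of the \<open>a l\<close>.\<close>
 have flat: "flat_dir j (a k)" if j: "j : I" and k: "k <= t" for j k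
  unfolding flat_dir_def
 proof
  fix x
  have ji: "j ~= i" using j insert by auto
  have "\<exists>p. \<forall>s. a l (x(j := x j + s)) = poly p s" for l
  proof -
   obtain p where "!!s. a l (%i. x i + s * (if i = j then 1 else 0)) = poly p s"
    using pfun_line[OF a(1)[of l]] by metis
   moreover have "(%i. x i + s * (if i = j then 1 else 0)) = x(j := x j + s)" for s by auto
   ultimately show ?thesis by auto
  qed
  then have "\<forall>l. \<exists>p. \<forall>s. a l (x(j := x j + s)) = poly p s" by blast
  from choice[OF this] obtain p where pl: "!!l s. a l (x(j := x j + s)) = poly (p l) s" by blast
  have "poly (\<Sum>l\<le>t. Polynomial.monom (poly.coeff (p l) 1) l) r = 0" for r
  proof -
   obtain q where q: "!!s. G ((x(i := r))(j := (x(i := r)) j + s)) = poly q s" "poly.coeff q 1 = 0"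
    using insert.prems(2)[of j] j unfolding flat_dir_def by (meson insertI2)
   have "G ((x(i := r))(j := (x(i := r)) j + s)) = poly (\<Sum>l\<le>t. smult (r ^ l) (p l)) s" for s
   proof -
    have "(x(i := r))(j := (x(i := r)) j + s) = (x(j := x j + s))(i := r)" using ji by auto
    then show ?thesis by (simp add: P P_def poly_sum poly_monom pl mult.commute)
   qed
   then have "poly (q - (\<Sum>l\<le>t. smult (r ^ l) (p l))) s = 0" for s using q(1)[of s] by simp
   then have "q = (\<Sum>l\<le>t. smult (r ^ l) (p l))" using poly_zero_if_all_roots by (metis eq_iff_diff_eq_0)
   then show ?thesis using q(2) by (simp add: coeff_sum poly_sum poly_monom mult.commute)
  qed
  then have "(\<Sum>l\<le>t. Polynomial.monom (poly.coeff (p l) 1) l) = 0" by (rule poly_zero_if_all_roots)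
  then have "poly.coeff (\<Sum>l\<le>t. Polynomial.monom (poly.coeff (p l) 1) l) k = 0" by simp
  then have "poly.coeff (p k) 1 = 0" using k by (simp add: coeff_sum if_distrib sum.delta cong: if_cong)
  then show "\<exists>p. (\<forall>t. a k (x(j := x j + t)) = poly p t) \<and> poly.coeff p 1 = 0" using pl by blast
 qed
 have "\<exists>H\<in>pfun I {..(t - k) div ?p}. a k = H ^ ?p" if "k <= t" for k
  using insert.IH[of "a k" "t - k"] a(1)[of k] flat that I by auto
 then obtain b where b: "!!k. k <= t ==> b k : pfun I {..(t - k) div ?p}" "!!k. k <= t ==> a k = b k ^ ?p" by metis
 define H where "H = (\<Sum>l\<le>t div ?p. b (?p * l) * coord i ^ l)"
 have lt: "?p * l <= t" if "l <= t div ?p" for l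
  using that mult_le_mono2[OF that, of ?p] by (meson order.trans times_div_less_eq_dividend)
 have "H : pfun (insert i I) {..t div ?p}"
  unfolding H_def
 proof (rule pfun_sum)
  fix l assume "l : {..t div ?p}"
  then have l: "l <= t div ?p" "?p * l <= t" using lt by auto
  have "(t - ?p * l) div ?p = t div ?p - l"
   using l p div_mult_self2[of ?p "t - ?p * l" l] by (simp add: mult.commute)
  then have "b (?p * l) : pfun (insert i I) {..t div ?p - l}" using b(1)[OF l(2)] by (auto intro: pfun_mono)
  moreover have "coord i ^ l : pfun (insert i I) {l * 1}" by (intro pfun_power_eq pfun_coord) auto
  ultimately show "b (?p * l) * coord i ^ l : pfun (insert i I) {..t div ?p}"
   by (rule pfun_mult) (use l in auto)
 qed
 moreover have "G = H ^ ?p"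
 proof
  fix x
  have "(H ^ ?p) x = (\<Sum>l\<le>t div ?p. (b (?p * l) x * x i ^ l) ^ ?p)"
   by (simp add: H_def ev freshmans_dream_sum[OF assms(2) refl])
  also have "... = (\<Sum>l\<le>t div ?p. a (?p * l) x * x i ^ (?p * l))"
  proof (rule sum.cong)
   fix l assume "l : {..t div ?p}"
   then have "a (?p * l) x = b (?p * l) x ^ ?p" using b(2)[OF lt] by (simp add: ev)
   then show "(b (?p * l) x * x i ^ l) ^ ?p = a (?p * l) x * x i ^ (?p * l)"
    by (simp add: power_mult_distrib power_mult[symmetric] mult.commute)
  qed simp
  also have "... = (\<Sum>k\<in>(%l. ?p * l) ` {..t div ?p}. a k x * x i ^ k)"
   using p by (subst sum.reindex) (auto simp: inj_on_def)
  also have "... = (\<Sum>k\<le>t. a k x * x i ^ k)"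
  proof (rule sum.mono_neutral_left)
   show "\<forall>k\<in>{..t} - (%l. ?p * l) ` {..t div ?p}. a k x * x i ^ k = 0"
   proof
    fix k assume k: "k : {..t} - (%l. ?p * l) ` {..t div ?p}"
    have "\<not> ?p dvd k"
    proof
     assume "?p dvd k"
     then obtain l where "k = ?p * l" by auto
     moreover have "l <= t div ?p" using k `k = ?p * l` p
      by (metis DiffD1 atMost_iff div_le_mono nonzero_mult_div_cancel_left less_numeral_extra(3))
     ultimately show False using k by auto
    qed
    then show "a k x * x i ^ k = 0" using az[of k] k by (simp add: ev)
   qed
  qed (use lt in auto)
  finally show "G x = (H ^ ?p) x" by (simp add: a(2) ev)
 qed
 ultimately show ?case by blast
qed

lemma flat_dir_if_derivative_zero:
 fixes f :: "('i, 'a::comm_ring_1) fn"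
 assumes D: "!!x. trans x f - cfun (f x) - (\<Sum>j\<in>I. cfun (de j x) * coord j) : pfun I {2..}"
  and I: "finite I" "j : I" "de j = 0"
 shows "flat_dir j f"
 unfolding flat_dir_def
proof
 fix x
 let ?R = "trans x f - cfun (f x) - (\<Sum>j\<in>I. cfun (de j x) * coord j)"
 let ?e = "%i. if i = j then 1 else 0"
 obtain p where p: "!!t. ?R (%i. t * ?e i) = t ^ 2 * poly p t"
  by (rule pfun_ge_line[OF D[of x], where v = ?e]) blast
 have "f (x(j := x j + t)) = poly ([:f x:] + Polynomial.monom 1 2 * p) t" for t
 proof -
  have eq: "(%i. t * ?e i + x i) = x(j := x j + t)" by auto
  have "?R (%i. t * ?e i) = f (x(j := x j + t)) - f x - (\<Sum>k\<in>I. de k x * (t * ?e k))"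
   by (simp only: ev trans_apply eq)
  also have "(\<Sum>k\<in>I. de k x * (t * ?e k)) = 0"
   using I by (intro sum.neutral) (auto simp: ev)
  finally have R: "?R (%i. t * ?e i) = f (x(j := x j + t)) - f x - 0" .
  have cancel: "a - b - 0 = c ==> a = b + c" for a b c :: 'a by (simp add: algebra_simps)
  have "f (x(j := x j + t)) = f x + t ^ 2 * poly p t"
   by (rule cancel) (rule HOL.trans[OF R[symmetric] p])
  then show ?thesis by (simp only: poly_add poly_mult poly_monom poly_pCons poly_0) simp
 qed
 moreover have "poly.coeff ([:f x:] + Polynomial.monom 1 2 * p) 1 = 0"
  by (simp add: coeff_monom_mult)
 ultimately show "\<exists>p. (\<forall>t. f (x(j := x j + t)) = poly p t) \<and> poly.coeff p 1 = 0" by blast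
qed

section \<open>Noether normalization\<close>

text \<open>\<open>True\<close> is for forms and \<open>False\<close> for bounded degrees, so that
  one division lemma serves both the local and the affine normalization.\<close>

definition gr :: "bool => nat => nat set" where "gr b t = (if b then {t} else {..t})"

lemma gr_add: "x : gr b s ==> y : gr b t ==> x + y : gr b (s + t)"
 by (auto simp: gr_def split: if_splits)

text \<open>Division by a monic \<open>F\<close> whose coefficients respect the grading keeps the
  grading. The clauses for \<open>t < e\<close> and \<open>k > t\<close> repair truncated
  subtraction: the true degree would be negative there, so the entry has to be zero.\<close>

lemma graded_division:
 assumes i: "i ~: I" and a: "!!k. k < e ==> a k : pfun I (gr b (e - k))"
  and F: "F = coord i ^ e + (\<Sum>k<e. a k * coord i ^ k)"
  and P: "P : pfun (insert i I) (gr b t)"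
 obtains q r where "q : pfun (insert i I) (gr b (t - e))" "t < e ==> q = 0" "!!k. k < e ==> k <= t ==> r k : pfun I (gr b (t - k))"
  "!!k. k > t ==> r k = 0" "P = q * F + (\<Sum>k<e. r k * coord i ^ k)"
proof -
 let ?Q = "{q : pfun (insert i I) (gr b (t - e)). t < e --> q = 0}"
 have main: "\<exists>q\<in>?Q. \<exists>r. (\<forall>k<e. k <= t --> r k : pfun I (gr b (t - k))) \<and> (\<forall>k>t. r k = 0) \<and>
   (\<Sum>k<n. c k * coord i ^ k) = q * F + (\<Sum>k<e. r k * coord i ^ k)"
  if "!!k. k < n ==> k <= t ==> c k : pfun I (gr b (t - k))" "!!k. k > t ==> c k = 0" for n c
  using that
 proof (induction n arbitrary: c)
  case 0
  show ?case by (intro bexI[of _ 0] exI[of _ "%_. 0"]) (auto intro: pfun_zero)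
 next
  case (Suc n)
  consider "n < e" | "n \<ge> e" "n > t" | "n \<ge> e" "n <= t" by linarith
  then show ?case
  proof cases
   case 1
   have "(\<Sum>k<Suc n. c k * coord i ^ k) = (\<Sum>k<e. (if k < Suc n then c k else 0) * coord i ^ k)"
    using 1 by (intro sum.mono_neutral_cong_left) auto
   then show ?thesis using Suc.prems
    by (intro bexI[of _ 0] exI[of _ "%k. if k < Suc n then c k else 0"]) (auto intro: pfun_zero)
  next
   case 2
   then show ?thesis using Suc.IH[of c] Suc.prems by auto
  next
   case 3
   have cn: "c n : pfun I (gr b (t - n))" using Suc.prems 3 by auto
   \<comment> \<open>What is left after \<open>c n * coord i ^ (n - e)\<close> times
     \<open>F\<close> has removed the leading term.\<close>
   define c' where "c' = (%k. if k < n then c k - (if k \<ge> n - e then c n * a (k - (n - e)) else 0) else 0)"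
   have c': "c' k : pfun I (gr b (t - k))" if k: "k < n" "k <= t" for k
   proof -
    have "c n * a (k - (n - e)) : pfun I (gr b (t - k))" if "k \<ge> n - e"
    proof (rule pfun_mult[OF cn a])
     show "k - (n - e) < e" using k 3 that by auto
     fix x y assume "x : gr b (t - n)" "y : gr b (e - (k - (n - e)))"
     then have "x + y : gr b ((t - n) + (e - (k - (n - e))))" by (rule gr_add)
     then show "x + y : gr b (t - k)" using k 3 that by simp
    qed
    then show ?thesis using Suc.prems(1)[of k] k by (auto simp: c'_def intro!: pfun_diff)
   qed
   have eq: "(\<Sum>k<Suc n. c k * coord i ^ k) = (c n * coord i ^ (n - e)) * F + (\<Sum>k<n. c' k * coord i ^ k)"
   proof -
    have "(\<Sum>k<n. c' k * coord i ^ k)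
     = (\<Sum>k<n. c k * coord i ^ k) - (\<Sum>k<n. (if k \<ge> n - e then c n * a (k - (n - e)) * coord i ^ k else 0))"
     unfolding sum_subtractf[symmetric] by (rule sum.cong) (auto simp: c'_def left_diff_distrib)
    also have "(\<Sum>k<n. (if k \<ge> n - e then c n * a (k - (n - e)) * coord i ^ k else 0))
     = (\<Sum>k\<in>{n-e..<n}. c n * a (k - (n - e)) * coord i ^ k)"
     by (rule sum.mono_neutral_cong_right) auto
    also have "... = (\<Sum>k<e. c n * a k * coord i ^ (k + (n - e)))"
     by (rule sum.reindex_bij_witness[of _ "%k. k + (n - e)" "%k. k - (n - e)"]) (use 3 in auto)
    also have "... = c n * coord i ^ (n - e) * (\<Sum>k<e. a k * coord i ^ k)"
     by (simp add: sum_distrib_left power_add mult_ac)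
    also have "c n * coord i ^ n = c n * coord i ^ (n - e) * coord i ^ e"
     using 3 by (simp add: mult.assoc flip: power_add)
    ultimately show ?thesis by (simp add: F distrib_left)
   qed
   have "\<exists>q\<in>?Q. \<exists>r. (\<forall>k<e. k <= t --> r k : pfun I (gr b (t - k))) \<and> (\<forall>k>t. r k = 0) \<and>
    (\<Sum>k<n. c' k * coord i ^ k) = q * F + (\<Sum>k<e. r k * coord i ^ k)"
    by (rule Suc.IH) (use c' 3 in "auto simp: c'_def")
   then obtain q r where qr: "q : ?Q" "\<forall>k<e. k <= t --> r k : pfun I (gr b (t - k))"
    "\<forall>k>t. r k = 0" "(\<Sum>k<n. c' k * coord i ^ k) = q * F + (\<Sum>k<e. r k * coord i ^ k)" by blast
   have "c n * coord i ^ (n - e) : pfun (insert i I) (gr b (t - e))"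
   proof (rule pfun_mult[of _ _ "gr b (t - n)" _ "{(n - e) * 1}"])
    show "c n : pfun (insert i I) (gr b (t - n))" using cn by (rule pfun_mono) auto
    show "coord i ^ (n - e) : pfun (insert i I) {(n - e) * 1}" by (intro pfun_power_eq pfun_coord) auto
   qed (use 3 in "auto simp: gr_def split: if_splits")
   then have "c n * coord i ^ (n - e) + q : ?Q" using qr(1) 3 by (auto intro: pfun_add)
   moreover have "(\<Sum>k<Suc n. c k * coord i ^ k) = (c n * coord i ^ (n - e) + q) * F + (\<Sum>k<e. r k * coord i ^ k)"
    unfolding eq qr(4) by (simp add: distrib_right add.assoc)
   ultimately show ?thesis using qr(2,3) by blast
  qed
 qed
 have "gr b t <= {..t}" by (auto simp: gr_def)
 then obtain c where c: "!!k. c k : pfun (insert i I - {i}) ((%d. d - k) ` (gr b t \<inter> {k..}))"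
  "P = (\<Sum>k\<le>t. c k * coord i ^ k)" using pfun_split[OF P, where i = i] by blast
 have "c k : pfun I (gr b (t - k))" if "k <= t" for k
  using c(1)[of k] by (rule pfun_mono) (use i that in "auto simp: gr_def")
 then have "\<exists>q\<in>?Q. \<exists>r. (\<forall>k<e. k <= t --> r k : pfun I (gr b (t - k))) \<and> (\<forall>k>t. r k = 0) \<and>
   (\<Sum>k<Suc t. (if k <= t then c k else 0) * coord i ^ k) = q * F + (\<Sum>k<e. r k * coord i ^ k)"
  by (intro main) auto
 then obtain q r where qr: "q : ?Q" "\<forall>k<e. k <= t --> r k : pfun I (gr b (t - k))" "\<forall>k>t. r k = 0"
   "(\<Sum>k<Suc t. (if k <= t then c k else 0) * coord i ^ k) = q * F + (\<Sum>k<e. r k * coord i ^ k)" by blast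
 have "(\<Sum>k<Suc t. (if k <= t then c k else 0) * coord i ^ k) = P"
  unfolding c(2) lessThan_Suc_atMost by (rule sum.cong) auto
 then show ?thesis using qr by (intro that[of q r]) auto
qed

section \<open>Finite and separable systems of linear forms\<close>

lemma sub_untilt:
 fixes f :: "(nat, 'a::comm_ring_1) fn"
 assumes "f : pfun {..<Suc m} D"
 shows "sub v f = sub ((%i. v i - cfun (xi i) * v m)(m := v m)) (sub (tilt xi m) f)"
proof
 fix p
 show "sub v f p = sub ((%i. v i - cfun (xi i) * v m)(m := v m)) (sub (tilt xi m) f) p"
  unfolding sub_apply by (rule pfun_cong[OF assms]) (auto simp: tilt_def ev)
qed

lemma sub_cong:
 assumes "f : pfun I D" "!!i. i : I ==> v i = w i" shows "sub v f = sub w f"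
proof
 fix p show "sub v f p = sub w f p"
  unfolding sub_apply by (rule pfun_cong[OF assms(1)]) (simp add: assms(2))
qed

text \<open>Finiteness of the coordinate ring of \<open>Y\<close> over the subring generated by
  \<open>v\<close>, with degree control: functions of degree at most \<open>t\<close> need
  coefficients of degree at most \<open>t\<close> only. This control bounds the Hilbert function of
  \<open>Y\<close>.\<close>

definition gen_over :: "('n => 'a::field) set => (nat => ('n, 'a) fn) => nat => bool" where
 "gen_over Y v m \<longleftrightarrow> (\<exists>(n::nat) w. (\<forall>l<n. w l : polys UNIV) \<and>
  (\<forall>t. \<forall>f\<in>pfun UNIV {..t}. \<exists>a. (\<forall>l<n. a l : pfun {..<m} {..t}) \<and> f - (\<Sum>l<n. sub v (a l) * w l) : van Y))"

definition alg_ind :: "('n => 'a::field) set => (nat => ('n, 'a) fn) => nat => bool" where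
 "alg_ind Y v m \<longleftrightarrow> (\<forall>P\<in>polys {..<m}. sub v P : van Y --> P = 0)"

text \<open>Generically on \<open>Y\<close>, the fibres of \<open>v\<close> are reduced: their tangent spaces are trivial.\<close>
definition sep_over :: "('n => 'a::field) set => (nat => ('n, 'a) fn) => nat => bool" where
 "sep_over Y v m \<longleftrightarrow> (\<exists>h\<in>polys UNIV. h ~: van Y \<and> (\<forall>y\<in>Y. h y ~= 0 --> (\<forall>j. \<exists>c. \<exists>R\<in>mpow y 2.
  coord j - cfun (y j) - (\<Sum>i<m. cfun (c i) * (v i - cfun (v i y))) - R : van Y)))"

lemma gen_overI:
 fixes Y :: "('n => 'a::field) set"
 assumes J: "finite J" "!!l. l : J ==> w l : polys UNIV"
  and "!!t f. f : pfun UNIV {..t} ==> \<exists>a. (\<forall>l\<in>J. a l : pfun {..<m} {..t}) \<and> f - (\<Sum>l\<in>J. sub v (a l) * w l) : van Y"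
 shows "gen_over Y v m"
proof -
 obtain e where e: "bij_betw e {..<card J} J"
  using ex_bij_betw_nat_finite[OF J(1)] by (auto simp: atLeast0LessThan)
 show ?thesis
  unfolding gen_over_def
 proof (intro exI[of _ "card J"] exI[of _ "w \<circ> e"] conjI allI ballI impI)
  fix l assume "l < card J" then show "(w \<circ> e) l : polys UNIV" using e J by (auto simp: bij_betw_def)
 next
  fix t and f :: "('n, 'a) fn" assume "f : pfun UNIV {..t}"
  then obtain a where a: "\<forall>l\<in>J. a l : pfun {..<m} {..t}" "f - (\<Sum>l\<in>J. sub v (a l) * w l) : van Y"
   using assms(3) by blast
  have "(\<Sum>l\<in>J. sub v (a l) * w l) = (\<Sum>l<card J. sub v ((a \<circ> e) l) * (w \<circ> e) l)"
   using sum.reindex_bij_betw[OF e, of "%l. sub v (a l) * w l"] by simp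
  then show "\<exists>a. (\<forall>l<card J. a l : pfun {..<m} {..t}) \<and> f - (\<Sum>l<card J. sub v (a l) * (w \<circ> e) l) : van Y"
   using a e by (intro exI[of _ "a \<circ> e"]) (auto simp: bij_betw_def)
 qed
qed

text \<open>A relation whose top form is nonzero at \<open>xi\<close> makes \<open>v m\<close>
  integral over the forms \<open>v i - xi i * v m\<close>, so the old generators times the powers of
  \<open>v m\<close> below \<open>e\<close> generate over the new system. Division by the tilted
  relation respects degrees.\<close>

lemma gen_step:
 fixes Z :: "('n => 'a::alg_closed_field) set"
 assumes gen: "gen_over Z v (Suc m)" and v: "!!i. i < Suc m ==> v i : polys UNIV"
  and G: "G : pfun {..<Suc m} {..e}" "sub v G : van Z" "g : pfun {..<Suc m} {e}" "G - g : pfun {..<Suc m} {..<e}"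
  and xi: "g xi ~= 0" "xi m = 1"
 shows "gen_over Z (%i. v i - cfun (xi i) * v m) m"
proof -
 let ?v = "%i. v i - cfun (xi i) * v m"
 let ?u = "?v(m := v m)"
 have Im: "{..<Suc m} = insert m {..<m}" by auto
 obtain a where a: "!!k. k < e ==> a k : pfun ({..<Suc m} - {m}) ((%d. d - k) ` ({..e} \<inter> {k..}))"
  "sub (tilt xi m) G = cfun (g xi) * coord m ^ e + (\<Sum>k<e. a k * coord m ^ k)"
  using tilt_monic[OF G(1) order.refl G(3,4) xi] by blast
 define F where "F = coord m ^ e + (\<Sum>k<e. (cfun (inverse (g xi)) * a k) * coord m ^ k)"
 have "cfun (inverse (g xi)) * cfun (g xi) = (1 :: (nat, 'a) fn)" using xi by (simp add: fun_eq_iff ev)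
 then have F: "F = cfun (inverse (g xi)) * sub (tilt xi m) G"
  by (simp add: F_def a(2) distrib_left sum_distrib_left flip: mult.assoc)
 have uF: "sub ?u F : van Z"
  unfolding F using G(2) by (simp add: sub_untilt[OF G(1), of v xi, symmetric] van_mult)
 have aF: "cfun (inverse (g xi)) * a k : pfun {..<m} (gr False (e - k))" if "k < e" for k
 proof -
  have "a k : pfun {..<m} (gr False (e - k))"
   using a(1)[OF that] by (rule pfun_mono) (auto simp: gr_def)
  then show ?thesis by (rule pfun_scale)
 qed
 obtain n :: nat and w where w: "!!l. l < n ==> w l : polys UNIV"
  "!!t f. f : pfun UNIV {..t} ==> \<exists>a. (\<forall>l<n. a l : pfun {..<Suc m} {..t}) \<and> f - (\<Sum>l<n. sub v (a l) * w l) : van Z"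
  using gen unfolding gen_over_def by blast
 show ?thesis
 proof (rule gen_overI[where J = "{..<n} \<times> {..<e}" and w = "%(l, k). w l * v m ^ k"])
  show "(%(l, k). w l * v m ^ k) x : polys UNIV" if "x : {..<n} \<times> {..<e}" for x
   using that w(1) v[of m] by (auto intro!: polys_mult polys_power)
  fix t and f :: "('n, 'a) fn" assume "f : pfun UNIV {..t}"
  then obtain A where A: "!!l. l < n ==> A l : pfun {..<Suc m} {..t}" "f - (\<Sum>l<n. sub v (A l) * w l) : van Z"
   using w(2) by blast
  define Q where "Q = (%l r. (\<forall>k<e. r k : pfun {..<m} {..t}) \<and> sub v (A l) - (\<Sum>k<e. sub ?v (r k) * v m ^ k) : van Z)"
  have "\<exists>r. Q l r" if l: "l < n" for l
  proof -
   have tA: "sub (tilt xi m) (A l) : pfun (insert m {..<m}) (gr False t)"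
    using sub_tilt_pfun[OF A(1)[OF l], of m xi] by (simp add: gr_def Im)
   obtain q r where "q : pfun (insert m {..<m}) (gr False (t - e))" "t < e ==> q = 0" and qr:
    "!!k. k < e ==> k <= t ==> r k : pfun {..<m} (gr False (t - k))" "!!k. k > t ==> r k = 0"
    "sub (tilt xi m) (A l) = q * F + (\<Sum>k<e. r k * coord m ^ k)"
    by (rule graded_division[OF _ aF F_def, where P = "sub (tilt xi m) (A l)" and t = t]) (use tA in auto)
   have r: "r k : pfun {..<m} {..t}" if "k < e" for k
    using qr(1)[OF that] qr(2)[of k] by (cases "k <= t") (auto simp: gr_def intro: pfun_mono pfun_zero)
   have ru: "sub ?u (r k) = sub ?v (r k)" if "k < e" for k
    by (rule sub_cong[OF r[OF that]]) auto
   have "sub v (A l) = sub ?u q * sub ?u F + (\<Sum>k<e. sub ?v (r k) * v m ^ k)"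
    unfolding sub_untilt[OF A(1)[OF l], of v xi] qr(3) by (simp add: ru)
   then have "sub v (A l) - (\<Sum>k<e. sub ?v (r k) * v m ^ k) = sub ?u q * sub ?u F" by simp
   also have "... : van Z" by (rule van_mult[OF uF])
   finally show ?thesis using r unfolding Q_def by blast
  qed
  then obtain r where "!!l. l < n ==> Q l (r l)" by metis
  then have r: "!!l k. l < n ==> k < e ==> r l k : pfun {..<m} {..t}"
   "!!l. l < n ==> sub v (A l) - (\<Sum>k<e. sub ?v (r l k) * v m ^ k) : van Z" unfolding Q_def by blast+
  have "(\<Sum>l<n. w l * (sub v (A l) - (\<Sum>k<e. sub ?v (r l k) * v m ^ k))) : van Z"
   by (intro lsub_sum[OF van_lsub] van_mult r) auto
  then have "(f - (\<Sum>l<n. sub v (A l) * w l)) + (\<Sum>l<n. w l * (sub v (A l) - (\<Sum>k<e. sub ?v (r l k) * v m ^ k))) : van Z"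
   using A(2) by (intro lsub_add[OF van_lsub])
  moreover have "(f - (\<Sum>l<n. sub v (A l) * w l)) + (\<Sum>l<n. w l * (sub v (A l) - (\<Sum>k<e. sub ?v (r l k) * v m ^ k)))
   = f - (\<Sum>x\<in>{..<n} \<times> {..<e}. sub ?v ((%(l, k). r l k) x) * (%(l, k). w l * v m ^ k) x)"
   by (simp add: sum.cartesian_product case_prod_unfold right_diff_distrib sum_subtractf sum_distrib_left mult_ac)
  ultimately show "\<exists>a. (\<forall>x\<in>{..<n} \<times> {..<e}. a x : pfun {..<m} {..t}) \<and>
   f - (\<Sum>x\<in>{..<n} \<times> {..<e}. sub ?v (a x) * (%(l, k). w l * v m ^ k) x) : van Z"
   using r(1) by (intro exI[of _ "%(l, k). r l k"]) auto
 qed auto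
qed

text \<open>Minimality of the degree is what excludes relations among the derivatives and the
  \<open>p\<close>-th roots of \<open>G\<close>.\<close>

lemma minimal_relation:
 fixes Z :: "('n => 'a::alg_closed_field) set"
 assumes Z: "Z ~= {}" and dep: "\<not> alg_ind Z v m"
 obtains e G g where "e > 0" "G : pfun {..<m} {..e}" "sub v G : van Z" "G ~= 0" "g : pfun {..<m} {e}" "g ~= 0"
  "G - g : pfun {..<m} {..<e}" "!!P. P : pfun {..<m} {..<e} ==> sub v P : van Z ==> P = 0"
proof -
 define Q where "Q = (%e. \<exists>G\<in>pfun {..<m} {..e}. sub v G : van Z \<and> G ~= 0)"
 obtain G0 where "G0 : polys {..<m}" "sub v G0 : van Z" "G0 ~= 0" using dep by (auto simp: alg_ind_def)
 then have "\<exists>e. Q e" using polys_bounded[of G0 "{..<m}"] unfolding Q_def by metis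
 define e where "e = (LEAST e. Q e)"
 have "Q e" unfolding e_def using `\<exists>e. Q e` by (rule LeastI_ex)
 then obtain G where G: "G : pfun {..<m} {..e}" "sub v G : van Z" "G ~= 0" by (auto simp: Q_def)
 have min: "P = 0" if P: "P : pfun {..<m} {..<e}" "sub v P : van Z" for P
 proof (rule ccontr)
  assume "P ~= 0"
  then obtain e' where e': "e = Suc e'" using P pfun_empty_degrees[of P "{..<m}"] by (cases e) auto
  then have "Q e'" using P `P ~= 0` by (auto simp: Q_def lessThan_Suc_atMost)
  then have "e <= e'" unfolding e_def by (rule Least_le)
  then show False using e' by simp
 qed
 have "e > 0"
 proof (rule ccontr)
  assume "\<not> e > 0"
  then have "G : pfun {..<m} {0}" using G(1) by (simp add: atMost_0)
  then obtain c where c: "G = cfun c" using pfun_const_iff[of G "{..<m}"] by (auto simp: atMost_0)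
  then have "cfun c : van Z" using G(2) by simp
  then have "c = 0" using Z by (auto simp: van_def ev)
  then show False using c G(3) by (simp add: cfun_simps)
 qed
 moreover have "G ~: pfun {..<m} {..<e}" using min G by auto
 then obtain g where "g : pfun {..<m} {e}" "g ~= 0" "G - g : pfun {..<m} {..<e}"
  using pfun_highest[OF G(1)] by blast
 ultimately show ?thesis using that[of e G g] G min by blast
qed

text \<open>The relation \<open>G\<close> gives a linear relation between the differentials of the
  \<open>v i\<close> at a point. Where the derivative of \<open>G\<close> in direction
  \<open>xi\<close> is nonzero, the differential of \<open>v m\<close> is expressed by those of the
  new forms, so these still span the cotangent space. The new exceptional set is the zero set of
  \<open>h * h2\<close>, with \<open>h2\<close> this directional derivative.\<close>

lemma sep_step:
 fixes Z :: "('n => 'a::alg_closed_field) set"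
 assumes Z: "zprime Z" and sep: "sep_over Z v (Suc m)" and v: "!!i. i < Suc m ==> v i : pfun UNIV {..1}"
  and D: "!!x. trans x G - cfun (G x) - (\<Sum>j<Suc m. cfun (de j x) * coord j) : pfun {..<Suc m} {2..}"
   "!!j. de j : polys {..<Suc m}"
  and G: "G : polys {..<Suc m}" "sub v G : van Z"
  and y: "y0 : Z" "(\<Sum>j<Suc m. xi j * de j (%i. v i y0)) ~= 0" and xi: "xi m = 1"
 shows "sep_over Z (%i. v i - cfun (xi i) * v m) m"
proof -
 let ?v = "%i. v i - cfun (xi i) * v m"
 obtain h where h: "h : polys UNIV" "h ~: van Z"
  "!!y j. y : Z ==> h y ~= 0 ==> \<exists>c. \<exists>R\<in>mpow y 2.
   coord j - cfun (y j) - (\<Sum>i<Suc m. cfun (c i) * (v i - cfun (v i y))) - R : van Z"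
  using sep unfolding sep_over_def by blast
 define h2 where "h2 = (\<Sum>j<Suc m. cfun (xi j) * sub v (de j))"
 have h2: "h2 : polys UNIV" unfolding h2_def
  using v by (intro pfun_sum pfun_scale sub_polys[OF D(2)]) (auto intro: pfun_polys)
 have "h2 y0 ~= 0" using y(2) by (simp add: h2_def ev)
 then have h2': "h2 ~: van Z" using y(1) by (auto simp: van_def)
 show ?thesis
  unfolding sep_over_def
 proof (intro bexI[of _ "h * h2"] conjI ballI impI allI)
  show "h * h2 : polys UNIV" using h h2 by (intro polys_mult)
  show "h * h2 ~: van Z" using zprime_mult[OF Z h(1) h2] h(2) h2' by blast
 next
  fix y j assume y: "y : Z" and hy: "(h * h2) y ~= 0"
  then have hy: "h y ~= 0" "h2 y ~= 0" by (auto simp: ev)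
  obtain c R where cR: "R : mpow y 2"
   "coord j - cfun (y j) - (\<Sum>i<Suc m. cfun (c i) * (v i - cfun (v i y))) - R : van Z"
   using h(3)[OF y hy(1)] by blast
  define x where "x = (%i. v i y)"
  define R0 where "R0 = trans x G - cfun (G x) - (\<Sum>j<Suc m. cfun (de j x) * coord j)"
  define R1 where "R1 = sub (%i. v i - cfun (x i)) R0"
  have "trans y R1 : pfun UNIV {2..}"
  proof -
   have "trans y R1 = sub (%i. trans y (v i - cfun (x i))) R0"
    by (simp add: R1_def trans_def sub_def fun_eq_iff)
   also have "... : pfun UNIV {2..}"
   proof (rule sub_pfun_ge)
    show "R0 : pfun {..<Suc m} {2..}" using D(1) by (simp add: R0_def)
    fix i assume "i : {..<Suc m}"
    then have "v i - cfun (x i) : mpow y 1"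
     unfolding mpow_1_iff using v[of i] by (auto simp: x_def ev intro!: pfun_diff pfun_const intro: pfun_polys)
    then show "trans y (v i - cfun (x i)) : pfun UNIV {1..}" by (simp add: mpow_def)
   qed
   finally show ?thesis .
  qed
  then have R1: "R1 : mpow y 2" by (simp add: mpow_def)
  have Gx: "G x = 0" using G(2) y by (auto simp: van_def sub_apply x_def)
  have R1p: "R1 p = - (\<Sum>j<Suc m. de j x * (v j p - v j y))" if "p : Z" for p
  proof -
   have "(%i. (v i - cfun (x i)) p + x i) = (%i. v i p)" by (simp add: ev)
   then have "R1 p = G (%i. v i p) - G x - (\<Sum>j<Suc m. de j x * (v j p - v j y))"
    by (simp only: R1_def R0_def sub_apply ev trans_apply x_def)
   moreover have "G (%i. v i p) = 0" using G(2) that by (auto simp: van_def sub_apply)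
   ultimately show ?thesis using Gx by simp
  qed
  define H where "H = h2 y"
  have H: "H = (\<Sum>j<Suc m. xi j * de j x)" by (simp add: H_def h2_def ev x_def)
  \<comment> \<open>The first-order relation regrouped by \<open>v i = ?v i + xi i * v m\<close>:
    the total coefficient of \<open>v m\<close> is the directional derivative
    \<open>H\<close>.\<close>
  have vm: "H * (v m p - v m y) = - R1 p - (\<Sum>i<m. de i x * (?v i p - ?v i y))" if "p : Z" for p
  proof -
   have "(\<Sum>j<Suc m. de j x * (v j p - v j y))
    = (\<Sum>i<m. de i x * (?v i p - ?v i y)) + (\<Sum>i<m. xi i * de i x) * (v m p - v m y) + de m x * (v m p - v m y)"
    by (simp add: ev algebra_simps sum.distrib sum_subtractf sum_distrib_left sum_distrib_right)
   also have "... = (\<Sum>i<m. de i x * (?v i p - ?v i y)) + H * (v m p - v m y)"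
    using xi by (simp add: H algebra_simps)
   finally show ?thesis using R1p[OF that] by simp
  qed
  \<comment> \<open>The coefficient of \<open>v m\<close> after the same regrouping in the expansion
    of \<open>coord j\<close>; dividing by \<open>H\<close> eliminates it.\<close>
  define C where "C = c m + (\<Sum>i<m. c i * xi i)"
  define c' where "c' = (%i. c i - C / H * de i x)"
  define R' where "R' = R - cfun (C / H) * R1"
  have "R' : mpow y 2" using cR(1) R1 by (auto simp: R'_def intro!: mpow_diff mpow_scale)
  moreover have "coord j - cfun (y j) - (\<Sum>i<m. cfun (c' i) * (?v i - cfun (?v i y))) - R' : van Z"
   unfolding van_def
  proof (intro CollectI ballI)
   fix p assume p: "p : Z"
   have "p j - y j = (\<Sum>i<Suc m. c i * (v i p - v i y)) + R p"
    using cR(2) p by (auto simp: van_def ev algebra_simps)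
   also have "(\<Sum>i<Suc m. c i * (v i p - v i y)) = (\<Sum>i<m. c i * (?v i p - ?v i y)) + C * (v m p - v m y)"
    by (simp add: C_def ev algebra_simps sum.distrib sum_subtractf sum_distrib_left sum_distrib_right)
   also have "C * (v m p - v m y) = C / H * (H * (v m p - v m y))" using hy(2) by (simp add: H_def)
   also have "... = - (C / H) * R1 p - (\<Sum>i<m. C / H * de i x * (?v i p - ?v i y))"
    unfolding vm[OF p] by (simp add: algebra_simps sum_distrib_left)
   finally have "p j - y j = (\<Sum>i<m. c' i * (?v i p - ?v i y)) + R' p"
    by (simp add: c'_def R'_def ev left_diff_distrib sum_subtractf)
   then show "(coord j - cfun (y j) - (\<Sum>i<m. cfun (c' i) * (?v i - cfun (?v i y))) - R') p = 0"
    by (simp add: ev)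
  qed
  ultimately show "\<exists>c. \<exists>R\<in>mpow y 2. coord j - cfun (y j) - (\<Sum>i<m. cfun (c i) * (?v i - cfun (?v i y))) - R : van Z"
   by blast
 qed
qed

text \<open>All derivatives of the minimal relation can vanish only if it is a \<open>p\<close>-th
  power, but then its root would be a smaller relation. So some derivative is a nonzero polynomial
  of smaller degree and does not vanish identically on \<open>Z\<close>. The admissible directions
  avoid the zeros of the two forms \<open>g\<close> and \<open>L\<close>.\<close>

lemma normalization_step_single:
 fixes Z :: "('n => 'a::alg_closed_field) set"
 assumes p: "Factorial_Ring.prime CHAR('a)" and Z: "zprime Z"
  and st: "gen_over Z v (Suc m)" "sep_over Z v (Suc m)" and v: "!!i. i < Suc m ==> v i : pfun UNIV {1}"
  and dep: "\<not> alg_ind Z v (Suc m)"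
 shows "\<exists>g L. (\<exists>d. g : pfun {..<Suc m} {d}) \<and> (\<exists>d. L : pfun {..<Suc m} {d}) \<and> g ~= 0 \<and> L ~= 0 \<and>
  (\<forall>xi. xi m = 1 --> g xi ~= 0 --> L xi ~= 0 -->
   gen_over Z (%i. v i - cfun (xi i) * v m) m \<and> sep_over Z (%i. v i - cfun (xi i) * v m) m)"
proof -
 have Zne: "Z ~= {}" using Z by (simp add: zprime_def)
 obtain e G g where G: "e > 0" "G : pfun {..<Suc m} {..e}" "sub v G : van Z" "G ~= 0" "g : pfun {..<Suc m} {e}" "g ~= 0"
  "G - g : pfun {..<Suc m} {..<e}" "!!P. P : pfun {..<Suc m} {..<e} ==> sub v P : van Z ==> P = 0"
  using minimal_relation[OF Zne dep] by blast
 have v1: "v i : pfun UNIV {..1}" "v i : polys UNIV" if "i < Suc m" for i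
  using v[OF that] by (auto intro: pfun_mono)
 obtain de where de: "!!j. de j : pfun {..<Suc m} {..<e}"
  "!!x. trans x G - cfun (G x) - (\<Sum>j\<in>{..<Suc m}. cfun (de j x) * coord j) : pfun {..<Suc m} {2..}"
  using taylor[OF G(2)] by blast
 have "\<exists>j<Suc m. de j ~= 0"
 proof (rule ccontr)
  assume neg: "\<not> ?thesis"
  have "flat_dir j G" if "j : {..<Suc m}" for j
   by (rule flat_dir_if_derivative_zero[OF de(2)]) (use that neg in auto)
  then obtain H where H: "H : pfun {..<Suc m} {..e div CHAR('a)}" "G = H ^ CHAR('a)"
   using pth_power[OF _ p G(2)] by blast
  have "e div CHAR('a) < e" using G(1) prime_gt_1_nat[OF p] by simp
  then have "H : pfun {..<Suc m} {..<e}" using H(1) by (auto intro: pfun_mono)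
  moreover have "sub v H : van Z" using G(3) zprime_power[of "sub v H" "CHAR('a)" Z] H(2) by simp
  ultimately have "H = 0" using G(8) by blast
  then have "G = 0" using H(2) prime_gt_0_nat[OF p] by (simp add: power_0_left)
  then show False using G(4) by simp
 qed
 then obtain j where j: "j < Suc m" "de j ~= 0" by blast
 then have "sub v (de j) ~: van Z" using G(8)[of "de j"] de(1) by blast
 then obtain y where y: "y : Z" "de j (%i. v i y) ~= 0" by (auto simp: van_def sub_apply)
 \<comment> \<open>The differential of \<open>G\<close> at the image of \<open>y\<close>, as a
   linear form in the direction \<open>xi\<close>.\<close>
 define L where "L = (\<Sum>j<Suc m. cfun (de j (%i. v i y)) * coord j)"
 have L: "L : pfun {..<Suc m} {1}" unfolding L_def by (intro pfun_sum pfun_scale pfun_coord) auto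
 have L0: "L ~= 0"
 proof
  assume "L = 0"
  then have "L (%i. if i = j then 1 else 0) = 0" by (simp add: ev)
  moreover have "L (%i. if i = j then 1 else 0) = de j (%i. v i y)"
   using j(1) by (simp add: L_def ev if_distrib sum.delta del: sum.lessThan_Suc cong: if_cong)
  ultimately show False using y by simp
 qed
 show ?thesis
 proof (intro exI conjI allI impI)
  fix xi assume xi: "xi m = 1" "g xi ~= 0" "L xi ~= 0"
  show "gen_over Z (%i. v i - cfun (xi i) * v m) m"
   by (rule gen_step[OF st(1) v1(2) G(2,3,5,7) xi(2,1)])
  show "sep_over Z (%i. v i - cfun (xi i) * v m) m"
  proof (rule sep_step[where de = de and G = G and ?y0.0 = y and xi = xi, OF Z st(2) v1(1) de(2) _ _ G(3) y(1) _ xi(1)])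
   show "(\<Sum>j<Suc m. xi j * de j (%i. v i y)) ~= 0" using xi(3) by (simp add: L_def ev mult.commute)
  qed (use de(1) G(2) in "auto intro: pfun_polys")
 qed (use G(5,6) L L0 in auto)
qed

text \<open>One system for a whole family: the degree of a variety calls for linear sections adapted
  to all its geometric components at once.\<close>

definition normal_forms :: "('n => 'a::field) set set => (nat => ('n, 'a) fn) => nat => bool" where
 "normal_forms \<Z> v m \<longleftrightarrow> (\<forall>i<m. v i : pfun UNIV {1}) \<and> (\<forall>Z\<in>\<Z>. gen_over Z v m \<and> sep_over Z v m)"

text \<open>\<open>Ga\<close> imposes further open conditions on the direction, such as avoiding a
  cone in \<open>separating_hypersurface\<close>.\<close>

lemma normalization_step:
 fixes \<Z> :: "('n => 'a::alg_closed_field) set set"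
 assumes p: "Factorial_Ring.prime CHAR('a)" and Z: "finite \<Z>" "!!Z. Z : \<Z> ==> zprime Z"
  and st: "normal_forms \<Z> v (Suc m)" and dep: "!!Z. Z : \<Z> ==> \<not> alg_ind Z v (Suc m)"
  and Ga: "finite Ga" "!!ga. ga : Ga ==> \<exists>d. ga : pfun {..<Suc m} {d}" "!!ga. ga : Ga ==> ga ~= 0"
 obtains xi where "xi m = 1" "!!ga. ga : Ga ==> ga xi ~= 0" "normal_forms \<Z> (%i. v i - cfun (xi i) * v m) m"
proof -
 define Q where "Q = (%Z gL. (\<exists>d. fst gL : pfun {..<Suc m} {d}) \<and> (\<exists>d. snd gL : pfun {..<Suc m} {d}) \<and> fst gL ~= 0 \<and> snd gL ~= 0 \<and>
  (\<forall>xi. xi m = 1 --> fst gL xi ~= 0 --> snd gL xi ~= 0 -->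
   gen_over Z (%i. v i - cfun (xi i) * v m) m \<and> sep_over Z (%i. v i - cfun (xi i) * v m) m))"
 have v: "!!i. i < Suc m ==> v i : pfun UNIV {1}" using st by (auto simp: normal_forms_def)
 have "\<exists>gL. Q Z gL" if ZZ: "Z : \<Z>" for Z
 proof -
  have "gen_over Z v (Suc m)" "sep_over Z v (Suc m)" using st ZZ by (auto simp: normal_forms_def)
  then obtain g L where "Q Z (g, L)"
   using normalization_step_single[OF p Z(2)[OF ZZ] _ _ v dep[OF ZZ]] unfolding Q_def fst_conv snd_conv by blast
  then show ?thesis by blast
 qed
 then obtain gL where gL: "!!Z. Z : \<Z> ==> Q Z (gL Z)" by metis
 let ?F = "Ga \<union> (fst \<circ> gL) ` \<Z> \<union> (snd \<circ> gL) ` \<Z>"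
 have F: "finite ?F" using Ga(1) Z(1) by auto
 have "\<exists>d. f : pfun {..<Suc m} {d}" if "f : ?F" for f using that Ga(2) gL unfolding Q_def by auto
 moreover have "f ~= 0" if "f : ?F" for f using that
 proof (elim UnE imageE)
  assume "f : Ga" then show ?thesis by (rule Ga(3))
 next
  fix Z assume "f = (fst \<circ> gL) Z" "Z : \<Z>" then show ?thesis using gL[of Z] unfolding Q_def by simp
 next
  fix Z assume "f = (snd \<circ> gL) Z" "Z : \<Z>" then show ?thesis using gL[of Z] unfolding Q_def by simp
 qed
 ultimately obtain xi where xi: "xi m = 1" "!!f. f : ?F ==> f xi ~= 0"
  using hom_common_nonzero[OF F, of "{..<Suc m}" m] by blast
 show ?thesis
 proof (rule that[of xi])
  show "xi m = 1" by (rule xi(1))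
  show "ga xi ~= 0" if "ga : Ga" for ga using xi(2) that by blast
  show "normal_forms \<Z> (%i. v i - cfun (xi i) * v m) m"
   unfolding normal_forms_def
  proof (intro conjI allI impI ballI)
   fix i assume "i < m" then show "v i - cfun (xi i) * v m : pfun UNIV {1}"
    using v[of i] v[of m] by (intro pfun_diff pfun_scale) auto
  next
   fix Z assume Z: "Z : \<Z>"
   have "fst (gL Z) xi ~= 0" "snd (gL Z) xi ~= 0" using xi(2) Z by auto
   then show "gen_over Z (%i. v i - cfun (xi i) * v m) m" "sep_over Z (%i. v i - cfun (xi i) * v m) m"
    using gL[OF Z] xi(1) unfolding Q_def by blast+
  qed
 qed
qed

lemma alg_ind_0: "Y ~= {} ==> alg_ind Y v 0"
proof -
 assume Y: "Y ~= {}"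
 have "P = 0" if "P : polys {..<0::nat}" "sub v P : van Y" for P
 proof -
  obtain c where c: "P = cfun c" using pfun_no_vars[of P UNIV] `P : polys {..<0::nat}` by auto
  then show ?thesis using Y `sub v P : van Y` by (auto simp: van_def ev cfun_simps)
 qed
 then show ?thesis by (auto simp: alg_ind_def)
qed

lemma coord_forms:
 fixes \<Z> :: "('n::finite => 'a::alg_closed_field) set set"
 assumes "!!Z. Z : \<Z> ==> zprime Z"
 obtains e :: "nat => 'n" where "bij_betw e {..<(card (UNIV :: 'n set))} UNIV" "normal_forms \<Z> (%i. coord (e i)) (card (UNIV :: 'n set))"
proof -
 obtain e :: "nat => 'n" where e: "bij_betw e {..<(card (UNIV :: 'n set))} UNIV"
  using ex_bij_betw_nat_finite[of "UNIV :: 'n set"] by (auto simp: atLeast0LessThan)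
 let ?d = "inv_into {..<(card (UNIV :: 'n set))} e"
 have ed: "e (?d j) = j" "?d j < (card (UNIV :: 'n set))" for j
  using e inv_into_into[of j e "{..<(card (UNIV :: 'n set))}"] by (auto simp: bij_betw_def f_inv_into_f)
 have "gen_over Z (%i. coord (e i)) (card (UNIV :: 'n set))" for Z :: "('n => 'a) set"
 proof (rule gen_overI[where J = "{0::nat}" and w = "%_. 1"])
  fix t and f :: "('n, 'a) fn" assume f: "f : pfun UNIV {..t}"
  have 1: "sub (%j. coord (?d j)) f : pfun {..<(card (UNIV :: 'n set))} {..t}"
   by (rule sub_pfun_le1[OF f]) (use ed in "auto intro: pfun_coord")
  have 2: "sub (%i. coord (e i)) (sub (%j. coord (?d j)) f) = f"
   by (simp add: fun_eq_iff sub_apply coord_apply ed)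
  show "\<exists>a. (\<forall>l\<in>{0::nat}. a l : pfun {..<(card (UNIV :: 'n set))} {..t}) \<and> f - (\<Sum>l\<in>{0::nat}. sub (%i. coord (e i)) (a l) * 1) : van Z"
   using 1 2 lsub_zero[OF van_lsub, of Z] by (intro exI[of _ "%_. sub (%j. coord (?d j)) f"]) simp
 qed (auto intro: pfun_one)
 moreover have "sep_over Z (%i. coord (e i)) (card (UNIV :: 'n set))" if "Z : \<Z>" for Z
  unfolding sep_over_def
 proof (intro bexI[of _ 1] conjI ballI impI allI)
  show "1 ~: van Z" using assms[OF that] by (auto simp: zprime_def van_def ev)
  fix y :: "'n => 'a" and j
  have "(\<Sum>i<(card (UNIV :: 'n set)). cfun (if i = ?d j then 1 else 0) * (coord (e i) - cfun (coord (e i) y)))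
   = (\<Sum>i<(card (UNIV :: 'n set)). if i = ?d j then coord (e i) - cfun (coord (e i) y) else 0)"
   by (rule sum.cong) (auto simp: cfun_simps)
  also have "... = coord j - cfun (y j)" using ed by (simp add: coord_apply)
  finally show "\<exists>c. \<exists>R\<in>mpow y 2. coord j - cfun (y j) - (\<Sum>i<(card (UNIV :: 'n set)). cfun (c i) * (coord (e i) - cfun (coord (e i) y))) - R : van Z"
   using lsub_zero[OF van_lsub, of Z] mpow_zero[of y 2]
   by (intro exI[of _ "%i. if i = ?d j then 1 else 0"] bexI[of _ 0]) simp_all
 qed (auto intro: pfun_one)
 ultimately have "normal_forms \<Z> (%i. coord (e i)) (card (UNIV :: 'n set))"
  by (auto simp: normal_forms_def intro!: pfun_coord)
 then show ?thesis using that e by blast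
qed

text \<open>Forms are eliminated as long as every member satisfies a relation; the process stops
  when one member has none. For members of equal dimension \<open>alg_ind_of_dim\<close> transfers
  independence to all.\<close>

theorem noether_normalization:
 fixes \<Z> :: "('n::finite => 'a::alg_closed_field) set set"
 assumes p: "Factorial_Ring.prime CHAR('a)" and Z: "finite \<Z>" "\<Z> ~= {}" "!!Z. Z : \<Z> ==> zprime Z"
 obtains m v where "normal_forms \<Z> v m" "\<exists>Z\<in>\<Z>. alg_ind Z v m"
proof -
 have *: "\<exists>m v. normal_forms \<Z> v m \<and> (\<exists>Z\<in>\<Z>. alg_ind Z v m)" if "normal_forms \<Z> v m" for v m
  using that
 proof (induction m arbitrary: v)
  case 0
  obtain Z0 where "Z0 : \<Z>" using Z by blast
  then have "Z0 ~= {}" using Z(3)[of Z0] by (simp add: zprime_def)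
  then have "alg_ind Z0 v 0" by (rule alg_ind_0)
  then show ?case using 0 `Z0 : \<Z>` by blast
 next
  case (Suc m)
  show ?case
  proof (cases "\<exists>Z\<in>\<Z>. alg_ind Z v (Suc m)")
   case True then show ?thesis using Suc by blast
  next
   case False
   then obtain xi where "normal_forms \<Z> (%i. v i - cfun (xi i) * v m) m"
    using normalization_step[OF p Z(1,3) Suc.prems, of "{}"] by blast
   then show ?thesis by (rule Suc.IH)
  qed
 qed
 obtain e :: "nat => 'n" where "normal_forms \<Z> (%i. coord (e i)) (card (UNIV :: 'n set))"
  using coord_forms[OF Z(3)] by blast
 from *[OF this] show ?thesis using that by blast
qed

section \<open>Dimension by growth of the Hilbert function\<close>

lemma hle_of_generators:
 fixes W :: "('n, 'a::alg_closed_field) fn set" and n :: nat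
 assumes "!!f. f : V ==> \<exists>a. (\<forall>l<n. a l : pfun {..<m} {..t}) \<and> f - (\<Sum>l<n. sub v (a l) * w l) : W"
 shows "hle V W (n * ((m + t) choose m))"
proof -
 let ?N = "(m + t) choose m"
 have "hle (pfun {..<m} {..t} :: (nat, 'a) fn set) {0} ?N" using pfun_dim by blast
 then obtain b where b: "!!f :: (nat => 'a) => 'a. f : pfun {..<m} {..t} ==> \<exists>c. f - (\<Sum>j<?N. cfun (c j) * b j) : {0}"
  unfolding hle_def by blast
 have "hle V W (card ({..<n} \<times> {..<?N}))"
 proof (rule hleI[where g = "%(l, j). sub v (b j) * w l"])
  fix f :: "('n, 'a) fn" assume "f : V"
  then obtain a where a: "!!l. l < n ==> a l : pfun {..<m} {..t}" "f - (\<Sum>l<n. sub v (a l) * w l) : W"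
   using assms by blast
  have "\<forall>l. \<exists>c. l < n --> a l = (\<Sum>j<?N. cfun (c j) * b j)"
  proof
   fix l
   show "\<exists>c. l < n --> a l = (\<Sum>j<?N. cfun (c j) * b j)" using b[of "a l"] a(1)[of l] by (cases "l < n") auto
  qed
  from choice[OF this] obtain c where c: "!!l. l < n ==> a l = (\<Sum>j<?N. cfun (c l j) * b j)" by blast
  have "(\<Sum>l<n. sub v (a l) * w l) = (\<Sum>x\<in>{..<n} \<times> {..<?N}. cfun ((%(l, j). c l j) x) * (%(l, j). sub v (b j) * w l) x)"
   by (simp add: c sum.cartesian_product case_prod_unfold sum_distrib_right mult.assoc)
  then show "\<exists>c. f - (\<Sum>x\<in>{..<n} \<times> {..<?N}. cfun (c x) * (%(l, j). sub v (b j) * w l) x) : W"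
   using a(2) by (intro exI[of _ "%(l, j). c l j"]) simp
 qed auto
 then show ?thesis by (simp add: card_cartesian_product)
qed

lemma gen_over_dim:
 fixes Y :: "('n => 'a::alg_closed_field) set"
 assumes "gen_over Y v m"
 obtains n where "!!t. hle (pfun UNIV {..t}) (van Y) (n * ((m + t) choose m))"
proof -
 obtain n :: nat and w where w: "!!t f. f : pfun UNIV {..t} ==>
  \<exists>a. (\<forall>l<n. a l : pfun {..<m} {..t}) \<and> f - (\<Sum>l<n. sub v (a l) * w l) : van Y"
  using assms unfolding gen_over_def by blast
 show ?thesis by (rule that[OF hle_of_generators[OF w]])
qed

lemma alg_ind_dim:
 fixes Y :: "('n => 'a::alg_closed_field) set"
 assumes "alg_ind Y v m" "!!i. i < m ==> v i : pfun UNIV {..1}"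
 shows "hge (pfun UNIV {..t}) (van Y) ((m + t) choose m)"
proof -
 have "hge (sub v ` pfun {..<m} {..t}) (van Y) ((m + t) choose m)"
  by (rule hge_image[where W = "{0}"]) (use pfun_dim assms(1) in "auto simp: alg_ind_def intro: pfun_polys")
 then show ?thesis
  by (rule hge_mono) (use assms(2) in "auto intro!: sub_pfun_le1")
qed

definition dim_is :: "('n => 'a::field) set => nat => bool" where
 "dim_is Y s \<longleftrightarrow> (\<exists>n. \<forall>t. hle (pfun UNIV {..t}) (van Y) (n * ((s + t) choose s))) \<and>
  (\<forall>t. hge (pfun UNIV {..t}) (van Y) ((s + t) choose s))"

lemma dim_compare:
 assumes "!!t. hge (pfun UNIV {..t}) (van Y) ((s + t) choose s)"
  "!!t. hle (pfun UNIV {..t}) (van Y) (n * ((m + t) choose m))"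
 shows "s <= m"
proof (rule binomial_growth)
 fix M show "(M + s) choose s <= n * ((1 * M + 0 + m) choose m)"
  using hge_le_hle[OF van_lsub assms(1)[of M] assms(2)[of M]] by (simp add: add.commute)
qed

lemma dim_is_unique: "dim_is Y s ==> dim_is Y t ==> s = t"
 unfolding dim_is_def using dim_compare by (metis le_antisym)

text \<open>Functions independent on \<open>Z\<close>, multiplied by different powers of
  \<open>f\<close>, stay independent on \<open>Y\<close>, since every multiple of \<open>f\<close>
  dies on \<open>Z\<close>. Thus \<open>k\<close> powers give \<open>k\<close> copies of the Hilbert
  function of \<open>Z\<close>, and letting \<open>k\<close> grow linearly raises the exponent by
  one.\<close>

lemma dim_strict:
 fixes Y Z :: "('n => 'a::field) set"
 assumes Y: "zprime Y" "dim_is Y s" and f: "f : polys UNIV" "f : van Z" "f ~: van Y"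
  and ZY: "Z <= Y" and Z: "!!t. hge (pfun UNIV {..t}) (van Z) ((r + t) choose r)"
 shows "r < s"
proof -
 obtain e where e: "f : pfun UNIV {..e}" using f(1) by (rule polys_bounded)
 have *: "hge (pfun UNIV {..e * k + t}) (van Y) (k * ((r + t) choose r))" for k t
 proof (induction k)
  case 0 then show ?case by (simp add: hge_def indep_mod_def)
 next
  case (Suc k)
  have "hge (pfun UNIV {..e * Suc k + t}) (van Y) (((r + t) choose r) + k * ((r + t) choose r))"
  proof (rule hge_add[OF Z])
   show "hge ((%g. f * g) ` pfun UNIV {..e * k + t}) (van Y) (k * ((r + t) choose r))"
    by (rule hge_mult[OF Suc]) (use zprime_mult[OF Y(1) f(1)] f(3) in "auto intro: pfun_polys")
   show "(%g. f * g) ` pfun UNIV {..e * k + t} <= pfun UNIV {..e * Suc k + t}"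
   proof (rule image_subsetI)
    fix g :: "('n, 'a) fn" assume "g : pfun UNIV {..e * k + t}"
    from pfun_mult_le[OF e this] show "f * g : pfun UNIV {..e * Suc k + t}" by (simp add: add.assoc)
   qed
   show "(%g. f * g) ` pfun UNIV {..e * k + t} <= van Z" using f(2) by (auto simp: van_def ev)
   show "van Y <= van Z" using ZY by (auto simp: van_def)
  qed (auto intro: pfun_mono)
  then show ?case by simp
 qed
 obtain n where n: "!!t. hle (pfun UNIV {..t}) (van Y) (n * ((s + t) choose s))" using Y(2) by (auto simp: dim_is_def)
 have "Suc r <= s"
 proof (rule binomial_growth)
  fix M
  \<comment> \<open>The number of copies is \<open>M + Suc r\<close> because its product with
    \<open>(r + M) choose r\<close> is exactly \<open>Suc r\<close> times the next binomial.\<close>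
  have "(M + Suc r) choose Suc r <= Suc r * ((M + Suc r) choose Suc r)" by simp
  also have "... = (M + Suc r) * ((r + M) choose r)"
   using Suc_times_binomial_eq[of "M + r" r] by (simp add: add.commute)
  also have "... <= n * ((s + (e * (M + Suc r) + M)) choose s)"
   using hge_le_hle[OF van_lsub *[of "M + Suc r" M] n] .
  also have "s + (e * (M + Suc r) + M) = (e + 1) * M + e * Suc r + s" by (simp add: algebra_simps)
  finally show "(M + Suc r) choose Suc r <= n * (((e + 1) * M + e * Suc r + s) choose s)" .
 qed
 then show ?thesis by simp
qed

lemma normal_forms_dim_is:
 fixes Y :: "('n => 'a::alg_closed_field) set"
 assumes "normal_forms \<Z> v m" "Y : \<Z>" "alg_ind Y v m" shows "dim_is Y m"
proof -
 have v: "v i : pfun UNIV {..1}" if "i < m" for i using assms(1) that by (auto simp: normal_forms_def intro: pfun_mono)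
 have "gen_over Y v m" using assms by (auto simp: normal_forms_def)
 then obtain n where "!!t. hle (pfun UNIV {..t}) (van Y) (n * ((m + t) choose m))" using gen_over_dim by blast
 then show ?thesis using alg_ind_dim[OF assms(3) v] by (auto simp: dim_is_def)
qed

text \<open>A member whose forms were dependent could be normalized further, contradicting its dimension.\<close>
lemma alg_ind_of_dim:
 fixes Y :: "('n => 'a::alg_closed_field) set"
 assumes p: "Factorial_Ring.prime CHAR('a)" and Y: "zprime Y" and st: "gen_over Y v m" "sep_over Y v m"
  and v: "!!i. i < m ==> v i : pfun UNIV {1}" and dim: "!!t. hge (pfun UNIV {..t}) (van Y) ((m + t) choose m)"
 shows "alg_ind Y v m"
proof (rule ccontr)
 assume dep: "\<not> alg_ind Y v m"
 then obtain m' where m': "m = Suc m'" using alg_ind_0 Y by (cases m) (auto simp: zprime_def)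
 have nf: "normal_forms {Y} v (Suc m')" using st v m' by (auto simp: normal_forms_def)
 obtain xi where "normal_forms {Y} (%i. v i - cfun (xi i) * v m') m'"
  using normalization_step[OF p _ _ nf, of "{}"] Y dep m' by auto
 then have "gen_over Y (%i. v i - cfun (xi i) * v m') m'" by (auto simp: normal_forms_def)
 then obtain n where "!!t. hle (pfun UNIV {..t}) (van Y) (n * ((m' + t) choose m'))" using gen_over_dim by blast
 then have "m <= m'" using dim dim_compare by blast
 then show False using m' by simp
qed

lemma dim_exists:
 fixes Y :: "('n::finite => 'a::alg_closed_field) set"
 assumes "Factorial_Ring.prime CHAR('a)" "zprime Y"
 obtains s where "dim_is Y s" "s <= (card (UNIV :: 'n set))"
proof -
 obtain m v where nf: "normal_forms {Y} v m" "\<exists>Z\<in>{Y}. alg_ind Z v m"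
  by (rule noether_normalization[OF assms(1), of "{Y}"]) (use assms(2) in auto)
 then have d: "dim_is Y m" using normal_forms_dim_is by blast
 obtain e :: "nat => 'n" where "normal_forms {Y} (%i. coord (e i)) (card (UNIV :: 'n set))"
  using coord_forms[of "{Y}"] assms(2) by blast
 then have "gen_over Y (%i. coord (e i)) (card (UNIV :: 'n set))" by (auto simp: normal_forms_def)
 then obtain n where "!!t. hle (pfun UNIV {..t}) (van Y) (n * (((card (UNIV :: 'n set)) + t) choose (card (UNIV :: 'n set))))"
  using gen_over_dim by blast
 then have "m <= (card (UNIV :: 'n set))" using d dim_compare unfolding dim_is_def by blast
 then show ?thesis using that d by blast
qed

section \<open>Finite covers\<close>

lemma prime_elem_linear: "prime_elem [:- a, 1 :: 'a::field:]"
 by (rule prime_elemI) (auto simp: poly_eq_0_iff_dvd[symmetric] is_unit_poly_iff)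

text \<open>The linear factors of \<open>g\<close> are stripped one at a time: each is a prime
  constant dividing \<open>P\<close> or \<open>H\<close>. Once \<open>g\<close> is constant, the
  leading coefficient of \<open>P\<close> is a unit because \<open>E\<close> is monic.\<close>

lemma gauss_monic_factor:
 fixes P H E :: "'a::alg_closed_field poly poly"
 assumes "g ~= 0" "[:g:] * E = P * H" "lead_coeff E = 1"
 shows "lead_coeff P dvd poly.coeff P i"
 using assms
proof (induction "degree g" arbitrary: g P H)
 case 0
 then obtain c where c: "g = [:c:]" "c ~= 0" by (metis degree_eq_zeroE pCons_0_0)
 have "lead_coeff [:g:] * lead_coeff E = lead_coeff P * lead_coeff H"
  using arg_cong[OF "0.prems"(2), of lead_coeff] by (simp only: lead_coeff_mult)
 then have "g = lead_coeff P * lead_coeff H" using "0.prems"(3) by simp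
 then have "lead_coeff P dvd g" by (rule dvdI)
 then have "is_unit (lead_coeff P)" using c by (metis is_unit_pCons_iff dvd_trans dvd_refl)
 then show ?case by (rule unit_imp_dvd)
next
 case (Suc n)
 then obtain a where "poly g a = 0" using alg_closed_imp_poly_has_root[of g] by auto
 then obtain g' where g': "g = [:- a, 1:] * g'" by (auto simp: poly_eq_0_iff_dvd)
 have g'0: "g' ~= 0" using Suc.prems(1) g' by auto
 have deg: "n = degree g'"
  using Suc.hyps(2) g'0 unfolding g' by (subst (asm) degree_mult_eq) auto
 let ?c = "[:[:- a, 1:]:] :: 'a poly poly"
 have pc: "prime_elem ?c" using prime_elem_linear by (simp only: prime_elem_const_poly_iff)
 have c0: "?c ~= 0" by simp
 have gE: "[:g:] * E = ?c * ([:g':] * E)" by (simp only: g' mult.assoc[symmetric]) simp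
 then have "?c dvd P * H" using Suc.prems(2) by (metis dvd_triv_left)
 then consider "?c dvd P" | "?c dvd H" using pc by (auto simp: prime_elem_dvd_mult_iff)
 then show ?case
 proof cases
  case 1
  then obtain P1 where P1: "P = ?c * P1" by auto
  have "?c * ([:g':] * E) = ?c * (P1 * H)" using Suc.prems(2) gE P1 by (simp only: mult.assoc)
  then have "[:g':] * E = P1 * H" using c0 by (simp only: mult_cancel_left) blast
  then have "lead_coeff P1 dvd poly.coeff P1 i" by (rule Suc.hyps(1)[OF deg g'0 _ Suc.prems(3)])
  moreover have "lead_coeff P = [:- a, 1:] * lead_coeff P1" unfolding P1 lead_coeff_mult by simp
  moreover have "poly.coeff P i = [:- a, 1:] * poly.coeff P1 i" unfolding P1 by simp
  ultimately show ?thesis by (simp only: mult_dvd_mono dvd_refl)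
 next
  case 2
  then obtain H1 where H1: "H = ?c * H1" by auto
  have "?c * ([:g':] * E) = ?c * (P * H1)" using Suc.prems(2) gE H1 by (simp only: mult.left_commute)
  then have "[:g':] * E = P * H1" using c0 by (simp only: mult_cancel_left) blast
  then show ?thesis by (rule Suc.hyps(1)[OF deg g'0 _ Suc.prems(3)])
 qed
qed

lemma poly_poly_eqI:
 fixes A B :: "'a::alg_closed_field poly poly"
 assumes "!!s t. poly (poly A [:t:]) s = poly (poly B [:t:]) s"
 shows "A = B"
proof -
 have ev2: "poly (poly C [:t:]) s = poly (\<Sum>k\<le>degree C. Polynomial.monom (poly (poly.coeff C k) s) k) t"
  for C :: "'a poly poly" and s t
  by (simp add: poly_altdef[of C] poly_sum poly_monom)
 define C where "C = A - B"
 have "poly (\<Sum>k\<le>degree C. Polynomial.monom (poly (poly.coeff C k) s) k) t = 0" for s t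
 proof -
  have "poly (poly C [:t:]) s = 0" using assms[of t s] by (simp add: C_def)
  then show ?thesis by (simp only: ev2)
 qed
 then have z: "(\<Sum>k\<le>degree C. Polynomial.monom (poly (poly.coeff C k) s) k) = 0" for s
  by (rule poly_zero_if_all_roots)
 have "poly (poly.coeff C k) s = 0" for k s
 proof (cases "k <= degree C")
  case True
  have "poly.coeff (\<Sum>k\<le>degree C. Polynomial.monom (poly (poly.coeff C k) s) k) k = 0" by (simp add: z)
  then show ?thesis using True by (simp add: coeff_sum if_distrib sum.delta cong: if_cong)
 qed (simp add: coeff_eq_0)
 then have "poly.coeff C k = 0" for k by (rule poly_zero_if_all_roots)
 then have "C = 0" by (intro poly_eqI) simp
 then show ?thesis by (simp add: C_def)
qed

text \<open>On a line through the origin \<open>f\<close> equals \<open>f x * t ^ d\<close> and is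
  divisible by \<open>t ^ (d + 1)\<close>.\<close>

lemma pfun_lowest_unique:
 fixes f g :: "('i, 'a::alg_closed_field) fn"
 assumes "f : pfun I {d}" "f : pfun I {Suc d..}" shows "f = 0"
proof
 fix x
 obtain p where p: "!!t. f (%i. t * x i) = t ^ Suc d * poly p t" by (rule pfun_ge_line[OF assms(2), of x]) blast
 have "t ^ d * (f x - t * poly p t) = 0" for t
  using p[of t] pfun_hom[OF assms(1), of t x] by (simp add: algebra_simps)
 then have "poly (Polynomial.monom 1 d * ([:f x:] - [:0, 1:] * p)) t = 0" for t by (simp add: poly_monom)
 then have "Polynomial.monom 1 d * ([:f x:] - [:0, 1:] * p) = 0" by (rule poly_zero_if_all_roots)
 then have "[:f x:] - [:0, 1:] * p = 0" by (simp only: mult_eq_0_iff monom_eq_0_iff) simp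
 then have "poly ([:f x:] - [:0, 1:] * p) 0 = 0" by simp
 then show "f x = 0 x" by (simp add: ev)
qed

lemma lowest_forms_eq:
 fixes f g :: "('i, 'a::alg_closed_field) fn"
 assumes "f : pfun I {a}" "g : pfun I {b}" "f ~= 0" "g ~= 0"
  "h - f : pfun I {Suc a..}" "h - g : pfun I {Suc b..}"
 shows "f = g"
proof -
 have *: "f = g" if "f : pfun I {a}" "g : pfun I {b}" "f ~= 0" "h - f : pfun I {Suc a..}" "h - g : pfun I {Suc b..}" "a <= b"
  for f g :: "('i, 'a) fn" and a b
 proof -
  have "h - g : pfun I {Suc a..}" by (rule pfun_mono[OF that(5)]) (use that(6) in auto)
  then have d: "f - g : pfun I {Suc a..}" using pfun_diff[of "h - g" I "{Suc a..}" "h - f"] that by simp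
  show ?thesis
  proof (cases "a = b")
   case True
   then have "f - g : pfun I {a}" using that by (auto intro: pfun_diff)
   then have "f - g = 0" using pfun_lowest_unique[of "f - g" I a] d by blast
   then show ?thesis by simp
  next
   case False
   have "g : pfun I {Suc a..}" by (rule pfun_mono[OF that(2)]) (use False that(6) in auto)
   then have "f : pfun I {Suc a..}" using pfun_add[OF d, of g] by simp
   then show ?thesis using pfun_lowest_unique[of f I a] that by blast
  qed
 qed
 show ?thesis
 proof (cases "a <= b")
  case True then show ?thesis using *[OF assms(1,2,3,5,6)] by blast
 next
  case False then show ?thesis using *[OF assms(2,1,4,6,5)] by simp
 qed
qed

lemma lowest_mult:
 assumes "f - f' : pfun I {Suc a..}" "g - g' : pfun I {Suc b..}" "f' : pfun I {a}" "g' : pfun I {b}"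
 shows "f * g - f' * g' : pfun I {Suc (a + b)..}"
proof -
 have "f * g - f' * g' = (f - f') * (g - g') + (f - f') * g' + f' * (g - g')" by (simp add: algebra_simps)
 moreover have "(f - f') * (g - g') : pfun I {Suc (a + b)..}" by (rule pfun_mult[OF assms(1,2)]) auto
 moreover have "(f - f') * g' : pfun I {Suc (a + b)..}" by (rule pfun_mult[OF assms(1,4)]) auto
 moreover have "f' * (g - g') : pfun I {Suc (a + b)..}" by (rule pfun_mult[OF assms(3,2)]) auto
 ultimately show ?thesis by (simp add: pfun_add)
qed

lemma lowest_power:
 assumes "f - f' : pfun I {Suc a..}" "f' : pfun I {a}"
 shows "f ^ k - f' ^ k : pfun I {Suc (k * a)..}"
proof (induction k)
 case (Suc k)
 have "f * f ^ k - f' * f' ^ k : pfun I {Suc (a + k * a)..}"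
  by (rule lowest_mult[OF assms(1) Suc assms(2)]) (use pfun_power_eq[OF assms(2), of k] in auto)
 then show ?case by simp
qed (simp add: pfun_zero)

text \<open>The outcome of Noether normalization: \<open>l\<close> defines a finite dominant map
  from \<open>Y\<close> to affine \<open>s\<close>-space. That it is onto is
  \<open>surjective\<close>.\<close>

locale finite_cover =
 fixes Y :: "('n::finite => 'a::alg_closed_field) set" and l :: "nat => ('n, 'a) fn" and s :: nat
 assumes prime: "zprime Y" and closed: "zclosed Y"
  and l: "!!i. i < s ==> l i : polys UNIV" and ind: "alg_ind Y l s" and gen: "gen_over Y l s"
begin

lemma generators:
 obtains n :: nat and w where "!!j. j < n ==> w j : polys UNIV"
  "!!f. f : polys UNIV ==> \<exists>a. (\<forall>j<n. a j : polys {..<s}) \<and> f - (\<Sum>j<n. sub l (a j) * w j) : van Y"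
proof -
 obtain n :: nat and w where w: "!!j. j < n ==> w j : polys UNIV"
  "!!t f. f : pfun UNIV {..t} ==> \<exists>a. (\<forall>j<n. a j : pfun {..<s} {..t}) \<and> f - (\<Sum>j<n. sub l (a j) * w j) : van Y"
  using gen unfolding gen_over_def by blast
 show ?thesis
 proof (rule that[OF w(1)])
  fix f :: "('n, 'a) fn" assume "f : polys UNIV"
  then obtain t where "f : pfun UNIV {..t}" by (rule polys_bounded)
  then show "\<exists>a. (\<forall>j<n. a j : polys {..<s}) \<and> f - (\<Sum>j<n. sub l (a j) * w j) : van Y"
   using w(2)[of f t] pfun_polys by blast
 qed
qed

lemma annihilator_vanishes:
 assumes "!!f. f : polys UNIV ==> \<exists>a. (\<forall>j<n. a j : polys {..<s}) \<and> f - (\<Sum>j<n. sub l (a j) * w j) : van Y"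
  and "!!j. j < n ==> g * w j : van Y"
 shows "g : van Y"
proof -
 obtain a where a: "1 - (\<Sum>j<n. sub l (a j) * w j) : van Y" using assms(1)[of 1] by (auto intro: pfun_one)
 have "g * (1 - (\<Sum>j<n. sub l (a j) * w j)) + (\<Sum>j<n. sub l (a j) * (g * w j)) : van Y"
  by (intro lsub_add[OF van_lsub] lsub_sum[OF van_lsub] van_mult a assms) auto
 moreover have "g * (1 - (\<Sum>j<n. sub l (a j) * w j)) + (\<Sum>j<n. sub l (a j) * (g * w j)) = g"
  by (simp add: right_diff_distrib sum_distrib_left mult_ac)
 ultimately show ?thesis by simp
qed

text \<open>Multiplication by \<open>u\<close> acts on the module generators by a matrix
  \<open>a\<close>; elimination in \<open>T - a\<close>, with monic polynomials as pivots and lower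
  degrees elsewhere, replaces the characteristic polynomial.\<close>

lemma integral:
 assumes u: "u : polys UNIV"
 obtains k r where "r : plt (polys {..<s}) (coord s) k" "sub (l(s := u)) (coord s ^ k + r) : van Y"
proof -
 let ?A = "polys {..<s} :: (nat, 'a) fn set"
 let ?T = "coord s :: (nat, 'a) fn"
 obtain n :: nat and w where w: "!!j. j < n ==> w j : polys UNIV"
  "!!f. f : polys UNIV ==> \<exists>a. (\<forall>j<n. a j : polys {..<s}) \<and> f - (\<Sum>j<n. sub l (a j) * w j) : van Y"
  using generators by blast
 have "\<forall>j. \<exists>a. j < n --> (\<forall>i<n. a i : ?A) \<and> u * w j - (\<Sum>i<n. sub l (a i) * w i) : van Y"
  using w polys_mult[OF u] by blast
 from choice[OF this] obtain a where a: "!!j i. j < n ==> i < n ==> a j i : ?A"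
  "!!j. j < n ==> u * w j - (\<Sum>i<n. sub l (a j i) * w i) : van Y" by blast
 have A: "!!x y. x : ?A ==> y : ?A ==> x + y : ?A" "!!x y. x : ?A ==> y : ?A ==> x * y : ?A" "0 : ?A"
  by (auto intro: pfun_add polys_mult pfun_zero)
 have padd: "x : plt ?A ?T k ==> y : plt ?A ?T k ==> x + y : plt ?A ?T k" for x y k
  by (rule plt_add) (auto intro: pfun_add)
 have pmul: "x : plt ?A ?T i ==> y : plt ?A ?T k ==> x * y : plt ?A ?T (i + k)" for x y i k
  by (rule plt_mult) (auto intro: A)
 note psh = plt_shift[where A = ?A and T = ?T, OF A(3)]
 have pneg: "x : plt ?A ?T k ==> - x : plt ?A ?T k" for x k
  using plt_scale[where A = ?A and f = x and T = ?T and n = k and c = "cfun (-1)"] A(2) pfun_const[where D = UNIV and c = "-1" and I = "{..<s}"] by (simp add: cfun_simps)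
 have pdiff: "x : plt ?A ?T k ==> y : plt ?A ?T k ==> x - y : plt ?A ?T k" for x y k
  using padd[of x k "- y"] pneg[of y k] by simp
 have const1: "c : ?A ==> c : plt ?A ?T 1" for c using pltI[where n = 1 and a = "%_. c" and A = ?A and T = ?T] A(3) by simp
 define P1 where "P1 = (%k. {?T ^ k + r | r. r : plt ?A ?T k})"
 define b where "b = (%j i. (if i = j then ?T else 0) - a j i)"
 have "\<exists>k. \<exists>g\<in>P1 k. \<forall>i<n. sub (l(s := u)) g * w i : van Y"
 proof (rule elimination[where ?P0.0 = "%k. plt ?A ?T k" and b = b and i = 1])
  show "1 : P1 0" by (auto simp: P1_def plt_def intro!: exI[of _ "%_. 0"] pfun_zero)
  show "x * y : P1 (i + k)" if xy: "x : P1 i" "y : P1 k" for i k x y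
  proof -
   obtain r r' where r: "x = ?T ^ i + r" "r : plt ?A ?T i" "y = ?T ^ k + r'" "r' : plt ?A ?T k"
    using xy by (auto simp: P1_def)
   have "x * y = ?T ^ (i + k) + (?T ^ i * r' + ?T ^ k * r + r * r')" by (simp add: r power_add algebra_simps)
   moreover have "?T ^ k * r : plt ?A ?T (i + k)" using psh[OF r(2), where m = k] by (simp add: add.commute)
   then have "?T ^ i * r' + ?T ^ k * r + r * r' : plt ?A ?T (i + k)"
    by (rule padd[OF padd[OF psh[OF r(4)]] pmul[OF r(2,4)]])
   ultimately show ?thesis unfolding P1_def by blast
  qed
  show "x * y - p * q : P1 (i + i)" if xy: "x : P1 i" "y : P1 i" "p : plt ?A ?T i" "q : plt ?A ?T i" for i x y p q
  proof -
   obtain r r' where r: "x = ?T ^ i + r" "r : plt ?A ?T i" "y = ?T ^ i + r'" "r' : plt ?A ?T i"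
    using xy by (auto simp: P1_def)
   have "x * y - p * q = ?T ^ (i + i) + (?T ^ i * r' + ?T ^ i * r + r * r' - p * q)"
    by (simp add: r power_add algebra_simps)
   moreover have "?T ^ i * r' + ?T ^ i * r + r * r' - p * q : plt ?A ?T (i + i)"
    by (intro pdiff padd psh pmul r xy)
   ultimately show ?thesis unfolding P1_def by blast
  qed
  show "x * y - p * q : plt ?A ?T (i + i)"
   if xy: "x : P1 i" "y : plt ?A ?T i" "p : plt ?A ?T i" "q : plt ?A ?T i" for i x y p q
  proof -
   obtain r where r: "x = ?T ^ i + r" "r : plt ?A ?T i" using xy by (auto simp: P1_def)
   have "x * y - p * q = ?T ^ i * y + r * y - p * q" by (simp add: r algebra_simps)
   then show ?thesis by (simp only:) (intro pdiff padd psh pmul r xy)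
  qed
  show "x - y : van Y" if "x : van Y" "y : van Y" for x y using that lsub_diff[OF van_lsub] by blast
  show "sub (l(s := u)) c * x : van Y" if "x : van Y" for c x using that by (rule van_mult)
  show "b j j : P1 1" if "j < n" for j
   using pneg[OF const1[OF a(1)[OF that that]]] by (auto simp: b_def P1_def intro!: exI[of _ "- a j j"])
  show "b j i : plt ?A ?T 1" if "j < n" "i < n" "j ~= i" for i j
   using pneg[OF const1[OF a(1)[OF that(1,2)]]] that by (simp add: b_def)
  show "(\<Sum>i<n. sub (l(s := u)) (b j i) * w i) : van Y" if j: "j < n" for j
  proof -
   have "sub (l(s := u)) (a j i) = sub l (a j i)" if "i < n" for i
    by (rule sub_cong[OF a(1)[OF j that]]) auto
   then have "(\<Sum>i<n. sub (l(s := u)) (b j i) * w i) = (\<Sum>i<n. (if i = j then u * w i else 0) - sub l (a j i) * w i)"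
    by (intro sum.cong) (auto simp: b_def left_diff_distrib)
   also have "... = u * w j - (\<Sum>i<n. sub l (a j i) * w i)" using j by (simp add: sum_subtractf)
   finally show ?thesis using a(2)[OF j] by simp
  qed
 qed (auto simp: sub_simps)
 then obtain k g where g: "g : P1 k" "!!i. i < n ==> sub (l(s := u)) g * w i : van Y" by blast
 then have "sub (l(s := u)) g : van Y" using annihilator_vanishes[OF w(2)] by blast
 moreover obtain r where "g = ?T ^ k + r" "r : plt ?A ?T k" using g(1) by (auto simp: P1_def)
 ultimately show ?thesis using that by blast
qed

text \<open>Normality of the polynomial ring: the relation of least degree in the last variable is monic.
 Along every line in a fixed direction Gauss's lemma applies, and division with remainder in that
 direction makes the quotients polynomial.\<close>
lemma minimal_polynomial:
 assumes u: "u : polys UNIV"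
 obtains k r where "r : plt (polys {..<s}) (coord s) k" "sub (l(s := u)) (coord s ^ k + r) : van Y"
  "!!P. P : polys {..<Suc s} ==> sub (l(s := u)) P : van Y ==> \<exists>H\<in>polys {..<Suc s}. P = (coord s ^ k + r) * H"
proof -
 let ?A = "polys {..<s} :: (nat, 'a) fn set"
 let ?T = "coord s :: (nat, 'a) fn"
 let ?v = "l(s := u)"
 have A: "!!x y. x : ?A ==> y : ?A ==> x + y : ?A" "!!x y. x : ?A ==> y : ?A ==> x * y : ?A" "0 : ?A"
   "!!x. x : ?A ==> - x : ?A"
  by (auto intro: pfun_add polys_mult pfun_zero pfun_uminus)
 have AS: "polys ({..<Suc s} - {s}) = ?A" by (rule arg_cong[of _ _ polys]) auto
 have Asub: "?A <= polys {..<Suc s}" by (auto intro: pfun_mono)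
 have pltp: "f : polys {..<Suc s}" if "f : plt ?A ?T k" for f k
  using that Asub by (auto simp: plt_def intro!: pfun_sum polys_mult polys_power pfun_coord)
 have toplt: "\<exists>n. f : plt ?A ?T n" if "f : polys {..<Suc s}" for f
  using polys_plt[OF that, of s] unfolding AS by blast
 have subA: "sub ?v f = sub l f" if "f : ?A" for f by (rule sub_cong[OF that]) auto
 have vp: "sub ?v f : polys UNIV" if "f : polys {..<Suc s}" for f
  by (rule sub_polys[OF that]) (use l u in "auto simp: less_Suc_eq")
 obtain N E0 where E0: "E0 : plt ?A ?T N" "sub ?v (?T ^ N + E0) : van Y" using integral[OF u] by blast
 \<comment> \<open>The degrees of nontrivial relations, not necessarily monic; the integral equation
   shows that there are any.\<close>
 define Q where "Q = (%k. \<exists>p. (\<forall>i\<le>k. p i : ?A) \<and> p k ~= 0 \<and> sub ?v (\<Sum>i\<le>k. p i * ?T ^ i) : van Y)"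
 have "Q N"
 proof -
  obtain a where a: "E0 = (\<Sum>i<N. a i * ?T ^ i)" "!!i. a i : ?A" using E0(1) by (auto simp: plt_def)
  have "(\<Sum>i\<le>N. (if i = N then 1 else a i) * ?T ^ i) = (\<Sum>i<N. (if i = N then 1 else a i) * ?T ^ i) + ?T ^ N"
   by (simp flip: lessThan_Suc_atMost)
  also have "(\<Sum>i<N. (if i = N then 1 else a i) * ?T ^ i) = E0" unfolding a(1) by (rule sum.cong) auto
  finally show ?thesis unfolding Q_def using E0(2) a(2)
   by (intro exI[of _ "%i. if i = N then 1 else a i"]) (auto simp: add.commute intro: pfun_one)
 qed
 define k where "k = (LEAST k. Q k)"
 have "Q k" unfolding k_def using `Q N` by (rule LeastI)
 then obtain p where p: "!!i. i <= k ==> p i : ?A" "p k ~= 0" "sub ?v (\<Sum>i\<le>k. p i * ?T ^ i) : van Y"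
  unfolding Q_def by blast
 have min: "\<not> Q k'" if "k' < k" for k' using that not_less_Least unfolding k_def by blast
 have rem0: "r = 0" if r: "r : plt ?A ?T k" "sub ?v r : van Y" for r
 proof -
  obtain a where a: "r = (\<Sum>i<k. a i * ?T ^ i)" "!!i. a i : ?A" using r(1) by (auto simp: plt_def)
  have "r : plt ?A ?T j ==> j <= k ==> r = 0" for j
  proof (induction j)
   case 0 then show ?case by (auto simp: plt_def)
  next
   case (Suc j)
   obtain c where c: "r = (\<Sum>i<Suc j. c i * ?T ^ i)" "!!i. c i : ?A" using Suc.prems(1) by (auto simp: plt_def)
   have "c j = 0"
   proof (rule ccontr)
    assume "c j ~= 0"
    then have "Q j" unfolding Q_def using c r(2) by (intro exI[of _ c]) (simp add: lessThan_Suc_atMost)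
    then show False using min Suc.prems by simp
   qed
   then have "r : plt ?A ?T j" using c unfolding plt_def by (intro CollectI exI[of _ c]) simp
   then show ?case using Suc by simp
  qed
  then show ?thesis using r(1) by blast
 qed
 define L where "L = (\<Sum>i<k. p i * ?T ^ i)"
 have L: "L : plt ?A ?T k" unfolding L_def by (rule pltI) (use p A in auto)
 have Peq: "(\<Sum>i\<le>k. p i * ?T ^ i) = p k * ?T ^ k + L"
  by (simp add: L_def add.commute flip: lessThan_Suc_atMost)
 have pk: "p k ^ j : ?A" for j using p(1) by (intro polys_power) auto
 have "sub l (p k) ~: van Y" using ind p(1,2) by (auto simp: alg_ind_def)
 \<comment> \<open>Pseudo-division of the integral equation by the minimal relation leaves no
   remainder, by minimality of \<open>k\<close>. This factorization is the input for Gauss's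
   lemma.\<close>
 have "\<exists>M q. q : polys {..<Suc s} \<and> p k ^ M * (?T ^ N + E0) = q * (p k * ?T ^ k + L)"
 proof -
  have "?T ^ N + E0 : polys {..<Suc s}" using pltp[OF E0(1)] by (intro pfun_add polys_power pfun_coord) auto
  then obtain M where M: "?T ^ N + E0 : plt ?A ?T M" using toplt by blast
  obtain q r where qr: "q : plt ?A ?T M" "r : plt ?A ?T k"
   "p k ^ M * (?T ^ N + E0) = q * (p k * ?T ^ k + L) + r"
   using plt_division[of ?A "p k" M L ?T k "?T ^ N + E0", OF A pk p(1)[OF order.refl] L M] by blast
  have "r = p k ^ M * (?T ^ N + E0) - q * (p k * ?T ^ k + L)" using qr(3) by simp
  then have "sub ?v r = sub ?v (p k ^ M) * sub ?v (?T ^ N + E0) - sub ?v q * sub ?v (p k * ?T ^ k + L)" by simp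
  also have "... : van Y" using E0(2) p(3) unfolding Peq by (intro lsub_diff[OF van_lsub] van_mult)
  finally have "r = 0" using rem0 qr(2) by blast
  then show ?thesis using qr pltp by auto
 qed
 then obtain M q where q: "q : polys {..<Suc s}" "p k ^ M * (?T ^ N + E0) = q * (p k * ?T ^ k + L)" by blast
 \<comment> \<open>A leading coefficient dividing all others can be cancelled, as it does not vanish
   on \<open>Y\<close>. Gauss's lemma gives divisibility only along lines; division in a generic
   direction turns this into divisibility of polynomials.\<close>
 have divides: "\<exists>r\<in>?A. p i = p k * r" if i: "i <= k" for i
 proof -
  obtain t where t: "p k : pfun {..<s} {..t}" using polys_bounded[OF p(1)[OF order.refl]] by blast
  define e where "e = (LEAST t. p k : pfun {..<s} {..t})"
  have e: "p k : pfun {..<s} {..e}" unfolding e_def using t by (rule LeastI)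
  have "p k ~: pfun {..<s} {..<e}"
  proof
   assume *: "p k : pfun {..<s} {..<e}"
   then obtain e' where e': "e = Suc e'" using p(2) pfun_empty_degrees[of "p k" "{..<s}"] by (cases e) auto
   then have "p k : pfun {..<s} {..e'}" using * by (simp add: lessThan_Suc_atMost)
   then have "e <= e'" unfolding e_def by (rule Least_le)
   then show False using e' by simp
  qed
  then obtain g where g: "g : pfun {..<s} {e}" "g ~= 0" "p k - g : pfun {..<s} {..<e}"
   using pfun_highest[OF e] by blast
  have mon: "f : pfun {..<s} D ==> f : pfun {..<Suc s} D" for f :: "(nat, 'a) fn" and D
   by (rule pfun_mono) auto
  \<comment> \<open>The coefficients are free of \<open>x s\<close>, so the tilt makes
    \<open>x s\<close> the parameter in direction \<open>xi\<close>, and \<open>p k\<close> becomes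
    monic in it up to a constant.\<close>
  obtain xi where xi: "xi s = 1" "g xi ~= 0"
   using hom_common_nonzero[of "{g}" "{..<Suc s}" s] g mon[OF g(1)] by auto
  obtain a where a: "!!j. j < e ==> a j : pfun ({..<Suc s} - {s}) ((%d. d - j) ` ({..e} \<inter> {j..}))"
   "sub (tilt xi s) (p k) = cfun (g xi) * ?T ^ e + (\<Sum>j<e. a j * ?T ^ j)"
   using tilt_monic[OF mon[OF e] order.refl mon[OF g(1)] mon[OF g(3)] xi(2,1)] by blast
  let ?c = "cfun (g xi) :: (nat, 'a) fn"
  have aA: "a j : ?A" if "j < e" for j using a(1)[OF that] by (rule pfun_mono) auto
  have La: "(\<Sum>j<e. a j * ?T ^ j) : plt ?A ?T e" by (rule pltI) (use aA A in auto)
  have "sub (tilt xi s) (p i) : polys {..<Suc s}" by (rule sub_tilt_pfun[OF mon[OF p(1)[OF i]]]) auto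
  then obtain M' where M': "sub (tilt xi s) (p i) : plt ?A ?T M'" using toplt by blast
  have cA: "?c ^ j : ?A" for j by (intro polys_power pfun_const) auto
  obtain Qt Rm where QR: "Qt : plt ?A ?T M'" "Rm : plt ?A ?T e"
   "?c ^ M' * sub (tilt xi s) (p i) = Qt * (?c * ?T ^ e + (\<Sum>j<e. a j * ?T ^ j)) + Rm"
   using plt_division[of ?A ?c M' "\<Sum>j<e. a j * ?T ^ j" ?T e, OF A cA _ La M'] cA[of 1] by auto
  have Rm0: "Rm x = 0" for x
  proof -
   define z where "z = x(s := 0)"
   have line: "sub (tilt xi s) f (z(s := t)) = f (%j. z j + t * xi j)" if "f : ?A" for f t
    unfolding sub_apply by (rule pfun_cong[OF that]) (auto simp: tilt_def ev)
   have pol: "\<exists>pp. \<forall>t. f (%j. z j + t * xi j) = poly pp t" if f: "f : ?A" for f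
   proof -
    obtain d where "f : pfun {..<s} {..d}" using f by (rule polys_bounded)
    then show ?thesis by (rule pfun_line[where x = z and v = xi]) blast
   qed
   have "\<forall>f. \<exists>pp. f : ?A --> (\<forall>t. f (%j. z j + t * xi j) = poly pp t)" using pol by blast
   from choice[OF this] obtain pp where pp: "!!f t. f : ?A ==> f (%j. z j + t * xi j) = poly (pp f) t" by blast
   \<comment> \<open>A polynomial in the last variable turns into a bivariate one whose coefficients
     are the restrictions \<open>pp\<close> to the line.\<close>
   define lift where "lift = (%n (c :: nat => (nat, 'a) fn). \<Sum>i<n. Polynomial.monom (pp (c i)) i)"
   have lift: "poly (poly (lift n c) [:ta:]) t = (\<Sum>i<n. c i * ?T ^ i) ((%j. z j + t * xi j)(s := ta))"
    if c: "!!i. i < n ==> c i : ?A" for n c t ta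
   proof -
    have "c i ((%j. z j + t * xi j)(s := ta)) = poly (pp (c i)) t" if "i < n" for i
    proof -
     have "c i ((%j. z j + t * xi j)(s := ta)) = c i (%j. z j + t * xi j)"
      by (rule pfun_cong[OF c[OF that]]) auto
     then show ?thesis using pp[OF c[OF that]] by simp
    qed
    then show ?thesis by (simp add: lift_def poly_sum poly_monom ev)
   qed
   obtain ce where ce: "E0 = (\<Sum>i<N. ce i * ?T ^ i)" "!!i. ce i : ?A" using E0(1) by (auto simp: plt_def)
   obtain nq where "q : plt ?A ?T nq" using toplt[OF q(1)] by blast
   then obtain cq where cq: "q = (\<Sum>i<nq. cq i * ?T ^ i)" "!!i. cq i : ?A" by (auto simp: plt_def)
   let ?E = "Polynomial.monom 1 N + lift N ce"
   let ?P = "Polynomial.monom (pp (p k)) k + lift k p"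
   have "[:pp (p k) ^ M:] * ?E = ?P * lift nq cq"
   proof (rule poly_poly_eqI)
    fix t ta
    let ?x = "(%j. z j + ta * xi j)(s := t)"
    have pkx: "p k ?x = poly (pp (p k)) ta"
    proof -
     have "p k ?x = p k (%j. z j + ta * xi j)" by (rule pfun_cong[OF p(1)[OF order.refl]]) auto
     then show ?thesis using pp[OF p(1)[OF order.refl]] by simp
    qed
    have "(p k ^ M * (?T ^ N + E0)) ?x = (q * (p k * ?T ^ k + L)) ?x" using q(2) by simp
    then show "poly (poly ([:pp (p k) ^ M:] * ?E) [:t:]) ta = poly (poly (?P * lift nq cq) [:t:]) ta"
     using lift[of N ce t ta] lift[of nq cq t ta] lift[of k p t ta] ce cq p(1)
     by (simp add: ev pkx poly_monom L_def mult.commute)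
   qed
   moreover have "pp (p k) ^ M ~= 0" and degpk: "pp (p k) ~= 0 \<and> degree (pp (p k)) = e"
   proof -
    obtain pa where pa: "e > 0 ==> degree pa < e" "e = 0 ==> pa = 0" "!!t. (\<Sum>j<e. a j * ?T ^ j) (z(s := t)) = poly pa t"
     using plt_poly[of "\<Sum>j<e. a j * ?T ^ j" "{..<Suc s}" s e z] La unfolding AS by blast
    have "poly (pp (p k) - (Polynomial.monom (g xi) e + pa)) t = 0" for t
     using pp[OF p(1)[OF order.refl], of t] line[OF p(1)[OF order.refl], of t] pa(3)[of t]
     by (simp add: a(2) ev poly_monom)
    then have eq: "pp (p k) = Polynomial.monom (g xi) e + pa"
     using poly_zero_if_all_roots by (metis eq_iff_diff_eq_0)
    have "poly.coeff (pp (p k)) e = g xi" using pa(1,2) by (cases "e = 0") (auto simp: eq coeff_eq_0)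
    moreover have "degree (pp (p k)) <= e" unfolding eq using pa(1,2)
     by (cases "e = 0") (auto intro!: degree_add_le simp: degree_monom_le monom_0)
    ultimately show "pp (p k) ~= 0 \<and> degree (pp (p k)) = e" using xi(2)
     by (metis le_antisym le_degree coeff_0)
    then show "pp (p k) ^ M ~= 0" by simp
   qed
   moreover have "degree (lift N ce) < N" if "N > 0"
    unfolding lift_def by (rule le_less_trans[OF degree_sum_le[of _ _ "N - 1"]])
     (use that in "auto intro!: order.trans[OF degree_monom_le]")
   then have "lead_coeff ?E = 1"
    by (cases "N = 0") (auto simp: lead_coeff_add_le degree_monom_eq lift_def degree_add_eq_left coeff_eq_0)
   ultimately have dv: "lead_coeff ?P dvd poly.coeff ?P i" using gauss_monic_factor by blast
   have coeffP: "poly.coeff ?P j = (if j <= k then pp (p j) else 0)" for j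
    by (auto simp: lift_def coeff_sum if_distrib sum.delta cong: if_cong)
   have "degree ?P = k"
   proof (rule le_antisym)
    show "degree ?P <= k" by (intro degree_le allI impI) (subst coeffP, simp)
    show "k <= degree ?P" by (rule le_degree) (subst coeffP, simp add: degpk)
   qed
   then have dvd: "pp (p k) dvd pp (p i)" using dv i unfolding coeffP by simp
   obtain pR where pR: "e > 0 ==> degree pR < e" "e = 0 ==> pR = 0" "!!t. Rm (z(s := t)) = poly pR t"
    using plt_poly[of Rm "{..<Suc s}" s e z] QR(2) unfolding AS by blast
   obtain pQ where pQ: "!!t. Qt (z(s := t)) = poly pQ t"
    using plt_poly[of Qt "{..<Suc s}" s M' z] QR(1) unfolding AS by blast
   \<comment> \<open>On the line the remainder is a multiple of \<open>pp (p k)\<close>, of degree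
     \<open>e\<close>, while its own degree is below \<open>e\<close>.\<close>
   have "poly (pR - (smult (g xi ^ M') (pp (p i)) - pQ * pp (p k))) t = 0" for t
   proof -
    have "(?c ^ M' * sub (tilt xi s) (p i)) (z(s := t)) = (Qt * sub (tilt xi s) (p k) + Rm) (z(s := t))"
     using QR(3) unfolding a(2) by simp
    then show ?thesis
     using line[OF p(1)[OF i], of t] line[OF p(1)[OF order.refl], of t] pp[OF p(1)[OF i], of t]
      pp[OF p(1)[OF order.refl], of t] pQ[of t] pR(3)[of t] by (simp add: ev)
   qed
   then have "pR = smult (g xi ^ M') (pp (p i)) - pQ * pp (p k)"
    using poly_zero_if_all_roots by (metis eq_iff_diff_eq_0)
   then have "pp (p k) dvd pR" using dvd by (simp add: dvd_smult)
   then have "pR = 0" using pR(1,2) degpk by (metis dvd_imp_degree_le leD not_gr_zero)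
   then have "Rm (z(s := x s)) = 0" using pR(3) by simp
   then show ?thesis by (simp add: z_def)
  qed
  have Rm: "Rm = 0" using Rm0 by (auto simp: fun_eq_iff ev)
  \<comment> \<open>Setting the parameter \<open>x s\<close> to 0 undoes the tilt on functions free
    of \<open>x s\<close>.\<close>
  let ?z = "%j. if j = s then 0 else coord j :: (nat, 'a) fn"
  have zt: "sub ?z (sub (tilt xi s) f) = f" if "f : ?A" for f
  proof
   fix x show "sub ?z (sub (tilt xi s) f) x = f x"
    unfolding sub_apply by (rule pfun_cong[OF that]) (auto simp: tilt_def ev)
  qed
  have "sub ?z (?c ^ M' * sub (tilt xi s) (p i)) = sub ?z (Qt * sub (tilt xi s) (p k))"
   using QR(3) Rm unfolding a(2) by simp
  then have "?c ^ M' * p i = sub ?z Qt * p k" using zt p(1) i by simp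
  then have "cfun (inverse (g xi ^ M')) * (?c ^ M' * p i) = cfun (inverse (g xi ^ M')) * (sub ?z Qt * p k)" by simp
  moreover have "cfun (inverse (g xi ^ M')) * (?c ^ M' * p i) = p i" using xi by (simp add: fun_eq_iff ev)
  ultimately have "p i = p k * (cfun (inverse (g xi ^ M')) * sub ?z Qt)" by (simp add: mult_ac)
  moreover have "cfun (inverse (g xi ^ M')) * sub ?z Qt : ?A"
   by (intro pfun_scale sub_polys[OF pltp[OF QR(1)]]) (auto intro: pfun_zero pfun_coord)
  ultimately show ?thesis by blast
 qed
 then have "\<forall>i. \<exists>r. i <= k --> r : ?A \<and> p i = p k * r" by blast
 from choice[OF this] obtain r where r: "!!i. i <= k ==> r i : ?A" "!!i. i <= k ==> p i = p k * r i" by blast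
 define R where "R = (\<Sum>i<k. r i * ?T ^ i)"
 have R: "R : plt ?A ?T k" unfolding R_def by (rule pltI) (use r A in auto)
 have "p i * ?T ^ i = p k * (r i * ?T ^ i)" if "i < k" for i
  unfolding mult.assoc[symmetric] by (rule arg_cong[OF r(2)]) (use that in simp)
 then have "L = (\<Sum>i<k. p k * (r i * ?T ^ i))" unfolding L_def by (intro sum.cong) auto
 then have "L = p k * R" by (simp only: R_def sum_distrib_left)
 then have pF: "p k * ?T ^ k + L = p k * (?T ^ k + R)" by (simp only: distrib_left)
 have Fp: "?T ^ k + R : polys {..<Suc s}" using pltp[OF R] by (intro pfun_add polys_power pfun_coord) auto
 have "sub ?v (p k) * sub ?v (?T ^ k + R) : van Y" using p(3) unfolding Peq pF by simp
 moreover have "sub ?v (p k) ~: van Y" using ind p(1,2) by (auto simp: alg_ind_def subA)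
 ultimately have F: "sub ?v (?T ^ k + R) : van Y"
  by (intro zprime_mult[OF prime vp[OF subsetD[OF Asub p(1)[OF order.refl]]] vp[OF Fp]])
 show ?thesis
 proof (rule that[OF R F])
  fix P assume P: "P : polys {..<Suc s}" "sub ?v P : van Y"
  obtain n where n: "P : plt ?A ?T n" using toplt P(1) by blast
  have oneA: "1 ^ j : ?A" for j by (simp add: pfun_one)
  obtain q' r' where qr: "q' : plt ?A ?T n" "r' : plt ?A ?T k" "1 ^ n * P = q' * (1 * ?T ^ k + R) + r'"
   using plt_division[of ?A 1 n R ?T k P, OF A oneA _ R n] oneA[of 1] by auto
  have "r' = P - q' * (?T ^ k + R)" using qr(3) by simp
  then have "sub ?v r' = sub ?v P - sub ?v q' * sub ?v (?T ^ k + R)" by simp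
  also have "... : van Y" using P(2) F by (intro lsub_diff[OF van_lsub] van_mult)
  finally have "r' = 0" using rem0 qr(2) by blast
  then show "\<exists>H\<in>polys {..<Suc s}. P = (?T ^ k + R) * H"
   using qr pltp by (intro bexI[of _ q']) (auto simp: mult.commute)
 qed
qed

end

lemma monic_polys: "r : plt (polys {..<s}) (coord s) k ==> coord s ^ k + r : polys {..<Suc s}"
 by (auto simp: plt_def intro!: pfun_add pfun_sum polys_mult polys_power pfun_coord intro: pfun_mono)

lemma split_last:
 assumes "P : polys {..<Suc s}"
 obtains C G where "C : polys {..<s}" "G : polys {..<Suc s}" "P = C + coord s * G"
proof -
 have AS: "polys ({..<Suc s} - {s}) = (polys {..<s} :: (nat, 'a::comm_ring_1) fn set)" by (rule arg_cong[of _ _ polys]) auto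
 obtain n where "P : plt (polys {..<s}) (coord s) n" using polys_plt[OF assms, of s] unfolding AS by blast
 then have "P : plt (polys {..<s}) (coord s) (Suc n)" by (rule plt_mono) (auto intro: pfun_zero)
 then obtain a where a: "P = (\<Sum>i<Suc n. a i * coord s ^ i)" "!!i. a i : polys {..<s}" by (auto simp: plt_def)
 have "a i : polys {..<Suc s}" for i using a(2)[of i] by (rule pfun_mono) auto
 then have "(\<Sum>i<n. a (Suc i) * coord s ^ i) : polys {..<Suc s}" by (intro pfun_sum polys_mult polys_power pfun_coord) auto
 moreover have "P = a 0 + coord s * (\<Sum>i<n. a (Suc i) * coord s ^ i)"
  unfolding a(1) sum.lessThan_Suc_shift by (simp add: sum_distrib_left mult_ac)
 ultimately show ?thesis using that a(2) by blast
qed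

lemma monic_section:
 fixes r :: "(nat, 'a::alg_closed_field) fn"
 assumes "r : plt (polys {..<s}) (coord s) k"
 obtains p where "p ~= 0" "!!t. (coord s ^ k + r) (x(s := t)) = poly p t" "degree p = k"
proof -
 have AS: "polys ({..<Suc s} - {s}) = (polys {..<s} :: (nat, 'a) fn set)" by (rule arg_cong[of _ _ polys]) auto
 obtain p where p: "k > 0 ==> degree p < k" "k = 0 ==> p = 0" "!!t. r (x(s := t)) = poly p t"
  using plt_poly[of r "{..<Suc s}" s k x] assms unfolding AS by blast
 have "poly.coeff (Polynomial.monom 1 k + p) k = 1" using p(1,2) by (cases "k = 0") (auto simp: coeff_eq_0)
 then have "Polynomial.monom 1 k + p ~= 0" by (metis coeff_0 zero_neq_one)
 moreover have "degree (Polynomial.monom 1 k + p) = k"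
  using p(1,2) by (cases "k = 0") (auto simp: degree_add_eq_left degree_monom_eq)
 ultimately show ?thesis using p(3) that[of "Polynomial.monom 1 k + p"] by (simp add: ev poly_monom)
qed

lemma monic_nonzero:
 fixes r :: "(nat, 'a::alg_closed_field) fn"
 assumes "r : plt (polys {..<s}) (coord s) k" shows "coord s ^ k + r ~= 0"
proof
 assume z: "coord s ^ k + r = 0"
 obtain p where p: "p ~= 0" "!!t. (coord s ^ k + r) ((%_. 0)(s := t)) = poly p t" using monic_section[OF assms] by blast
 have "poly p t = 0" for t using p(2)[of t] by (simp add: z ev)
 then show False using p(1) poly_zero_if_all_roots by blast
qed

text \<open>The picture is a finite map, given by \<open>l\<close> and \<open>u\<close>, from
  \<open>Y\<close> to the hypersurface \<open>F = 0\<close> through the origin. That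
  \<open>F\<close> divides every relation says that the closure of the image contains this
  hypersurface.\<close>

locale covered_hypersurface = finite_cover Y l s
 for Y :: "('a::finite => 'b::alg_closed_field) set" and l :: "nat => ('a, 'b) fn" and s :: nat +
 fixes u :: "('a, 'b) fn" and F :: "(nat, 'b) fn" and n :: nat and w :: "nat => ('a, 'b) fn"
 assumes u: "u : polys UNIV" and F: "F : polys {..<Suc s}" "F ~= 0" "F (%_. 0) = 0"
  and F_dvd: "!!P. P : polys {..<Suc s} ==> sub (l(s := u)) P : van Y ==> \<exists>H\<in>polys {..<Suc s}. P = F * H"
  and w: "!!j. j < n ==> w j : polys UNIV"
   "!!f. f : polys UNIV ==> \<exists>a. (\<forall>j<n. a j : polys {..<s}) \<and> f - (\<Sum>j<n. sub l (a j) * w j) : van Y"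
begin

abbreviation v where "v == l(s := u)"

lemma v_polys: "i < Suc s ==> v i : polys UNIV"
 using l u by (auto simp: less_Suc_eq)

text \<open>The powers of the ideal of the origin of the hypersurface \<open>F = 0\<close>, extended to \<open>Y\<close>.\<close>
definition npow :: "nat => ('a, 'b) fn set" where
 "npow N = {f. \<exists>a. (\<forall>j<n. a j : pfun {..<Suc s} {N..}) \<and> f - (\<Sum>j<n. sub v (a j) * w j) : van Y}"

lemma npowE:
 assumes "f : npow N"
 obtains a where "!!j. j < n ==> a j : pfun {..<Suc s} {N..}" "f - (\<Sum>j<n. sub v (a j) * w j) : van Y"
 using assms unfolding npow_def by blast

lemma van_npow: "f : van Y ==> f : npow N"
 unfolding npow_def by (intro CollectI exI[of _ "%_. 0"]) (simp add: pfun_zero)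

lemma npow_lsub: "lsub (npow N)"
proof (rule lsubI)
 show "0 : npow N" using van_npow lsub_zero[OF van_lsub] by blast
next
 fix f g assume "f : npow N" "g : npow N"
 obtain a where a: "!!j. j < n ==> a j : pfun {..<Suc s} {N..}" "f - (\<Sum>j<n. sub v (a j) * w j) : van Y"
  using `f : npow N` by (rule npowE) blast
 obtain b where b: "!!j. j < n ==> b j : pfun {..<Suc s} {N..}" "g - (\<Sum>j<n. sub v (b j) * w j) : van Y"
  using `g : npow N` by (rule npowE) blast
 have "f + g - (\<Sum>j<n. sub v (a j + b j) * w j)
  = (f - (\<Sum>j<n. sub v (a j) * w j)) + (g - (\<Sum>j<n. sub v (b j) * w j))"
  by (simp add: distrib_right sum.distrib)
 also have "... : van Y" using a(2) b(2) by (rule lsub_add[OF van_lsub])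
 finally show "f + g : npow N" unfolding npow_def using a(1) b(1)
  by (intro CollectI exI[of _ "%j. a j + b j"]) (auto intro: pfun_add)
next
 fix c f assume "f : npow N"
 then obtain a where a: "!!j. j < n ==> a j : pfun {..<Suc s} {N..}" "f - (\<Sum>j<n. sub v (a j) * w j) : van Y"
  by (rule npowE) blast
 have "cfun c * f - (\<Sum>j<n. sub v (cfun c * a j) * w j) = cfun c * (f - (\<Sum>j<n. sub v (a j) * w j))"
  by (simp add: right_diff_distrib sum_distrib_left mult.assoc)
 also have "... : van Y" using a(2) by (rule van_mult)
 finally show "cfun c * f : npow N" unfolding npow_def using a(1)
  by (intro CollectI exI[of _ "%j. cfun c * a j"]) (auto intro: pfun_scale)
qed

lemma npow_mod_van: "f - g : van Y ==> g : npow N ==> f : npow N"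
 using lsub_add[OF npow_lsub van_npow, where f = "f - g" and g = g] by simp

lemma npow_gen:
 assumes h: "h : pfun {..<Suc s} {N..}" and r: "r : polys UNIV"
 shows "sub v h * r : npow N"
proof -
 obtain a where a: "!!j. j < n ==> a j : polys {..<s}" "r - (\<Sum>j<n. sub l (a j) * w j) : van Y" using w(2)[OF r] by blast
 have av: "sub l (a j) = sub v (a j)" if "j < n" for j by (rule sub_cong[OF a(1)[OF that]]) auto
 have "sub v h * r - (\<Sum>j<n. sub v (h * a j) * w j) = sub v h * (r - (\<Sum>j<n. sub l (a j) * w j))"
  by (simp add: right_diff_distrib sum_distrib_left mult.assoc av)
 also have "... : van Y" using a(2) by (rule van_mult)
 finally have "sub v h * r - (\<Sum>j<n. sub v (h * a j) * w j) : van Y" .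
 moreover have "h * a j : pfun {..<Suc s} {N..}" if "j < n" for j
 proof (rule pfun_mult[OF h])
  show "a j : polys {..<Suc s}" using a(1)[OF that] by (rule pfun_mono) auto
 qed auto
 ultimately show ?thesis unfolding npow_def by (intro CollectI exI[of _ "%j. h * a j"]) auto
qed

lemma npow_mult:
 assumes "f : npow M" "g : npow N" shows "f * g : npow (M + N)"
proof -
 obtain a where a: "!!j. j < n ==> a j : pfun {..<Suc s} {M..}" "f - (\<Sum>j<n. sub v (a j) * w j) : van Y"
  using assms(1) by (rule npowE) blast
 obtain b where b: "!!j. j < n ==> b j : pfun {..<Suc s} {N..}" "g - (\<Sum>j<n. sub v (b j) * w j) : van Y"
  using assms(2) by (rule npowE) blast
 let ?A = "\<Sum>j<n. sub v (a j) * w j" and ?B = "\<Sum>j<n. sub v (b j) * w j"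
 have "?A * ?B = (\<Sum>i<n. \<Sum>j<n. sub v (a i * b j) * (w i * w j))"
  by (simp add: sum_product mult_ac)
 also have "... : npow (M + N)"
 proof (intro lsub_sum[OF npow_lsub])
  fix i j assume "i : {..<n}" "j : {..<n}"
  then have "i < n" "j < n" by auto
  then show "sub v (a i * b j) * (w i * w j) : npow (M + N)"
   using pfun_mult_ge[OF a(1) b(1)] polys_mult[OF w(1) w(1)] npow_gen by blast
 qed
 finally have AB: "?A * ?B : npow (M + N)" .
 have "f * g - ?A * ?B = g * (f - ?A) + ?A * (g - ?B)" by (simp add: algebra_simps)
 also have "... : van Y" using a(2) b(2) by (intro lsub_add[OF van_lsub] van_mult)
 finally show ?thesis using AB by (rule npow_mod_van)
qed

lemma npow_ideal:
 assumes "f : npow N" "g : polys UNIV" shows "f * g : npow N"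
proof -
 have "sub v 1 * g : npow 0" by (rule npow_gen) (use assms in "auto intro: pfun_one")
 then show ?thesis using npow_mult[OF assms(1), of g 0] by simp
qed

text \<open>\<open>G\<close> is the equation of the tangent cone at the origin and \<open>xi\<close>
  a direction outside it.\<close>

lemma tangent_direction:
 obtains mu G xi where "mu > 0" "G : pfun {..<Suc s} {mu}" "F - G : pfun {..<Suc s} {Suc mu..}" "G xi ~= 0" "xi s = 1"
proof -
 obtain mu G where G: "G : pfun {..<Suc s} {mu}" "G ~= 0" "F - G : pfun {..<Suc s} (UNIV \<inter> {Suc mu..})"
  by (rule pfun_lowest[OF F(1,2)]) blast
 have "mu > 0"
 proof (rule ccontr)
  assume "\<not> mu > 0"
  then have "F - G : pfun {..<Suc s} {1..}" "mu = 0" using G(3) by auto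
  then have "G (%_. 0) = 0" using pfun_ge1_zero[of "F - G"] F(3) by (simp add: ev)
  moreover have "G x = G (%_. 0)" for x using pfun_hom[of G "{..<Suc s}" 0 0 x] G(1) `mu = 0` by simp
  ultimately have "G = 0" by (simp add: fun_eq_iff ev)
  then show False using G(2) by simp
 qed
 moreover obtain xi where "xi s = 1" "G xi ~= 0"
  using hom_common_nonzero[of "{G}" "{..<Suc s}" s] G by auto
 ultimately show ?thesis using that[of mu G xi] G by simp
qed

text \<open>If \<open>Q\<close> were in \<open>npow N\<close>, elimination would produce an element of the ideal of \<open>F\<close> whose lowest
 form is a power of the lowest form of \<open>Q\<close>; but the lowest form of \<open>F\<close> has a zero above every point.\<close>
lemma not_in_npow:
 assumes mu: "mu > 0" and G: "G : pfun {..<Suc s} {mu}" "F - G : pfun {..<Suc s} {Suc mu..}"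
  and xi: "G xi ~= 0" "xi s = 1"
  and Q: "Q : pfun {..<s} {..<N}" "Q ~= 0"
 shows "sub v (sub (tilt (%j. - xi j) s) Q) ~: npow N"
proof
 let ?t = "tilt (%j. - xi j) s"
 let ?Q = "sub ?t Q"
 let ?I = "{..<Suc s}"
 assume inN: "sub v ?Q : npow N"
 obtain d Q0 where Q0: "d : {..<N}" "Q0 : pfun {..<s} {d}" "Q0 ~= 0" "Q - Q0 : pfun {..<s} ({..<N} \<inter> {Suc d..})"
  by (rule pfun_lowest[OF Q]) blast
 have lift: "f : pfun {..<s} D ==> sub ?t f : pfun ?I D" for f :: "(nat, 'b) fn" and D
  by (rule sub_tilt_pfun) (auto intro: pfun_mono)
 have Q0': "sub ?t Q0 : pfun ?I {d}" by (rule lift[OF Q0(2)])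
 have "sub ?t (Q - Q0) : pfun ?I ({..<N} \<inter> {Suc d..})" by (rule lift[OF Q0(4)])
 then have QQ0: "?Q - sub ?t Q0 : pfun ?I {Suc d..}" by (auto intro: pfun_mono)
 have "?Q = (?Q - sub ?t Q0) + sub ?t Q0" by simp
 also have "... : pfun ?I {d..}" using QQ0 Q0' by (intro pfun_add) (auto intro: pfun_mono)
 finally have Qd: "?Q : pfun ?I {d..}" .
 have "\<forall>j. \<exists>a. j < n --> (\<forall>i<n. a i : pfun ?I {N..}) \<and> sub v ?Q * w j - (\<Sum>i<n. sub v (a i) * w i) : van Y"
  using npow_ideal[OF inN w(1)] unfolding npow_def by blast
 from choice[OF this] obtain c where c: "!!j i. j < n ==> i < n ==> c j i : pfun ?I {N..}"
  "!!j. j < n ==> sub v ?Q * w j - (\<Sum>i<n. sub v (c j i) * w i) : van Y" by blast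
 \<comment> \<open>Pivots agree with a power of the tilted \<open>Q\<close> up to terms of higher
   order; since \<open>d < N\<close>, the entries of \<open>c\<close> have order above
   \<open>d\<close>.\<close>
 define P1 where "P1 = (%k. {f. f - ?Q ^ k : pfun ?I {Suc (k * d)..}})"
 define P0 where "P0 = (%k. pfun ?I {Suc (k * d)..} :: (nat, 'b) fn set)"
 define b where "b = (%j i. (if i = j then ?Q else 0) - c j i)"
 have Qk: "?Q ^ k : pfun ?I {k * d..}" for k using Qd by (rule pfun_power_ge)
 have c1: "c j i : P0 1" if "j < n" "i < n" for i j
  unfolding P0_def using c(1)[OF that] by (rule pfun_mono) (use Q0(1) in auto)
 have "\<exists>k. \<exists>g\<in>P1 k. \<forall>i<n. sub v g * w i : van Y"
 proof (rule elimination[where ?P0.0 = P0 and b = b and i = 1])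
  show "1 : P1 0" by (auto simp: P1_def pfun_zero)
  show P1P1: "x * y : P1 (i + k)" if "x : P1 i" "y : P1 k" for i k x y
  proof -
   have r: "x - ?Q ^ i : pfun ?I {Suc (i * d)..}" "y - ?Q ^ k : pfun ?I {Suc (k * d)..}" using that by (auto simp: P1_def)
   have "x * y - ?Q ^ (i + k) = (x - ?Q ^ i) * (y - ?Q ^ k) + (x - ?Q ^ i) * ?Q ^ k + ?Q ^ i * (y - ?Q ^ k)"
    by (simp add: power_add algebra_simps)
   moreover have "(x - ?Q ^ i) * (y - ?Q ^ k) : pfun ?I {Suc ((i + k) * d)..}"
    by (rule pfun_mult[OF r]) (auto simp: add_mult_distrib)
   moreover have "(x - ?Q ^ i) * ?Q ^ k : pfun ?I {Suc ((i + k) * d)..}"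
    by (rule pfun_mult[OF r(1) Qk]) (auto simp: add_mult_distrib)
   moreover have "?Q ^ i * (y - ?Q ^ k) : pfun ?I {Suc ((i + k) * d)..}"
    by (rule pfun_mult[OF Qk r(2)]) (auto simp: add_mult_distrib)
   ultimately show ?thesis unfolding P1_def by (auto intro: pfun_add)
  qed
  have P0P0: "x * y : P0 (i + i)" if "x : P0 i" "y : P0 i" for x y i
   using that unfolding P0_def by (rule pfun_mult) (auto simp: add_mult_distrib)
  show "x * y - p * q : P1 (i + i)" if xy: "x : P1 i" "y : P1 i" "p : P0 i" "q : P0 i" for i x y p q
  proof -
   have "x * y : P1 (i + i)" using P1P1 xy by blast
   then have "x * y - ?Q ^ (i + i) - p * q : pfun ?I {Suc ((i + i) * d)..}"
    using P0P0[OF xy(3,4)] unfolding P1_def P0_def by (auto intro: pfun_diff)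
   then show ?thesis by (simp add: P1_def algebra_simps)
  qed
  show "x * y - p * q : P0 (i + i)" if xy: "x : P1 i" "y : P0 i" "p : P0 i" "q : P0 i" for i x y p q
  proof -
   have "x - ?Q ^ i : P0 i" using xy by (simp add: P1_def P0_def)
   then have 1: "(x - ?Q ^ i) * y : P0 (i + i)" using P0P0 xy by blast
   have 2: "?Q ^ i * y : P0 (i + i)" using xy(2) unfolding P0_def
    by (rule pfun_mult[OF Qk]) (auto simp: add_mult_distrib)
   have "x * y - p * q = (x - ?Q ^ i) * y + ?Q ^ i * y - p * q" by (simp add: algebra_simps)
   then show ?thesis using 1 2 P0P0[OF xy(3,4)] unfolding P0_def by (simp only:) (intro pfun_diff pfun_add)
  qed
  show "x - y : van Y" if "x : van Y" "y : van Y" for x y using that lsub_diff[OF van_lsub] by blast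
  show "sub v c * x : van Y" if "x : van Y" for c x using that by (rule van_mult)
  show "b j j : P1 1" if "j < n" for j
  proof -
   have "b j j - ?Q ^ 1 = - c j j" by (simp add: b_def)
   moreover have "- c j j : pfun ?I {Suc (1 * d)..}" using c1[OF that that] unfolding P0_def by (rule pfun_uminus)
   ultimately show ?thesis unfolding P1_def by (simp only: mem_Collect_eq)
  qed
  show "b j i : P0 1" if "j < n" "i < n" "j ~= i" for i j
   using c1[OF that(1,2)] that(3) unfolding P0_def b_def by (auto intro: pfun_uminus)
  show "(\<Sum>i<n. sub v (b j i) * w i) : van Y" if j: "j < n" for j
  proof -
   have "(\<Sum>i<n. sub v (b j i) * w i) = (\<Sum>i<n. (if i = j then sub v ?Q * w i else 0) - sub v (c j i) * w i)"
    by (intro sum.cong) (auto simp: b_def left_diff_distrib)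
   also have "... = sub v ?Q * w j - (\<Sum>i<n. sub v (c j i) * w i)" using j by (simp add: sum_subtractf)
   finally show ?thesis using c(2)[OF j] by simp
  qed
 qed (simp_all add: sub_simps)
 then obtain k g where g: "g : P1 k" "!!i. i < n ==> sub v g * w i : van Y" by blast
 then have "sub v g : van Y" using annihilator_vanishes[OF w(2)] by blast
 moreover have "g : polys ?I"
 proof -
  have "g - ?Q ^ k : polys ?I" "?Q ^ k : polys ?I" using g(1) Qk[of k] by (auto simp: P1_def intro: pfun_polys)
  then show ?thesis using pfun_add[of "g - ?Q ^ k" ?I UNIV "?Q ^ k"] by simp
 qed
 ultimately obtain H where H: "H : polys ?I" "g = F * H" using F_dvd by blast
 let ?q = "sub ?t Q0 ^ k"
 have "?Q ^ k - ?q : pfun ?I {Suc (k * d)..}" by (rule lowest_power[OF QQ0 Q0'])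
 then have "(g - ?Q ^ k) + (?Q ^ k - ?q) : pfun ?I {Suc (k * d)..}" using g(1) unfolding P1_def by (intro pfun_add) auto
 moreover have "(g - ?Q ^ k) + (?Q ^ k - ?q) = g - ?q" by simp
 ultimately have gq: "g - ?q : pfun ?I {Suc (k * d)..}" by (simp only:)
 have q: "?q : pfun ?I {k * d}" using Q0' by (rule pfun_power_eq)
 have "sub ?t Q0 ~= 0"
 proof
  assume "sub ?t Q0 = 0"
  then have "sub (tilt (%j. - (- xi j)) s) (sub ?t Q0) = 0" by simp
  then show False using sub_tilt_inverse[of "%j. - (- xi j)" s Q0] Q0(3) by simp
 qed
 then have q0: "?q ~= 0" using polys_power_zero[of "sub ?t Q0" ?I k] pfun_polys[OF Q0'] by blast
 have "H ~= 0"
 proof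
  assume "H = 0"
  then have "- ?q : pfun ?I {Suc (k * d)..}" using gq H by simp
  then have "?q : pfun ?I {Suc (k * d)..}" using pfun_uminus by fastforce
  then show False using pfun_lowest_unique[OF q] q0 by blast
 qed
 then obtain e H0 where H0: "H0 : pfun ?I {e}" "H0 ~= 0" "H - H0 : pfun ?I (UNIV \<inter> {Suc e..})"
  using pfun_lowest[OF H(1)] by blast
 have "F * H - G * H0 : pfun ?I {Suc (mu + e)..}" by (rule lowest_mult[OF G(2) _ G(1) H0(1)]) (use H0(3) in simp)
 moreover have "G ~= 0" using xi(1) by (auto simp: ev)
 then have "G * H0 ~= 0" using polys_domain[of G ?I H0] G(1) H0 by (auto intro: pfun_polys)
 \<comment> \<open>The lowest form of \<open>g\<close> is computed twice: from its congruence to a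
   power of \<open>?Q\<close> and from the factorization \<open>F * H\<close>.\<close>
 ultimately have eq: "G * H0 = ?q"
  using lowest_forms_eq[OF pfun_mult_eq[OF G(1) H0(1)] q _ q0, of g] gq H(2) by simp
 have "\<exists>x. Q0 x ~= 0" using Q0(3) by (auto simp: fun_eq_iff ev)
 then obtain ze where ze: "Q0 ze ~= 0" by blast
 obtain a where a: "!!j. j < mu ==> a j : pfun (?I - {s}) ((%d. d - j) ` ({mu} \<inter> {j..}))"
  "sub (tilt xi s) G = cfun (G xi) * coord s ^ mu + (\<Sum>j<mu. a j * coord s ^ j)"
  using tilt_monic[OF G(1) _ G(1) _ xi] by (auto simp: pfun_zero)
 have "(\<Sum>j<mu. a j * coord s ^ j) : plt (polys (?I - {s})) (coord s) mu"
  by (rule pltI) (use a(1) in "auto intro: pfun_polys pfun_zero")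
 then obtain p where p: "degree p < mu" "!!t. (\<Sum>j<mu. a j * coord s ^ j) (ze(s := t)) = poly p t"
  using plt_poly[of "\<Sum>j<mu. a j * coord s ^ j" ?I s mu ze] mu by blast
 \<comment> \<open>In direction \<open>xi\<close> the form \<open>G\<close> has degree
   \<open>mu > 0\<close> with constant leading coefficient, hence a zero above \<open>ze\<close>;
   there the tilted \<open>Q0\<close> still has the value \<open>Q0 ze\<close>.\<close>
 have "degree (Polynomial.monom (G xi) mu + p) = mu" using p(1) xi(1) by (simp add: degree_add_eq_left degree_monom_eq)
 then obtain t where t: "poly (Polynomial.monom (G xi) mu + p) t = 0"
  using alg_closed_imp_poly_has_root[of "Polynomial.monom (G xi) mu + p"] mu by auto
 define x where "x = (%j. tilt xi s j (ze(s := t)))"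
 have "G x = sub (tilt xi s) G (ze(s := t))" by (simp add: sub_apply x_def)
 also have "... = 0" using t p(2)[of t] by (simp add: a(2) ev poly_monom)
 finally have "?q x = 0" using fun_cong[OF eq, of x] by (simp add: ev)
 moreover have "sub ?t Q0 x = Q0 ze"
  unfolding sub_apply by (rule pfun_cong[OF Q0(2)]) (auto simp: x_def tilt_def ev)
 ultimately show False using ze by (simp add: ev)
qed

lemma npow_growth: "hge (polys UNIV) (npow (Suc N)) ((s + N) choose s)"
proof -
 obtain mu G xi where G: "mu > 0" "G : pfun {..<Suc s} {mu}" "F - G : pfun {..<Suc s} {Suc mu..}" "G xi ~= 0" "xi s = 1"
  by (rule tangent_direction)
 let ?ph = "%Q. sub v (sub (tilt (%j. - xi j) s) Q)"
 have "hge (?ph ` pfun {..<s} {..N}) (npow (Suc N)) ((s + N) choose s)"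
 proof (rule hge_image[where W = "{0 :: (nat => 'b) => 'b}"])
  show "hge (pfun {..<s} {..N} :: (nat, 'b) fn set) {0} (s + N choose s)" using pfun_dim by (rule conjunct1)
  fix f :: "(nat, 'b) fn" assume f: "f : pfun {..<s} {..N}" "?ph f : npow (Suc N)"
  have "f : pfun {..<s} {..<Suc N}" using f(1) by (simp add: lessThan_Suc_atMost)
  then show "f : {0}" using not_in_npow[OF G] f(2) by blast
 qed auto
 moreover have "?ph ` pfun {..<s} {..N} <= polys UNIV"
 proof (rule image_subsetI)
  fix Q :: "(nat, 'b) fn" assume "Q : pfun {..<s} {..N}"
  then have "sub (tilt (%j. - xi j) s) Q : pfun {..<Suc s} {..N}"
   by (intro sub_tilt_pfun) (auto intro: pfun_mono)
  then show "?ph Q : polys UNIV" using v_polys by (intro sub_polys[OF pfun_polys]) (auto simp del: fun_upd_apply)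
 qed
 ultimately show ?thesis by (rule hge_mono) auto
qed

lemma idl_npow:
 assumes "f : idl Y {..s} v" shows "f : npow 1"
proof -
 obtain h where h: "\<forall>i\<in>{..s}. h i : polys UNIV" "\<forall>p\<in>Y. f p = (\<Sum>i\<in>{..s}. h i p * v i p)"
  using assms unfolding idl_def by blast
 have "v i * h i : npow 1" if "i : {..s}" for i
 proof -
  have "sub v (coord i) * h i : npow 1" using h(1) that by (intro npow_gen pfun_coord) auto
  then show ?thesis by (simp add: sub_simps)
 qed
 then have "(\<Sum>i\<in>{..s}. v i * h i) : npow 1" by (rule lsub_sum[OF npow_lsub])
 moreover have "f - (\<Sum>i\<in>{..s}. v i * h i) : van Y" using h(2) by (simp add: van_def ev mult.commute)
 ultimately show ?thesis using npow_mod_van by blast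
qed

text \<open>Lying over: otherwise the Nullstellensatz puts 1 into the extended ideal of the origin,
  contradicting \<open>not_in_npow\<close> for \<open>Q = 1\<close>.\<close>

lemma point_over_origin: "\<exists>y\<in>Y. \<forall>i\<le>s. v i y = 0"
proof (rule ccontr)
 assume neg: "\<not> ?thesis"
 have "1 : idl Y {..s} v"
  by (rule nullstellensatz_one[OF closed]) (use neg v_polys in "auto simp del: fun_upd_apply")
 then have "1 : npow 1" by (rule idl_npow)
 obtain mu G xi where G: "mu > 0" "G : pfun {..<Suc s} {mu}" "F - G : pfun {..<Suc s} {Suc mu..}" "G xi ~= 0" "xi s = 1"
  by (rule tangent_direction)
 have "1 ~= (0 :: (nat, 'b) fn)" by simp
 then have "sub v (sub (tilt (%j. - xi j) s) 1) ~: npow 1"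
  by (intro not_in_npow[OF G]) (auto intro: pfun_one)
 then show False using `1 : npow 1` by simp
qed

end

context finite_cover
begin

lemma cover_exists:
 assumes u: "u : polys UNIV" and k: "r : plt (polys {..<s}) (coord s) k"
  "!!P. P : polys {..<Suc s} ==> sub (l(s := u)) P : van Y ==> \<exists>H\<in>polys {..<Suc s}. P = (coord s ^ k + r) * H"
  and zero: "(coord s ^ k + r) (%_. 0) = 0"
 obtains n w where "covered_hypersurface Y l s u (coord s ^ k + r) n w"
proof -
 obtain n :: nat and w where w: "!!j. j < n ==> w j : polys UNIV"
  "!!f. f : polys UNIV ==> \<exists>a. (\<forall>j<n. a j : polys {..<s}) \<and> f - (\<Sum>j<n. sub l (a j) * w j) : van Y"
  using generators by blast
 have "covered_hypersurface Y l s u (coord s ^ k + r) n w"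
  by unfold_locales (use u k(2) zero w monic_polys[OF k(1)] monic_nonzero[OF k(1)] in auto)
 then show ?thesis by (rule that)
qed

text \<open>Every coordinate is integral over the base, so on the fibre it is a root of one fixed
  monic polynomial.\<close>

lemma fibre_finite: "finite {y:Y. \<forall>i<s. l i y = 0}"
proof -
 have "\<exists>R. finite R \<and> (\<forall>y\<in>Y. (\<forall>i<s. l i y = 0) --> y j : R)" for j
 proof -
  have "coord j : polys UNIV" by (auto intro: pfun_coord)
  then obtain k r where kr: "r : plt (polys {..<s}) (coord s) k" "sub (l(s := coord j)) (coord s ^ k + r) : van Y"
   by (rule integral) blast
  let ?F = "coord s ^ k + r"
  obtain p where p: "p ~= 0" "!!t. ?F ((%_. 0)(s := t)) = poly p t" using monic_section[OF kr(1)] by blast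
  have "finite {t. poly p t = 0}" using p(1) by (rule poly_roots_finite)
  moreover have "y j : {t. poly p t = 0}" if "y : Y" "\<forall>i<s. l i y = 0" for y
  proof -
   have "?F (%i. (l(s := coord j)) i y) = ?F ((%_. 0)(s := y j))"
    by (rule pfun_cong[OF monic_polys[OF kr(1)]]) (use that in "auto simp: ev less_Suc_eq")
   moreover have "?F (%i. (l(s := coord j)) i y) = 0" using kr(2) that(1) by (simp only: van_def sub_apply mem_Collect_eq)
   ultimately show ?thesis using p(2) by simp
  qed
  ultimately show ?thesis by blast
 qed
 then have "\<forall>j. \<exists>R. finite R \<and> (\<forall>y\<in>Y. (\<forall>i<s. l i y = 0) --> y j : R)" by blast
 from choice[OF this] obtain R where R: "!!j. finite (R j)" "!!j y. y : Y ==> (\<forall>i<s. l i y = 0) ==> y j : R j" by blast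
 have "finite (PiE UNIV R)" by (rule finite_PiE) (use R(1) in auto)
 moreover have "{y:Y. \<forall>i<s. l i y = 0} <= PiE UNIV R" using R(2) by auto
 ultimately show ?thesis by (rule finite_subset[rotated])
qed

end

section \<open>Translation of covers and interpolation\<close>

lemma alg_ind_translate:
 assumes "alg_ind Y l s" shows "alg_ind Y (%i. l i - cfun (c i)) s"
 unfolding alg_ind_def
proof (intro ballI impI)
 fix P :: "(nat, 'b) fn" assume P: "P : polys {..<s}" "sub (%i. l i - cfun (c i)) P : van Y"
 have "sub l (trans (%i. - c i) P) = sub (%i. l i - cfun (c i)) P"
  by (simp add: fun_eq_iff sub_apply trans_apply ev)
 then have "trans (%i. - c i) P = 0" using assms P trans_polys[of P] unfolding alg_ind_def by metis
 then have "trans c (trans (%i. - c i) P) = 0" by simp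
 then show "P = 0" by (simp add: trans_trans trans_zero)
qed

lemma gen_over_translate:
 fixes Y :: "('n => 'a::field) set"
 assumes "gen_over Y l s" shows "gen_over Y (%i. l i - cfun (c i)) s"
proof -
 obtain n :: nat and w where w: "!!j. j < n ==> w j : polys UNIV"
  "!!t f. f : pfun UNIV {..t} ==> \<exists>a. (\<forall>j<n. a j : pfun {..<s} {..t}) \<and> f - (\<Sum>j<n. sub l (a j) * w j) : van Y"
  using assms unfolding gen_over_def by blast
 show ?thesis unfolding gen_over_def
 proof (intro exI[of _ n] exI[of _ w] conjI allI ballI impI)
  fix t and f :: "('n, 'a) fn" assume "f : pfun UNIV {..t}"
  then obtain a where a: "!!j. j < n ==> a j : pfun {..<s} {..t}" "f - (\<Sum>j<n. sub l (a j) * w j) : van Y"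
   using w(2) by blast
  have "sub (%i. l i - cfun (c i)) (trans c P) = sub l P" for P
   by (simp add: fun_eq_iff sub_apply trans_apply ev)
  then show "\<exists>a. (\<forall>j<n. a j : pfun {..<s} {..t}) \<and> f - (\<Sum>j<n. sub (%i. l i - cfun (c i)) (a j) * w j) : van Y"
   using a by (intro exI[of _ "%j. trans c (a j)"]) (auto intro: trans_pfun_le)
 qed (use w(1) in auto)
qed

lemma lagrange:
 fixes S :: "('n => 'a::field) set"
 assumes "finite S"
 obtains u where "u : polys UNIV" "u a = 1" "!!y. y : S ==> y ~= a ==> u y = 0"
proof -
 have "\<forall>y. \<exists>j. y ~= a --> y j ~= a j" by (auto simp: fun_eq_iff)
 from choice[OF this] obtain j where j: "!!y. y ~= a ==> y (j y) ~= a (j y)" by blast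
 let ?u = "\<Prod>y\<in>S - {a}. cfun (inverse (a (j y) - y (j y))) * (coord (j y) - cfun (y (j y)))"
 show ?thesis
 proof (rule that)
  show "?u : polys UNIV" by (intro polys_prod pfun_scale pfun_diff pfun_coord pfun_const) auto
  show "?u a = 1"
   unfolding prod_fun_apply
  proof (rule prod.neutral, rule ballI)
   fix y assume "y : S - {a}"
   then show "(cfun (inverse (a (j y) - y (j y))) * (coord (j y) - cfun (y (j y)))) a = 1"
    using j[of y] by (simp add: ev)
  qed
  fix y assume "y : S" "y ~= a"
  then show "?u y = 0" unfolding prod_fun_apply using assms
   by (intro prod_zero) (auto simp: ev intro!: bexI[of _ y])
 qed
qed

section \<open>Local dimension\<close>

text \<open>The functions vanishing at \<open>a\<close> to order \<open>t\<close> as functions on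
  \<open>Y\<close>; the polynomials modulo it are the jets of order below \<open>t\<close> on
  \<open>Y\<close>.\<close>

definition locmod :: "('n => 'a::comm_ring_1) set => ('n => 'a) => nat => ('n, 'a) fn set" where
 "locmod Y a t = {f. \<exists>g\<in>mpow a t. f - g : van Y}"

lemma mpow_locmod: "f : mpow a t ==> f : locmod Y a t"
 unfolding locmod_def by (auto simp: van_def ev)

lemma van_locmod: "f : van Y ==> f : locmod Y a t"
 unfolding locmod_def using mpow_zero by force

lemma locmod_lsub [intro]: "lsub (locmod Y a t :: ('n, 'a::field) fn set)"
proof (rule lsubI)
 show "0 : locmod Y a t" by (intro mpow_locmod mpow_zero)
next
 fix f g :: "('n, 'a) fn" assume "f : locmod Y a t" "g : locmod Y a t"
 then obtain f' g' where "f' : mpow a t" "f - f' : van Y" "g' : mpow a t" "g - g' : van Y" by (auto simp: locmod_def)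
 then show "f + g : locmod Y a t" unfolding locmod_def
  by (intro CollectI bexI[of _ "f' + g'"] mpow_add) (auto simp: van_def ev algebra_simps)
next
 fix c and f :: "('n, 'a) fn" assume "f : locmod Y a t"
 then obtain f' where "f' : mpow a t" "f - f' : van Y" by (auto simp: locmod_def)
 then show "cfun c * f : locmod Y a t" unfolding locmod_def
  by (intro CollectI bexI[of _ "cfun c * f'"] mpow_scale) (auto simp: van_def ev)
qed

lemma locmod_mono: "f : locmod Y a t ==> t' <= t ==> f : locmod Y a t'"
 unfolding locmod_def using mpow_mono by blast

lemma locmod_mult:
 assumes "f : locmod Y a s" "g : mpow a t" shows "g * f : locmod Y a (s + t)"
proof -
 obtain f' where f': "f' : mpow a s" "f - f' : van Y" using assms(1) by (auto simp: locmod_def)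
 have "g * f - f' * g = g * (f - f')" by (simp add: algebra_simps)
 then have "g * f - f' * g : van Y" using van_mult[OF f'(2)] by simp
 then show ?thesis using mpow_mult[OF f'(1) assms(2)] unfolding locmod_def by blast
qed

lemma sub_mpow:
 assumes "P : pfun I {t..}" "!!i. i : I ==> v i : mpow a 1" shows "sub v P : mpow a t"
proof -
 have "trans a (sub v P) = sub (%i. trans a (v i)) P" by (simp add: trans_def sub_def fun_eq_iff)
 also have "... : pfun UNIV {t..}" using assms by (intro sub_pfun_ge) (auto simp: mpow_def)
 finally show ?thesis by (simp add: mpow_def)
qed

text \<open>The graded ring of the local ring of \<open>Y\<close> at \<open>a\<close> is finite over the polynomials in the initial
 forms of \<open>v\<close>.\<close>
definition local_forms :: "('n => 'a::comm_ring_1) set => ('n => 'a) => (nat => ('n, 'a) fn) => nat => bool" where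
 "local_forms Y a v m \<longleftrightarrow> (\<forall>i<m. v i : mpow a 1) \<and> (\<exists>(n::nat) w d. (\<forall>l<n. w l : mpow a (d l)) \<and>
  (\<forall>t. \<forall>f\<in>mpow a t. \<exists>b. (\<forall>l<n. b l : pfun {..<m} {t - d l} \<and> (t < d l --> b l = 0)) \<and>
   f - (\<Sum>l<n. sub v (b l) * w l) : locmod Y a (Suc t)))"

lemma local_formsI:
 fixes Y :: "('n => 'a::comm_ring_1) set"
 assumes v: "!!i. i < m ==> v i : mpow a 1" and J: "finite J" "!!l. l : J ==> w l : mpow a (d l)"
  and "!!t f. f : mpow a t ==> \<exists>b. (\<forall>l\<in>J. b l : pfun {..<m} {t - d l} \<and> (t < d l --> b l = 0)) \<and>
   f - (\<Sum>l\<in>J. sub v (b l) * w l) : locmod Y a (Suc t)"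
 shows "local_forms Y a v m"
proof -
 obtain e where e: "bij_betw e {..<card J} J"
  using ex_bij_betw_nat_finite[OF J(1)] by (auto simp: atLeast0LessThan)
 show ?thesis
  unfolding local_forms_def
 proof (intro conjI exI[of _ "card J"] exI[of _ "w \<circ> e"] exI[of _ "d \<circ> e"] allI ballI impI)
  fix l assume "l < card J" then show "(w \<circ> e) l : mpow a ((d \<circ> e) l)" using e J by (auto simp: bij_betw_def)
 next
  fix t and f :: "('n, 'a) fn" assume "f : mpow a t"
  then obtain b where b: "\<forall>l\<in>J. b l : pfun {..<m} {t - d l} \<and> (t < d l --> b l = 0)"
   "f - (\<Sum>l\<in>J. sub v (b l) * w l) : locmod Y a (Suc t)" using assms(4) by blast
  have "(\<Sum>l\<in>J. sub v (b l) * w l) = (\<Sum>l<card J. sub v ((b \<circ> e) l) * (w \<circ> e) l)"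
   using sum.reindex_bij_betw[OF e, of "%l. sub v (b l) * w l"] by simp
  then show "\<exists>b. (\<forall>l<card J. b l : pfun {..<m} {t - (d \<circ> e) l} \<and> (t < (d \<circ> e) l --> b l = 0)) \<and>
   f - (\<Sum>l<card J. sub v (b l) * (w \<circ> e) l) : locmod Y a (Suc t)"
   using b e by (intro exI[of _ "b \<circ> e"]) (auto simp: bij_betw_def)
 qed (use v in auto)
qed

lemma local_forms_coord:
 fixes Y :: "('n::finite => 'a::field) set"
 shows "\<exists>v. local_forms Y a v (card (UNIV :: 'n set))"
proof -
 obtain e :: "nat => 'n" where e: "bij_betw e {..<card (UNIV :: 'n set)} UNIV"
  using ex_bij_betw_nat_finite[of "UNIV :: 'n set"] by (auto simp: atLeast0LessThan)
 let ?d = "inv_into {..<card (UNIV :: 'n set)} e"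
 have ed: "e (?d j) = j" "?d j < card (UNIV :: 'n set)" for j
  using e inv_into_into[of j e "{..<card (UNIV :: 'n set)}"] by (auto simp: bij_betw_def f_inv_into_f)
 let ?v = "%i. coord (e i) - cfun (a (e i)) :: ('n, 'a) fn"
 have "local_forms Y a ?v (card (UNIV :: 'n set))"
 proof (rule local_formsI[where J = "{0::nat}" and w = "%_. 1" and d = "%_. 0"])
  fix t and f :: "('n, 'a) fn" assume f: "f : mpow a t"
  have "{t..} = {t} \<union> {Suc t..}" by auto
  then have "trans a f : pfun UNIV ({t} \<union> {Suc t..})" using f by (simp only: mpow_def mem_Collect_eq)
  then obtain g h where gh: "g : pfun UNIV {t}" "h : pfun UNIV {Suc t..}" "trans a f = g + h" by (rule pfun_Un)
  have 1: "sub (%j. coord (?d j)) g : pfun {..<card (UNIV :: 'n set)} {t}"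
   by (rule sub_pfun_eq[OF gh(1)]) (use ed in "auto intro: pfun_coord")
  have "f p - sub ?v (sub (%j. coord (?d j)) g) p = trans (%j. - a j) h p" for p
   using fun_cong[OF gh(3), of "%j. p j - a j"] by (simp add: trans_apply sub_apply ed ev)
  then have eq: "f - sub ?v (sub (%j. coord (?d j)) g) = trans (%j. - a j) h" by (simp add: fun_eq_iff ev)
  have "trans a (trans (%j. - a j) h) = h" by (simp add: trans_trans trans_zero)
  then have "trans (%j. - a j) h : mpow a (Suc t)" using gh(2) by (simp add: mpow_def)
  then have "f - sub ?v (sub (%j. coord (?d j)) g) : locmod Y a (Suc t)" unfolding eq by (rule mpow_locmod)
  then show "\<exists>b. (\<forall>l\<in>{0::nat}. b l : pfun {..<card (UNIV :: 'n set)} {t - 0} \<and> (t < 0 --> b l = 0)) \<and>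
   f - (\<Sum>l\<in>{0::nat}. sub ?v (b l) * 1) : locmod Y a (Suc t)"
   using 1 by (intro exI[of _ "%_. sub (%j. coord (?d j)) g"]) simp
 qed (auto simp: mpow_0 intro: coord_mpow[simplified] pfun_one)
 then show ?thesis by blast
qed

text \<open>The elimination of \<open>gen_step\<close> carried over to the associated graded ring:
  \<open>G\<close> is a form, relations hold up to terms of one order higher, and the division is
  the one for forms.\<close>

lemma local_step:
 fixes Y :: "('n::finite => 'a::alg_closed_field) set"
 assumes lf: "local_forms Y a v (Suc m)"
  and G: "G : pfun {..<Suc m} {e}" "G ~= 0" "sub v G : locmod Y a (Suc e)"
 shows "\<exists>v. local_forms Y a v m"
proof -
 obtain xi where xi: "xi m = 1" "G xi ~= 0" using hom_common_nonzero[of "{G}" "{..<Suc m}" m] G by auto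
 let ?v = "%i. v i - cfun (xi i) * v m"
 let ?u = "?v(m := v m)"
 have Im: "{..<Suc m} = insert m {..<m}" by auto
 have v: "v i : mpow a 1" if "i < Suc m" for i using lf that by (auto simp: local_forms_def)
 have v': "?v i : mpow a 1" if "i < m" for i using v[of i] v[of m] that by (intro mpow_diff mpow_scale) auto
 obtain c where c: "!!k. k < e ==> c k : pfun ({..<Suc m} - {m}) ((%d. d - k) ` ({e} \<inter> {k..}))"
  "sub (tilt xi m) G = cfun (G xi) * coord m ^ e + (\<Sum>k<e. c k * coord m ^ k)"
  using tilt_monic[OF G(1) _ G(1) _ xi(2,1)] by (auto simp: pfun_zero)
 define F where "F = coord m ^ e + (\<Sum>k<e. (cfun (inverse (G xi)) * c k) * coord m ^ k)"
 have "cfun (inverse (G xi)) * cfun (G xi) = (1 :: (nat, 'a) fn)" using xi by (simp add: fun_eq_iff ev)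
 then have F: "F = cfun (inverse (G xi)) * sub (tilt xi m) G"
  by (simp add: F_def c(2) distrib_left sum_distrib_left flip: mult.assoc)
 have uF: "sub ?u F : locmod Y a (Suc e)"
  unfolding F using G(3) by (simp add: sub_untilt[OF G(1), of v xi, symmetric] lsub_scale[OF locmod_lsub])
 have cF: "cfun (inverse (G xi)) * c k : pfun {..<m} (gr True (e - k))" if "k < e" for k
 proof -
  have "c k : pfun {..<m} (gr True (e - k))"
   using c(1)[OF that] by (rule pfun_mono) (auto simp: gr_def)
  then show ?thesis by (rule pfun_scale)
 qed
 obtain n :: nat and w d where w: "!!l. l < n ==> w l : mpow a (d l)"
  "!!t f. f : mpow a t ==> \<exists>b. (\<forall>l<n. b l : pfun {..<Suc m} {t - d l} \<and> (t < d l --> b l = 0)) \<and>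
   f - (\<Sum>l<n. sub v (b l) * w l) : locmod Y a (Suc t)"
  using lf unfolding local_forms_def by blast
 have "local_forms Y a ?v m"
 proof (rule local_formsI[where J = "{..<n} \<times> {..<e}" and w = "%(l, k). w l * v m ^ k" and d = "%(l, k). d l + k"])
  show "(%(l, k). w l * v m ^ k) x : mpow a ((%(l, k). d l + k) x)" if x: "x : {..<n} \<times> {..<e}" for x
  proof -
   obtain l k where x: "x = (l, k)" "l < n" using x by auto
   show ?thesis using mpow_mult[OF w(1)[OF x(2)] mpow_power[OF v[of m], of k]] x by simp
  qed
  fix t and f :: "('n, 'a) fn" assume "f : mpow a t"
  then obtain A where A: "!!l. l < n ==> A l : pfun {..<Suc m} {t - d l}" "!!l. l < n ==> t < d l ==> A l = 0"
   "f - (\<Sum>l<n. sub v (A l) * w l) : locmod Y a (Suc t)" using w(2) by blast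
  define Q where "Q = (%l r. (\<forall>k<e. r k : pfun {..<m} {t - (d l + k)} \<and> (t < d l + k --> r k = 0)) \<and>
   (sub v (A l) - (\<Sum>k<e. sub ?v (r k) * v m ^ k)) * w l : locmod Y a (Suc t))"
  have "\<exists>r. Q l r" if l: "l < n" for l
  proof (cases "t < d l")
   case True
   then show ?thesis unfolding Q_def using A(2)[OF l] lsub_zero[OF locmod_lsub, of Y a "Suc t"]
    by (intro exI[of _ "%_. 0"]) (simp add: pfun_zero)
  next
   case False
   have tA: "sub (tilt xi m) (A l) : pfun (insert m {..<m}) (gr True (t - d l))"
    using sub_tilt_pfun[OF A(1)[OF l], of m xi] by (simp add: gr_def Im)
   obtain q r where q: "q : pfun (insert m {..<m}) (gr True (t - d l - e))" "t - d l < e ==> q = 0" and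
    r: "!!k. k < e ==> k <= t - d l ==> r k : pfun {..<m} (gr True (t - d l - k))" "!!k. k > t - d l ==> r k = 0"
    "sub (tilt xi m) (A l) = q * F + (\<Sum>k<e. r k * coord m ^ k)"
    by (rule graded_division[OF _ cF F_def, where P = "sub (tilt xi m) (A l)" and t = "t - d l"]) (use tA in auto)
   have rk: "r k : pfun {..<m} {t - (d l + k)} \<and> (t < d l + k --> r k = 0)" if "k < e" for k
    using r(1)[OF that] r(2)[of k] False by (cases "k <= t - d l") (auto simp: gr_def pfun_zero)
   have ru: "sub ?u (r k) = sub ?v (r k)" if "k < e" for k
    using rk[OF that] by (intro sub_cong[where I = "{..<m}"]) auto
   have "sub v (A l) = sub ?u q * sub ?u F + (\<Sum>k<e. sub ?v (r k) * v m ^ k)"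
    unfolding sub_untilt[OF A(1)[OF l], of v xi] r(3) by (simp add: ru)
   then have eq: "(sub v (A l) - (\<Sum>k<e. sub ?v (r k) * v m ^ k)) * w l = (sub ?u q * w l) * sub ?u F"
    by (simp add: mult_ac)
   have "(sub ?u q * w l) * sub ?u F : locmod Y a (Suc t)"
   proof (cases "t - d l < e")
    case True
    then show ?thesis using q(2) lsub_zero[OF locmod_lsub] by simp
   next
    case False': False
    have "sub ?u q : mpow a (t - d l - e)"
    proof (rule sub_mpow)
     show "q : pfun (insert m {..<m}) {t - d l - e..}" using q(1) by (rule pfun_mono) (auto simp: gr_def)
    qed (use v[of m] v' in auto)
    from locmod_mult[OF uF mpow_mult[OF this w(1)[OF l]]] show ?thesis
     using False False' by (simp add: algebra_simps)
   qed
   then show ?thesis unfolding Q_def using rk eq by (intro exI[of _ r]) simp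
  qed
  then have "\<forall>l. \<exists>r. l < n --> Q l r" by blast
  from choice[OF this] obtain r where "!!l. l < n ==> Q l (r l)" by blast
  then have r: "!!l k. l < n ==> k < e ==> r l k : pfun {..<m} {t - (d l + k)} \<and> (t < d l + k --> r l k = 0)"
   "!!l. l < n ==> (sub v (A l) - (\<Sum>k<e. sub ?v (r l k) * v m ^ k)) * w l : locmod Y a (Suc t)"
   unfolding Q_def by blast+
  have "(f - (\<Sum>l<n. sub v (A l) * w l)) + (\<Sum>l<n. (sub v (A l) - (\<Sum>k<e. sub ?v (r l k) * v m ^ k)) * w l) : locmod Y a (Suc t)"
   using A(3) r(2) by (intro lsub_add[OF locmod_lsub] lsub_sum[OF locmod_lsub]) auto
  moreover have "(f - (\<Sum>l<n. sub v (A l) * w l)) + (\<Sum>l<n. (sub v (A l) - (\<Sum>k<e. sub ?v (r l k) * v m ^ k)) * w l)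
   = f - (\<Sum>x\<in>{..<n} \<times> {..<e}. sub ?v ((%(l, k). r l k) x) * (%(l, k). w l * v m ^ k) x)"
   by (simp add: sum.cartesian_product case_prod_unfold left_diff_distrib right_diff_distrib sum_subtractf sum_distrib_left sum_distrib_right mult_ac)
  ultimately show "\<exists>b. (\<forall>x\<in>{..<n} \<times> {..<e}. b x : pfun {..<m} {t - (%(l, k). d l + k) x} \<and> (t < (%(l, k). d l + k) x --> b x = 0)) \<and>
   f - (\<Sum>x\<in>{..<n} \<times> {..<e}. sub ?v (b x) * (%(l, k). w l * v m ^ k) x) : locmod Y a (Suc t)"
   using r(1) by (intro exI[of _ "%(l, k). r l k"]) auto
 qed (use v' in auto)
 then show ?thesis by blast
qed

text \<open>Initial forms are eliminated until no form relates them; then the jets grow with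
  exponent exactly \<open>m\<close>. How \<open>m\<close> compares with the dimension of
  \<open>Y\<close> is left to \<open>local_dimension\<close>.\<close>

lemma local_dimension_bounds:
 fixes Y :: "('n::finite => 'a::alg_closed_field) set"
 assumes a: "a : Y"
 obtains m n where "!!t. hge (polys UNIV) (locmod Y a (Suc t)) ((m + t) choose m)"
  "!!t. hle (polys UNIV) (locmod Y a (Suc t)) (n * ((m + t) choose m))"
proof -
 have red: "\<exists>m v. local_forms Y a v m \<and> (\<forall>e. \<forall>G\<in>pfun {..<m} {e}. sub v G : locmod Y a (Suc e) --> G = 0)"
  if "local_forms Y a v m" for v m using that
 proof (induction m arbitrary: v)
  case 0
  have "G = 0" if G: "G : pfun {..<0} {e}" "sub v G : locmod Y a (Suc e)" for e G
  proof -
   obtain c where c: "G = cfun c" using pfun_no_vars[of G "{e}"] G(1) by auto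
   obtain g where g: "g : mpow a (Suc e)" "cfun c - g : van Y" using G(2) by (auto simp: c locmod_def)
   have "g : mpow a 1" using g(1) by (rule mpow_mono) simp
   then have "g a = 0" unfolding mpow_1_iff ..
   then show ?thesis using g(2) a by (auto simp: c van_def ev cfun_simps)
  qed
  then show ?case using 0 by blast
 next
  case (Suc m)
  show ?case
  proof (cases "\<forall>e. \<forall>G\<in>pfun {..<Suc m} {e}. sub v G : locmod Y a (Suc e) --> G = 0")
   case True then show ?thesis using Suc.prems by blast
  next
   case False then show ?thesis using local_step[OF Suc.prems] Suc.IH by blast
  qed
 qed
 obtain v0 where "local_forms Y a v0 (card (UNIV :: 'n set))" using local_forms_coord by blast
 from red[OF this] obtain m v where lf: "local_forms Y a v m"
  and li: "!!e G. G : pfun {..<m} {e} ==> sub v G : locmod Y a (Suc e) ==> G = 0" by blast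
 obtain n :: nat and w d where w: "!!i. i < m ==> v i : mpow a 1"
  "!!t f. f : mpow a t ==> \<exists>b. (\<forall>l<n. b l : pfun {..<m} {t - d l} \<and> (t < d l --> b l = 0)) \<and>
   f - (\<Sum>l<n. sub v (b l) * w l) : locmod Y a (Suc t)"
  using lf unfolding local_forms_def by blast
 show ?thesis
 proof (rule that)
  fix t
  have "\<exists>b. (\<forall>l<n. b l : pfun {..<m} {..t}) \<and> f - (\<Sum>l<n. sub v (b l) * w l) : locmod Y a (Suc t)"
   if "f : polys UNIV" for f
  proof -
   \<comment> \<open>Successive approximation: orders 0 to \<open>t\<close> are matched one after
     the other, each correction having degree at most \<open>t\<close>.\<close>
   have "\<exists>b. (\<forall>l<n. b l : pfun {..<m} {..t}) \<and> f - (\<Sum>l<n. sub v (b l) * w l) : locmod Y a k"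
    if "k <= Suc t" for k using that
   proof (induction k)
    case 0
    have "f - (\<Sum>l<n. sub v 0 * w l) : locmod Y a 0"
     using `f : polys UNIV` by (intro mpow_locmod) (simp add: mpow_0)
    then show ?case using pfun_zero by (intro exI[of _ "%_. 0"]) blast
   next
    case (Suc k)
    then obtain b where b: "!!l. l < n ==> b l : pfun {..<m} {..t}"
     "f - (\<Sum>l<n. sub v (b l) * w l) : locmod Y a k" by auto
    then obtain g where g: "g : mpow a k" "f - (\<Sum>l<n. sub v (b l) * w l) - g : van Y" by (auto simp: locmod_def)
    obtain b' where b': "!!l. l < n ==> b' l : pfun {..<m} {k - d l}"
     "g - (\<Sum>l<n. sub v (b' l) * w l) : locmod Y a (Suc k)" using w(2)[OF g(1)] by blast
    have "b' l : pfun {..<m} {..t}" if "l < n" for l using b'(1)[OF that] by (rule pfun_mono) (use Suc.prems in auto)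
    then have "b l + b' l : pfun {..<m} {..t}" if "l < n" for l using b(1) that by (intro pfun_add)
    moreover have "(f - (\<Sum>l<n. sub v (b l) * w l) - g) + (g - (\<Sum>l<n. sub v (b' l) * w l)) : locmod Y a (Suc k)"
     using van_locmod[OF g(2)] b'(2) by (rule lsub_add[OF locmod_lsub])
    moreover have "(f - (\<Sum>l<n. sub v (b l) * w l) - g) + (g - (\<Sum>l<n. sub v (b' l) * w l))
     = f - (\<Sum>l<n. sub v (b l + b' l) * w l)" by (simp add: distrib_right sum.distrib)
    ultimately show ?case by (intro exI[of _ "%l. b l + b' l"]) (simp del: sub_simps)
   qed
   then show ?thesis by blast
  qed
  then show "hle (polys UNIV) (locmod Y a (Suc t)) (n * ((m + t) choose m))" by (rule hle_of_generators)
  have "hge (sub v ` pfun {..<m} {..t}) (locmod Y a (Suc t)) ((m + t) choose m)"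
  proof (rule hge_image[where W = "{0 :: (nat => 'a) => 'a}"])
   show "hge (pfun {..<m} {..t} :: (nat, 'a) fn set) {0} ((m + t) choose m)" using pfun_dim by (rule conjunct1)
   fix P :: "(nat, 'a) fn" assume P: "P : pfun {..<m} {..t}" "sub v P : locmod Y a (Suc t)"
   show "P : {0}"
   proof (rule ccontr)
    assume "P ~: {0}"
    then obtain e P0 where P0: "e : {..t}" "P0 : pfun {..<m} {e}" "P0 ~= 0" "P - P0 : pfun {..<m} ({..t} \<inter> {Suc e..})"
     using pfun_lowest[OF P(1)] by auto
    \<comment> \<open>The lowest form of \<open>P\<close> turns out to be a relation between the
      initial forms.\<close>
    have "P - P0 : pfun {..<m} {Suc e..}" using P0(4) by (rule pfun_mono) auto
    then have "sub v (P - P0) : locmod Y a (Suc e)" using w(1) by (intro mpow_locmod sub_mpow) auto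
    moreover have "sub v P : locmod Y a (Suc e)" using P(2) P0(1) by (rule_tac locmod_mono) auto
    ultimately have "sub v P - sub v (P - P0) : locmod Y a (Suc e)" using lsub_diff[OF locmod_lsub] by blast
    then show False using li[OF P0(2)] P0(3) by simp
   qed
  qed auto
  moreover have "sub v ` pfun {..<m} {..t} <= polys UNIV"
   using w(1) by (auto intro!: sub_polys intro: pfun_polys mpow_polys)
  ultimately show "hge (polys UNIV) (locmod Y a (Suc t)) ((m + t) choose m)" by (rule hge_mono) auto
 qed
qed

lemma monomial_fun_prod:
 fixes m :: "('i::finite, 'a::comm_ring_1) fn"
 assumes "monomial_fun UNIV d m"
 obtains al where "(\<Sum>i\<in>UNIV. al i) = d" "m = (\<Prod>i\<in>UNIV. coord i ^ al i)"
proof -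
 have "\<exists>al. (\<Sum>i\<in>UNIV. al i) = d \<and> m = (\<Prod>i\<in>UNIV. coord i ^ al i)" using assms
 proof (induction rule: monomial_fun.induct)
  case monomial_one then show ?case by (intro exI[of _ "%_. 0"]) simp
 next
  case (monomial_step d m i)
  then obtain al where al: "(\<Sum>i\<in>UNIV. al i) = d" "m = (\<Prod>i\<in>UNIV. coord i ^ al i)" by blast
  let ?be = "%j. if j = i then Suc (al j) else al j"
  have "(\<Sum>j\<in>UNIV. ?be j) = (\<Sum>j\<in>UNIV. al j + (if j = i then 1 else 0))" by (rule sum.cong) auto
  then have 1: "(\<Sum>j\<in>UNIV. ?be j) = Suc d" by (simp add: sum.distrib al(1))
  have "(\<Prod>j\<in>UNIV. coord j ^ ?be j) = (\<Prod>j\<in>UNIV. (if j = i then coord j else 1) * coord j ^ al j)"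
   by (rule prod.cong) auto
  then have "(\<Prod>j\<in>UNIV. coord j ^ ?be j) = coord i * m" by (simp add: prod.distrib al(2))
  with 1 show ?case by (intro exI[of _ ?be]) simp
 qed
 then show ?thesis using that by blast
qed

text \<open>A function separating \<open>a\<close> from the other points of its fibre exhibits \<open>Y\<close> as a cover of a
 hypersurface totally ramified at \<open>a\<close>, so that the powers of the two maximal ideals are comparable.\<close>
theorem local_dimension:
 fixes Y :: "('n::finite => 'a::alg_closed_field) set"
 assumes p: "Factorial_Ring.prime CHAR('a)" and Y: "zprime Y" "zclosed Y" "dim_is Y s" and a: "a : Y"
 shows "hge (polys UNIV) (locmod Y a (Suc M)) ((s + M) choose s)"
proof -
 obtain s' l0 where nf: "normal_forms {Y} l0 s'" "\<exists>Z\<in>{Y}. alg_ind Z l0 s'"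
  by (rule noether_normalization[OF p, of "{Y}"]) (use Y in auto)
 have "s' = s" using dim_is_unique[OF Y(3)] normal_forms_dim_is[OF nf(1), of Y] nf(2) by blast
 define l where "l = (%i. l0 i - cfun (l0 i a))"
 have l0: "l0 i : polys UNIV" if "i < s" for i
  using nf(1) that `s' = s` by (auto simp: normal_forms_def intro: pfun_polys)
 interpret finite_cover Y l s
  by unfold_locales (use Y nf `s' = s` l0 in "auto simp: l_def normal_forms_def
   intro!: alg_ind_translate gen_over_translate pfun_diff pfun_const")
 obtain u0 where u0: "u0 : polys UNIV" "u0 a = 1" "!!y. y : {y:Y. \<forall>i<s. l i y = 0} ==> y ~= a ==> u0 y = 0"
  by (rule lagrange[OF fibre_finite, of a]) blast
 \<comment> \<open>\<open>u\<close> vanishes at \<open>a\<close> and is 1 at the other points of its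
   fibre, so \<open>a\<close> is the only point of \<open>Y\<close> over the origin under
   \<open>l\<close> and \<open>u\<close> together.\<close>
 define u where "u = 1 - u0"
 have u: "u : polys UNIV" using u0(1) by (auto simp: u_def intro!: pfun_diff pfun_one)
 obtain k r where kr: "r : plt (polys {..<s}) (coord s) k" "sub (l(s := u)) (coord s ^ k + r) : van Y"
  "!!P. P : polys {..<Suc s} ==> sub (l(s := u)) P : van Y ==> \<exists>H\<in>polys {..<Suc s}. P = (coord s ^ k + r) * H"
  by (rule minimal_polynomial[OF u]) blast
 have rp: "coord s ^ k + r : polys {..<Suc s}" by (rule monic_polys[OF kr(1)])
 have va: "(l(s := u)) i a = 0" if "i <= s" for i using that u0(2) by (auto simp: l_def u_def ev)
 have "(coord s ^ k + r) (%i. (l(s := u)) i a) = (coord s ^ k + r) (%_. 0)"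
  by (rule pfun_cong[OF rp]) (use va in "auto simp: less_Suc_eq_le simp del: fun_upd_apply")
 moreover have "(coord s ^ k + r) (%i. (l(s := u)) i a) = 0"
  using kr(2) a by (simp only: van_def sub_apply mem_Collect_eq)
 ultimately have zero: "(coord s ^ k + r) (%_. 0) = 0" by simp
 obtain n w where cov: "covered_hypersurface Y l s u (coord s ^ k + r) n w"
  by (rule cover_exists[OF u kr(1) _ zero]) (use kr(3) in blast)+
 interpret covered_hypersurface Y l s u "coord s ^ k + r" n w by (rule cov)
 have npow_pow: "f ^ N : npow N" if "f : npow 1" for f N
 proof (induction N)
  case 0
  have "sub v 1 * 1 : npow 0" by (rule npow_gen) (auto intro: pfun_one)
  then show ?case by simp
 next
  case (Suc N) then show ?case using npow_mult[OF that Suc] by simp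
 qed
 let ?c = "%i. coord i - cfun (a i) :: ('n, 'a) fn"
 have c: "?c i : polys UNIV" for i by (auto intro!: pfun_diff pfun_coord pfun_const)
 have "\<exists>e. ?c i ^ e : npow 1" for i
 proof -
  have "\<exists>e. ?c i ^ e : idl Y {..s} v"
  proof (rule nullstellensatz[OF closed])
   fix y assume y: "y : Y" "!!j. j : {..s} ==> v j y = 0"
   have "l j y = 0" if "j < s" for j using y(2)[of j] that by simp
   moreover have "u0 y ~= 0" using y(2)[of s] by (auto simp: u_def ev)
   ultimately have "y = a" using u0(3) y(1) by blast
   then show "?c i y = 0" by (simp add: ev)
  qed (use v_polys c in "auto simp del: fun_upd_apply")
  then show ?thesis using idl_npow by blast
 qed
 then have "\<forall>i. \<exists>e. ?c i ^ e : npow 1" by blast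
 from choice[OF this] obtain e0 where e0: "!!i. ?c i ^ e0 i : npow 1" by blast
 define e where "e = (\<Sum>i\<in>UNIV. e0 i)"
 have ce: "?c i ^ (e * N) : npow N" for i N
 proof -
  have "e0 i <= e" unfolding e_def by (rule member_le_sum) auto
  then have "?c i ^ e = ?c i ^ e0 i * ?c i ^ (e - e0 i)" by (simp flip: power_add)
  then have "?c i ^ e : npow 1" using npow_ideal[OF e0 polys_power[OF c]] by simp
  then show ?thesis using npow_pow by (simp add: power_mult)
 qed
 let ?n = "card (UNIV :: 'n set)"
 \<comment> \<open>Pigeonhole: a monomial of degree at least \<open>?n * (e * N)\<close> in
   \<open>?n\<close> variables has an exponent of at least \<open>e * N\<close>.\<close>
 have mono: "sub ?c m : npow N" if m: "monomial_fun UNIV d m" and d: "?n * (e * N) <= d" for d m N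
 proof -
  obtain al where al: "(\<Sum>i\<in>UNIV. al i) = d" "m = (\<Prod>i\<in>UNIV. coord i ^ al i)"
   by (rule monomial_fun_prod[OF m])
  have "\<exists>i. e * N <= al i"
  proof (rule ccontr)
   assume "\<not> ?thesis"
   then have "(\<Sum>i\<in>UNIV. al i) < (\<Sum>i\<in>(UNIV :: 'n set). e * N)" by (intro sum_strict_mono) (auto simp: not_le)
   then show False using al(1) d by simp
  qed
  then obtain i where i: "e * N <= al i" by blast
  have "sub ?c m = (\<Prod>i\<in>UNIV. ?c i ^ al i)" by (simp add: al(2) fun_eq_iff sub_apply ev)
  also have "... = ?c i ^ al i * (\<Prod>i\<in>UNIV - {i}. ?c i ^ al i)" by (simp add: prod.remove)
  also have "?c i ^ al i = ?c i ^ (e * N) * ?c i ^ (al i - e * N)" using i by (simp flip: power_add)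
  finally show ?thesis
   using npow_ideal[OF ce polys_mult[OF polys_power[OF c] polys_prod[OF polys_power[OF c]]]] by (simp add: mult.assoc)
 qed
 have "f : npow N" if f: "f : locmod Y a (?n * (e * N))" for f N
 proof -
  have sub: "sub ?c h : npow N" if "h : pfun UNIV {?n * (e * N)..}" for h using that
  proof (induction rule: pfun_induct)
   case zero
   have "sub ?c 0 : npow N" using lsub_zero[OF npow_lsub] by simp
   then show ?case .
  next
   case (step f d m c)
   have "cfun c * sub ?c m + sub ?c f : npow N"
    using mono[OF step(3)] step(2,4) by (intro lsub_add[OF npow_lsub] lsub_scale[OF npow_lsub]) auto
   then show ?case by simp
  qed
  obtain g where g: "g : mpow a (?n * (e * N))" "f - g : van Y" using f by (auto simp: locmod_def)
  have "sub ?c (trans a g) = g" by (simp add: fun_eq_iff sub_apply trans_apply ev)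
  then have "g : npow N" using sub[of "trans a g"] g(1) by (simp add: mpow_def)
  then show ?thesis using npow_mod_van[OF g(2)] by blast
 qed
 then have loc: "locmod Y a (Suc (?n * (e * Suc N))) <= npow (Suc N)" for N
  using locmod_mono[of _ Y a "Suc (?n * (e * Suc N))" "?n * (e * Suc N)"] by auto
 obtain m n' where b: "!!t. hge (polys UNIV) (locmod Y a (Suc t)) ((m + t) choose m)"
  "!!t. hle (polys UNIV) (locmod Y a (Suc t)) (n' * ((m + t) choose m))"
  using local_dimension_bounds[OF a] by blast
 \<comment> \<open>Passing from the powers of one ideal to those of the other stretches orders by a
   constant factor, which leaves the exponent of growth comparable.\<close>
 have "s <= m"
 proof (rule binomial_growth)
  fix N
  have "hge (polys UNIV) (locmod Y a (Suc (?n * (e * Suc N)))) ((s + N) choose s)"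
   by (rule hge_mono[OF npow_growth _ loc]) auto
  then have "(s + N) choose s <= n' * ((m + ?n * (e * Suc N)) choose m)" by (rule hge_le_hle[OF locmod_lsub _ b(2)])
  also have "m + ?n * (e * Suc N) = ?n * e * N + ?n * e + m" by (simp add: algebra_simps)
  finally show "(N + s) choose s <= n' * ((?n * e * N + ?n * e + m) choose m)" by (simp add: add.commute)
 qed
 \<comment> \<open>The bound for jets in terms of \<open>m\<close> has constant 1, so the inequality
   of exponents recovers a sharp bound despite the stretching.\<close>
 then have "(s + M) choose M <= (m + M) choose M" by (intro binomial_right_mono) simp
 then have "(s + M) choose s <= (m + M) choose m" using binomial_symmetric[of s "s + M"] binomial_symmetric[of m "m + M"] by simp
 then show ?thesis by (rule hge_mono[OF b(1) order.refl order.refl])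
qed

section \<open>Good fibres\<close>

context finite_cover
begin

text \<open>Nakayama's lemma: a neighbourhood of each point of the fibre meets the reduced fibre only there.\<close>
lemma reduced_fibre:
 assumes sep: "!!y j. y : Y ==> (!!i. i < s ==> l i y = 0) ==>
   \<exists>c. \<exists>R\<in>mpow y 2. coord j - cfun (y j) - (\<Sum>i<s. cfun (c i) * l i) - R : van Y"
  and f: "f : polys UNIV" "!!y. y : Y ==> (!!i. i < s ==> l i y = 0) ==> f y = 0"
 shows "f : idl Y {..<s} l"
proof (rule ccontr)
 let ?I = "idl Y {..<s} l"
 assume "f ~: ?I"
 \<comment> \<open>The multipliers taking \<open>f\<close> into \<open>?I\<close>; this ideal is
   proper and so has a common zero \<open>x\<close>, which lies on the fibre.\<close>
 define J where "J = {g : polys UNIV. g * f : ?I}"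
 have "ideal_in UNIV J"
  unfolding ideal_in_def J_def
 proof (intro conjI ballI)
  show "0 : {g : polys UNIV. g * f : ?I}" using idl_vanishing[of 0 Y "{..<s}" l] by (auto simp: ev pfun_zero)
 qed (auto simp: distrib_right mult.assoc intro: pfun_add idl_add idl_mult polys_mult)
 moreover have "1 ~: J" using `f ~: ?I` by (simp add: J_def)
 ultimately obtain x where x: "!!g. g : J ==> g x = 0" using weak_nullstellensatz[of UNIV J] by auto
 have IJ: "g x = 0" if "g : ?I" for g
  using x[of g] that idl_mult[OF f(1) that] idl_polys[OF that] by (simp add: J_def mult.commute)
 obtain P where P: "P <= polys UNIV" "Y = {x. \<forall>f\<in>P. f x = 0}" using closed by (auto simp: zclosed_def)
 have xY: "x : Y" unfolding P(2)
 proof (intro CollectI ballI)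
  fix g assume "g : P"
  then show "g x = 0" using P idl_vanishing[of g Y "{..<s}" l] by (intro IJ) auto
 qed
 have lx: "l i x = 0" if "i < s" for i by (rule IJ, rule idl_gen) (use that l in auto)
 let ?c = "%j. coord j - cfun (x j) :: ('n, 'a) fn"
 \<comment> \<open>By separability the maximal ideal at \<open>x\<close> is contained in its square
   plus \<open>?I\<close>.\<close>
 have "\<exists>h. (\<forall>k. h k : mpow x 1) \<and> ?c j - (\<Sum>k\<in>UNIV. h k * ?c k) : ?I" for j
 proof -
  obtain c R where cR: "R : mpow x 2" "?c j - (\<Sum>i<s. cfun (c i) * l i) - R : van Y" using sep[OF xY lx] by blast
  have "R : mpow x (Suc 1)" using cR(1) by (simp add: numeral_2_eq_2)
  then obtain h where h: "!!k. h k : mpow x 1" "R = (\<Sum>k\<in>UNIV. h k * ?c k)" by (rule mpow_Suc_decomp) blast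
  have "(\<Sum>i<s. cfun (c i) * l i) : ?I" by (intro idl_sum idl_mult idl_gen pfun_const) (use l in auto)
  moreover have "?c j - (\<Sum>i<s. cfun (c i) * l i) - R : ?I"
  proof (rule idl_vanishing)
   show "?c j - (\<Sum>i<s. cfun (c i) * l i) - R : polys UNIV"
    by (intro pfun_diff pfun_sum pfun_scale pfun_coord pfun_const mpow_polys[OF cR(1)]) (use l in auto)
  qed (use cR(2) in "simp add: van_def")
  ultimately have "(?c j - (\<Sum>i<s. cfun (c i) * l i) - R) + (\<Sum>i<s. cfun (c i) * l i) : ?I" by (intro idl_add)
  moreover have "(?c j - (\<Sum>i<s. cfun (c i) * l i) - R) + (\<Sum>i<s. cfun (c i) * l i) = ?c j - R" by simp
  ultimately have "?c j - R : ?I" by simp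
  then show ?thesis using h by blast
 qed
 then have "\<forall>j. \<exists>h. (\<forall>k. h k : mpow x 1) \<and> ?c j - (\<Sum>k\<in>UNIV. h k * ?c k) : ?I" by blast
 from choice[OF this] obtain h where h: "!!j k. h j k : mpow x 1" "!!j. ?c j - (\<Sum>k\<in>UNIV. h j k * ?c k) : ?I" by blast
 obtain e :: "nat => 'n" where e: "bij_betw e {..<card (UNIV :: 'n set)} UNIV"
  using ex_bij_betw_nat_finite[of "UNIV :: 'n set"] by (auto simp: atLeast0LessThan)
 have hp: "h j k : polys UNIV" "h j k x = 0" for j k using h(1)[of j k] by (simp_all only: mpow_1_iff)
 define b where "b = (%i k. (if k = i then 1 else 0) - h (e i) (e k))"
 have "\<exists>k::nat. \<exists>g\<in>{g : polys UNIV. g x = 1}. \<forall>i<card (UNIV :: 'n set). id g * ?c (e i) : ?I"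
 proof (rule elimination[where ?P1.0 = "%_. {g : polys UNIV. g x = 1}" and ?P0.0 = "%_. {g : polys UNIV. g x = 0}"
   and b = b and i = "0::nat"])
  show "(\<Sum>k<card (UNIV :: 'n set). id (b i k) * ?c (e k)) : ?I" if i: "i < card (UNIV :: 'n set)" for i
  proof -
   have "(\<Sum>k<card (UNIV :: 'n set). id (b i k) * ?c (e k))
    = (\<Sum>k<card (UNIV :: 'n set). (if k = i then ?c (e k) else 0) - h (e i) (e k) * ?c (e k))"
    by (rule sum.cong) (auto simp: b_def left_diff_distrib)
   also have "... = ?c (e i) - (\<Sum>k\<in>UNIV. h (e i) k * ?c k)"
    using i sum.reindex_bij_betw[OF e, of "%k. h (e i) k * ?c k"] by (simp add: sum_subtractf)
   finally show ?thesis using h(2) by simp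
  qed
 qed (auto simp: b_def ev hp pfun_zero intro!: polys_mult pfun_diff pfun_uminus pfun_one idl_diff idl_mult)
 then obtain g where g: "g : polys UNIV" "g x = 1" "!!i. i < card (UNIV :: 'n set) ==> g * ?c (e i) : ?I" by auto
 have gc: "g * ?c j : ?I" for j
 proof -
  obtain i where "i < card (UNIV :: 'n set)" "e i = j" using e by (metis bij_betw_iff_bijections UNIV_I lessThan_iff)
  then show ?thesis using g(3) by blast
 qed
 \<comment> \<open>\<open>g\<close> takes the whole maximal ideal at \<open>x\<close>, hence
   \<open>f\<close>, into \<open>?I\<close>, although \<open>g x = 1\<close>.\<close>
 have "f : mpow x (Suc 0)" using f(1) f(2)[OF xY lx] mpow_1_iff[of f x] by simp
 then obtain h' where h': "!!k. h' k : mpow x 0" "f = (\<Sum>k\<in>UNIV. h' k * ?c k)" by (rule mpow_Suc_decomp) blast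
 have "g * f = (\<Sum>k\<in>UNIV. h' k * (g * ?c k))" unfolding h'(2) sum_distrib_left by (rule sum.cong) (auto simp: mult_ac)
 also have "... : ?I" using h'(1) by (intro idl_sum idl_mult gc) (simp add: mpow_0)
 finally have "g : J" using g(1) by (simp add: J_def)
 then show False using x g(2) by force
qed

text \<open>Modulo the forms \<open>l\<close> a function is determined by its values on the reduced
  fibre, so the Lagrange functions \<open>u y\<close> generate the coordinate ring locally over the
  origin. A denominator \<open>g\<close> with value 1 at the origin leaves as many generators as the
  fibre has points, at the cost of a fixed degree shift \<open>c\<close>.\<close>

lemma hilbert_bound:
 assumes sep: "!!y j. y : Y ==> (!!i. i < s ==> l i y = 0) ==>
   \<exists>c. \<exists>R\<in>mpow y 2. coord j - cfun (y j) - (\<Sum>i<s. cfun (c i) * l i) - R : van Y"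
 obtains c where "!!t. hle (pfun UNIV {..t}) (van Y) (card {y:Y. \<forall>i<s. l i y = 0} * ((s + (t + c)) choose s))"
proof -
 let ?A = "polys {..<s} :: (nat, 'a) fn set"
 define S where "S = {y:Y. \<forall>i<s. l i y = 0}"
 have S: "finite S" unfolding S_def by (rule fibre_finite)
 obtain ys where ys: "bij_betw ys {..<card S} S" using ex_bij_betw_nat_finite[OF S] by (auto simp: atLeast0LessThan)
 have "\<forall>y. \<exists>u\<in>polys UNIV. u y = 1 \<and> (\<forall>z\<in>S. z ~= y --> u z = 0)" using lagrange[OF S] by metis
 from bchoice[of UNIV, simplified, OF this[unfolded Bex_def]] obtain u where
  u: "!!y. u y : polys UNIV" "!!y. u y y = 1" "!!y z. z : S ==> z ~= y ==> u y z = 0" by blast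
 obtain n :: nat and w where w: "!!j. j < n ==> w j : polys UNIV"
  "!!t f. f : pfun UNIV {..t} ==> \<exists>a. (\<forall>j<n. a j : pfun {..<s} {..t}) \<and> f - (\<Sum>j<n. sub l (a j) * w j) : van Y"
  using gen unfolding gen_over_def by blast
 have w': "\<exists>a. (\<forall>j<n. a j : ?A) \<and> f - (\<Sum>j<n. sub l (a j) * w j) : van Y" if "f : polys UNIV" for f
 proof -
  obtain t where "f : pfun UNIV {..t}" using `f : polys UNIV` by (rule polys_bounded)
  then show ?thesis using w(2)[of f t] pfun_polys by blast
 qed
 \<comment> \<open>The submodule over the base generated by the Lagrange functions; some
   \<open>g\<close> with value 1 at the origin will take all \<open>w j\<close> into it.\<close>
 define U where "U = {f. \<exists>B. (\<forall>k<card S. B k : ?A) \<and> f - (\<Sum>k<card S. sub l (B k) * u (ys k)) : van Y}"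
 have Umult: "sub l c * f : U" if "f : U" "c : ?A" for f c
 proof -
  obtain B where B: "!!k. k < card S ==> B k : ?A" "f - (\<Sum>k<card S. sub l (B k) * u (ys k)) : van Y"
   using `f : U` by (auto simp: U_def)
  have "sub l c * (f - (\<Sum>k<card S. sub l (B k) * u (ys k))) : van Y" by (rule van_mult[OF B(2)])
  then show ?thesis unfolding U_def using B(1) that(2)
   by (intro CollectI exI[of _ "%k. c * B k"]) (auto simp: right_diff_distrib sum_distrib_left mult.assoc intro: polys_mult)
 qed
 have Udiff: "f - g : U" if "f : U" "g : U" for f g
 proof -
  obtain B where B: "!!k. k < card S ==> B k : ?A" "f - (\<Sum>k<card S. sub l (B k) * u (ys k)) : van Y"
   using `f : U` by (auto simp: U_def)
  obtain C where C: "!!k. k < card S ==> C k : ?A" "g - (\<Sum>k<card S. sub l (C k) * u (ys k)) : van Y"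
   using `g : U` by (auto simp: U_def)
  have "(f - (\<Sum>k<card S. sub l (B k) * u (ys k))) - (g - (\<Sum>k<card S. sub l (C k) * u (ys k))) : van Y"
   using B(2) C(2) by (rule lsub_diff[OF van_lsub])
  then show ?thesis unfolding U_def using B(1) C(1)
   by (intro CollectI exI[of _ "%k. B k - C k"]) (auto simp: left_diff_distrib sum_subtractf algebra_simps intro: pfun_diff)
 qed
 have "\<exists>h. (\<forall>k<n. h k : ?A \<and> h k (%_. 0) = 0) \<and> w j - (\<Sum>k<n. sub l (h k) * w k) : U" if j: "j < n" for j
 proof -
  let ?g = "\<Sum>k<card S. cfun (w j (ys k)) * u (ys k)"
  have "w j - ?g : idl Y {..<s} l"
  proof (rule reduced_fibre[OF sep])
   show "w j - ?g : polys UNIV" by (intro pfun_diff pfun_sum pfun_scale u w(1)[OF j])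
   fix y assume "y : Y" "!!i. i < s ==> l i y = 0"
   then have y: "y : S" by (simp add: S_def)
   have "?g y = (\<Sum>z\<in>S. w j z * u z y)"
    using sum.reindex_bij_betw[OF ys, of "%z. w j z * u z y"] by (simp add: ev)
   also have "... = (\<Sum>z\<in>S. if z = y then w j z else 0)" by (rule sum.cong) (use u y in auto)
   finally show "(w j - ?g) y = 0" using S y by (simp add: ev)
  qed
  then obtain h where h: "!!i. i < s ==> h i : polys UNIV" "!!p. p : Y ==> (w j - ?g) p = (\<Sum>i<s. h i p * l i p)"
   unfolding idl_def by auto
  have "\<forall>i. \<exists>a. i < s --> (\<forall>k<n. a k : ?A) \<and> h i - (\<Sum>k<n. sub l (a k) * w k) : van Y" using h(1) w' by blast
  from choice[OF this] obtain a where a: "!!i k. i < s ==> k < n ==> a i k : ?A"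
   "!!i. i < s ==> h i - (\<Sum>k<n. sub l (a i k) * w k) : van Y" by blast
  let ?h = "%k. \<Sum>i<s. coord i * a i k"
  have "w j - (\<Sum>k<n. sub l (?h k) * w k) - ?g : van Y"
   unfolding van_def
  proof (intro CollectI ballI)
   fix p assume p: "p : Y"
   have "h i p = (\<Sum>k<n. sub l (a i k) p * w k p)" if "i < s" for i
    using a(2)[OF that] p by (simp add: van_def ev)
   then have "(w j - ?g) p = (\<Sum>i<s. \<Sum>k<n. sub l (a i k) p * w k p * l i p)"
    using h(2)[OF p] by (simp add: sum_distrib_right)
   also have "... = (\<Sum>k<n. \<Sum>i<s. sub l (a i k) p * w k p * l i p)" by (rule sum.swap)
   also have "... = (\<Sum>k<n. sub l (?h k) * w k) p" by (simp add: ev sum_distrib_right sum_distrib_left mult_ac)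
   finally have "(w j - ?g) p - (\<Sum>k<n. sub l (?h k) * w k) p = 0" by simp
   moreover have "w j - (\<Sum>k<n. sub l (?h k) * w k) - ?g = (w j - ?g) - (\<Sum>k<n. sub l (?h k) * w k)" by simp
   ultimately show "(w j - (\<Sum>k<n. sub l (?h k) * w k) - ?g) p = 0" by (simp only: minus_apply)
  qed
  then have "w j - (\<Sum>k<n. sub l (?h k) * w k) : U"
   unfolding U_def by (intro CollectI exI[of _ "%k. cfun (w j (ys k))"]) (auto intro: pfun_const)
  moreover have "?h k : ?A \<and> ?h k (%_. 0) = 0" if "k < n" for k
  proof
   show "?h k : ?A"
   proof (rule pfun_sum)
    fix i assume "i : {..<s}"
    then show "coord i * a i k : ?A" using a(1)[of i k] that by (intro polys_mult pfun_coord) auto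
   qed
  qed (simp add: ev)
  ultimately show ?thesis by (intro exI[of _ ?h]) simp
 qed
 then have "\<forall>j. \<exists>h. j < n --> (\<forall>k<n. h k : ?A \<and> h k (%_. 0) = 0) \<and> w j - (\<Sum>k<n. sub l (h k) * w k) : U" by blast
 from choice[OF this] obtain h where h: "!!j k. j < n ==> k < n ==> h j k : ?A \<and> h j k (%_. 0) = 0"
  "!!j. j < n ==> w j - (\<Sum>k<n. sub l (h j k) * w k) : U" by blast
 define b where "b = (%j k. (if k = j then 1 else 0) - h j k)"
 have "\<exists>k::nat. \<exists>g\<in>{g : ?A. g (%_. 0) = 1}. \<forall>j<n. sub l g * w j : U"
 proof (rule elimination[where ph = "sub l" and ?P1.0 = "%_. {g : ?A. g (%_. 0) = 1}" and ?P0.0 = "%_. {g : ?A. g (%_. 0) = 0}"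
   and b = b and i = "0::nat"])
  show "(\<Sum>k<n. sub l (b j k) * w k) : U" if j: "j < n" for j
  proof -
   have "(\<Sum>k<n. sub l (b j k) * w k) = (\<Sum>k<n. (if k = j then w k else 0) - sub l (h j k) * w k)"
    by (rule sum.cong) (auto simp: b_def left_diff_distrib)
   also have "... = w j - (\<Sum>k<n. sub l (h j k) * w k)" using j by (simp add: sum_subtractf)
   finally show ?thesis using h(2)[OF j] by simp
  qed
 qed (use h(1) in "auto simp: b_def ev pfun_zero intro!: polys_mult pfun_diff pfun_uminus pfun_one Udiff Umult")
 then obtain g where g: "g : ?A" "g (%_. 0) = 1" "!!j. j < n ==> sub l g * w j : U" by auto
 have "g ~= 0" using g(2) by (auto simp: ev)
 then have gY: "sub l g ~: van Y" using ind g(1) by (auto simp: alg_ind_def)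
 have gp: "sub l g : polys UNIV" by (rule sub_polys[OF g(1)]) (use l in auto)
 have "\<forall>j. \<exists>B. j < n --> (\<forall>k<card S. B k : ?A) \<and> sub l g * w j - (\<Sum>k<card S. sub l (B k) * u (ys k)) : van Y"
  using g(3) unfolding U_def by blast
 from choice[OF this] obtain B where B: "!!j k. j < n ==> k < card S ==> B j k : ?A"
  "!!j. j < n ==> sub l g * w j - (\<Sum>k<card S. sub l (B j k) * u (ys k)) : van Y" by blast
 have "\<forall>x. \<exists>c. x : {..<n} \<times> {..<card S} --> B (fst x) (snd x) : pfun {..<s} {..c}"
  using B(1) polys_bounded by (metis SigmaE fst_conv lessThan_iff snd_conv)
 from choice[OF this] obtain c0 where c0: "!!j k. j < n ==> k < card S ==> B j k : pfun {..<s} {..c0 (j, k)}" by force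
 \<comment> \<open>The finitely many coefficients \<open>B j k\<close> have a common degree bound;
   this is the shift.\<close>
 define c where "c = (\<Sum>x\<in>{..<n} \<times> {..<card S}. c0 x)"
 have Bc: "B j k : pfun {..<s} {..c}" if "j < n" "k < card S" for j k
 proof (rule pfun_mono[OF c0[OF that]])
  have "c0 (j, k) <= c" unfolding c_def by (rule member_le_sum) (use that in auto)
  then show "{..c0 (j, k)} <= {..c}" by simp
 qed simp
 show ?thesis
 proof (rule that)
  fix t
  have up: "hle ((%f. sub l g * f) ` pfun UNIV {..t}) (van Y) (card S * ((s + (t + c)) choose s))"
  proof (rule hle_of_generators)
   fix f' assume "f' : (%f. sub l g * f) ` pfun UNIV {..t}"
   then obtain f where f: "f : pfun UNIV {..t}" "f' = sub l g * f" by auto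
   obtain a where a: "!!j. j < n ==> a j : pfun {..<s} {..t}" "f - (\<Sum>j<n. sub l (a j) * w j) : van Y"
    using w(2)[OF f(1)] by blast
   let ?a = "%k. \<Sum>j<n. a j * B j k"
   have "sub l g * (f - (\<Sum>j<n. sub l (a j) * w j)) + (\<Sum>j<n. sub l (a j) * (sub l g * w j - (\<Sum>k<card S. sub l (B j k) * u (ys k)))) : van Y"
    using a(2) B(2) by (intro lsub_add[OF van_lsub] lsub_sum[OF van_lsub] van_mult) auto
   also have "sub l g * (f - (\<Sum>j<n. sub l (a j) * w j)) + (\<Sum>j<n. sub l (a j) * (sub l g * w j - (\<Sum>k<card S. sub l (B j k) * u (ys k))))
    = f' - (\<Sum>j<n. \<Sum>k<card S. sub l (a j) * (sub l (B j k) * u (ys k)))"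
    by (simp add: f(2) right_diff_distrib sum_subtractf sum_distrib_left mult_ac)
   also have "(\<Sum>j<n. \<Sum>k<card S. sub l (a j) * (sub l (B j k) * u (ys k))) = (\<Sum>k<card S. sub l (?a k) * u (ys k))"
    by (subst sum.swap) (simp add: sum_distrib_right mult.assoc)
   finally show "\<exists>a. (\<forall>k<card S. a k : pfun {..<s} {..t + c}) \<and> f' - (\<Sum>k<card S. sub l (a k) * u (ys k)) : van Y"
    using a(1) Bc by (intro exI[of _ ?a]) (auto intro!: pfun_sum pfun_mult_le)
  qed
  obtain D where D: "hge (pfun UNIV {..t}) (van Y) D" "hle (pfun UNIV {..t}) (van Y) D"
  proof -
   obtain D0 where "hle (pfun UNIV {..t} :: ('n, 'a) fn set) {0} D0" by (rule pfun_finite_dim[OF finite]) blast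
   then have "hle (pfun UNIV {..t}) (van Y) D0" by (rule hle_mono) (auto simp: van_def ev)
   then show ?thesis using hdim_exists that by (metis van_lsub lsub_pfun)
  qed
  \<comment> \<open>Multiplication by \<open>sub l g\<close> is injective on the coordinate ring, so
    a bound for the image bounds the Hilbert function itself.\<close>
  have "hge ((%f. sub l g * f) ` pfun UNIV {..t}) (van Y) D"
   by (rule hge_mult[OF D(1)]) (use zprime_mult[OF prime gp _ _ gY] in "auto intro: pfun_polys")
  then have DS: "D <= card S * ((s + (t + c)) choose s)" using up by (rule hge_le_hle[OF van_lsub])
  show "hle (pfun UNIV {..t}) (van Y) (card {y:Y. \<forall>i<s. l i y = 0} * ((s + (t + c)) choose s))"
   unfolding S_def[symmetric] by (rule hle_mono[OF D(2) _ _ DS]) auto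
 qed
qed

text \<open>The constant term of the minimal polynomial of a function is a multiple of it that comes from the base.\<close>
lemma multiple_from_base:
 assumes h: "h : polys UNIV" "h ~: van Y"
 obtains C w where "C : polys {..<s}" "C ~= 0" "w : polys UNIV" "sub l C - h * w : van Y"
proof -
 obtain k r where kr: "r : plt (polys {..<s}) (coord s) k" "sub (l(s := h)) (coord s ^ k + r) : van Y"
  "!!P. P : polys {..<Suc s} ==> sub (l(s := h)) P : van Y ==> \<exists>H\<in>polys {..<Suc s}. P = (coord s ^ k + r) * H"
  by (rule minimal_polynomial[OF h(1)]) blast
 let ?F = "coord s ^ k + r"
 have Fp: "?F : polys {..<Suc s}" by (rule monic_polys[OF kr(1)])
 obtain C G where CG: "C : polys {..<s}" "G : polys {..<Suc s}" "?F = C + coord s * G" by (rule split_last[OF Fp])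
 have sG: "sub (l(s := h)) G : polys UNIV" by (rule sub_polys[OF CG(2)]) (use l h in "auto simp: less_Suc_eq")
 have "sub (l(s := h)) C = sub l C" by (rule sub_cong[OF CG(1)]) auto
 then have rel: "sub l C + h * sub (l(s := h)) G : van Y" using kr(2) unfolding CG(3) by simp
 have "C ~= 0"
 proof
  assume C0: "C = 0"
  then have "h * sub (l(s := h)) G : van Y" using rel by simp
  then have "sub (l(s := h)) G : van Y" using zprime_mult[OF prime h(1) sG] h(2) by blast
  then obtain H where H: "H : polys {..<Suc s}" "G = ?F * H" using kr(3)[OF CG(2)] by blast
  have G0: "G = 0"
  proof (rule ccontr)
   assume "G ~= 0"
   have "coord s * G * H = G" using H(2) CG(3) C0 by simp
   then have "G * (1 - coord s * H) = 0" by (simp add: right_diff_distrib mult_ac)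
   moreover have "1 - coord s * H : polys {..<Suc s}" using H(1) by (intro pfun_diff pfun_one polys_mult pfun_coord) auto
   ultimately have "1 - coord s * H = 0" using polys_domain[OF CG(2)] `G ~= 0` by blast
   then have "(1 - coord s * H) (%_. 0) = 0" by (simp add: ev)
   then show False by (simp add: ev)
  qed
  then show False using CG(3) C0 monic_nonzero[OF kr(1)] by simp
 qed
 moreover have "sub l C - h * (- sub (l(s := h)) G) : van Y" using rel by simp
 ultimately show ?thesis using that[of C "- sub (l(s := h)) G"] CG(1) sG by (auto intro: pfun_uminus)
qed

lemma translate: "finite_cover Y (%i. l i - cfun (b i)) s"
 by unfold_locales (use prime closed l ind gen in "auto intro!: alg_ind_translate gen_over_translate pfun_diff pfun_const")

text \<open>The multiple \<open>C\<close> of \<open>h\<close> comes from the base and is constant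
  along fibres, so a fibre on which it is nonzero avoids the zeros of \<open>h\<close>, and every
  point of it is separable. Translating this fibre to the origin reduces to
  \<open>hilbert_bound\<close>.\<close>

theorem good_fibre:
 assumes "sep_over Y l s"
 obtains b c where "!!t. hle (pfun UNIV {..t}) (van Y) (card {y:Y. \<forall>i<s. l i y = b i} * ((s + (t + c)) choose s))"
proof -
 obtain h where h: "h : polys UNIV" "h ~: van Y" "!!y j. y : Y ==> h y ~= 0 ==> \<exists>c. \<exists>R\<in>mpow y 2.
  coord j - cfun (y j) - (\<Sum>i<s. cfun (c i) * (l i - cfun (l i y))) - R : van Y"
  using assms unfolding sep_over_def by blast
 obtain C w where C: "C : polys {..<s}" "C ~= 0" "sub l C - h * w : van Y" by (rule multiple_from_base[OF h(1,2)]) blast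
 have "sub l C ~: van Y" using ind C by (auto simp: alg_ind_def)
 then obtain y0 where y0: "y0 : Y" "C (%i. l i y0) ~= 0" by (auto simp: van_def sub_apply)
 interpret t: finite_cover Y "%i. l i - cfun (l i y0)" s by (rule translate)
 obtain c where c: "!!t. hle (pfun UNIV {..t}) (van Y) (card {y:Y. \<forall>i<s. (l i - cfun (l i y0)) y = 0} * ((s + (t + c)) choose s))"
 proof (rule t.hilbert_bound)
  fix y j assume y: "y : Y" "!!i. i < s ==> (l i - cfun (l i y0)) y = 0"
  then have ly: "l i y = l i y0" if "i < s" for i using that by (simp add: ev)
  have "C (%i. l i y) = C (%i. l i y0)" by (rule pfun_cong[OF C(1)]) (use ly in auto)
  moreover have "C (%i. l i y) = h y * w y" using C(3) y(1) by (auto simp: van_def sub_apply ev)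
  ultimately have "h y ~= 0" using y0(2) by auto
  then show "\<exists>c. \<exists>R\<in>mpow y 2. coord j - cfun (y j) - (\<Sum>i<s. cfun (c i) * (l i - cfun (l i y0))) - R : van Y"
   using h(3)[OF y(1), of j] ly by simp
 qed blast
 have "{y:Y. \<forall>i<s. (l i - cfun (l i y0)) y = 0} = {y:Y. \<forall>i<s. l i y = l i y0}" by (simp add: ev)
 then show ?thesis using that[of "%i. l i y0" c] c by simp
qed

end

section \<open>Bezout inequalities\<close>

text \<open>Moving the window by one gains a term of at most \<open>H\<close> and drops
  another.\<close>

lemma shifted_sum_le:
 fixes h :: "nat => nat"
 assumes "!!i. i <= a + k + n ==> h i <= H"
 shows "(\<Sum>i<n. h (a + k + i)) <= (\<Sum>i<n. h (a + i)) + k * H"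
 using assms
proof (induction k)
 case (Suc k)
 have "(\<Sum>i<n. h (a + Suc k + i)) + h (a + k) = (\<Sum>i<Suc n. h (a + k + i))"
  by (simp add: sum.lessThan_Suc_shift del: sum.lessThan_Suc)
 also have "... = (\<Sum>i<n. h (a + k + i)) + h (a + k + n)" by simp
 also have "... <= ((\<Sum>i<n. h (a + i)) + k * H) + H" using Suc by (intro add_mono Suc.IH) auto
 finally show ?case by simp
qed simp

text \<open>\<open>S\<close> is cut out on \<open>Y\<close> by equations of degree at most
  \<open>e\<close>: for rational points \<open>e\<close> is the cardinality of the field, for linear
  sections it is 1.\<close>

locale section_points =
 fixes Y :: "('n::finite => 'a::alg_closed_field) set" and s :: nat and A :: "'j set" and g :: "'j => ('n, 'a) fn"
  and e :: nat and S :: "('n => 'a) set"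
 assumes char: "Factorial_Ring.prime CHAR('a)" and prime: "zprime Y" and closed: "zclosed Y" and dim: "dim_is Y s"
  and A: "finite A" and g: "!!i. i : A ==> g i : pfun UNIV {..e}"
  and S_def: "S = {p:Y. \<forall>i\<in>A. g i p = 0}" and S: "finite S"
begin

lemma g_polys: "i : A ==> g i : polys UNIV" using g by (blast intro: pfun_polys)

text \<open>By the Nullstellensatz each coordinate satisfies a monic univariate equation modulo the
  ideal. A monomial of degree above the sum \<open>c\<close> of their degrees has an exponent
  reaching one of them and can be reduced.\<close>

lemma finite_codimension:
 obtains c where "!!P. P : polys UNIV ==> \<exists>Q\<in>pfun UNIV {..c}. P - Q : idl Y A g"
proof -
 let ?I = "idl Y A g"
 have "\<exists>D. \<exists>r\<in>pfun UNIV {..<D}. coord j ^ D + r : ?I" for j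
 proof -
  let ?f = "\<Prod>a\<in>S. coord j - cfun (a j) :: ('n, 'a) fn"
  have "\<exists>M. ?f ^ M : ?I"
  proof (rule nullstellensatz[OF closed A g_polys])
   show "?f : polys UNIV" by (intro polys_prod pfun_diff pfun_coord pfun_const) auto
   fix p assume "p : Y" "!!i. i : A ==> g i p = 0"
   then have "p : S" by (simp add: S_def)
   then show "?f p = 0" using S by (auto simp: ev intro!: prod_zero bexI[of _ p])
  qed
  then obtain M where M: "?f ^ M : ?I" by blast
  define q where "q = (\<Prod>a\<in>S. [:- a j, 1:]) ^ M"
  have q1: "lead_coeff q = 1" unfolding q_def by (simp add: lead_coeff_power lead_coeff_prod)
  define r where "r = (\<Sum>k<degree q. cfun (poly.coeff q k) * coord j ^ k :: ('n, 'a) fn)"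
  have "?f ^ M = coord j ^ degree q + r"
  proof
   fix p :: "'n => 'a"
   have "(?f ^ M) p = poly q (p j)" by (simp add: q_def ev poly_prod)
   also have "... = (coord j ^ degree q + r) p"
    using q1 by (simp add: poly_altdef r_def ev add.commute flip: lessThan_Suc_atMost)
   finally show "(?f ^ M) p = (coord j ^ degree q + r) p" .
  qed
  moreover have "r : pfun UNIV {..<degree q}" unfolding r_def
  proof (intro pfun_sum pfun_scale)
   fix k assume "k : {..<degree q}"
   have "coord j ^ k : pfun (UNIV :: 'n set) {k * 1}" by (intro pfun_power_eq pfun_coord) auto
   then show "coord j ^ k : pfun (UNIV :: 'n set) {..<degree q}" by (rule pfun_mono) (use `k : _` in auto)
  qed
  ultimately show ?thesis using M by metis
 qed
 then have "\<forall>j. \<exists>D. \<exists>r\<in>pfun UNIV {..<D}. coord j ^ D + r : ?I" by blast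
 from choice[OF this] obtain D where D: "!!j. \<exists>r\<in>pfun UNIV {..<D j}. coord j ^ D j + r : ?I" by blast
 define c where "c = (\<Sum>j\<in>UNIV. D j)"
 define T where "T = {P : polys UNIV. \<exists>Q\<in>pfun UNIV {..c}. P - Q : ?I}"
 have TI: "P + Q : T" if "P : ?I" "Q : T" for P Q
 proof -
  obtain Q' where "Q' : pfun UNIV {..c}" "Q - Q' : ?I" using `Q : T` by (auto simp: T_def)
  then show ?thesis using that idl_add[OF that(1), of "Q - Q'"] idl_polys[OF that(1)]
   by (auto simp: T_def add_diff_eq intro: pfun_add)
 qed
 have Tspan: "P : T" if "P : pfun UNIV {..<d}" "!!d' m. d' < d ==> monomial_fun UNIV d' m ==> m : T" for P d
  using that(1)
 proof (induction rule: pfun_induct)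
  case zero
  have "0 : T" using idl_vanishing[of 0 Y A g] by (auto simp: T_def ev pfun_zero intro!: bexI[of _ 0])
  then show ?case .
 next
  case (step f d' m k)
  obtain Q where Q: "f : polys UNIV" "Q : pfun UNIV {..c}" "f - Q : ?I" using step(4) by (auto simp: T_def)
  have "m : T" using that(2) step by auto
  then obtain Q' where Q': "m : polys UNIV" "Q' : pfun UNIV {..c}" "m - Q' : ?I" by (auto simp: T_def)
  have "cfun k * (m - Q') + (f - Q) : ?I" using Q Q' by (intro idl_add idl_mult pfun_const) auto
  then have "(cfun k * m + f) - (cfun k * Q' + Q) : ?I" by (simp add: algebra_simps)
  then show ?case using Q Q' unfolding T_def by (intro CollectI conjI bexI[of _ "cfun k * Q' + Q"] pfun_add pfun_scale)
 qed
 have mon: "monomial_fun UNIV d m ==> m : T" for d m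
 proof (induction d arbitrary: m rule: less_induct)
  case (less d)
  have mp: "m : pfun UNIV {d}" using less.prems by (rule pfun_monomial) simp
  show ?case
  proof (cases "d <= c")
   case True
   have "m : pfun UNIV {..c}" using mp by (rule pfun_mono) (use True in auto)
   then show ?thesis using idl_vanishing[of 0 Y A g] unfolding T_def by (auto simp: ev pfun_zero intro: pfun_polys intro!: bexI[of _ m])
  next
   case False
   obtain al where al: "(\<Sum>i\<in>UNIV. al i) = d" "m = (\<Prod>i\<in>UNIV. coord i ^ al i)" by (rule monomial_fun_prod[OF less.prems])
   have "\<exists>j. D j <= al j"
   proof (rule ccontr)
    assume "\<not> ?thesis"
    then have "(\<Sum>j\<in>UNIV. al j) <= c" unfolding c_def by (intro sum_mono) (auto simp: not_le less_imp_le)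
    then show False using al(1) False by simp
   qed
   then obtain j where j: "D j <= al j" by blast
   obtain r where r: "r : pfun UNIV {..<D j}" "coord j ^ D j + r : ?I" using D by blast
   define m' where "m' = coord j ^ (al j - D j) * (\<Prod>i\<in>UNIV - {j}. coord i ^ al i :: ('n, 'a) fn)"
   have "coord j ^ al j = coord j ^ D j * (coord j ^ (al j - D j) :: ('n, 'a) fn)" using j by (simp flip: power_add)
   then have mm: "m = coord j ^ D j * m'" unfolding al(2) m'_def by (subst prod.remove[of _ j]) (simp_all flip: mult.assoc)
   have pr: "(\<Prod>i\<in>B. coord i ^ al i :: ('n, 'a) fn) : pfun UNIV {(\<Sum>i\<in>B. al i)}" for B
   proof (induction B rule: infinite_finite_induct)
    case (insert x F)
    have "coord x ^ al x : pfun (UNIV :: 'n set) {al x * 1}" by (intro pfun_power_eq pfun_coord) auto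
    from pfun_mult_eq[OF this insert.IH] show ?case using insert by simp
   qed (auto intro: pfun_one)
   have "coord j ^ (al j - D j) : pfun (UNIV :: 'n set) {(al j - D j) * 1}" by (intro pfun_power_eq pfun_coord) auto
   from pfun_mult_eq[OF this pr[of "UNIV - {j}"]] have m'd: "m' : pfun UNIV {d - D j}"
    using al(1) j unfolding m'_def by (simp add: sum.remove[of UNIV j])
   have "D j <= d" using j al(1) member_le_sum[of j UNIV al] by simp
   have "r * m' : pfun UNIV {..<d}" by (rule pfun_mult[OF r(1) m'd]) (use `D j <= d` in auto)
   from Tspan[OF pfun_uminus[OF this] less.IH] have "- (r * m') : T" .
   moreover have "m' * (coord j ^ D j + r) : ?I" by (rule idl_mult[OF pfun_polys[OF m'd] r(2)])
   ultimately have "m' * (coord j ^ D j + r) + - (r * m') : T" by (intro TI)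
   then show ?thesis by (simp add: mm algebra_simps)
  qed
 qed
 show ?thesis
 proof (rule that)
  fix P :: "('n, 'a) fn" assume "P : polys UNIV"
  then obtain t where "P : pfun UNIV {..t}" by (rule polys_bounded)
  then have "P : pfun UNIV {..<Suc t}" by (simp add: lessThan_Suc_atMost)
  then have "P : T" using mon by (rule Tspan)
  then show "\<exists>Q\<in>pfun UNIV {..c}. P - Q : ?I" by (simp add: T_def)
 qed
qed

text \<open>Raising the order by one costs degree \<open>e\<close>: the remainder is a combination
  of the \<open>g i\<close>, which vanish on \<open>S\<close>, and its coefficients need
  approximation to one order less. The slope \<open>e\<close> becomes \<open>e ^ s\<close> in the
  Bezout estimates.\<close>

lemma jets_bounded:
 obtains c where "!!k P. P : polys UNIV ==> \<exists>Q\<in>pfun UNIV {..e * k + c}. \<forall>a\<in>S. P - Q : locmod Y a k"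
proof -
 obtain c where c: "!!P. P : polys UNIV ==> \<exists>Q\<in>pfun UNIV {..c}. P - Q : idl Y A g" using finite_codimension by blast
 have "\<exists>Q\<in>pfun UNIV {..e * k + c}. \<forall>a\<in>S. P - Q : locmod Y a k" if "P : polys UNIV" for k P
  using that
 proof (induction k arbitrary: P)
  case 0 then show ?case by (intro bexI[of _ 0]) (auto simp: mpow_0 intro: mpow_locmod pfun_zero)
 next
  case (Suc k)
  obtain Q0 where Q0: "Q0 : pfun UNIV {..c}" "P - Q0 : idl Y A g" using c[OF Suc.prems] by blast
  then obtain h where h: "!!i. i : A ==> h i : polys UNIV" "!!p. p : Y ==> (P - Q0) p = (\<Sum>i\<in>A. h i p * g i p)"
   unfolding idl_def by blast
  have "\<forall>i. \<exists>Q. i : A --> Q : pfun UNIV {..e * k + c} \<and> (\<forall>a\<in>S. h i - Q : locmod Y a k)" using Suc.IH h(1) by blast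
  from choice[OF this] obtain Q where Q: "!!i. i : A ==> Q i : pfun UNIV {..e * k + c}"
   "!!i a. i : A ==> a : S ==> h i - Q i : locmod Y a k" by blast
  let ?Q = "Q0 + (\<Sum>i\<in>A. Q i * g i)"
  show ?case
  proof (intro bexI[of _ ?Q] ballI)
   have "Q i * g i : pfun UNIV {..e * Suc k + c}" if "i : A" for i
    using pfun_mult_le[OF Q(1)[OF that] g[OF that]] by (simp add: algebra_simps)
   moreover have "Q0 : pfun UNIV {..e * Suc k + c}" using Q0(1) by (rule pfun_mono) auto
   ultimately show "?Q : pfun UNIV {..e * Suc k + c}" by (intro pfun_add pfun_sum)
   fix a assume a: "a : S"
   have "g i * (h i - Q i) : locmod Y a (k + 1)" if "i : A" for i
   proof (rule locmod_mult[OF Q(2)[OF that a]])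
    show "g i : mpow a 1" unfolding mpow_1_iff using g_polys[OF that] a that by (auto simp: S_def)
   qed
   then have 1: "(\<Sum>i\<in>A. g i * (h i - Q i)) : locmod Y a (Suc k)" by (intro lsub_sum[OF locmod_lsub]) auto
   have "P - Q0 - (\<Sum>i\<in>A. h i * g i) : van Y" using h(2) by (simp add: van_def ev)
   then have "P - Q0 - (\<Sum>i\<in>A. h i * g i) + (\<Sum>i\<in>A. g i * (h i - Q i)) : locmod Y a (Suc k)"
    using 1 by (rule lsub_add[OF locmod_lsub van_locmod])
   also have "P - Q0 - (\<Sum>i\<in>A. h i * g i) + (\<Sum>i\<in>A. g i * (h i - Q i)) = P - ?Q"
    by (simp add: right_diff_distrib sum_subtractf mult.commute)
   finally show "P - ?Q : locmod Y a (Suc k)" .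
  qed
 qed
 then show ?thesis using that by blast
qed

text \<open>Jets at the points of \<open>S\<close> are prescribed independently in degree
  \<open>e * k + c\<close>. The general \<open>W\<close> admits jets modulo a further equation, and
  \<open>j\<close> leaves room in the degree.\<close>

lemma jets_at_points:
 obtains c where "!!k j W N W'. (!!a. a : S ==> locmod Y a k <= W a \<and> lsub (W a) \<and> hge (polys UNIV) (W a) (N a) \<and> W' <= W a \<and>
   (\<forall>f\<in>W a. \<forall>h\<in>polys UNIV. h * f : W a)) ==>
  hge (pfun UNIV {..e * k + c + j}) W' (\<Sum>a\<in>S. N a)"
proof -
 obtain c where c: "!!k P. P : polys UNIV ==> \<exists>Q\<in>pfun UNIV {..e * k + c}. \<forall>a\<in>S. P - Q : locmod Y a k"
  using jets_bounded by blast
 show ?thesis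
 proof (rule that)
  fix k j W N W' assume W: "!!a. a : S ==> locmod Y a k <= W a \<and> lsub (W a) \<and> hge (polys UNIV) (W a) (N a) \<and> W' <= W a \<and>
   (\<forall>f\<in>W a. \<forall>h\<in>polys UNIV. h * f : W a)"
  have "hge (pfun UNIV {..e * k + c}) W' (\<Sum>a\<in>S. N a)"
  proof (rule hge_crt[OF S, where V = "polys UNIV" and W = W])
   fix a and f :: "('n, 'a) fn" assume a: "a : S" and f: "f : polys UNIV"
   obtain u where u: "u : polys UNIV" "u a = 1" "!!y. y : S ==> y ~= a ==> u y = 0" using lagrange[OF S] by blast
   let ?z = "u ^ k"
   \<comment> \<open>Approximately idempotent: 1 up to order \<open>k\<close> at \<open>a\<close>
     and 0 up to order \<open>k\<close> at the other points.\<close>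
   let ?E = "1 - (1 - ?z) ^ k"
   have z: "1 - ?z : polys UNIV" using u by (intro pfun_diff pfun_one polys_power) auto
   have E: "f * ?E : polys UNIV" using f z u(1) by (intro polys_mult pfun_diff pfun_one polys_power) auto
   have "1 - ?z : mpow a 1" unfolding mpow_1_iff using z u by (simp add: ev)
   then have "(1 - ?z) ^ k : mpow a (k * 1)" by (rule mpow_power)
   then have "- (f * (1 - ?z) ^ k) : locmod Y a k" using f by (intro lsub_uminus[OF locmod_lsub] mpow_locmod mpow_ideal) auto
   then have 1: "f * ?E - f : W a" using W[OF a] by (auto simp: algebra_simps)
   have 2: "f * ?E : W a'" if "a' : S" "a' ~= a" for a'
   proof -
    have "u : mpow a' 1" unfolding mpow_1_iff using u that by simp
    then have "?z : mpow a' (k * 1)" by (rule mpow_power)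
    moreover have "f * ?E = (f * (\<Sum>i<k. (1 - ?z) ^ i)) * ?z" using one_diff_power_eq[of "1 - ?z" k] by (simp add: mult_ac)
    moreover have "f * (\<Sum>i<k. (1 - ?z) ^ i) : polys UNIV" using f z by (intro polys_mult pfun_sum polys_power)
    ultimately have "f * ?E : mpow a' k" using mpow_ideal by simp
    then show ?thesis using W[OF that(1)] mpow_locmod by blast
   qed
   obtain Q where Q: "Q : pfun UNIV {..e * k + c}" "!!b. b : S ==> f * ?E - Q : locmod Y b k" using c[OF E] by blast
   have QW: "f * ?E - Q : W b" if "b : S" for b using Q(2)[OF that] W[OF that] by blast
   have "(f * ?E - f) - (f * ?E - Q) : W a" using 1 QW[OF a] W[OF a] lsub_diff by blast
   then have "Q - f : W a" by simp
   moreover have "Q : W b" if "b : S" "b ~= a" for b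
   proof -
    have "f * ?E - (f * ?E - Q) : W b" using 2[OF that] QW W that lsub_diff by blast
    then show ?thesis by simp
   qed
   ultimately show "\<exists>P\<in>pfun UNIV {..e * k + c}. P - f : W a \<and> (\<forall>a'\<in>S. a' ~= a --> P : W a')" using Q(1) by blast
  qed (use W in auto)
  then show "hge (pfun UNIV {..e * k + c + j}) W' (\<Sum>a\<in>S. N a)" by (rule hge_mono) (auto intro: pfun_mono)
 qed
qed

theorem bezout_points:
 assumes N: "!!t. hle (pfun UNIV {..t}) (van Y) (N * ((s + (t + c)) choose s))"
 shows "card S <= N * e ^ s"
proof -
 obtain c' where c': "!!k j W N W'. (!!a. a : S ==> locmod Y a k <= W a \<and> lsub (W a) \<and> hge (polys UNIV) (W a) (N a) \<and> W' <= W a \<and>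
   (\<forall>f\<in>W a. \<forall>h\<in>polys UNIV. h * f : W a)) ==>
  hge (pfun UNIV {..e * k + c' + j}) W' (\<Sum>a\<in>S. N a)" by (rule jets_at_points) blast
 show ?thesis
 proof (rule binomial_limit)
  fix M
  \<comment> \<open>Each point contributes at least as many jets as a point of affine
    \<open>s\<close>-space; the Hilbert function in degree about \<open>e * M\<close> has to
    accommodate all of them.\<close>
  have "hge (pfun UNIV {..e * Suc M + c' + 0}) (van Y) (\<Sum>a\<in>S. (s + M) choose s)"
  proof (rule c'[where W = "%a. locmod Y a (Suc M)"], intro conjI)
   fix a assume a: "a : S"
   show "hge (polys UNIV) (locmod Y a (Suc M)) ((s + M) choose s)"
    by (rule local_dimension[OF char prime closed dim]) (use a in "auto simp: S_def")
   show "\<forall>f\<in>locmod Y a (Suc M). \<forall>h\<in>polys UNIV. h * f : locmod Y a (Suc M)"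
    using locmod_mult[where t = 0] by (force simp: mpow_0)
  qed (auto intro: van_locmod)
  from hge_le_hle[OF van_lsub this N[of "e * Suc M + c' + 0"]]
  show "card S * ((M + s) choose s) <= N * ((e * M + (e + c' + c) + s) choose s)" by (simp add: algebra_simps)
 qed
qed

lemma local_dimensions:
 obtains dm where "!!a k. a : S ==> hge (polys UNIV) (locmod Y a k) (dm a k) \<and> hle (polys UNIV) (locmod Y a k) (dm a k)"
proof -
 have "\<exists>d. hge (polys UNIV) (locmod Y a k) d \<and> hle (polys UNIV) (locmod Y a k) d" if "a : S" for a k
 proof -
  have "a : Y" using that by (simp add: S_def)
  then obtain m n where "hle (polys UNIV) (locmod Y a (Suc k)) (n * ((m + k) choose m))" by (rule local_dimension_bounds) blast
  then have "hle (polys UNIV) (locmod Y a k) (n * ((m + k) choose m))" by (rule hle_mono) (auto intro: locmod_mono)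
  then show ?thesis by (rule hdim_exists[OF locmod_lsub]) blast
 qed
 then have "\<forall>x. \<exists>d. fst x : S --> hge (polys UNIV) (locmod Y (fst x) (snd x)) d \<and> hle (polys UNIV) (locmod Y (fst x) (snd x)) d" by blast
 from choice[OF this] obtain dm where "!!x. fst x : S ==> hge (polys UNIV) (locmod Y (fst x) (snd x)) (dm x) \<and> hle (polys UNIV) (locmod Y (fst x) (snd x)) (dm x)"
  by blast
 from this[of "(_, _)"] show ?thesis using that[of "%a k. dm (a, k)"] by simp
qed

text \<open>Killing a function of order one at the points of \<open>S\<close> costs at most one order of their jets; summing over
 \<open>e\<close> consecutive degrees makes the increments of the Hilbert function telescope.\<close>
theorem bezout_hypersurface:
 assumes N: "!!t. hle (pfun UNIV {..t}) (van Y) (N * ((s + (t + c)) choose s))"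
  and f: "f : pfun UNIV {..e'}" "f ~: van Y" "!!a. a : S ==> f a = 0"
 shows "card S * e <= N * e' * e ^ s"
proof -
 obtain c' where c': "!!k j W N W'. (!!a. a : S ==> locmod Y a k <= W a \<and> lsub (W a) \<and> hge (polys UNIV) (W a) (N a) \<and> W' <= W a \<and>
   (\<forall>f\<in>W a. \<forall>h\<in>polys UNIV. h * f : W a)) ==>
  hge (pfun UNIV {..e * k + c' + j}) W' (\<Sum>a\<in>S. N a)" by (rule jets_at_points) blast
 obtain dm where dm: "!!a k. a : S ==> hge (polys UNIV) (locmod Y a k) (dm a k)"
  "!!a k. a : S ==> hle (polys UNIV) (locmod Y a k) (dm a k)" by (rule local_dimensions) blast
 have "\<exists>h. hge (pfun UNIV {..t}) (van Y) h \<and> hle (pfun UNIV {..t}) (van Y) h" for t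
  by (rule hdim_exists[OF van_lsub N[of t]]) blast
 then have "\<forall>t. \<exists>h. hge (pfun UNIV {..t}) (van Y) h \<and> hle (pfun UNIV {..t}) (van Y) h" by blast
 from choice[OF this] obtain h where h: "!!t. hge (pfun UNIV {..t}) (van Y) (h t)" "!!t. hle (pfun UNIV {..t}) (van Y) (h t)" by blast
 have hmono: "h t <= h t'" if "t <= t'" for t t'
  by (rule hge_le_hle[OF van_lsub h(1)], rule hle_mono[OF h(2)[of t']]) (use that in "auto intro: pfun_mono")
 \<comment> \<open>Order \<open>k\<close> at \<open>a\<close> together with all multiples of
   \<open>f\<close>: the quotient consists of jets on the section \<open>f = 0\<close>.\<close>
 define W where "W = (%a k. {x. \<exists>y\<in>locmod Y a k. \<exists>p\<in>polys UNIV. x = y + f * p})"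
 have fp: "f : polys UNIV" using f(1) by (rule pfun_polys)
 have f1: "f : mpow a 1" if "a : S" for a unfolding mpow_1_iff using fp f(3)[OF that] by simp
 have WI: "y + f * p : W a k" if "y : locmod Y a k" "p : polys UNIV" for y p a k using that by (auto simp: W_def)
 have W: "lsub (W a k)" for a k
 proof (rule lsubI)
  show "0 : W a k" using WI[of 0 a k 0] lsub_zero[OF locmod_lsub, of Y a k] by (simp add: pfun_zero)
 next
  fix x x' assume "x : W a k" "x' : W a k"
  then obtain y p y' p' where y: "y : locmod Y a k" "p : polys UNIV" "x = y + f * p"
   "y' : locmod Y a k" "p' : polys UNIV" "x' = y' + f * p'" unfolding W_def by blast
  have "(y + y') + f * (p + p') : W a k" using y by (intro WI pfun_add lsub_add[OF locmod_lsub])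
  then show "x + x' : W a k" using y by (simp add: algebra_simps)
 next
  fix d x assume "x : W a k"
  then obtain y p where y: "y : locmod Y a k" "p : polys UNIV" "x = y + f * p" unfolding W_def by blast
  have "cfun d * y + f * (cfun d * p) : W a k" using y by (intro WI pfun_scale lsub_scale[OF locmod_lsub])
  then show "cfun d * x : W a k" using y by (simp add: algebra_simps)
 qed
 have locW: "locmod Y a k <= W a k" for a k using WI[of _ a k 0] by (auto simp: pfun_zero)
 have Wmult: "q * x : W a k" if x: "x : W a k" and q: "q : polys UNIV" for q x a k
 proof -
  obtain y p where y: "y : locmod Y a k" "p : polys UNIV" "x = y + f * p" using x unfolding W_def by blast
  have "q * y : locmod Y a (k + 0)" using y(1) q by (intro locmod_mult) (simp_all add: mpow_0)
  then have "q * y + f * (q * p) : W a k" using y q by (intro WI polys_mult) auto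
  then show ?thesis using y by (simp add: algebra_simps)
 qed
 \<comment> \<open>Since \<open>f\<close> vanishes at \<open>a\<close>, multiplication by it raises
   the order, so passing to the section loses at most the jets of one order less.\<close>
 have "\<exists>rh. hge (polys UNIV) (W a (Suc k)) rh \<and> dm a (Suc k) <= rh + dm a k" if a: "a : S" for a k
 proof -
  have "hle (polys UNIV) (W a (Suc k)) (dm a (Suc k))" by (rule hle_mono[OF dm(2)[OF a] order.refl locW]) simp
  from this obtain rh where rh: "hge (polys UNIV) (W a (Suc k)) rh" "hle (polys UNIV) (W a (Suc k)) rh"
   by (rule hdim_exists[OF W]) blast
  then obtain b where b: "!!x. x : polys UNIV ==> \<exists>c. x - (\<Sum>j<rh. cfun (c j) * b j) : W a (Suc k)"
   unfolding hle_def by blast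
  let ?V = "{x. \<exists>c. x - (\<Sum>j<rh. cfun (c j) * b j) : locmod Y a (Suc k)}"
  have "hle (polys UNIV) (locmod Y a (Suc k)) (rh + dm a k)"
  proof (rule hle_add)
   show "hle ?V (locmod Y a (Suc k)) rh" unfolding hle_def by blast
   show "hle ((%p. f * p) ` polys UNIV) (locmod Y a (Suc k)) (dm a k)"
    by (rule hle_image[OF dm(2)[OF a]]) (use locmod_mult[OF _ f1[OF a], of _ Y k] in "auto simp: algebra_simps")
   fix x :: "('n, 'a) fn" assume "x : polys UNIV"
   then obtain c y p where c: "x - (\<Sum>j<rh. cfun (c j) * b j) = y + f * p" "y : locmod Y a (Suc k)" "p : polys UNIV"
    using b[of x] unfolding W_def by blast
   have "x - f * p - (\<Sum>j<rh. cfun (c j) * b j) = y" using c(1) by (simp add: algebra_simps)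
   then have "x - f * p : ?V" using c(2) by (intro CollectI exI[of _ c]) simp
   then show "\<exists>u\<in>?V. \<exists>v\<in>(%p. f * p) ` polys UNIV. x = u + v"
    using c(3) by (intro bexI[of _ "x - f * p"] bexI[of _ "f * p"]) auto
  qed auto
  then have "dm a (Suc k) <= rh + dm a k" by (rule hge_le_hle[OF locmod_lsub dm(1)[OF a]])
  then show ?thesis using rh(1) by blast
 qed
 then have "\<forall>x. \<exists>rh. fst x : S --> hge (polys UNIV) (W (fst x) (Suc (snd x))) rh \<and> dm (fst x) (Suc (snd x)) <= rh + dm (fst x) (snd x)" by blast
 from choice[OF this] obtain rh where rh': "\<forall>x. fst x : S --> hge (polys UNIV) (W (fst x) (Suc (snd x))) (rh x) \<and> dm (fst x) (Suc (snd x)) <= rh x + dm (fst x) (snd x)" ..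
 have rh: "hge (polys UNIV) (W a (Suc k)) (rh (a, k))" "dm a (Suc k) <= rh (a, k) + dm a k" if "a : S" for a k
  using rh'[rule_format, of "(a, k)"] that by auto
 define P where "P = (%k. \<Sum>a\<in>S. rh (a, k))"
 define L where "L = (%k. \<Sum>a\<in>S. dm a k)"
 have LP: "L (Suc k) <= P k + L k" for k
  unfolding L_def P_def sum.distrib[symmetric] by (rule sum_mono) (rule rh(2))
 \<comment> \<open>Functions independent modulo \<open>f\<close> in degree \<open>?T + e'\<close>
   and the multiples of \<open>f\<close> by functions of degree \<open>?T\<close> add up.\<close>
 have P: "P k + h (e * Suc k + c' + j) <= h (e * Suc k + c' + j + e')" for k j
 proof -
  let ?T = "e * Suc k + c' + j"
  let ?F = "(%p. f * p) ` pfun UNIV {..?T} :: ('n, 'a) fn set"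
  let ?W = "{x. \<exists>y\<in>van Y. \<exists>p\<in>pfun UNIV {..?T}. x = y + f * p}"
  have "hge (pfun UNIV {..e * Suc k + c' + (j + e')}) ?W (\<Sum>a\<in>S. rh (a, k))"
  proof (rule c'[where W = "%a. W a (Suc k)"], intro conjI)
   fix a assume "a : S"
   show "?W <= W a (Suc k)" using WI[OF van_locmod] pfun_polys by blast
  qed (use locW W rh(1) Wmult in auto)
  then have 1: "hge (pfun UNIV {..?T + e'}) ?W (P k)" by (simp add: P_def add.assoc)
  have 2: "hge ?F (van Y) (h ?T)"
   by (rule hge_mult[OF h(1)]) (use zprime_mult[OF prime fp _ _ f(2)] in "auto intro: pfun_polys")
  have "hge (pfun UNIV {..?T + e'}) (van Y) (P k + h ?T)"
  proof (rule hge_add[OF 1 2])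
   show "lsub ?W"
   proof (rule lsubI)
    show "0 : ?W" using lsub_zero[OF van_lsub] by (auto intro!: bexI[of _ 0] pfun_zero)
   next
    fix x x' assume "x : ?W" "x' : ?W"
    then obtain y p y' p' where "y : van Y" "p : pfun UNIV {..?T}" "x = y + f * p" "y' : van Y" "p' : pfun UNIV {..?T}" "x' = y' + f * p'" by blast
    then show "x + x' : ?W" using lsub_add[OF van_lsub, of y Y y']
     by (intro CollectI bexI[of _ "y + y'"] bexI[of _ "p + p'"] pfun_add) (simp_all add: algebra_simps)
   next
    fix d x assume "x : ?W"
    then obtain y p where "y : van Y" "p : pfun UNIV {..?T}" "x = y + f * p" by blast
    then show "cfun d * x : ?W" using lsub_scale[OF van_lsub, of y Y d]
     by (intro CollectI bexI[of _ "cfun d * y"] bexI[of _ "cfun d * p"] pfun_scale) (simp_all add: algebra_simps)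
   qed
   show "?F <= pfun UNIV {..?T + e'}" using pfun_mult_le[OF f(1), of _ ?T] by (auto simp: add.commute)
   show "?F <= ?W" using lsub_zero[OF van_lsub, of Y] by force
   show "van Y <= ?W" using pfun_zero by force
  qed auto
  then show ?thesis by (rule hge_le_hle[OF van_lsub _ h(2)])
 qed
 let ?b = "e + c'"
 have split: "(\<Sum>i<m + n. h (x + i)) = (\<Sum>i<m. h (x + i)) + (\<Sum>i<n. h (x + m + i))" for x m n
  by (induction n) (auto simp: add.assoc)
 \<comment> \<open>Each step uses the \<open>e\<close> degrees from \<open>e * Suc K + c'\<close>
   on, so the windows are adjacent and the jet increments telescope to \<open>L K\<close>.\<close>
 have tele: "e * L K + (\<Sum>i<e * K. h (?b + i)) <= (\<Sum>i<e * K. h (?b + e' + i))" for K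
 proof (induction K)
  case 0
  have "dm a 0 = 0" if a: "a : S" for a
  proof -
   have "hle (polys UNIV) (locmod Y a 0) 0" unfolding hle_def by (auto intro: mpow_locmod simp: mpow_0)
   then show ?thesis using hge_le_hle[OF locmod_lsub dm(1)[OF a]] by blast
  qed
  then show ?case by (simp add: L_def)
 next
  case (Suc K)
  have "e * P K + (\<Sum>j<e. h (?b + e * K + j)) = (\<Sum>j<e. P K + h (e * Suc K + c' + j))"
   by (simp add: sum.distrib algebra_simps)
  also have "... <= (\<Sum>j<e. h (e * Suc K + c' + j + e'))" by (rule sum_mono) (rule P)
  also have "... = (\<Sum>j<e. h (?b + e' + e * K + j))" by (simp add: algebra_simps)
  finally have "e * P K + (\<Sum>j<e. h (?b + e * K + j)) <= (\<Sum>j<e. h (?b + e' + e * K + j))" .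
  moreover have "e * L (Suc K) <= e * P K + e * L K" using LP[of K] by (simp flip: distrib_left)
  moreover have "e * Suc K = e * K + e" by simp
  ultimately show ?case using Suc split[of ?b "e * K" e] split[of "?b + e'" "e * K" e] by (simp only:)
 qed
 have "card S * e <= (N * e') * e ^ s"
 proof (rule binomial_limit)
  fix M
  let ?K = "Suc M"
  let ?T = "?b + e' + e * ?K"
  have "(s + M) choose s <= dm a ?K" if "a : S" for a
   by (rule hge_le_hle[OF locmod_lsub local_dimension[OF char prime closed dim] dm(2)[OF that]]) (use that in "auto simp: S_def")
  then have "card S * ((s + M) choose s) <= L ?K"
   using sum_mono[of S "%_. (s + M) choose s" "%a. dm a ?K"] by (simp add: L_def)
  then have "e * (card S * ((s + M) choose s)) <= e * L ?K" by simp
  \<comment> \<open>The two windows differ by a shift of \<open>e'\<close>, each unit of which costs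
    at most the largest value \<open>h ?T\<close>.\<close>
  also have "e * L ?K <= e' * h ?T"
   using tele[of ?K] shifted_sum_le[of ?b e' "e * ?K" h "h ?T"] hmono by simp
  also have "h ?T <= N * ((s + (?T + c)) choose s)" by (rule hge_le_hle[OF van_lsub h(1) N])
  finally have "e * (card S * ((s + M) choose s)) <= e' * (N * ((s + (?T + c)) choose s))" by simp
  then show "card S * e * ((M + s) choose s) <= N * e' * ((e * M + (e + ?b + e' + c) + s) choose s)"
   by (simp add: algebra_simps)
 qed
 then show ?thesis .
qed

end

section \<open>Separating hypersurfaces\<close>

lemma pfun_top_unique:
 fixes f :: "('i, 'a::alg_closed_field) fn"
 assumes "f : pfun I {d}" "f : pfun I {..<d}" shows "f = 0"
proof (cases d)
 case 0 then show ?thesis using assms(2) pfun_empty_degrees by simp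
next
 case (Suc d')
 show ?thesis
 proof
  fix x
  have "f : pfun I {..d'}" using assms(2) Suc by (simp add: lessThan_Suc_atMost)
  then obtain p where p: "degree p <= d'" "!!t. f (%i. 0 + t * x i) = poly p t"
   by (rule pfun_line[where x = "%_. 0" and v = x]) blast
  have "poly (Polynomial.monom (f x) d - p) t = 0" for t
   using p(2)[of t] pfun_hom[OF assms(1), of t x] by (simp add: poly_monom mult.commute)
  then have "Polynomial.monom (f x) d - p = 0" by (rule poly_zero_if_all_roots)
  then have "poly.coeff (Polynomial.monom (f x) d) d = poly.coeff p d" by simp
  then show "f x = 0 x" using p(1) Suc by (simp add: coeff_eq_0 ev)
 qed
qed

lemma top_form:
 assumes "f : polys I" "f ~= 0"
 obtains d g where "f : pfun I {..d}" "g : pfun I {d}" "g ~= 0" "f - g : pfun I {..<d}"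
proof -
 have "\<exists>t. f : pfun I {..t}" using polys_bounded[OF assms(1)] by metis
 define d where "d = (LEAST t. f : pfun I {..t})"
 have d: "f : pfun I {..d}" unfolding d_def by (rule LeastI_ex) fact
 have "f ~: pfun I {..<d}"
 proof
  assume *: "f : pfun I {..<d}"
  then obtain d' where d': "d = Suc d'" using assms(2) pfun_empty_degrees[of f I] by (cases d) auto
  then have "d <= d'" unfolding d_def using * by (intro Least_le) (simp add: d_def[symmetric] lessThan_Suc_atMost)
  then show False using d' by simp
 qed
 from pfun_highest[OF d this] show ?thesis using that d by blast
qed

text \<open>The cone with vertex \<open>x\<close> over the image of \<open>Z\<close> has dimension
  at most \<open>s + 1\<close>. In terms of functions: if no form vanished on it, forms of degree
  \<open>k\<close> would embed into functions of degree at most \<open>k\<close> on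
  \<open>Z\<close>, and summing over \<open>k <= d\<close> would bound the polynomials in
  \<open>m\<close> variables by order \<open>d ^ (s + 1)\<close>.\<close>

lemma cone_form:
 fixes Z :: "('n => 'a::alg_closed_field) set"
 assumes v: "!!i. i < m ==> v i : pfun UNIV {..1}" and N: "!!t. hle (pfun UNIV {..t}) (van Z) (N * ((s + (t + c)) choose s))"
  and m: "m > Suc s"
 obtains k ga where "ga : pfun {..<m} {k}" "ga ~= 0" "!!z. z : Z ==> ga (%i. v i z - x i) = 0"
proof (rule ccontr)
 assume neg: "\<not> thesis"
 let ?B = "%d. N * ((s + (d + c)) choose s)"
 have forms: "hle (pfun {..<m} {k} :: (nat, 'a) fn set) {0} (?B k)" for k
 proof -
  have "hle (pfun {..<m} {..k} :: (nat, 'a) fn set) {0} ((m + k) choose m)" using pfun_dim by (rule conjunct2)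
  then have "hle (pfun {..<m} {k} :: (nat, 'a) fn set) {0} ((m + k) choose m)"
   by (rule hle_mono) (auto intro: pfun_mono)
  then obtain n where n: "hge (pfun {..<m} {k} :: (nat, 'a) fn set) {0} n"
   "hle (pfun {..<m} {k} :: (nat, 'a) fn set) {0} n"
   by (rule hdim_exists[OF lsub_singleton]) blast
  let ?ph = "sub (%i. v i - cfun (x i))"
  have "hge (?ph ` pfun {..<m} {k}) (van Z) n"
  proof (rule hge_image[OF n(1)])
   fix ga :: "(nat, 'a) fn" assume ga: "ga : pfun {..<m} {k}" "?ph ga : van Z"
   then show "ga : {0}" using neg that[OF ga(1)] by (auto simp: van_def sub_apply ev)
  qed auto
  moreover have "?ph ` pfun {..<m} {k} <= pfun UNIV {..k}"
  proof (rule image_subsetI)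
   fix ga :: "(nat, 'a) fn" assume "ga : pfun {..<m} {k}"
   then have "ga : pfun {..<m} {..k}" by (rule pfun_mono) auto
   then show "?ph ga : pfun UNIV {..k}" by (rule sub_pfun_le1) (use v in "auto intro!: pfun_diff pfun_const")
  qed
  ultimately have "hge (pfun UNIV {..k}) (van Z) n" by (rule hge_mono) auto
  then have "n <= ?B k" using N by (rule hge_le_hle[OF van_lsub])
  then show ?thesis by (rule hle_mono[OF n(2) order.refl order.refl])
 qed
 have "hle (pfun {..<m} {..d} :: (nat, 'a) fn set) {0} (Suc d * ?B d)" for d
 proof (induction d)
  case 0 then show ?case using forms[of 0] by (simp add: atMost_0)
 next
  case (Suc d)
  have B: "?B d <= ?B (Suc d)" by (intro mult_le_mono2 binomial_right_mono) simp
  have "hle (pfun {..<m} {..Suc d} :: (nat, 'a) fn set) {0} (Suc d * ?B d + ?B (Suc d))"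
  proof (rule hle_add[OF Suc forms])
   fix f :: "(nat, 'a) fn" assume "f : pfun {..<m} {..Suc d}"
   then have "f : pfun {..<m} ({..d} \<union> {Suc d})" by (rule pfun_mono) auto
   then show "\<exists>a\<in>pfun {..<m} {..d}. \<exists>b\<in>pfun {..<m} {Suc d}. f = a + b" by (rule pfun_Un) blast
  qed auto
  then show ?case by (rule hle_mono) (use mult_le_mono2[OF B, of "Suc d"] in auto)
 qed
 then have cmp: "(m + d) choose m <= Suc d * ?B d" for d
  using hge_le_hle[OF lsub_singleton conjunct1[OF pfun_dim]] by blast
 have "m <= Suc s"
 proof (rule binomial_growth)
  fix d
  have "Suc d * ((s + (d + c)) choose s) <= Suc (s + (d + c)) * ((s + (d + c)) choose s)" by (intro mult_le_mono1) simp
  also have "... = Suc s * (Suc (s + (d + c)) choose Suc s)" using Suc_times_binomial_eq[of "s + (d + c)" s] by (simp add: mult.commute)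
  finally have "N * (Suc d * ((s + (d + c)) choose s)) <= N * (Suc s * (Suc (s + (d + c)) choose Suc s))" by (rule mult_le_mono2)
  moreover have "Suc (s + (d + c)) = 1 * d + c + Suc s" "m + d = d + m" by simp_all
  ultimately show "(d + m) choose m <= (N * Suc s) * ((1 * d + c + Suc s) choose Suc s)"
   using cmp[of d] by (simp only: ac_simps)
 qed
 then show False using m by simp
qed

context finite_cover
begin

text \<open>Translating \<open>x\<close> to the origin reduces to
  \<open>point_over_origin\<close>.\<close>

lemma hypersurface_image:
 assumes u: "u : polys UNIV" and F: "F : polys {..<Suc s}" "F ~= 0" "F x = 0"
  and dvd: "!!P. P : polys {..<Suc s} ==> sub (l(s := u)) P : van Y ==> \<exists>H\<in>polys {..<Suc s}. P = F * H"
 shows "\<exists>y\<in>Y. \<forall>i\<le>s. (l(s := u)) i y = x i"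
proof -
 let ?l = "%i. l i - cfun (x i)"
 interpret t: finite_cover Y ?l s by (rule translate)
 have v: "?l(s := u - cfun (x s)) = (%i. (l(s := u)) i - cfun (x i))" by auto
 obtain n :: nat and w where w: "!!j. j < n ==> w j : polys UNIV"
  "!!f. f : polys UNIV ==> \<exists>a. (\<forall>j<n. a j : polys {..<s}) \<and> f - (\<Sum>j<n. sub ?l (a j) * w j) : van Y"
  using t.generators by blast
 have inv: "trans (%i. - x i) (trans x P) = P" "trans x (trans (%i. - x i) P) = P" for P :: "(nat, 'a) fn"
  by (simp_all add: trans_trans trans_zero)
 have "trans x F ~= 0"
 proof
  assume "trans x F = 0"
  then have "F = trans (%i. - x i) 0" using inv(1)[of F] by simp
  then show False using F(2) by simp
 qed
 then interpret c: covered_hypersurface Y ?l s "u - cfun (x s)" "trans x F" n w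
 proof unfold_locales
  fix P assume P: "P : polys {..<Suc s}" "sub (?l(s := u - cfun (x s))) P : van Y"
  have "sub (?l(s := u - cfun (x s))) P = sub (l(s := u)) (trans (%i. - x i) P)"
   unfolding v by (simp add: fun_eq_iff sub_apply trans_apply ev)
  then obtain H where H: "H : polys {..<Suc s}" "trans (%i. - x i) P = F * H" using dvd[of "trans (%i. - x i) P"] P trans_polys by metis
  have "P = trans x F * trans x H" using arg_cong[OF H(2), of "trans x"] inv(2)[of P] by simp
  then show "\<exists>H\<in>polys {..<Suc s}. P = trans x F * H" using H(1) trans_polys by blast
 qed (use F u w trans_polys in "auto simp: trans_apply intro!: pfun_diff pfun_const")
 obtain y where "y : Y" "!!i. i <= s ==> (?l(s := u - cfun (x s))) i y = 0" using c.point_over_origin by blast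
 then show ?thesis unfolding v by (intro bexI[of _ y]) (simp_all add: ev del: fun_upd_apply)
qed

text \<open>The case \<open>u = 0\<close> of \<open>hypersurface_image\<close>, with affine
  \<open>s\<close>-space as the hyperplane \<open>coord s = 0\<close>.\<close>

lemma surjective: "\<exists>y\<in>Y. \<forall>i<s. l i y = b i"
proof -
 have "coord s (%_. 1) ~= (0 :: (nat, 'a) fn) (%_. 1)" by (simp add: ev)
 then have c0: "coord s ~= (0 :: (nat, 'a) fn)" by metis
 have "\<exists>y\<in>Y. \<forall>i\<le>s. (l(s := 0)) i y = (b(s := 0)) i"
 proof (rule hypersurface_image[of 0 "coord s"])
  fix P :: "(nat, 'a) fn" assume P: "P : polys {..<Suc s}" "sub (l(s := 0)) P : van Y"
  obtain C G where C: "C : polys {..<s}" "G : polys {..<Suc s}" "P = C + coord s * G" by (rule split_last[OF P(1)])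
  have "sub (l(s := 0)) C = sub l C" by (rule sub_cong[OF C(1)]) auto
  then have "sub l C : van Y" using P(2) by (simp add: C(3))
  then have "C = 0" using ind C(1) by (auto simp: alg_ind_def)
  then show "\<exists>H\<in>polys {..<Suc s}. P = coord s * H" using C by auto
 qed (use c0 in "auto simp: coord_apply intro: pfun_zero pfun_coord")
 then obtain y where y: "y : Y" "\<forall>i\<le>s. (l(s := 0)) i y = (b(s := 0)) i" by blast
 have "l i y = b i" if "i < s" for i using y(2)[rule_format, of i] that by simp
 then show ?thesis using y(1) by blast
qed

text \<open>The functions of degree less than \<open>k\<close> in the last variable are independent.\<close>
lemma degree_le_of_bound:
 assumes l1: "!!i. i < s ==> l i : pfun UNIV {..1}" and u: "u : pfun UNIV {..1}"
  and kr: "r : plt (polys {..<s}) (coord s) k"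
  and dvd: "!!P. P : polys {..<Suc s} ==> sub (l(s := u)) P : van Y ==> \<exists>H\<in>polys {..<Suc s}. P = (coord s ^ k + r) * H"
  and N: "!!t. hle (pfun UNIV {..t}) (van Y) (N * ((s + (t + c)) choose s))"
 shows "k <= N"
proof -
 let ?T = "coord s :: (nat, 'a) fn" and ?A = "polys {..<s} :: (nat, 'a) fn set" and ?v = "l(s := u)"
 have AS: "polys ({..<Suc s} - {s}) = ?A" by (rule arg_cong[of _ _ polys]) auto
 define W where "W = (%j. {f. \<exists>P\<in>plt ?A ?T j. f - sub ?v P : van Y})"
 have W: "lsub (W j)" for j
 proof (rule lsubI)
  have "0 : plt ?A ?T j" unfolding plt_def by (auto intro!: exI[of _ "%_. 0"] pfun_zero)
  then show "0 : W j" using lsub_zero[OF van_lsub, of Y] unfolding W_def by force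
 next
  fix f g assume "f : W j" "g : W j"
  then obtain P Q where P: "P : plt ?A ?T j" "f - sub ?v P : van Y" and Q: "Q : plt ?A ?T j" "g - sub ?v Q : van Y"
   unfolding W_def by blast
  have "P + Q : plt ?A ?T j" by (rule plt_add[OF _ P(1) Q(1)]) (auto intro: pfun_add)
  moreover have "(f - sub ?v P) + (g - sub ?v Q) : van Y" using P(2) Q(2) by (rule lsub_add[OF van_lsub])
  then have "f + g - sub ?v (P + Q) : van Y" by (simp add: algebra_simps)
  ultimately show "f + g : W j" unfolding W_def by blast
 next
  fix d f assume "f : W j"
  then obtain P where P: "P : plt ?A ?T j" "f - sub ?v P : van Y" unfolding W_def by blast
  have "cfun d * P : plt ?A ?T j" by (rule plt_scale[OF _ P(1)]) (auto intro: polys_mult pfun_const)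
  moreover have "cfun d * (f - sub ?v P) : van Y" using P(2) by (rule van_mult)
  then have "cfun d * f - sub ?v (cfun d * P) : van Y" by (simp add: algebra_simps)
  ultimately show "cfun d * f : W j" unfolding W_def by blast
 qed
 have vanW: "van Y <= W j" for j
 proof
  fix f assume "f : van Y"
  moreover have "0 : plt ?A ?T j" unfolding plt_def by (auto intro!: exI[of _ "%_. 0"] pfun_zero)
  ultimately show "f : W j" unfolding W_def by (intro CollectI bexI[of _ 0]) auto
 qed
 \<comment> \<open>A relation of degree \<open>j < k\<close> in the last variable would be a
   multiple of a monic polynomial of degree \<open>k\<close>; on each vertical line this forces it
   to be zero.\<close>
 have indep: "rh = 0" if rh: "rh : ?A" "u ^ j * sub l rh : W j" and j: "j < k" for rh j
 proof
  obtain P where P: "P : plt ?A ?T j" "u ^ j * sub l rh - sub ?v P : van Y" using rh(2) unfolding W_def by blast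
  have "rh : polys {..<Suc s}" using rh(1) by (rule pfun_mono) auto
  then have R: "?T ^ j * rh - P : polys {..<Suc s}"
   using P(1) by (auto simp: plt_def intro!: pfun_diff pfun_sum polys_mult polys_power pfun_coord intro: pfun_mono)
  have "sub ?v rh = sub l rh" by (rule sub_cong[OF rh(1)]) auto
  then obtain H where H: "H : polys {..<Suc s}" "?T ^ j * rh - P = (?T ^ k + r) * H" using dvd[OF R] P(2) by auto
  fix x
  obtain pF where pF: "pF ~= 0" "!!t. (?T ^ k + r) (x(s := t)) = poly pF t" "degree pF = k" using monic_section[OF kr] by blast
  obtain nH where "H : plt ?A ?T nH" using polys_plt[OF H(1), of s] unfolding AS by blast
  then obtain pH where pH: "!!t. H (x(s := t)) = poly pH t" using plt_poly[of H "{..<Suc s}" s nH x] unfolding AS by blast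
  obtain pP where pP: "j > 0 ==> degree pP < j" "j = 0 ==> pP = 0" "!!t. P (x(s := t)) = poly pP t"
   using plt_poly[of P "{..<Suc s}" s j x] P(1) unfolding AS by blast
  have rhx: "rh (x(s := t)) = rh x" for t by (rule pfun_cong[OF rh(1)]) auto
  let ?p = "Polynomial.monom (rh x) j - pP"
  have "poly (?p - pF * pH) t = 0" for t
   using fun_cong[OF H(2), of "x(s := t)"] pF(2)[of t] pH[of t] pP(3)[of t] rhx[of t] by (simp add: ev poly_monom mult.commute)
  then have "?p - pF * pH = 0" by (rule poly_zero_if_all_roots)
  then have "pF dvd ?p" by simp
  moreover have "degree ?p <= j" using pP(1,2) by (cases "j = 0") (auto intro!: degree_diff_le simp: degree_monom_le monom_0)
  ultimately have "?p = 0" using pF(3) j dvd_imp_degree_le[of pF ?p] by fastforce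
  then have "poly.coeff ?p j = 0" by (simp only: coeff_0)
  then show "rh x = 0 x" using pP(1,2) by (cases "j = 0") (auto simp: coeff_eq_0 ev)
 qed
 have count: "j <= k ==> hge (sub ?v ` plt (pfun {..<s} {..M}) ?T j) (van Y) (j * ((s + M) choose s))" for j M
 proof (induction j)
  case 0 then show ?case by (simp add: hge_def indep_mod_def)
 next
  case (Suc j)
  let ?V1 = "(%rh. u ^ j * sub l rh) ` pfun {..<s} {..M}"
  let ?V = "%j. sub ?v ` plt (pfun {..<s} {..M}) ?T j"
  have "hge (?V (Suc j)) (van Y) (((s + M) choose s) + j * ((s + M) choose s))"
  proof (rule hge_add)
   show "hge ?V1 (W j) ((s + M) choose s)"
   proof (rule hge_image[OF conjunct1[OF pfun_dim]])
    fix rh :: "(nat, 'a) fn" assume "rh : pfun {..<s} {..M}" "u ^ j * sub l rh : W j"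
    then show "rh : {0}" using indep[OF pfun_polys, of rh "{..M}" j] Suc.prems by simp
   qed (auto simp: algebra_simps)
   show "hge (?V j) (van Y) (j * ((s + M) choose s))" using Suc.prems by (intro Suc.IH) simp
   show "?V1 <= ?V (Suc j)"
   proof (rule image_subsetI)
    fix rh :: "(nat, 'a) fn" assume rh: "rh : pfun {..<s} {..M}"
    have "(\<Sum>i<Suc j. (if i = j then rh else 0) * ?T ^ i) : plt (pfun {..<s} {..M}) ?T (Suc j)"
     by (rule pltI) (use rh pfun_zero in auto)
    note P = this
    have "sub ?v rh = sub l rh" by (rule sub_cong[OF rh]) auto
    then have "sub ?v (\<Sum>i<Suc j. (if i = j then rh else 0) * ?T ^ i) = u ^ j * sub l rh" by (simp add: mult.commute)
    with imageI[OF P, of "sub ?v"] show "u ^ j * sub l rh : ?V (Suc j)" by (simp only:)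
   qed
   show "?V j <= ?V (Suc j)" by (intro image_mono subsetI, erule plt_mono) (simp_all add: pfun_zero)
   show "?V j <= W j"
   proof (rule image_subsetI)
    fix P assume "P : plt (pfun {..<s} {..M}) ?T j"
    then have "P : plt ?A ?T j" by (auto simp: plt_def intro: pfun_polys)
    then show "sub ?v P : W j" unfolding W_def using lsub_zero[OF van_lsub, of Y] by force
   qed
  qed (rule W vanW)+
  then show ?case by (simp only: mult_Suc)
 qed
 have "k <= N * 1 ^ s"
 proof (rule binomial_limit)
  fix M
  have "sub ?v ` plt (pfun {..<s} {..M}) ?T k <= pfun UNIV {..M + k}"
  proof (rule image_subsetI)
   fix P assume "P : plt (pfun {..<s} {..M}) ?T k"
   then obtain a where a: "P = (\<Sum>i<k. a i * ?T ^ i)" "!!i. a i : pfun {..<s} {..M}" by (auto simp: plt_def)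
   have "sub ?v (a i) * u ^ i : pfun UNIV {..M + k}" if "i < k" for i
   proof (rule pfun_mult)
    show "sub ?v (a i) : pfun UNIV {..M}" by (rule sub_pfun_le1[OF a(2)]) (use l1 in auto)
    show "u ^ i : pfun UNIV {..i * 1}" by (rule pfun_power_le[OF u])
   qed (use that in auto)
   then show "sub ?v P : pfun UNIV {..M + k}" by (auto simp: a(1) intro!: pfun_sum)
  qed
  then have "hge (pfun UNIV {..M + k}) (van Y) (k * ((s + M) choose s))" by (rule hge_mono[OF count[OF order.refl]]) auto
  then have "k * ((s + M) choose s) <= N * ((s + ((M + k) + c)) choose s)" using N by (rule hge_le_hle[OF van_lsub])
  then show "k * ((M + s) choose s) <= N * ((1 * M + (k + c) + s) choose s)" by (simp add: ac_simps)
 qed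
 then show ?thesis by simp
qed

end

text \<open>Comparison of top forms: a monic divisor of a polynomial that is regular in the last variable is itself regular.\<close>
lemma regular_divisor:
 fixes F H G :: "(nat, 'a::alg_closed_field) fn"
 assumes r: "r : plt (polys {..<s}) (coord s) k" and F: "F = coord s ^ k + r"
  and H: "H : polys {..<Suc s}" and GFH: "sub (tilt xi s) G = F * H"
  and G: "G : pfun {..<Suc s} {..e}" "g : pfun {..<Suc s} {e}" "G - g : pfun {..<Suc s} {..<e}" and xi: "xi s = 1" "g xi ~= 0"
 shows "F : pfun {..<Suc s} {..k}"
proof -
 have Fp: "F : polys {..<Suc s}" "F ~= 0" using monic_polys[OF r] monic_nonzero[OF r] by (simp_all add: F)
 let ?z = "%t. (%_. 0)(s := t) :: nat => 'a"
 obtain p1 where p1: "e > 0 --> degree p1 < e" "e = 0 --> p1 = 0" "!!t. (G - g) (%j. 0 + t * xi j) = poly p1 t"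
 proof (cases e)
  case 0
  then have "G - g = 0" using G(3) pfun_empty_degrees[of "G - g"] by simp
  then show ?thesis using that[of 0] 0 by (simp add: ev)
 next
  case (Suc e')
  then have "G - g : pfun {..<Suc s} {..e'}" using G(3) by (simp add: lessThan_Suc_atMost)
  then obtain p where "degree p <= e'" "!!t. (G - g) (%j. 0 + t * xi j) = poly p t"
   by (rule pfun_line[where x = "%_. 0" and v = xi]) blast
  then show ?thesis using that[of p] Suc by simp
 qed
 have Gz: "sub (tilt xi s) G (?z t) = poly (Polynomial.monom (g xi) e + p1) t" for t
 proof -
  have "sub (tilt xi s) G (?z t) = G (%j. t * xi j)"
   unfolding sub_apply by (rule arg_cong[of _ _ G]) (auto simp: fun_eq_iff tilt_def ev xi)
  also have "... = g (%j. t * xi j) + (G - g) (%j. 0 + t * xi j)" by (simp add: ev)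
  finally show ?thesis using pfun_hom[OF G(2), of t xi] p1(3)[of t] by (simp add: poly_monom)
 qed
 have degG: "degree (Polynomial.monom (g xi) e + p1) = e" using p1(1,2) xi(2)
  by (cases "e = 0") (auto simp: degree_add_eq_left degree_monom_eq)
 have "poly.coeff (Polynomial.monom (g xi) e + p1) e = g xi" using p1(1,2) by (cases "e = 0") (auto simp: coeff_eq_0)
 then have G0: "Polynomial.monom (g xi) e + p1 ~= 0" using xi(2) by (metis coeff_0)
 have "H ~= 0"
 proof
  assume "H = 0"
  then have "poly (Polynomial.monom (g xi) e + p1) t = 0" for t using Gz[of t] GFH by (simp add: ev)
  then show False using G0 poly_zero_if_all_roots by blast
 qed
 obtain dF F1 where F1: "F : pfun {..<Suc s} {..dF}" "F1 : pfun {..<Suc s} {dF}" "F1 ~= 0" "F - F1 : pfun {..<Suc s} {..<dF}"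
  by (rule top_form[OF Fp])
 obtain dH H1 where H1: "H : pfun {..<Suc s} {..dH}" "H1 : pfun {..<Suc s} {dH}" "H1 ~= 0" "H - H1 : pfun {..<Suc s} {..<dH}"
  by (rule top_form[OF H `H ~= 0`])
 obtain pF where pF: "pF ~= 0" "!!t. F (?z t) = poly pF t" "degree pF = k" using monic_section[OF r] unfolding F by blast
 let ?\<epsilon> = "%j. if j = s then 1 else 0 :: 'a"
 obtain q where q: "degree q <= dH" "!!t. H (%i. 0 + t * ?\<epsilon> i) = poly q t"
  by (rule pfun_line[OF H1(1), where x = "%_. 0" and v = ?\<epsilon>]) blast
 have z: "(%i. 0 + t * ?\<epsilon> i) = ?z t" for t by auto
 have "poly (Polynomial.monom (g xi) e + p1 - pF * q) t = 0" for t
  using Gz[of t] pF(2)[of t] q(2)[of t] unfolding z GFH by (simp add: ev del: fun_upd_apply)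
 then have eq: "Polynomial.monom (g xi) e + p1 = pF * q" using poly_zero_if_all_roots by (metis eq_iff_diff_eq_0)
 then have "q ~= 0" using G0 by auto
 then have "e = k + degree q" using degG pF eq by (simp add: degree_mult_eq)
 then have 1: "e <= k + dH" using q(1) by simp
 \<comment> \<open>The product of the top forms is nonzero, so degrees of factors add up; with
   \<open>e <= k + dH\<close> this gives \<open>dF <= k\<close>.\<close>
 have "dF + dH <= e"
 proof (rule ccontr)
  assume big: "\<not> ?thesis"
  have "sub (tilt xi s) G : pfun {..<Suc s} {..e}" by (rule sub_tilt_pfun[OF G(1)]) simp
  then have a: "F * H : pfun {..<Suc s} {..<dF + dH}" unfolding GFH by (rule pfun_mono) (use big in auto)
  have b: "(F - F1) * H : pfun {..<Suc s} {..<dF + dH}" by (rule pfun_mult[OF F1(4) H1(1)]) auto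
  have c: "F1 * (H - H1) : pfun {..<Suc s} {..<dF + dH}" by (rule pfun_mult[OF F1(2) H1(4)]) auto
  have "F1 * H1 = F * H - (F - F1) * H - F1 * (H - H1)" by (simp add: algebra_simps)
  then have "F1 * H1 : pfun {..<Suc s} {..<dF + dH}" using pfun_diff[OF pfun_diff[OF a b] c] by simp
  then have "F1 * H1 = 0" using pfun_top_unique[OF pfun_mult_eq[OF F1(2) H1(2)]] by blast
  then show False using polys_domain[OF pfun_polys[OF F1(2)] pfun_polys[OF H1(2)]] F1(3) H1(3) by blast
 qed
 then show ?thesis using F1(1) 1 by (auto intro: pfun_mono)
qed

text \<open>A generic projection to an affine space of dimension \<open>s + 1\<close> separates \<open>x0\<close> from \<open>Z\<close>; the image of \<open>Z\<close>
 is a hypersurface whose equation is the minimal polynomial of the last coordinate.\<close>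
theorem separating_hypersurface:
 fixes Z :: "('n::finite => 'a::alg_closed_field) set"
 assumes p: "Factorial_Ring.prime CHAR('a)" and Z: "zprime Z" "zclosed Z" "dim_is Z s" and x0: "x0 ~: Z"
  and N: "!!t. hle (pfun UNIV {..t}) (van Z) (N * ((s + (t + c)) choose s))"
 obtains f where "f : pfun UNIV {..N}" "f : van Z" "f x0 ~= 0"
proof -
 let ?n = "card (UNIV :: 'n set)"
 define sepd where "sepd = (%v (m::nat). \<forall>z\<in>Z. \<exists>i<m. v i z ~= (v i x0 :: 'a))"
 have nodim: "\<not> alg_ind Z v m" if "normal_forms {Z} v m" "m > s" for v m
  using normal_forms_dim_is[OF that(1), of Z] dim_is_unique[OF Z(3)] that(2) by force
 \<comment> \<open>Forms are removed while more than \<open>s + 1\<close> remain; a direction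
   outside the cone over \<open>Z\<close> with vertex \<open>x0\<close> keeps the image of
   \<open>x0\<close> off that of \<open>Z\<close>.\<close>
 have red: "\<exists>v. normal_forms {Z} v (Suc s) \<and> sepd v (Suc s)" if "normal_forms {Z} v m" "sepd v m" "m \<ge> Suc s" for v m
  using that
 proof (induction m arbitrary: v)
  case (Suc m)
  show ?case
  proof (cases "m = s")
   case True then show ?thesis using Suc.prems by blast
  next
   case False
   then have m: "Suc m > Suc s" using Suc.prems(3) by simp
   have v: "v i : pfun UNIV {..1}" if "i < Suc m" for i using Suc.prems(1) that by (auto simp: normal_forms_def intro: pfun_mono)
   obtain k ga where ga: "ga : pfun {..<Suc m} {k}" "ga ~= 0" "!!z. z : Z ==> ga (%i. v i z - v i x0) = 0"
    by (rule cone_form[OF v N m, where x = "%i. v i x0"]) blast+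
   obtain xi where xi: "xi m = 1" "ga xi ~= 0" "normal_forms {Z} (%i. v i - cfun (xi i) * v m) m"
    using normalization_step[OF p _ _ Suc.prems(1), of "{ga}"] nodim[OF Suc.prems(1)] m Z(1) ga(1,2) by auto
   have "sepd (%i. v i - cfun (xi i) * v m) m"
    unfolding sepd_def
   proof (intro ballI, rule ccontr)
    fix z assume z: "z : Z" and eq: "\<not> (\<exists>i<m. (v i - cfun (xi i) * v m) z ~= (v i - cfun (xi i) * v m) x0)"
    define d where "d = v m z - v m x0"
    have d: "v i z - v i x0 = d * xi i" if "i < Suc m" for i
    proof (cases "i = m")
     case True then show ?thesis by (simp add: d_def xi(1))
    next
     case False
     then have "(v i - cfun (xi i) * v m) z = (v i - cfun (xi i) * v m) x0" using eq that by simp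
     then show ?thesis by (simp add: d_def ev algebra_simps)
    qed
    have "ga (%i. v i z - v i x0) = ga (%i. d * xi i)" by (rule pfun_cong[OF ga(1)]) (use d in auto)
    then have "d ^ k * ga xi = 0" using ga(3)[OF z] pfun_hom[OF ga(1)] by simp
    then have "d = 0" using xi(2) by simp
    then have "\<forall>i<Suc m. v i z = v i x0" using d by simp
    then show False using Suc.prems(2) z by (auto simp: sepd_def)
   qed
   then show ?thesis using Suc.IH[OF xi(3)] m by simp
  qed
 qed simp
 obtain P where P: "P <= polys UNIV" "Z = {x. \<forall>f\<in>P. f x = 0}" using Z(2) by (auto simp: zclosed_def)
 obtain f0 where f0: "f0 : polys UNIV" "f0 : van Z" "f0 x0 ~= 0" using x0 P by (auto simp: van_def)
 obtain e where e: "bij_betw e {..<?n} (UNIV :: 'n set)" "normal_forms {Z} (%i. coord (e i)) ?n"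
  using coord_forms[of "{Z}"] Z(1) by blast
 let ?d = "inv_into {..<?n} e"
 have ed: "e (?d j) = j" "?d j < ?n" for j
  using e(1) inv_into_into[of j e "{..<?n}"] by (auto simp: bij_betw_def f_inv_into_f)
 have "sepd (%i. coord (e i)) ?n" unfolding sepd_def
 proof
  fix z assume "z : Z"
  then obtain j where "z j ~= x0 j" using x0 by (metis ext)
  then show "\<exists>i<?n. coord (e i) z ~= coord (e i) x0" using ed[of j] by (intro exI[of _ "?d j"]) (simp add: coord_apply)
 qed
 \<comment> \<open>A nonzero polynomial vanishes on \<open>Z\<close>, so \<open>s\<close> is smaller
   than the number of coordinates and at least \<open>s + 1\<close> forms are available at the
   start.\<close>
 moreover have "\<not> alg_ind Z (%i. coord (e i)) ?n"
 proof
  assume ai: "alg_ind Z (%i. coord (e i)) ?n"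
  have 1: "sub (%j. coord (?d j)) f0 : polys {..<?n}" by (rule sub_polys[OF f0(1)]) (use ed in "auto intro: pfun_coord")
  have 2: "sub (%i. coord (e i)) (sub (%j. coord (?d j)) f0) = f0" by (simp add: fun_eq_iff sub_apply ed coord_apply)
  then have "sub (%j. coord (?d j)) f0 = 0" using ai 1 f0(2) by (simp add: alg_ind_def)
  then have "f0 = 0" using 2 by simp
  then show False using f0(3) by (simp add: ev)
 qed
 then have "s ~= ?n" using normal_forms_dim_is e(2) alg_ind_of_dim[OF p Z(1)] Z(3) by (auto simp: normal_forms_def dim_is_def)
 moreover obtain s' where "dim_is Z s'" "s' <= ?n" by (rule dim_exists[OF p Z(1)])
 ultimately obtain v where v: "normal_forms {Z} v (Suc s)" "sepd v (Suc s)"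
  using red[OF e(2)] dim_is_unique[OF Z(3)] by force
 have dep: "\<not> alg_ind Z v (Suc s)" using nodim[OF v(1)] by simp
 have "Z ~= {}" using Z(1) by (simp add: zprime_def)
 then obtain e G g where G: "G : pfun {..<Suc s} {..e}" "sub v G : van Z" "g : pfun {..<Suc s} {e}" "g ~= 0"
  "G - g : pfun {..<Suc s} {..<e}" using minimal_relation[OF _ dep] by metis
 obtain xi where xi: "xi s = 1" "g xi ~= 0" "normal_forms {Z} (%i. v i - cfun (xi i) * v s) s"
  using normalization_step[OF p _ _ v(1), of "{g}"] dep Z(1) G(3,4) by auto
 define l where "l = (%i. v i - cfun (xi i) * v s)"
 have v1: "v i : pfun UNIV {..1}" if "i < Suc s" for i using v(1) that by (auto simp: normal_forms_def intro: pfun_mono)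
 have l1: "l i : pfun UNIV {..1}" if "i < s" for i using v1[of i] v1[of s] that by (auto simp: l_def intro!: pfun_diff pfun_scale)
 have nf: "normal_forms {Z} l s" using xi(3) by (simp add: l_def)
 interpret finite_cover Z l s
  by unfold_locales (use Z nf l1 alg_ind_of_dim[OF p Z(1), of l s] in "auto simp: normal_forms_def dim_is_def intro: pfun_polys")
 have up: "v s : polys UNIV" using v1[of s] by (auto intro: pfun_polys)
 obtain k r where kr: "r : plt (polys {..<s}) (coord s) k" "sub (l(s := v s)) (coord s ^ k + r) : van Z"
  "!!P. P : polys {..<Suc s} ==> sub (l(s := v s)) P : van Z ==> \<exists>H\<in>polys {..<Suc s}. P = (coord s ^ k + r) * H"
  by (rule minimal_polynomial[OF up]) blast
 let ?F = "coord s ^ k + r"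
 have "sub (l(s := v s)) (sub (tilt xi s) G) = sub v G" unfolding l_def by (rule sub_untilt[OF G(1), symmetric])
 moreover have "sub (tilt xi s) G : polys {..<Suc s}" by (rule sub_tilt_pfun[OF pfun_polys[OF G(1)]]) simp
 ultimately obtain H where H: "H : polys {..<Suc s}" "sub (tilt xi s) G = ?F * H" using kr(3) G(2) by metis
 have "?F : pfun {..<Suc s} {..k}" by (rule regular_divisor[OF kr(1) refl H G(1,3,5) xi(1,2)])
 moreover have "k <= N" by (rule degree_le_of_bound[OF l1 v1 kr(1,3) N]) auto
 ultimately have "?F : pfun {..<Suc s} {..N}" by (auto intro: pfun_mono)
 then have "sub (l(s := v s)) ?F : pfun UNIV {..N}"
  by (rule sub_pfun_le1) (use l1 v1[of s] in "auto simp: less_Suc_eq")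
 \<comment> \<open>\<open>Z\<close> maps onto the hypersurface, so a zero at \<open>x0\<close> would
   give a point of \<open>Z\<close> with the same image as \<open>x0\<close>.\<close>
 moreover have "sub (l(s := v s)) ?F x0 ~= 0"
 proof
  assume "sub (l(s := v s)) ?F x0 = 0"
  then have "?F (%i. (l(s := v s)) i x0) = 0" by (simp only: sub_apply)
  from hypersurface_image[OF up monic_polys[OF kr(1)] monic_nonzero[OF kr(1)] this kr(3)]
  obtain z where z: "z : Z" "!!i. i <= s ==> (l(s := v s)) i z = (l(s := v s)) i x0" by blast
  have vs: "v s z = v s x0" using z(2)[of s] by simp
  have "v i z = v i x0" if "i < Suc s" for i
   using z(2)[of i] vs that by (cases "i = s") (auto simp: l_def ev)
  then show False using v(2) z(1) by (auto simp: sepd_def)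
 qed
 ultimately show ?thesis using that kr(2) by blast
qed

section \<open>Irreducible components\<close>

definition ideal_of :: "'r::comm_ring_1 set => 'r set => bool" where
 "ideal_of A I \<longleftrightarrow> I <= A \<and> 0 : I \<and> (\<forall>x\<in>I. \<forall>y\<in>I. x - y : I) \<and> (\<forall>a\<in>A. \<forall>x\<in>I. a * x : I)"

definition noeth :: "'r::comm_ring_1 set => bool" where
 "noeth A \<longleftrightarrow> (\<forall>I. (\<forall>n::nat. ideal_of A (I n) \<and> I n <= I (Suc n)) --> (\<exists>N. \<forall>n\<ge>N. I n = I N))"

text \<open>Hilbert's basis theorem, by comparing the ideals of leading coefficients in each degree.\<close>
lemma noeth_polynomials:
 fixes A B :: "'r::comm_ring_1 set"
 assumes A: "noeth A" "0 : A" and Acl: "!!x y. x : A ==> y : A ==> x - y : A \<and> x * y : A"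
  and AB: "A <= B" "T : B" and BT: "!!f. f : B ==> \<exists>n. f : plt A T n"
 shows "noeth B"
 unfolding noeth_def
proof (intro allI impI)
 fix I :: "nat => 'r set" assume I: "\<forall>n. ideal_of B (I n) \<and> I n <= I (Suc n)"
 have Imono: "I m <= I n" if "m <= n" for m n by (rule lift_Suc_mono_le[of I, OF _ that]) (use I in blast)
 have In: "0 : I n" "x : I n ==> y : I n ==> x - y : I n" "b : B ==> x : I n ==> b * x : I n" "x : I n ==> x : B" for n x y b
  using I by (auto simp: ideal_of_def)
 have p0: "0 : plt A T k" for k using A(2) by (auto simp: plt_def intro!: exI[of _ "%_. 0"])
 have pd: "x - y : plt A T k" if xy: "x : plt A T k" "y : plt A T k" for x y k
 proof -
  obtain b d where b: "x = (\<Sum>i<k. b i * T ^ i)" "!!i. b i : A" "y = (\<Sum>i<k. d i * T ^ i)" "!!i. d i : A"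
   using xy unfolding plt_def by blast
  then show ?thesis using Acl by (auto simp: plt_def left_diff_distrib sum_subtractf intro!: exI[of _ "%i. b i - d i"])
 qed
 \<comment> \<open>The coefficients of \<open>T ^ k\<close> in elements of \<open>I n\<close> of
   degree at most \<open>k\<close>; these ideals increase in both indices.\<close>
 define L where "L = (%k n. {a : A. \<exists>r\<in>plt A T k. a * T ^ k + r : I n})"
 have L_ideal: "ideal_of A (L k n)" for k n unfolding ideal_of_def
 proof (intro conjI ballI)
  show "0 : L k n" using A(2) p0 In(1) by (auto simp: L_def intro!: bexI[of _ 0])
  fix x assume "x : L k n"
  then obtain r where r: "x : A" "r : plt A T k" "x * T ^ k + r : I n" by (auto simp: L_def)
  {
   fix y assume "y : L k n"
   then obtain r' where r': "y : A" "r' : plt A T k" "y * T ^ k + r' : I n" by (auto simp: L_def)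
   have "(x - y) * T ^ k + (r - r') = (x * T ^ k + r) - (y * T ^ k + r')" by (simp add: algebra_simps)
   then have "(x - y) * T ^ k + (r - r') : I n" using In(2)[OF r(3) r'(3)] by (simp only:)
   then show "x - y : L k n" using r r' Acl pd by (auto simp: L_def)
  next
   fix a assume a: "a : A"
   have "a * r : plt A T k" by (rule plt_scale[OF _ r(2) a]) (use Acl in blast)
   moreover have "a * x * T ^ k + a * r : I n" using In(3)[OF _ r(3), of a] a AB(1) by (auto simp: distrib_left mult.assoc)
   ultimately show "a * x : L k n" using r(1) a Acl by (auto simp: L_def)
  }
 qed (auto simp: L_def)
 have Lmono: "L k n <= L k' n'" if "k <= k'" "n <= n'" for k k' n n'
 proof -
  have "L k n <= L k n'" using Imono[OF that(2)] unfolding L_def by blast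
  moreover have "L j n' <= L (Suc j) n'" for j
  proof
   fix a assume "a : L j n'"
   then obtain r where r: "a : A" "r : plt A T j" "a * T ^ j + r : I n'" by (auto simp: L_def)
   have "T ^ 1 * r : plt A T (1 + j)" using A(2) r(2) by (rule plt_shift)
   moreover have "T * (a * T ^ j + r) : I n'" using In(3) AB(2) r(3) by blast
   ultimately show "a : L (Suc j) n'" using r(1) by (auto simp: L_def algebra_simps intro!: bexI[of _ "T * r"])
  qed
  then have "L k n' <= L k' n'" using that(1) lift_Suc_mono_le[of "%j. L j n'" k k'] by blast
  ultimately show ?thesis by blast
 qed
 have stable: "\<exists>N. \<forall>n\<ge>N. J n = J N" if "!!n. ideal_of A (J n)" "!!n. J n <= J (Suc n)" for J :: "nat => 'r set"
  using A(1) that unfolding noeth_def by blast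
 \<comment> \<open>The diagonal sequence handles all degrees from \<open>N\<close> on at once; the
   finitely many smaller degrees stabilize separately.\<close>
 obtain N where N: "!!m. m \<ge> N ==> L m m = L N N" using stable[of "%m. L m m"] L_ideal Lmono by auto
 have "\<exists>M. \<forall>n\<ge>M. L k n = L k M" for k by (rule stable) (use L_ideal Lmono in auto)
 then obtain M where M: "!!k n. n \<ge> M k ==> L k n = L k (M k)" by metis
 define R where "R = Max (insert N (M ` {..<N}))"
 have R: "N <= R" "k < N ==> M k <= R" for k by (auto simp: R_def)
 have LR: "L k n = L k R" if n: "n \<ge> R" for k n
 proof (cases "k < N")
  case True
  then have "M k <= R" by (rule R(2))
  then show ?thesis using M[of k n] M[of k R] n by simp
 next
  case False
  have "L k j = L N N" if "j \<ge> R" for j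
  proof
   have "L k j <= L (max k j) (max k j)" by (rule Lmono) auto
   then show "L k j <= L N N" using N[of "max k j"] False by auto
   show "L N N <= L k j" by (rule Lmono) (use False R(1) that in auto)
  qed
  then show ?thesis using n by simp
 qed
 have "I n = I R" if n: "n \<ge> R" for n
 proof
  \<comment> \<open>Subtracting an element of \<open>I R\<close> with the same leading coefficient
    lowers the degree.\<close>
  have "f : plt A T d ==> f : I n ==> f : I R" for f d
  proof (induction d arbitrary: f)
   case 0 then show ?case using In(1) by (simp add: plt_def)
  next
   case (Suc d)
   obtain a where a: "f = (\<Sum>k<Suc d. a k * T ^ k)" "!!k. a k : A" using Suc.prems(1) by (auto simp: plt_def)
   define r where "r = (\<Sum>k<d. a k * T ^ k)"
   have r: "r : plt A T d" "f = a d * T ^ d + r" using a by (auto simp: r_def plt_def)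
   then have "a d : L d R" using LR[OF n, of d] a(2) Suc.prems(2) by (auto simp: L_def)
   then obtain r' where r': "r' : plt A T d" "a d * T ^ d + r' : I R" by (auto simp: L_def)
   have "f - (a d * T ^ d + r') : I n" by (rule In(2)[OF Suc.prems(2) subsetD[OF Imono[OF n] r'(2)]])
   then have "r - r' : I n" by (simp add: r(2))
   then have "r - r' : I R" by (rule Suc.IH[OF pd[OF r(1) r'(1)]])
   then have "(r - r') - (0 - (a d * T ^ d + r')) : I R" by (rule In(2)[OF _ In(2)[OF In(1) r'(2)]])
   then show ?case by (simp add: r(2) add.commute)
  qed
  then show "I n <= I R" using BT[OF In(4)] by (meson subsetI)
 qed (rule Imono[OF n])
 then show "\<exists>N. \<forall>n\<ge>N. I n = I N" by blast
qed

lemma noeth_polys: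
 assumes "finite I" shows "noeth (polys I :: ('i, 'a::field) fn set)"
 using assms
proof (induction rule: finite_induct)
 case empty
 show ?case unfolding noeth_def
 proof (intro allI impI)
  fix I :: "nat => ('i, 'a) fn set" assume I: "\<forall>n. ideal_of (polys {}) (I n) \<and> I n <= I (Suc n)"
  have full: "I n = polys {}" if f: "f : I n" "f ~= 0" for n f
  proof
   show "I n <= polys {}" using I by (simp add: ideal_of_def)
   have "f : polys {}" using f(1) `I n <= polys {}` by blast
   then obtain c where c: "f = cfun c" using pfun_no_vars by metis
   then have c0: "c ~= 0" using f(2) by (auto simp: cfun_simps)
   show "polys {} <= I n"
   proof
    fix g :: "('i, 'a) fn" assume g: "g : polys {}"
    have "g * cfun (inverse c) : polys {}" using g by (intro polys_mult pfun_const) auto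
    then have "g * cfun (inverse c) * f : I n" using I f(1) unfolding ideal_of_def by blast
    moreover have "g * cfun (inverse c) * f = g" using c0 by (simp add: c fun_eq_iff ev)
     ultimately show "g : I n" by simp
   qed
  qed
  have mono: "I m <= I n" if "m <= n" for m n by (rule lift_Suc_mono_le[of I, OF _ that]) (use I in blast)
  show "\<exists>N. \<forall>n\<ge>N. I n = I N"
  proof (cases "\<exists>N. \<exists>f\<in>I N. f ~= 0")
   case True
   then obtain N f where "f : I N" "f ~= 0" by blast
   then have "I n = I N" if "N <= n" for n using full[of f n] full[of f N] mono[OF that] by auto
   then show ?thesis by (intro exI[of _ N]) blast
  next
   case False
   then have "I n = {0}" for n using I unfolding ideal_of_def by blast
   then show ?thesis by blast
  qed
 qed
next
 case (insert i I)
 show ?case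
 proof (rule noeth_polynomials[OF insert.IH, where T = "coord i"])
  show "\<exists>n. f : plt (polys I) (coord i) n" if "f : polys (insert i I)" for f :: "('i, 'a) fn"
  proof -
   have "polys (insert i I - {i}) = (polys I :: ('i, 'a) fn set)" using insert(2) by (intro arg_cong[of _ _ polys]) auto
   then show ?thesis using polys_plt[OF that, of i] by metis
  qed
 qed (auto intro: pfun_zero pfun_diff polys_mult pfun_coord pfun_mono)
qed

lemma zclosed_van:
 fixes E :: "('n => 'a::field) set"
 assumes "zclosed E" shows "E = {x. \<forall>f \<in> van E \<inter> polys UNIV. f x = 0}"
 using assms unfolding zclosed_def van_def by blast

section \<open>Decomposition into irreducible components\<close>

lemma zclosed_dcc:
 "wfp (%E Y. zclosed E \<and> zclosed Y \<and> E \<subset> (Y :: ('n::finite => 'a::field) set))"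
 unfolding wfp_def wf_iff_no_infinite_down_chain
proof
 assume "\<exists>E. \<forall>i. (E (Suc i), E i) : {(x, y). zclosed x \<and> zclosed y \<and> x \<subset> (y :: ('n => 'a) set)}"
 then have "\<exists>E. \<forall>i. zclosed (E (Suc i)) \<and> zclosed (E i) \<and> E (Suc i) \<subset> (E i :: ('n => 'a) set)" by simp
 then obtain E :: "nat => ('n => 'a) set" where E: "!!i. zclosed (E i)" "!!i. E (Suc i) \<subset> E i" by blast
 let ?I = "%i. van (E i) \<inter> polys UNIV"
 have "ideal_of (polys UNIV) (?I i) \<and> ?I i <= ?I (Suc i)" for i
  using E(2)[of i] by (auto simp: ideal_of_def van_def ev intro: pfun_zero pfun_diff polys_mult)
 moreover have "\<forall>I. (\<forall>n::nat. ideal_of (polys UNIV) (I n) \<and> I n <= I (Suc n)) --> (\<exists>N. \<forall>n\<ge>N. I n = (I N :: ('n, 'a) fn set))"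
  using noeth_polys[OF finite[of "UNIV :: 'n set"], where ?'a = 'a] by (simp only: noeth_def)
 from spec[OF this, of ?I] have "(\<forall>n. ideal_of (polys UNIV) (?I n) \<and> ?I n <= ?I (Suc n)) --> (\<exists>N. \<forall>n\<ge>N. ?I n = ?I N)" .
 ultimately have "\<exists>N. \<forall>n\<ge>N. ?I n = ?I N" by (simp only: simp_thms if_True)
 then obtain N where "\<forall>n\<ge>N. ?I n = ?I N" by (rule exE)
 then have eq: "?I (Suc N) = ?I N" by (elim allE[of _ "Suc N"]) (simp only: le_Suc_eq order.refl simp_thms)
 have e: "E i = {x. \<forall>f\<in>?I i. f x = 0}" for i by (rule zclosed_van[OF E(1)])
 have "E (Suc N) = E N" by (rule trans[OF e[of "Suc N"]]) (simp only: eq e[of N, symmetric])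
 then show False using E(2)[of N] by blast
qed

text \<open>Noetherian induction, for an arbitrary class \<open>C\<close> of closed sets, so that it
  applies over the algebraic closure and over the finite field alike.\<close>

lemma irreducible_decomposition:
 fixes C :: "('n::finite => 'a::field) set => bool"
 assumes "!!E. C E ==> zclosed E" and "C E"
 obtains \<Z> where "finite \<Z>" "E = \<Union>\<Z>"
  "!!Z. Z : \<Z> ==> C Z \<and> Z ~= {} \<and> (\<forall>V W. C V \<and> C W \<and> Z = V \<union> W --> Z = V \<or> Z = W)"
proof -
 let ?irr = "%Z. C Z \<and> Z ~= {} \<and> (\<forall>V W. C V \<and> C W \<and> Z = V \<union> W --> Z = V \<or> Z = W)"
 have "C E --> (\<exists>\<Z>. finite \<Z> \<and> E = \<Union>\<Z> \<and> (\<forall>Z\<in>\<Z>. ?irr Z))"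
 proof (induction E rule: wfp_induct_rule[OF zclosed_dcc])
  case (1 E)
  show ?case
  proof
   assume E: "C E"
   consider "E = {}" | "?irr E" | V W where "C V" "C W" "E = V \<union> W" "V \<subset> E" "W \<subset> E" using E by blast
   then show "\<exists>\<Z>. finite \<Z> \<and> E = \<Union>\<Z> \<and> (\<forall>Z\<in>\<Z>. ?irr Z)"
   proof cases
    case 1 then show ?thesis by (intro exI[of _ "{}"]) auto
   next
    case 2 then show ?thesis by (intro exI[of _ "{E}"]) auto
   next
    case (3 V W)
    then obtain \<V> \<W> where "finite \<V>" "V = \<Union>\<V>" "\<forall>Z\<in>\<V>. ?irr Z" "finite \<W>" "W = \<Union>\<W>" "\<forall>Z\<in>\<W>. ?irr Z"
     using "1.IH"[of V] "1.IH"[of W] assms(1) E by blast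
    then show ?thesis using 3(3) by (intro exI[of _ "\<V> \<union> \<W>"] conjI) (simp_all add: ball_Un)
   qed
  qed
 qed
 then show ?thesis using assms(2) that by blast
qed

definition irr :: "('x set => bool) => 'x set => bool" where
 "irr C Z \<longleftrightarrow> C Z \<and> Z ~= {} \<and> (\<forall>V W. C V \<and> C W \<and> Z = V \<union> W --> Z = V \<or> Z = W)"

lemma irrD: "irr C Z ==> C V ==> C W ==> Z = V \<union> W ==> Z = V \<or> Z = W"
 by (simp add: irr_def)

definition comps :: "('x set => bool) => 'x set => 'x set set" where
 "comps C S = {Z. Z <= S \<and> irr C Z \<and> (\<forall>W. irr C W \<and> Z <= W \<and> W <= S --> W = Z)}"

locale closed_class =
 fixes C :: "('n::finite => 'a::field) set => bool"
 assumes closed: "C V ==> zclosed V" and Un: "C V ==> C W ==> C (V \<union> W)"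
  and Int: "C V ==> C W ==> C (V \<inter> W)" and empty: "C {}"
begin

lemma Union: "finite \<Z> ==> (!!Z. Z : \<Z> ==> C Z) ==> C (\<Union>\<Z>)"
 by (induction \<Z> rule: finite_induct) (auto intro: Un empty)

lemma irr_Union:
 assumes "finite \<Z>" "irr C Y" "Y <= \<Union>\<Z>" "!!Z. Z : \<Z> ==> C Z"
 shows "\<exists>Z\<in>\<Z>. Y <= Z"
 using assms
proof (induction \<Z> rule: finite_induct)
 case empty then show ?case by (auto simp: irr_def)
next
 case (insert Z \<Z>)
 have "Y = (Y \<inter> Z) \<union> (Y \<inter> \<Union>\<Z>)" using insert.prems by auto
 moreover have "C (Y \<inter> Z)" "C (Y \<inter> \<Union>\<Z>)" using insert by (auto simp: irr_def intro!: Int Union)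
 ultimately have "Y = Y \<inter> Z \<or> Y = Y \<inter> \<Union>\<Z>" using insert.prems(1) unfolding irr_def by blast
 then show ?case
 proof
  assume "Y = Y \<inter> \<Union>\<Z>"
  then have "\<exists>Z\<in>\<Z>. Y <= Z" using insert by (intro insert.IH) auto
  then show ?thesis by blast
 qed blast
qed

lemma components:
 assumes "C S" shows "finite (comps C S)" "\<Union>(comps C S) = S"
proof -
 obtain \<Z> where \<Z>: "finite \<Z>" "S = \<Union>\<Z>" "!!Z. Z : \<Z> ==> irr C Z"
  using irreducible_decomposition[of C S] closed assms unfolding irr_def by blast
 have CZ: "C Z" if "Z : \<Z>" for Z using \<Z>(3)[OF that] by (simp add: irr_def)
 have "comps C S <= \<Z>"
 proof
  fix Y assume Y: "Y : comps C S"
  then obtain Z where Z: "Z : \<Z>" "Y <= Z" using irr_Union[OF \<Z>(1) _ _ CZ, of Y] \<Z>(2) by (auto simp: comps_def)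
  then have "Z = Y" using Y \<Z>(2) \<Z>(3)[OF Z(1)] unfolding comps_def by blast
  then show "Y : \<Z>" using Z(1) by simp
 qed
 then show "finite (comps C S)" using \<Z>(1) finite_subset by blast
 have "\<exists>W\<in>comps C S. Z <= W" if Z: "Z : \<Z>" for Z
 proof -
  have fin: "finite {W : \<Z>. Z <= W}" using \<Z>(1) by simp
  have "\<exists>W\<in>{W : \<Z>. Z <= W}. \<forall>W'\<in>{W : \<Z>. Z <= W}. W <= W' --> W = W'"
   by (rule finite_has_maximal[OF fin]) (use Z in auto)
  then obtain W where W: "W : \<Z>" "Z <= W" "!!W'. W' : \<Z> ==> Z <= W' ==> W <= W' ==> W = W'" by auto
  have "W' = W" if W': "irr C W'" "W <= W'" "W' <= S" for W'
  proof -
   obtain W'' where "W'' : \<Z>" "W' <= W''" using irr_Union[OF \<Z>(1) W'(1) _ CZ] W'(3) \<Z>(2) by auto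
   then show ?thesis using W(3)[of W''] W(2) W'(2) by blast
  qed
  then show ?thesis using W \<Z> by (intro bexI[of _ W]) (auto simp: comps_def)
 qed
 then have "S <= \<Union>(comps C S)" unfolding \<Z>(2) by blast
 moreover have "\<Union>(comps C S) <= S" by (auto simp: comps_def)
 ultimately show "\<Union>(comps C S) = S" by blast
qed

end

lemma zclosed_Collect: "P <= polys UNIV ==> zclosed {x. \<forall>f\<in>P. f x = 0}"
 by (auto simp: zclosed_def)

interpretation zc: closed_class "zclosed :: ('n::finite => 'a::field) set => bool"
proof
 fix V W :: "('n => 'a) set" assume "zclosed V" "zclosed W"
 then obtain P Q where P: "P <= polys UNIV" "V = {x. \<forall>f\<in>P. f x = 0}" "Q <= polys UNIV" "W = {x. \<forall>f\<in>Q. f x = 0}"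
  unfolding zclosed_def by blast
 let ?R = "(%(f, g). f * g) ` (P \<times> Q)"
 have "V \<union> W = {x. \<forall>f\<in>?R. f x = 0}" unfolding P(2,4)
 proof (intro equalityI subsetI)
  fix x assume *: "x : {x. \<forall>f\<in>?R. f x = 0}"
  show "x : {x. \<forall>f\<in>P. f x = 0} \<union> {x. \<forall>f\<in>Q. f x = 0}"
  proof (rule ccontr)
   assume "\<not> ?thesis"
   then obtain f g where "f : P" "f x ~= 0" "g : Q" "g x ~= 0" by blast
   then show False using * by (force simp: ev)
  qed
 qed (auto simp: ev)
 moreover have "?R <= polys UNIV" using P(1,3) by (auto intro: polys_mult)
 ultimately show "zclosed (V \<union> W)" using zclosed_Collect[of ?R] by simp
 have "V \<inter> W = {x. \<forall>f\<in>P \<union> Q. f x = 0}" unfolding P by auto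
 then show "zclosed (V \<inter> W)" using P zclosed_Collect[of "P \<union> Q"] by simp
next
 have "zclosed {x :: 'n => 'a. \<forall>f\<in>{1 :: ('n => 'a) => 'a}. f x = 0}" by (rule zclosed_Collect) (auto intro: pfun_one)
 then show "zclosed ({} :: ('n => 'a) set)" by (simp add: ev)
qed auto

lemma irr_zclosed_iff: "irr zclosed (Z :: ('n::finite => 'a::field) set) \<longleftrightarrow> zclosed Z \<and> zprime Z"
proof
 assume Z: "irr zclosed Z"
 have "f : van Z \<or> g : van Z" if fg: "f : polys UNIV" "g : polys UNIV" "f * g : van Z" for f g
 proof -
  have "zclosed (Z \<inter> {x. \<forall>h\<in>{f}. h x = 0})" "zclosed (Z \<inter> {x. \<forall>h\<in>{g}. h x = 0})"
   using Z fg by (auto simp: irr_def simp del: ball_simps intro!: zc.Int zclosed_Collect)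
  moreover have "Z = (Z \<inter> {x. \<forall>h\<in>{f}. h x = 0}) \<union> (Z \<inter> {x. \<forall>h\<in>{g}. h x = 0})" using fg(3) by (auto simp: van_def ev)
  ultimately have "Z = Z \<inter> {x. \<forall>h\<in>{f}. h x = 0} \<or> Z = Z \<inter> {x. \<forall>h\<in>{g}. h x = 0}"
   by (rule irrD[OF Z])
  then show ?thesis by (auto simp: van_def)
 qed
 then show "zclosed Z \<and> zprime Z" using Z by (auto simp: irr_def zprime_def)
next
 assume Z: "zclosed Z \<and> zprime Z"
 have "Z = V \<or> Z = W" if VW: "zclosed V" "zclosed W" "Z = V \<union> W" for V W
 proof (rule ccontr)
  assume neg: "\<not> ?thesis"
  obtain P Q where P: "P <= polys UNIV" "V = {x. \<forall>f\<in>P. f x = 0}" "Q <= polys UNIV" "W = {x. \<forall>f\<in>Q. f x = 0}"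
   using VW(1,2) unfolding zclosed_def by blast
  obtain x y where "x : Z" "x ~: V" "y : Z" "y ~: W" using neg VW(3) by blast
  then obtain f g where f: "f : P" "f x ~= 0" "g : Q" "g y ~= 0" unfolding P by blast
  have "f * g : van Z" using f P VW(3) by (auto simp: van_def ev)
  moreover have "f : polys UNIV" "g : polys UNIV" using f P by auto
  ultimately have "f : van Z \<or> g : van Z" using Z unfolding zprime_def by blast
  then show False using f `x : Z` `y : Z` by (auto simp: van_def)
 qed
 then show "irr zclosed Z" using Z by (auto simp: irr_def zprime_def)
qed

section \<open>Chains of irreducible closed sets\<close>

lemma separated_by_function:
 assumes "zclosed Z" "x ~: Z" obtains f where "f : polys UNIV" "f : van Z" "f x ~= 0"
 using assms unfolding zclosed_def van_def by blast

lemma dim_subset_strict: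
 fixes Y Z :: "('n => 'a::field) set"
 assumes "zprime Y" "dim_is Y s" "zclosed Z" "dim_is Z r" "Z \<subset> Y" shows "r < s"
proof -
 obtain x where "x : Y" "x ~: Z" using assms by blast
 then obtain f where f: "f : polys UNIV" "f : van Z" "f x ~= 0" using separated_by_function[OF assms(3)] by metis
 then show ?thesis using dim_strict[OF assms(1,2) f(1,2)] assms `x : Y` by (auto simp: van_def dim_is_def)
qed

text \<open>Some component of the section \<open>l r = 0\<close> dominates affine
  \<open>r\<close>-space: otherwise the product of one relation per component would vanish on that
  whole space, because \<open>Y\<close> maps onto affine space. Finiteness over the forms restricts
  to the section.\<close>

lemma slice:
 fixes Y :: "('n::finite => 'a::alg_closed_field) set"
 assumes p: "Factorial_Ring.prime CHAR('a)" and Y: "zprime Y" "zclosed Y" "dim_is Y (Suc r)"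
 obtains Z where "irr zclosed Z" "dim_is Z r" "Z \<subset> Y"
proof -
 obtain m l where nf: "normal_forms {Y} l m" "\<exists>Z\<in>{Y}. alg_ind Z l m"
  by (rule noether_normalization[OF p, of "{Y}"]) (use Y in auto)
 have m: "m = Suc r" using dim_is_unique[OF Y(3)] normal_forms_dim_is[OF nf(1), of Y] nf(2) by blast
 have l1: "l i : pfun UNIV {..1}" if "i < Suc r" for i using nf(1) that m by (auto simp: normal_forms_def intro: pfun_mono)
 interpret finite_cover Y l "Suc r"
  by unfold_locales (use Y nf m l1 in "auto simp: normal_forms_def intro: pfun_polys")
 let ?C = "Y \<inter> {x. \<forall>f\<in>{l r}. f x = 0}"
 have C: "zclosed ?C" using Y(2) l1[of r] by (intro zc.Int zclosed_Collect) (auto intro: pfun_polys)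
 note cm = zc.components[OF C]
 have irrZ: "irr zclosed Z" "Z <= ?C" if "Z : comps zclosed ?C" for Z using that by (auto simp: comps_def)
 have "\<exists>Z\<in>comps zclosed ?C. alg_ind Z l r"
 proof (rule ccontr)
  assume "\<not> ?thesis"
  then have "\<forall>Z. \<exists>P. Z : comps zclosed ?C --> P : polys {..<r} \<and> sub l P : van Z \<and> P ~= 0" unfolding alg_ind_def by blast
  from choice[OF this] obtain P where P: "!!Z. Z : comps zclosed ?C ==> P Z : polys {..<r} \<and> sub l (P Z) : van Z \<and> P Z ~= 0" by blast
  let ?P = "\<Prod>Z\<in>comps zclosed ?C. P Z"
  have Pp: "?P : polys {..<r}" using P by (intro polys_prod) blast
  have "?P b = 0" for b
  proof -
   obtain y where y: "y : Y" "!!i. i < Suc r ==> l i y = (b(r := 0)) i" using surjective[of "b(r := 0)"] by blast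
   then have "y : ?C" by simp
   then obtain Z where Z: "Z : comps zclosed ?C" "y : Z" using cm(2) by blast
   have "?P b = ?P (%i. l i y)" by (rule pfun_cong[OF Pp]) (use y(2) in auto)
   also have "... = 0" unfolding prod_fun_apply
    by (rule prod_zero[OF cm(1)]) (use P[OF Z(1)] Z in "auto simp: van_def sub_apply")
   finally show ?thesis .
  qed
  then have "?P = 0" by (auto simp: fun_eq_iff ev)
  moreover have "?P ~= 0" by (rule polys_prod_nonzero[OF cm(1)]) (use P in blast)+
  ultimately show False by simp
 qed
 then obtain Z where Z: "Z : comps zclosed ?C" "alg_ind Z l r" by blast
 have "gen_over Z l r"
 proof -
  obtain n :: nat and w where w: "!!j. j < n ==> w j : polys UNIV"
   "!!t f. f : pfun UNIV {..t} ==> \<exists>a. (\<forall>j<n. a j : pfun {..<Suc r} {..t}) \<and> f - (\<Sum>j<n. sub l (a j) * w j) : van Y"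
   using gen unfolding gen_over_def by blast
  let ?z = "%i. if i = r then 0 else coord i :: (nat, 'a) fn"
  show ?thesis unfolding gen_over_def
  proof (intro exI[of _ n] exI[of _ w] conjI allI ballI impI)
   fix t and f :: "('n, 'a) fn" assume "f : pfun UNIV {..t}"
   then obtain a where a: "!!j. j < n ==> a j : pfun {..<Suc r} {..t}" "f - (\<Sum>j<n. sub l (a j) * w j) : van Y" using w(2) by blast
   have "sub ?z (a j) : pfun {..<r} {..t}" if "j < n" for j
    by (rule sub_pfun_le1[OF a(1)[OF that]]) (auto intro: pfun_zero pfun_coord)
   moreover have "f - (\<Sum>j<n. sub l (sub ?z (a j)) * w j) : van Z" unfolding van_diff_iff
   proof
    fix x assume x: "x : Z"
    then have xC: "x : Y" "l r x = 0" using irrZ(2)[OF Z(1)] by auto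
    have "sub l (sub ?z (a j)) x = sub l (a j) x" if "j < n" for j
     unfolding sub_apply by (rule pfun_cong[OF a(1)[OF that]]) (use xC in "auto simp: ev")
    moreover have "f x = (\<Sum>j<n. sub l (a j) * w j) x" using a(2) xC(1) by (auto simp: van_diff_iff)
    ultimately show "f x = (\<Sum>j<n. sub l (sub ?z (a j)) * w j) x" by (simp add: ev)
   qed
   ultimately show "\<exists>a. (\<forall>j<n. a j : pfun {..<r} {..t}) \<and> f - (\<Sum>j<n. sub l (a j) * w j) : van Z"
    by (intro exI[of _ "%j. sub ?z (a j)"]) blast
  qed (use w(1) in auto)
 qed
 then obtain n where "!!t. hle (pfun UNIV {..t}) (van Z) (n * ((r + t) choose r))" using gen_over_dim by blast
 then have dZ: "dim_is Z r" using alg_ind_dim[OF Z(2) l1] by (auto simp: dim_is_def)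
 moreover have "Z ~= Y" using dim_is_unique[OF Y(3), of r] dZ by auto
 ultimately show ?thesis using that irrZ[OF Z(1)] by blast
qed

definition chain_in :: "('n::finite => 'a::field) set => nat => bool" where
 "chain_in S k \<longleftrightarrow> (\<exists>Y :: nat => ('n => 'a) set. (\<forall>i\<le>k. irr zclosed (Y i) \<and> Y i <= S) \<and> (\<forall>i<k. Y i \<subset> Y (Suc i)))"

lemma chain_top:
 fixes S :: "('n::finite => 'a::alg_closed_field) set"
 assumes p: "Factorial_Ring.prime CHAR('a)" and "chain_in S k"
 obtains Y d where "irr zclosed Y" "Y <= S" "dim_is Y d" "k <= d" "d <= card (UNIV :: 'n set)"
proof -
 obtain Y where Y: "!!i. i <= k ==> irr zclosed (Y i) \<and> Y i <= S" "!!i. i < k ==> Y i \<subset> Y (Suc i)"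
  using assms(2) unfolding chain_in_def by blast
 have "\<exists>d. dim_is (Y i) d \<and> i <= d \<and> d <= card (UNIV :: 'n set)" if "i <= k" for i using that
 proof (induction i)
  case 0
  then show ?case using dim_exists[OF p, of "Y 0"] Y(1)[of 0] by (auto simp: irr_zclosed_iff)
 next
  case (Suc i)
  then obtain d where d: "dim_is (Y i) d" "i <= d" by auto
  obtain d' where d': "dim_is (Y (Suc i)) d'" "d' <= card (UNIV :: 'n set)"
   using dim_exists[OF p, of "Y (Suc i)"] Y(1)[of "Suc i"] Suc.prems by (auto simp: irr_zclosed_iff)
  have "d < d'" using dim_subset_strict[OF _ d'(1) _ d(1)] Y(1)[of i] Y(1)[of "Suc i"] Y(2)[of i] Suc.prems
   by (auto simp: irr_zclosed_iff)
  then show ?case using d d' by (intro exI[of _ d']) auto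
 qed
 from this[OF order.refl] obtain d where "dim_is (Y k) d" "k <= d" "d <= card (UNIV :: 'n set)" by blast
 then show ?thesis using Y(1)[of k] by (intro that[of "Y k" d]) auto
qed

text \<open>Repeated hyperplane sections. Together with \<open>chain_top\<close> this matches the
  exponent of growth with the chain length in the definition of \<open>var_dim\<close>.\<close>

lemma chain_exists:
 fixes Y :: "('n::finite => 'a::alg_closed_field) set"
 assumes p: "Factorial_Ring.prime CHAR('a)"
 shows "irr zclosed Y ==> dim_is Y s ==> chain_in Y s"
proof (induction s arbitrary: Y)
 case 0 then show ?case unfolding chain_in_def by (intro exI[of _ "%_. Y"]) simp
next
 case (Suc s)
 obtain Z where Z: "irr zclosed Z" "dim_is Z s" "Z \<subset> Y" using slice[OF p, of Y s] Suc.prems by (auto simp: irr_zclosed_iff)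
 have "chain_in Z s" using Z(1,2) by (rule Suc.IH)
 then obtain D where D: "\<forall>i\<le>s. irr zclosed (D i) \<and> D i <= Z" "\<forall>i<s. D i \<subset> D (Suc i)"
  unfolding chain_in_def by (elim exE conjE)
 have "D i \<subset> Y" if "i <= s" for i using D(1)[rule_format, OF that] Z(3) by blast
 then show ?case unfolding chain_in_def using D Suc.prems
  by (intro exI[of _ "%i. if i <= s then D i else Y"]) (auto simp: le_Suc_eq less_Suc_eq)
qed

section \<open>Frobenius and descent\<close>

definition pmono :: "('n::finite \<Rightarrow>\<^sub>0 nat) => ('n, 'a::comm_ring_1) fn" where
 "pmono m = (%x. \<Prod>i\<in>UNIV. x i ^ Poly_Mapping.lookup m i)"

lemma peval_eq:
 assumes "finite S" "Poly_Mapping.keys F <= S" "ph 0 = 0"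
 shows "peval ph F x = (\<Sum>m\<in>S. ph (Poly_Mapping.lookup F m) * pmono m x)"
 unfolding peval_def pmono_def by (rule sum.mono_neutral_left) (use assms in "auto simp: in_keys_iff")

lemma pmono_polys: "(pmono m :: ('n::finite, 'a::comm_ring_1) fn) : polys UNIV"
proof -
 have "(pmono m :: ('n, 'a) fn) = (\<Prod>i\<in>UNIV. coord i ^ Poly_Mapping.lookup m i)" by (simp add: pmono_def fun_eq_iff ev)
 then show ?thesis by (simp only:) (auto intro!: polys_prod polys_power pfun_coord)
qed

lemma peval_polys: "peval ph F : polys UNIV"
proof -
 have "peval ph F = (\<Sum>m\<in>Poly_Mapping.keys F. cfun (ph (Poly_Mapping.lookup F m)) * pmono m)"
  by (simp add: peval_def pmono_def fun_eq_iff ev)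
 then show ?thesis by (simp only:) (intro pfun_sum pfun_scale pmono_polys)
qed

lemma polys_peval:
 fixes h :: "('n::finite, 'a::comm_ring_1) fn"
 assumes "h : polys UNIV" shows "\<exists>F. h = peval id F"
 using assms
proof (induction rule: pfun_induct)
 case zero
 have "0 = peval id (0 :: ('n, 'a) mpoly)" by (simp add: peval_def fun_eq_iff ev)
 then show ?case by blast
next
 case (step f d m c)
 obtain F where F: "f = peval id F" using step(4) by blast
 obtain al where al: "m = (\<Prod>i\<in>UNIV. coord i ^ al i)" using monomial_fun_prod[OF step(3)] by metis
 define a where "a = Abs_poly_mapping al"
 have "Poly_Mapping.lookup a = al" unfolding a_def by (rule Abs_poly_mapping_inverse) simp
 then have m: "m x = pmono a x" for x by (simp add: al pmono_def ev)
 let ?G = "Poly_Mapping.single a c + F"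
 let ?S = "insert a (Poly_Mapping.keys F) \<union> Poly_Mapping.keys ?G"
 have "peval id ?G x = c * pmono a x + f x" for x
 proof -
  have "peval id ?G x = (\<Sum>m\<in>?S. (if a = m then c * pmono m x else 0) + Poly_Mapping.lookup F m * pmono m x)"
   by (subst peval_eq[of ?S]) (auto simp: lookup_add lookup_single when_def distrib_right intro!: sum.cong)
  also have "... = c * pmono a x + peval id F x"
   by (subst peval_eq[of ?S F]) (auto simp: sum.distrib)
  finally show ?thesis by (simp add: F)
 qed
 then have "cfun c * m + f = peval id ?G" by (simp add: fun_eq_iff ev m)
 then show ?case by blast
qed

text \<open>Artin's argument for the independence of characters: monomials are multiplicative in the
  point, so a rescaled relation minus a multiple of the original one eliminates a monomial.\<close>

lemma monomials_independent:
 fixes c :: "('n::finite \<Rightarrow>\<^sub>0 nat) => 'a::alg_closed_field"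
 assumes "finite M" "!!x. (\<Sum>m\<in>M. c m * pmono m x) = 0"
 shows "\<forall>m\<in>M. c m = 0"
 using assms
proof (induction M arbitrary: c rule: finite_induct)
 case (insert m1 M)
 have c0: "c m = 0" if m: "m : M" for m
 proof (rule ccontr)
  assume "c m ~= 0"
  have "m ~= m1" using m insert.hyps by blast
  then obtain i where i: "Poly_Mapping.lookup m i ~= Poly_Mapping.lookup m1 i" by (meson poly_mapping_eqI)
  have eq: "pmono m y = pmono m1 y" for y :: "'n => 'a"
  proof -
   have "\<forall>m\<in>M. c m * (pmono m y - pmono m1 y) = 0"
   proof (rule insert.IH)
    fix x
    have mult: "pmono m (%i. x i * y i) = pmono m x * pmono m y" for m
     by (simp add: pmono_def power_mult_distrib prod.distrib)
    have "(\<Sum>m\<in>M. c m * (pmono m y - pmono m1 y) * pmono m x)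
     = (\<Sum>m\<in>insert m1 M. c m * pmono m (%i. x i * y i) - pmono m1 y * (c m * pmono m x))"
     using insert.hyps by (simp add: mult algebra_simps)
    also have "... = 0" using insert.prems by (simp add: sum_subtractf flip: sum_distrib_left)
    finally show "(\<Sum>m\<in>M. c m * (pmono m y - pmono m1 y) * pmono m x) = 0" .
   qed
   then show ?thesis using m `c m ~= 0` by force
  qed
  have "pmono k (%j. if j = i then t else 1) = t ^ Poly_Mapping.lookup k i" for k and t :: 'a
  proof -
   have "pmono k (%j. if j = i then t else 1) = (\<Prod>j\<in>UNIV. if j = i then t ^ Poly_Mapping.lookup k i else 1)"
    unfolding pmono_def by (rule prod.cong) auto
   then show ?thesis by simp
  qed
  then have "poly (Polynomial.monom 1 (Poly_Mapping.lookup m i) - Polynomial.monom 1 (Poly_Mapping.lookup m1 i)) t = (0 :: 'a)" for t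
   using eq[of "%j. if j = i then t else 1"] by (simp add: poly_monom)
  then have "Polynomial.monom (1 :: 'a) (Poly_Mapping.lookup m i) - Polynomial.monom 1 (Poly_Mapping.lookup m1 i) = 0"
   by (rule poly_zero_if_all_roots)
  then show False using i by (metis degree_monom_eq eq_iff_diff_eq_0 zero_neq_one)
 qed
 moreover have "c m1 = 0" using insert.prems[of "%_. 1"] insert.hyps c0 by (simp add: pmono_def)
 ultimately show ?case by simp
qed simp

lemma alg_variety_iff: "alg_variety V \<longleftrightarrow> zclosed V"
proof
 assume "alg_variety V"
 then obtain P where P: "V = alg_zero_set P" by (auto simp: alg_variety_def)
 then have "V = {x. \<forall>f\<in>peval id ` P. f x = 0}" by (auto simp: alg_zero_set_def)
 then show "zclosed V" using zclosed_Collect[of "peval id ` P"] peval_polys by auto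
next
 assume "zclosed V"
 then obtain P where P: "P <= polys UNIV" "V = {x. \<forall>f\<in>P. f x = 0}" by (auto simp: zclosed_def)
 have "P <= peval id ` {F. peval id F : P}" using P(1) polys_peval by blast
 then have "V = alg_zero_set {F. peval id F : P}" unfolding P(2) alg_zero_set_def by auto
 then show "alg_variety V" by (auto simp: alg_variety_def)
qed

lemma abs_irreducible_iff: "abs_irreducible = irr zclosed"
 by (simp add: fun_eq_iff abs_irreducible_def irr_def alg_variety_iff)

section \<open>The Frobenius map\<close>

lemma field_card: "card (UNIV :: 'k::{finite,field} set) \<ge> 2"
 using card_mono[of "UNIV :: 'k set" "{0, 1}"] by simp

lemma power_card: "(x :: 'k::{finite,field}) ^ card (UNIV :: 'k set) = x"
proof (cases "x = 0")
 case False
 have "(\<Prod>y\<in>UNIV - {0}. x * y) = \<Prod>(UNIV - {0})"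
  by (rule prod.reindex_bij_witness[of _ "%y. y / x" "%y. x * y"]) (use False in auto)
 then have "x ^ (card (UNIV :: 'k set) - 1) = 1" by (simp add: prod.distrib)
 then have "x * x ^ (card (UNIV :: 'k set) - 1) = x" by simp
 then show ?thesis using field_card[where 'k = 'k] by (simp flip: power_Suc)
qed (use field_card[where 'k = 'k] in simp)

definition frob :: "'k::{finite,field} alg_closure => 'k alg_closure" where
 "frob x = x ^ card (UNIV :: 'k set)"

lemma frob_to_ac [simp]: "frob (to_ac c) = to_ac c"
 by (simp add: frob_def power_card flip: to_ac_power)

text \<open>The polynomial \<open>(1 + x)^q - x^q - 1\<close> has degree less than \<open>q\<close> and vanishes on the field with \<open>q\<close> elements.\<close>
lemma frob_add: "frob (x + y) = frob x + frob (y :: 'k::{finite,field} alg_closure)"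
proof (cases "y = 0")
 case False
 let ?q = "card (UNIV :: 'k set)"
 have q: "?q > 0" "?q ~= 0" using field_card[where 'k = 'k] by auto
 let ?p = "[:1, 1:] ^ ?q - Polynomial.monom 1 ?q - 1 :: 'k alg_closure poly"
 have "?p = 0"
 proof (rule ccontr)
  assume p0: "?p ~= 0"
  have lc: "degree ([:1, 1:] ^ ?q :: 'k alg_closure poly) = ?q" by (simp add: degree_power_eq)
  have "lead_coeff ([:1, 1:] ^ ?q :: 'k alg_closure poly) = 1" by (simp only: lead_coeff_power) simp
  then have "poly.coeff ?p ?q = 0" using lc q by (simp add: coeff_1)
  moreover have "degree ?p <= ?q" using lc by (intro degree_diff_le) (auto simp: degree_monom_le)
  ultimately have "degree ?p < ?q" using p0 by (metis leading_coeff_0_iff le_neq_implies_less)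
  moreover have "range to_ac <= {x. poly ?p x = 0}"
  proof (rule image_subsetI)
   fix c :: 'k
   have "poly ?p (to_ac c) = to_ac ((c + 1) ^ ?q - c ^ ?q - 1)" by (simp add: poly_monom add.commute)
   then show "to_ac c : {x. poly ?p x = 0}" by (simp only: power_card) simp
  qed
  then have "card (range (to_ac :: 'k => _)) <= card {x. poly ?p x = 0}" by (rule card_mono[OF poly_roots_finite[OF p0]])
  moreover have "card (range (to_ac :: 'k => _)) = ?q" by (rule card_image[OF inj_to_ac])
  ultimately show False using card_poly_roots_bound[OF p0] by simp
 qed
 then have "poly ?p (x / y) = 0" by (simp only: poly_0)
 then have e: "(1 + x / y) ^ ?q = (x / y) ^ ?q + 1" by (simp add: poly_monom diff_eq_eq add.commute)
 have "x + y = y * (1 + x / y)" using False by (simp add: field_simps)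
 then have "frob (x + y) = y ^ ?q * (1 + x / y) ^ ?q" by (simp only: frob_def power_mult_distrib)
 also have "... = frob x + frob y" unfolding e using False by (simp add: frob_def field_simps)
 finally show ?thesis .
qed (use field_card[where 'k = 'k] in "simp add: frob_def")

lemma frob_0 [simp]: "frob 0 = 0" and frob_1 [simp]: "frob 1 = 1"
 using frob_to_ac[of 0] frob_to_ac[of 1] by simp_all
lemma frob_mult: "frob (x * y) = frob x * frob y" by (simp add: frob_def power_mult_distrib)
lemma frob_power: "frob (x ^ n) = frob x ^ n" by (simp add: frob_def power_mult flip: power_mult) (simp add: mult.commute)
lemma frob_uminus: "frob (- x) = - frob x" using frob_add[of x "- x"] by (simp add: eq_neg_iff_add_eq_0 add.commute)
lemma frob_diff: "frob (x - y) = frob x - frob y" using frob_add[of x "- y"] by (simp add: frob_uminus)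
lemma frob_sum: "frob (\<Sum>i\<in>A. f i) = (\<Sum>i\<in>A. frob (f i))"
 by (induction A rule: infinite_finite_induct) (simp_all add: frob_add)
lemma frob_prod: "frob (\<Prod>i\<in>A. f i) = (\<Prod>i\<in>A. frob (f i))"
 by (induction A rule: infinite_finite_induct) (simp_all add: frob_mult)
lemma frob_eq_0 [simp]: "frob x = 0 \<longleftrightarrow> x = (0 :: 'b::{finite,field} alg_closure)"
 using field_card[where 'k = 'b] by (auto simp: frob_def)
lemma frob_eq [simp]: "frob x = frob y \<longleftrightarrow> x = y"
 using frob_eq_0[of "x - y"] by (simp add: frob_diff del: frob_eq_0)
lemma frob_surj: "\<exists>x. frob x = (y :: 'k::{finite,field} alg_closure)"
 unfolding frob_def by (rule nth_root_exists) (use field_card[where 'k = 'k] in simp)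

lemma frob_fixed: "frob c = c \<longleftrightarrow> c : range (to_ac :: 'k::{finite,field} => _)"
proof
 let ?q = "card (UNIV :: 'k set)"
 let ?p = "Polynomial.monom 1 ?q - Polynomial.monom 1 1 :: 'k alg_closure poly"
 assume c: "frob c = c"
 have "poly.coeff ?p ?q = 1" using field_card[where 'k = 'k] by simp
 then have p0: "?p ~= 0" by (metis coeff_0 zero_neq_one)
 have "degree ?p <= ?q" using field_card[where 'k = 'k] by (intro degree_diff_le) (auto simp: degree_monom_eq)
 then have "card {x. poly ?p x = 0} <= ?q" using card_poly_roots_bound[OF p0] by simp
 moreover have "range (to_ac :: 'k => _) <= {x. poly ?p x = 0}" using frob_to_ac by (auto simp: poly_monom frob_def)
 moreover have "card (range (to_ac :: 'k => _)) = ?q" by (rule card_image[OF inj_to_ac])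
 ultimately have "range (to_ac :: 'k => _) = {x. poly ?p x = 0}" by (intro card_seteq poly_roots_finite[OF p0]) auto
 then show "c : range to_ac" using c by (simp add: poly_monom frob_def)
qed auto

text \<open>\<open>x\<close> is a root of a nonzero polynomial over the finite field, and Frobenius
  preserves its finite set of roots; being injective, it returns to \<open>x\<close>.\<close>

lemma frob_periodic: "\<exists>N>0. (frob ^^ N) (x :: 'k::{finite,field} alg_closure) = x"
proof -
 obtain p :: "'k poly" where p: "p ~= 0" "poly (map_poly to_ac p) x = 0" by (rule alg_closure_algebraic)
 let ?P = "map_poly to_ac p"
 have step: "poly ?P (frob y) = frob (poly ?P y)" for y
  by (simp add: poly_altdef frob_sum frob_mult frob_power coeff_map_poly)
 have "poly ?P ((frob ^^ i) x) = 0" for i by (induction i) (simp_all add: p(2) step)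
 then have "range (%i. (frob ^^ i) x) <= {y. poly ?P y = 0}" by auto
 moreover have "?P ~= 0" using p(1) by (simp add: map_poly_eq_0_iff)
 ultimately have "finite (range (%i. (frob ^^ i) x))" using finite_subset poly_roots_finite by blast
 then have "\<not> inj (%i. (frob ^^ i) x)" using finite_imageD infinite_UNIV_nat by blast
 then obtain i j where ij: "i < j" "(frob ^^ i) x = (frob ^^ j) x" unfolding inj_def by (metis linorder_neqE_nat)
 have inj: "(frob ^^ i) y = (frob ^^ i) z ==> y = z" for i and y z :: "'k alg_closure" by (induction i) auto
 have "(frob ^^ j) x = (frob ^^ i) ((frob ^^ (j - i)) x)" using ij(1) by (simp flip: comp_apply[of "frob ^^ i"] funpow_add)
 then have "(frob ^^ (j - i)) x = x" using ij(2) inj by metis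
 then show ?thesis using ij(1) by (intro exI[of _ "j - i"]) simp
qed

section \<open>Conjugation and Galois descent\<close>

definition fro :: "('n => 'k::{finite,field} alg_closure) => 'n => 'k alg_closure" where "fro x = (%i. frob (x i))"

lemma fro_eq [simp]: "fro x = fro y \<longleftrightarrow> x = y" by (auto simp: fro_def fun_eq_iff)

lemma fro_surj: obtains x where "y = fro x"
proof -
 have "\<forall>i. \<exists>z. frob z = y i" using frob_surj by blast
 from choice[OF this] obtain x where "!!i. frob (x i) = y i" by blast
 then show ?thesis using that[of x] by (simp add: fro_def fun_eq_iff)
qed

lemma Fq_points_iff: "x : Fq_points \<longleftrightarrow> fro x = x"
 by (simp add: Fq_points_def fro_def fun_eq_iff frob_fixed)

text \<open>The conjugate of a function: Frobenius applied to its coefficients.\<close>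
definition fconj :: "(('n => 'k::{finite,field} alg_closure) => 'k alg_closure) => ('n => 'k alg_closure) => 'k alg_closure" where
 "fconj f = (%y. frob (f (inv_into UNIV fro y)))"

lemma fconj_fro [simp]: "fconj f (fro x) = frob (f x)"
 by (simp add: fconj_def inv_f_f inj_def)

lemma fconj_eqI:
 fixes f g :: "('n => 'k::{finite,field} alg_closure) => 'k alg_closure"
 assumes "!!x. frob (f x) = g (fro x)" shows "fconj f = g"
proof
 fix y :: "'n => 'k alg_closure"
 note assms
 moreover obtain x where "y = fro x" by (rule fro_surj)
 ultimately show "fconj f y = g y" by simp
qed

lemma fconj_0: "fconj 0 = 0" by (rule fconj_eqI) (simp add: ev)

lemma fconj_monomial: "monomial_fun I d m ==> fconj m = m"
proof (rule fconj_eqI)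
 fix x :: "'a => 'b alg_closure" assume "monomial_fun I d m"
 then show "frob (m x) = m (fro x)"
  by (induction rule: monomial_fun.induct) (simp_all add: ev frob_mult fro_def)
qed

lemma fconj_step: "monomial_fun I d m ==> fconj (cfun c * m + f) = cfun (frob c) * m + fconj f"
proof (rule fconj_eqI)
 fix x assume m: "monomial_fun I d m"
 show "frob ((cfun c * m + f) x) = (cfun (frob c) * m + fconj f) (fro x)"
  using fun_cong[OF fconj_monomial[OF m], of "fro x"] by (simp add: ev frob_add frob_mult)
qed

lemma fconj_pfun: "f : pfun I D ==> fconj f : pfun I D"
proof (induction rule: pfun_induct)
 case (step f d m c)
 have "cfun (frob c) * m + fconj f : pfun I D" by (rule pfun_step) (use step in auto)
 then show ?case by (simp only: fconj_step[OF step(3)])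
next
 case zero
 have "fconj 0 : pfun I D" by (simp add: fconj_0 pfun_zero)
 then show ?case .
qed

lemma fconj_periodic: "f : polys I ==> \<exists>N>0. (fconj ^^ N) f = f"
proof (induction rule: pfun_induct)
 case zero
 have "(fconj ^^ 1) 0 = 0" by (simp add: fconj_0)
 then have "\<exists>N>0. (fconj ^^ N) 0 = 0" by (intro exI[of _ 1]) simp
 then show ?case .
next
 case (step f d m c)
 obtain N where N: "N > 0" "(fconj ^^ N) f = f" using step(4) by blast
 obtain M where M: "M > 0" "(frob ^^ M) c = c" using frob_periodic by blast
 have per: "(g ^^ (i * j)) x = x" if "(g ^^ i) x = x" for g :: "'x => 'x" and i j x
  using that by (induction j) (simp_all add: funpow_add)
 have "(fconj ^^ k) (cfun c * m + f) = cfun ((frob ^^ k) c) * m + (fconj ^^ k) f" for k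
  by (induction k) (simp_all add: fconj_step[OF step(3)])
 then have "(fconj ^^ (N * M)) (cfun c * m + f) = cfun c * m + f"
  using per[OF N(2), of M] per[OF M(2), of N] by (simp add: mult.commute)
 then show ?case using N(1) M(1) by (intro exI[of _ "N * M"]) simp
qed

text \<open>Independence of the monomials forces each coefficient to be fixed by Frobenius.\<close>

lemma fconj_fixed:
 fixes h :: "('n::finite => 'k::{finite,field} alg_closure) => 'k alg_closure"
 assumes "h : polys UNIV" "fconj h = h" shows "\<exists>F. h = peval to_ac F"
proof -
 obtain F where F: "h = peval id F" using polys_peval[OF assms(1)] by blast
 let ?l = "Poly_Mapping.lookup F"
 have fm: "frob (pmono m x) = pmono m (fro x)" for m and x :: "'n => 'k alg_closure"
  by (simp add: pmono_def frob_prod frob_power fro_def)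
 have "(\<Sum>m\<in>Poly_Mapping.keys F. (frob (?l m) - ?l m) * pmono m y) = 0" for y
 proof -
  obtain x where y: "y = fro x" by (rule fro_surj)
  have "h (fro x) = frob (h x)" using fun_cong[OF assms(2), of "fro x"] by simp
  then show ?thesis by (simp add: y F peval_eq[OF finite_keys order.refl] frob_sum frob_mult fm left_diff_distrib sum_subtractf)
 qed
 then have fixd: "\<forall>m\<in>Poly_Mapping.keys F. frob (?l m) - ?l m = 0" by (intro monomials_independent) auto
 define G where "G = Poly_Mapping.map of_ac F"
 have lG: "to_ac (Poly_Mapping.lookup G m) = ?l m" for m
 proof (cases "m : Poly_Mapping.keys F")
  case True
  then have "?l m : range to_ac" using fixd by (simp add: frob_fixed[symmetric])
  then show ?thesis using True by (simp add: G_def Poly_Mapping.map.rep_eq in_keys_iff to_ac_of_ac when_def)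
 qed (simp add: G_def Poly_Mapping.map.rep_eq in_keys_iff when_def)
 have "Poly_Mapping.keys G <= Poly_Mapping.keys F" by (auto simp: in_keys_iff G_def Poly_Mapping.map.rep_eq when_def)
 then have "h x = peval to_ac G x" for x
  unfolding F by (subst (1 2) peval_eq[of "Poly_Mapping.keys F"]) (simp_all add: lG)
 then show ?thesis by blast
qed

lemma coeff_mult_linear:
 fixes R :: "'a::comm_ring_1 poly"
 shows "poly.coeff (R * [:b, 1:]) j = b * poly.coeff R j + (case j of 0 => 0 | Suc i => poly.coeff R i)"
 by (simp add: mult_pCons_right coeff_pCons)

lemma coeff_linear_product_polys:
 assumes "!!i::nat. g i : polys UNIV" shows "(%x. poly.coeff (\<Prod>i<N. [:- g i x, 1:]) j) : polys UNIV"
proof (induction N arbitrary: j)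
 case 0
 have "(%x. poly.coeff (\<Prod>i<0. [:- g i x, 1:]) j) = cfun (if j = 0 then 1 else 0)" by (auto simp: fun_eq_iff ev coeff_1)
 then show ?case by (simp only:) (auto intro: pfun_const)
next
 case (Suc N)
 let ?c = "%j x. poly.coeff (\<Prod>i<N. [:- g i x, 1:]) j"
 have "(%x. poly.coeff (\<Prod>i<Suc N. [:- g i x, 1:]) j) = - g N * ?c j + (case j of 0 => 0 | Suc i => ?c i)"
  by (auto simp: fun_eq_iff ev coeff_mult_linear split: nat.split)
 moreover have "(case j of 0 => 0 | Suc i => ?c i) : polys UNIV" using Suc by (auto split: nat.split intro: pfun_zero)
 moreover have "- g N * ?c j : polys UNIV" using Suc[of j] assms by (intro polys_mult pfun_uminus)
 ultimately show ?case by (simp only: pfun_add)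
qed

lemma frob_coeff_linear_product:
 fixes N :: nat
 shows "frob (poly.coeff (\<Prod>i<N. [:- a i, 1:]) j) = poly.coeff (\<Prod>i<N. [:- frob (a i), 1:]) j"
proof (induction N arbitrary: j)
 case (Suc N)
 show ?case unfolding prod.lessThan_Suc coeff_mult_linear
  by (auto simp: frob_add frob_diff frob_mult frob_uminus Suc split: nat.split)
qed (auto simp: coeff_1)

text \<open>Galois descent: the coefficients of \<open>\<Prod>\<^sub>i (T - f\<^sup>\<sigma>\<^sup>i)\<close> are defined over the finite field and vanish exactly
 where all conjugates of \<open>f\<close> do.\<close>
lemma Fq_variety_iff:
 fixes V :: "('n::finite => 'k::{finite,field} alg_closure) set"
 shows "Fq_variety V \<longleftrightarrow> zclosed V \<and> (\<forall>x. fro x : V \<longleftrightarrow> x : V)"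
proof
 assume "Fq_variety V"
 then obtain P where P: "V = Fq_zero_set P" by (auto simp: Fq_variety_def)
 then have "V = {x. \<forall>f\<in>peval to_ac ` P. f x = 0}" by (auto simp: Fq_zero_set_def)
 then have "zclosed V" using zclosed_Collect[of "peval to_ac ` P"] peval_polys by auto
 moreover have "peval to_ac f (fro x) = frob (peval to_ac f x)" for f :: "('n, 'k) mpoly" and x
  by (simp add: peval_def frob_sum frob_mult frob_prod frob_power fro_def)
 ultimately show "zclosed V \<and> (\<forall>x. fro x : V \<longleftrightarrow> x : V)" by (simp add: P Fq_zero_set_def)
next
 assume V: "zclosed V \<and> (\<forall>x. fro x : V \<longleftrightarrow> x : V)"
 let ?P = "{F. \<forall>x\<in>V. peval to_ac F x = 0}"
 have "x : V" if x: "x : Fq_zero_set ?P" for x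
 proof (rule ccontr)
  assume "x ~: V"
  then obtain f where f: "f : polys UNIV" "f : van V" "f x ~= 0" using separated_by_function[of V x] V by metis
  obtain M where M: "(fconj ^^ Suc M) f = f" using fconj_periodic[OF f(1)] by (metis gr0_conv_Suc)
  define g where "g = (%i. (fconj ^^ i) f)"
  have g: "g i : polys UNIV" "!!y. y : V ==> g i y = 0" for i
  proof (induction i)
   case (Suc i)
   show "g (Suc i) : polys UNIV" using fconj_pfun[OF Suc(1)] by (simp add: g_def)
   fix y assume y: "y : V"
   obtain z where "y = fro z" by (rule fro_surj)
   then show "g (Suc i) y = 0" using Suc(2)[of z] y V by (simp add: g_def)
  qed (use f in "simp_all add: g_def van_def")
  define R where "R = (%y. \<Prod>i<Suc M. [:- g i y, 1:])"
  have R0: "R y = Polynomial.monom 1 (Suc M)" if "!!i. g i y = 0" for y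
   unfolding R_def using that by (simp add: monom_altdef)
  have coef: "poly.coeff (R x) j = 0" if j: "j < Suc M" for j
  proof -
   let ?c = "%y. poly.coeff (R y) j"
   have cp: "?c : polys UNIV" unfolding R_def by (rule coeff_linear_product_polys) (rule g(1))
   \<comment> \<open>Conjugation rotates the linear factors, since the conjugates of
     \<open>f\<close> repeat with period \<open>Suc M\<close>.\<close>
   have "fconj ?c = ?c"
   proof (rule fconj_eqI)
    fix z
    have "frob (?c z) = poly.coeff (\<Prod>i<Suc M. [:- g (Suc i) (fro z), 1:]) j"
     unfolding R_def frob_coeff_linear_product by (simp add: g_def)
    moreover have rot: "(\<Prod>i<Suc M. h (Suc i)) = (\<Prod>i<Suc M. h i)" if "h (Suc M) = h 0" for h :: "nat => 'k alg_closure poly"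
     using that prod.lessThan_Suc_shift[of h M] by (simp add: mult.commute)
    have "g (Suc M) = g 0" using M by (simp add: g_def)
    then have "(\<Prod>i<Suc M. [:- g (Suc i) (fro z), 1:]) = R (fro z)"
     unfolding R_def by (intro rot) simp
    ultimately show "frob (?c z) = ?c (fro z)" by (simp del: prod.lessThan_Suc)
   qed
   then obtain F where F: "?c = peval to_ac F" using fconj_fixed[OF cp] by blast
   have "peval to_ac F y = 0" if "y : V" for y
    using fun_cong[OF F, of y] R0[of y] g(2)[OF that] j by simp
   then have "F : ?P" by simp
   then have "peval to_ac F x = 0" using x unfolding Fq_zero_set_def by blast
   then show ?thesis using fun_cong[OF F, of x] by simp
  qed
  have deg: "degree (R x) = Suc M" unfolding R_def by (subst degree_prod_eq_sum_degree) auto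
  have "poly (R x) (f x) = 0" unfolding R_def prod.lessThan_Suc_shift by (simp add: g_def)
  moreover have "poly (R x) (f x) = (f x) ^ Suc M"
  proof -
   have "lead_coeff (R x) = 1" unfolding R_def lead_coeff_prod by simp
   then have "R x = Polynomial.monom 1 (Suc M)"
    using coef deg by (intro poly_eqI) (metis coeff_eq_0 coeff_monom linorder_neqE_nat)
   then show ?thesis by (simp add: poly_monom)
  qed
  ultimately show False using f(3) by simp
 qed
 then have "V = Fq_zero_set ?P" by (auto simp: Fq_zero_set_def)
 then show "Fq_variety V" unfolding Fq_variety_def by blast
qed

interpretation fq: closed_class "Fq_variety :: ('n::finite => 'k::{finite,field} alg_closure) set => bool"
 by unfold_locales (auto simp: Fq_variety_iff intro: zc.Un zc.Int zc.empty)

lemma Fq_components_eq: "Fq_components = comps Fq_variety"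
 by (simp add: fun_eq_iff Fq_components_def comps_def Fq_irreducible_def irr_def)

section \<open>Dimension and degree\<close>

lemma char_prime: "Factorial_Ring.prime CHAR('k::{finite,field} alg_closure)"
 by (simp add: CHAR_alg_closure prime_CHAR_semidom finite_imp_CHAR_pos)

lemma irr_image:
 assumes h: "bij h" and C: "!!V. C (h ` V) \<longleftrightarrow> C V" shows "irr C (h ` Z) \<longleftrightarrow> irr C Z"
proof -
 have 1: "irr C' (g ` Z)" if g: "bij g" and C': "!!V. C' (g ` V) \<longleftrightarrow> C' V" and Z: "irr C' Z"
  for g :: "'x => 'x" and C' and Z
 proof -
  have "g ` Z = V \<or> g ` Z = W" if VW: "C' V" "C' W" "g ` Z = V \<union> W" for V W
  proof -
   have im: "g ` (g -` V) = V" "g ` (g -` W) = W" using g by (auto simp: bij_def surj_image_vimage_eq)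
   have "Z = g -` (g ` Z)" using g by (simp add: bij_def inj_vimage_image_eq)
   then have "Z = g -` V \<union> g -` W" unfolding VW(3) by (simp only: vimage_Un)
   moreover have "C' (g -` V)" "C' (g -` W)" using VW(1,2) im C' by metis+
   ultimately have "Z = g -` V \<or> Z = g -` W" by (intro irrD[OF Z])
   then show ?thesis using im by metis
  qed
  then show ?thesis using Z C' by (simp add: irr_def)
 qed
 have 2: "inv_into UNIV h ` h ` V = V" "h ` inv_into UNIV h ` V = V" for V
  using h by (simp_all add: bij_def image_inv_f_f image_f_inv_f)
 have "irr C Z" if "irr C (h ` Z)"
  using 1[OF bij_imp_bij_inv[OF h] _ that] C 2 by metis
 then show ?thesis using 1[of h C, OF h C] by metis
qed

lemma bij_fro: "bij (fro :: ('n => 'k::{finite,field} alg_closure) => _)"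
proof (rule bijI)
 show "inj (fro :: ('n => 'k alg_closure) => _)" by (simp add: inj_def)
 show "surj (fro :: ('n => 'k alg_closure) => _)" unfolding surj_def
 proof
  fix y :: "'n => 'k alg_closure" obtain x where "y = fro x" by (rule fro_surj)
  then show "\<exists>x. y = fro x" by blast
 qed
qed

text \<open>Images are described by conjugated equations, preimages by substituting
  \<open>q\<close>-th powers of the coordinates.\<close>

lemma zclosed_fro: "zclosed (fro ` V) \<longleftrightarrow> zclosed (V :: ('n::finite => 'k::{finite,field} alg_closure) set)"
proof
 assume "zclosed V"
 then obtain P where P: "P <= polys UNIV" "V = {x. \<forall>f\<in>P. f x = 0}" by (auto simp: zclosed_def)
 have "y : fro ` V \<longleftrightarrow> (\<forall>f\<in>fconj ` P. f y = 0)" for y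
 proof -
  obtain x where y: "y = fro x" by (rule fro_surj)
  show ?thesis unfolding y P(2) by (auto simp: image_iff)
 qed
 then have "fro ` V = {y. \<forall>f\<in>fconj ` P. f y = 0}" by blast
 moreover have "fconj ` P <= polys UNIV" using P(1) by (auto intro!: fconj_pfun)
 ultimately show "zclosed (fro ` V)" by (simp only: zclosed_Collect)
next
 assume "zclosed (fro ` V)"
 then obtain P where P: "P <= polys UNIV" "fro ` V = {x. \<forall>f\<in>P. f x = 0}" by (auto simp: zclosed_def)
 let ?F = "sub (%i. coord i ^ card (UNIV :: 'k set)) :: (('n => 'k alg_closure) => 'k alg_closure) => _"
 have F: "?F f x = f (fro x)" for f x by (simp add: ev fro_def frob_def)
 have "x : V \<longleftrightarrow> fro x : fro ` V" for x by auto
 then have "V = {x. \<forall>f\<in>?F ` P. f x = 0}" unfolding P(2) by (auto simp: F)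
 moreover have "?F ` P <= polys UNIV" using P(1) by (auto intro!: sub_polys polys_power pfun_coord)
 ultimately show "zclosed V" by (simp only: zclosed_Collect)
qed

text \<open>Conjugation preserves degrees and independence, since every scalar is the Frobenius
  image of another one.\<close>

lemma dim_fro:
 fixes Z :: "('n::finite => 'k::{finite,field} alg_closure) set"
 assumes "dim_is Z s" "dim_is (fro ` Z) t" shows "s <= t"
proof -
 have "hge (pfun UNIV {..d}) (van (fro ` Z)) N" if hge: "hge (pfun UNIV {..d}) (van Z) N" for d N
 proof -
  obtain f where f: "!!j. j < N ==> f j : pfun UNIV {..d}" "indep_mod (van Z) {..<N} f" using hge by (auto simp: hge_def)
  have "indep_mod (van (fro ` Z)) {..<N} (%j. fconj (f j))" unfolding indep_mod_def
  proof (intro allI impI)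
   fix c assume c: "(\<Sum>j<N. cfun (c j) * fconj (f j)) : van (fro ` Z)"
   have "\<forall>j. \<exists>z. frob z = c j" using frob_surj by blast
   from choice[OF this] obtain b where b: "!!j. c j = frob (b j)" by metis
   have "(\<Sum>j<N. cfun (c j) * fconj (f j)) (fro x) = frob ((\<Sum>j<N. cfun (b j) * f j) x)" for x
    by (simp add: ev b frob_sum frob_mult)
   then have "(\<Sum>j<N. cfun (b j) * f j) : van Z" using c by (simp add: van_def)
   then have "\<forall>j\<in>{..<N}. b j = 0" using f(2) unfolding indep_mod_def by blast
   then show "\<forall>j\<in>{..<N}. c j = 0" using b by simp
  qed
  moreover have "\<forall>j<N. fconj (f j) : pfun UNIV {..d}" using f(1) fconj_pfun by blast
  ultimately show ?thesis unfolding hge_def by (intro exI[of _ "%j. fconj (f j)"]) simp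
 qed
 then show ?thesis using assms dim_compare[of "fro ` Z" s] unfolding dim_is_def by blast
qed

text \<open>Frobenius permutes the geometric components, and the union of an invariant set of them
  is again defined over the finite field, so irreducibility makes every nonempty stable set of
  components the full set. This is applied to the components of largest dimension and to those
  through a given rational point.\<close>

lemma geometric_components:
 fixes Y :: "('n::finite => 'k::{finite,field} alg_closure) set"
 assumes Y: "irr Fq_variety Y"
 obtains s where "comps zclosed Y ~= {}" "!!Z. Z : comps zclosed Y ==> dim_is Z s"
  "!!Z. Z : comps zclosed Y ==> Y \<inter> Fq_points <= Z"
proof -
 let ?\<Z> = "comps zclosed Y" and ?F = "(`) fro :: ('n => 'k alg_closure) set => _"
 have YF: "zclosed Y" "fro x : Y \<longleftrightarrow> x : Y" for x using Y by (auto simp: irr_def Fq_variety_iff)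
 have FY: "fro ` Y = Y"
 proof (intro equalityI subsetI)
  fix y assume y: "y : Y"
  obtain x where "y = fro x" by (rule fro_surj)
  then show "y : fro ` Y" using YF(2) y by blast
 qed (use YF(2) in auto)
 have fin: "finite ?\<Z>" and un: "\<Union>?\<Z> = Y" by (rule zc.components[OF YF(1)])+
 have irrF: "irr zclosed (fro ` Z) \<longleftrightarrow> irr zclosed Z" for Z :: "('n => 'k alg_closure) set"
  by (rule irr_image[where C = zclosed and h = fro, OF bij_fro zclosed_fro])
 have Fc: "fro ` Z : ?\<Z>" if Z: "Z : ?\<Z>" for Z
 proof -
  have "W = fro ` Z" if W: "irr zclosed W" "fro ` Z <= W" "W <= Y" for W
  proof -
   have im: "W = fro ` (fro -` W)" using bij_fro by (metis bij_def surj_image_vimage_eq)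
   have "irr zclosed (fro -` W)" using W(1) im irrF by metis
   moreover have "Z <= fro -` W" using W(2) by auto
   moreover have "fro -` W <= Y" using W(3) YF(2) by auto
   ultimately have "fro -` W = Z" using Z unfolding comps_def by blast
   then show ?thesis using im by simp
  qed
  moreover have "fro ` Z <= Y" using Z FY by (auto simp: comps_def)
  ultimately show ?thesis using Z by (simp add: comps_def irrF)
 qed
 have injF: "inj_on ?F S" for S by (rule inj_onI) (metis bij_fro bij_def inj_image_eq_iff)
 have all: "\<A> = ?\<Z>" if A: "\<A> <= ?\<Z>" "\<A> ~= {}" "?F ` \<A> <= \<A>" for \<A>
 proof -
  have FA: "?F ` \<A> = \<A>" using finite_subset[OF A(1) fin] A(3) injF by (rule endo_inj_surj)
  have "?F ` ?\<Z> = ?\<Z>" using fin _ injF by (rule endo_inj_surj) (use Fc in blast)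
  then have FB: "?F ` (?\<Z> - \<A>) = ?\<Z> - \<A>" using FA inj_on_image_set_diff[OF injF[of UNIV], of ?\<Z> \<A>] by simp
  have V: "Fq_variety (\<Union>\<B>)" if B: "\<B> <= ?\<Z>" "?F ` \<B> = \<B>" for \<B>
  proof -
   have "fro ` \<Union>\<B> = \<Union>\<B>" using B(2) by (metis image_Union)
   then have "fro x : \<Union>\<B> \<longleftrightarrow> x : \<Union>\<B>" for x using inj_image_mem_iff[OF bij_is_inj[OF bij_fro], of x "\<Union>\<B>"] by simp
   moreover have "zclosed (\<Union>\<B>)" using finite_subset[OF B(1) fin] B(1) by (intro zc.Union) (auto simp: comps_def irr_def)
   ultimately show ?thesis by (simp add: Fq_variety_iff)
  qed
  have "Y = \<Union>\<A> \<union> \<Union>(?\<Z> - \<A>)" using un A(1) by blast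
  then have "Y = \<Union>\<A> \<or> Y = \<Union>(?\<Z> - \<A>)" using V[OF A(1) FA] V[OF _ FB] by (intro irrD[OF Y]) auto
  moreover have cov: "Z : \<B>" if Z: "Z : ?\<Z>" and sub: "\<B> <= ?\<Z>" and Y: "Y = \<Union>\<B>" for Z \<B>
  proof -
   have B: "irr zclosed W \<and> W <= Y" if "W : \<B>" for W using that sub by (auto simp: comps_def)
   have "finite \<B>" using fin sub by (rule rev_finite_subset)
   moreover have "irr zclosed Z" "Z <= \<Union>\<B>" using Z Y by (auto simp: comps_def)
   moreover have "zclosed W" if "W : \<B>" for W using B[OF that] by (simp add: irr_def)
   ultimately obtain W where W: "W : \<B>" "Z <= W" using zc.irr_Union by meson
   then have "W = Z" using Z B[OF W(1)] by (auto simp: comps_def)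
   then show ?thesis using W(1) by simp
  qed
  ultimately show ?thesis
  proof (elim disjE)
   assume "Y = \<Union>\<A>" then show ?thesis using A(1) cov[of _ \<A>] by blast
  next
   assume "Y = \<Union>(?\<Z> - \<A>)" then show ?thesis using A(1,2) cov[of _ "?\<Z> - \<A>"] by blast
  qed
 qed
 have ne: "?\<Z> ~= {}" using un Y by (auto simp: irr_def)
 have "\<exists>d. dim_is Z d" if "Z : ?\<Z>" for Z
 proof -
  have "zprime Z" using that by (simp add: comps_def irr_zclosed_iff)
  then obtain k where "dim_is Z k" by (rule dim_exists[OF char_prime])
  then show ?thesis by (rule exI[of _ k])
 qed
 then obtain d where d: "!!Z. Z : ?\<Z> ==> dim_is Z (d Z)" by metis
 let ?s = "Max (d ` ?\<Z>)" and ?\<A> = "{Z : ?\<Z>. d Z = Max (d ` ?\<Z>)}"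
 have "?\<A> = ?\<Z>"
 proof (rule all)
  have "?s : d ` ?\<Z>" using fin ne by (intro Max_in) auto
  then show "?\<A> ~= {}" by auto
  show "?F ` ?\<A> <= ?\<A>"
  proof (rule image_subsetI)
   fix Z assume Z: "Z : ?\<A>"
   then have "d Z <= d (fro ` Z)" using dim_fro d Fc by blast
   moreover have "d (fro ` Z) <= ?s" using fin Fc Z by (intro Max_ge) auto
   ultimately show "fro ` Z : ?\<A>" using Z Fc by auto
  qed
 qed auto
 then have "dim_is Z ?s" if "Z : ?\<Z>" for Z
 proof -
  have "Z : ?\<A>" using that `?\<A> = ?\<Z>` by (simp only:)
  then show ?thesis using d[OF that] by simp
 qed
 moreover have "Y \<inter> Fq_points <= Z" if "Z : ?\<Z>" for Z
 proof
  fix x assume x: "x : Y \<inter> Fq_points"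
  have "{Z : ?\<Z>. x : Z} = ?\<Z>"
  proof (rule all)
   show "{Z : ?\<Z>. x : Z} ~= {}" using x un by blast
   have "x : fro ` Z" if "x : Z" for Z using that x imageI[of x Z fro] by (simp add: Fq_points_iff)
   then show "?F ` {Z : ?\<Z>. x : Z} <= {Z : ?\<Z>. x : Z}" using Fc by blast
  qed auto
  then show "x : Z" using that by blast
 qed
 ultimately show thesis using that[of ?s] ne by blast
qed

lemma var_dim_chain: "V ~= {} ==> var_dim V = int (Sup {k. chain_in V k})"
 by (simp add: var_dim_def chain_in_def abs_irreducible_iff)

lemma chain_bound: "chain_in (V :: ('n::finite => 'k::{finite,field} alg_closure) set) k ==> k <= card (UNIV :: 'n set)"
 by (metis chain_top[OF char_prime] le_trans)

lemma var_dim_ge: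
 fixes V :: "('n::finite => 'k::{finite,field} alg_closure) set"
 assumes "irr zclosed Z" "dim_is Z s" "Z <= V" shows "int s <= var_dim V" "chain_in V s"
proof -
 have "chain_in Z s" by (rule chain_exists[OF char_prime assms(1,2)])
 then obtain D where "\<forall>i\<le>s. irr zclosed (D i) \<and> D i <= Z" "\<forall>i<s. D i \<subset> D (Suc i)" unfolding chain_in_def by (elim exE conjE)
 then show c: "chain_in V s" unfolding chain_in_def using assms(3) by (intro exI[of _ D]) blast
 have "s <= Sup {k. chain_in V k}"
  by (rule cSup_upper) (use c chain_bound in \<open>auto intro!: bdd_aboveI[of _ "card (UNIV :: 'n set)"]\<close>)
 moreover have "V ~= {}" using assms(1,3) by (auto simp: irr_def)
 ultimately show "int s <= var_dim V" by (simp add: var_dim_chain)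
qed

lemma var_dim_eq:
 fixes V :: "('n::finite => 'k::{finite,field} alg_closure) set"
 assumes fin: "finite \<Z>" "\<Z> ~= {}" and Z: "!!Z. Z : \<Z> ==> irr zclosed Z" "!!Z. Z : \<Z> ==> dim_is Z s" and V: "V = \<Union>\<Z>"
 shows "var_dim V = int s"
proof -
 obtain Z0 where Z0: "Z0 : \<Z>" using fin by blast
 have "k <= s" if k: "chain_in V k" for k
 proof -
  obtain Y d where Y: "irr zclosed Y" "Y <= V" "dim_is Y d" "k <= d" by (rule chain_top[OF char_prime k])
  have "zclosed Z" if "Z : \<Z>" for Z using Z(1)[OF that] by (simp add: irr_def)
  then obtain Z where Z': "Z : \<Z>" "Y <= Z" using zc.irr_Union[OF fin(1) Y(1)] Y(2) V by blast
  obtain n where n: "!!t. hle (pfun UNIV {..t}) (van Z) (n * ((s + t) choose s))" using Z(2)[OF Z'(1)] by (auto simp: dim_is_def)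
  have "hle (pfun UNIV {..t}) (van Y) (n * ((s + t) choose s))" for t
   by (rule hle_mono[OF n]) (use Z'(2) in "auto simp: van_def")
  then have "d <= s" using dim_compare Y(3) unfolding dim_is_def by blast
  then show ?thesis using Y(4) by simp
 qed
 moreover have "chain_in V s" using var_dim_ge(2)[OF Z(1,2)[OF Z0]] Z0 V by blast
 ultimately have "Sup {k. chain_in V k} = s" by (intro cSup_eq_maximum) auto
 moreover have "V ~= {}" using Z(1)[OF Z0] V Z0 by (auto simp: irr_def)
 ultimately show ?thesis by (simp add: var_dim_chain)
qed

section \<open>Degree and Hilbert function\<close>

lemma linear_form:
 fixes f :: "('n::finite, 'a::comm_ring_1) fn"
 shows "f : pfun UNIV {1} ==> \<exists>a. \<forall>x. f x = (\<Sum>j\<in>UNIV. a j * x j)"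
proof (induction rule: pfun_induct)
 case zero
 have "\<forall>x. (0 :: ('n, 'a) fn) x = (\<Sum>j\<in>UNIV. 0 * x j)" by (simp add: ev)
 then show ?case by (rule exI[of _ "%_. 0"])
next
 case (step f d m c)
 have "monomial_fun UNIV (Suc 0) m" using step(2,3) by simp
 then obtain i m' where "m = coord i * m'" "monomial_fun UNIV 0 m'" by cases auto
 moreover from this(2) have "m' = 1" by cases auto
 ultimately have m: "m = coord i" by simp
 obtain a where a: "!!x. f x = (\<Sum>j\<in>UNIV. a j * x j)" using step(4) by blast
 have "(cfun c * m + f) x = (\<Sum>j\<in>UNIV. (a j + (if j = i then c else 0)) * x j)" for x
  by (simp add: ev m a distrib_right sum.distrib if_distrib[of "%b. b * _"] cong: if_cong)
 then show ?case by (intro exI[of _ "%j. a j + (if j = i then c else 0)"]) simp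
qed

text \<open>\<open>N\<close> bounds the leading coefficient of the Hilbert function, normalized to 1
  for affine space; the shift \<open>c\<close> disappears in \<open>binomial_limit\<close>.\<close>

definition degree_bound :: "('n => 'a::field) set => nat => nat => bool" where
 "degree_bound Z s N \<longleftrightarrow> (\<exists>c. \<forall>t. hle (pfun UNIV {..t}) (van Z) (N * ((s + (t + c)) choose s)))"

lemma degree_bound_mono: "degree_bound Z s N ==> N <= N' ==> degree_bound Z s N'"
 unfolding degree_bound_def by (meson hle_mono mult_le_mono1 order_refl)

lemma linear_section:
 fixes v :: "nat => ('n::finite => 'k::{finite,field} alg_closure) => 'k alg_closure"
 assumes v: "!!i. i < s ==> v i : pfun UNIV {1}" and ind: "alg_ind Z v s"
 shows "affine_subspace_codim s {x. \<forall>i<s. v i x = b i}"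
proof -
 have "\<forall>i. \<exists>a. i < s --> (\<forall>x. v i x = (\<Sum>j\<in>UNIV. a j * x j))" using linear_form[OF v] by blast
 from choice[OF this] obtain a where a: "!!i x. i < s ==> v i x = (\<Sum>j\<in>UNIV. a i j * x j)" by blast
 have "lam i0 = 0" if lam: "\<forall>j. (\<Sum>i<s. lam i * a i j) = 0" and i0: "i0 < s" for lam i0
 proof -
  let ?P = "\<Sum>i<s. cfun (lam i) * coord i :: (nat => 'k alg_closure) => 'k alg_closure"
  have "sub v ?P x = 0" for x
  proof -
   have "sub v ?P x = (\<Sum>i<s. lam i * (\<Sum>j\<in>UNIV. a i j * x j))" by (simp add: ev a)
   also have "... = (\<Sum>j\<in>UNIV. (\<Sum>i<s. lam i * a i j) * x j)"
    by (simp add: sum_distrib_left sum_distrib_right mult.assoc) (rule sum.swap)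
   finally show ?thesis by (simp add: lam)
  qed
  then have "sub v ?P : van Z" by (simp add: van_def)
  moreover have "?P : polys {..<s}" by (intro pfun_sum pfun_scale pfun_coord) auto
  ultimately have "?P = 0" using ind by (auto simp: alg_ind_def)
  then have "?P (%i. if i = i0 then 1 else 0) = 0" by (simp add: ev)
  then show ?thesis using i0 by (simp add: ev if_distrib cong: if_cong)
 qed
 moreover have "{x. \<forall>i<s. v i x = b i} = {x. \<forall>i<s. (\<Sum>j\<in>UNIV. a i j * x j) = b i}" using a by auto
 ultimately show ?thesis unfolding affine_subspace_codim_def by (intro exI[of _ a] exI[of _ b]) blast
qed

text \<open>The fibre that \<open>good_fibre\<close> provides for \<open>Z0\<close> is a linear
  section meeting all of \<open>Y\<close> in finitely many points, so its cardinality is at most the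
  supremum defining the degree. Being a supremum of natural numbers, it is meaningful only for
  bounded counts; \<open>bezout_points\<close> with equations of degree 1 supplies the
  bound.\<close>

lemma irr_degree_bound:
 fixes Y :: "('n::finite => 'k::{finite,field} alg_closure) set"
 assumes fin: "finite \<Z>" "\<Z> ~= {}" and Z: "!!Z. Z : \<Z> ==> irr zclosed Z" "!!Z. Z : \<Z> ==> dim_is Z s" and Y: "Y = \<Union>\<Z>"
  and Z0: "Z0 : \<Z>"
 shows "degree_bound Z0 s (irr_degree Y)"
proof -
 have zp: "zprime Z" "zclosed Z" if "Z : \<Z>" for Z using Z(1)[OF that] by (auto simp: irr_zclosed_iff)
 obtain m v where nf: "normal_forms \<Z> v m" and ex: "\<exists>Z\<in>\<Z>. alg_ind Z v m"
  by (rule noether_normalization[OF char_prime fin zp(1)])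
 have m: "m = s" using ex normal_forms_dim_is[OF nf] Z(2) dim_is_unique by blast
 have v: "v i : pfun UNIV {1}" if "i < s" for i using nf that m by (auto simp: normal_forms_def)
 have go: "gen_over Z v s" "sep_over Z v s" if "Z : \<Z>" for Z using nf that m by (auto simp: normal_forms_def)
 have ai: "alg_ind Z v s" if "Z : \<Z>" for Z
  by (rule alg_ind_of_dim[OF char_prime zp(1)[OF that] go[OF that] v]) (use Z(2)[OF that] in "auto simp: dim_is_def")
 have fc: "finite_cover Z v s" if "Z : \<Z>" for Z
  by unfold_locales (use zp go ai that pfun_polys[OF v] in auto)
 have "\<exists>b c. \<forall>t. hle (pfun UNIV {..t}) (van Z) (card {y:Z. \<forall>i<s. v i y = b i} * ((s + (t + c)) choose s))" if "Z : \<Z>" for Z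
  by (rule finite_cover.good_fibre[OF fc go(2)]) (use that in blast)+
 then have "\<forall>Z. \<exists>b. Z : \<Z> --> degree_bound Z s (card {y:Z. \<forall>i<s. v i y = b i})" unfolding degree_bound_def by blast
 from choice[OF this] obtain b where b: "!!Z. Z : \<Z> ==> degree_bound Z s (card {y:Z. \<forall>i<s. v i y = b Z i})" by blast
 let ?N = "%Z. card {y:Z. \<forall>i<s. v i y = b Z i}"
 let ?S = "{card (Y \<inter> L) | L. affine_subspace_codim s L \<and> finite (Y \<inter> L)}"
 have bdd: "k <= (\<Sum>Z\<in>\<Z>. ?N Z)" if k: "k : ?S" for k
 proof -
  obtain L where L: "k = card (Y \<inter> L)" "affine_subspace_codim s L" "finite (Y \<inter> L)" using k by blast
  obtain a be where a: "L = {x. \<forall>i<s. (\<Sum>j\<in>UNIV. a i j * x j) = be i}" using L(2) unfolding affine_subspace_codim_def by blast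
  have "card (Z \<inter> L) <= ?N Z" if ZZ: "Z : \<Z>" for Z
  proof -
   let ?g = "%i. (\<Sum>j\<in>UNIV. cfun (a i j) * coord j) - cfun (be i)"
   interpret section_points Z s "{..<s}" ?g 1 "Z \<inter> L"
   proof
    show "finite (Z \<inter> L)" using L(3) by (rule rev_finite_subset) (use Y ZZ in blast)
    show "?g i : pfun UNIV {..1}" for i by (intro pfun_diff pfun_sum pfun_scale pfun_coord pfun_const) auto
   qed (use char_prime zp[OF ZZ] Z(2)[OF ZZ] in "auto simp: a ev")
   obtain c where "!!t. hle (pfun UNIV {..t}) (van Z) (?N Z * ((s + (t + c)) choose s))" using b[OF ZZ] by (auto simp: degree_bound_def)
   from bezout_points[OF this] show ?thesis by simp
  qed
  then have "(\<Sum>Z\<in>\<Z>. card (Z \<inter> L)) <= (\<Sum>Z\<in>\<Z>. ?N Z)" by (rule sum_mono)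
  moreover have "card (Y \<inter> L) <= (\<Sum>Z\<in>\<Z>. card (Z \<inter> L))"
  proof -
   have "Y \<inter> L = (\<Union>Z\<in>\<Z>. Z \<inter> L)" using Y by blast
   then show ?thesis using card_UN_le[OF fin(1), of "%Z. Z \<inter> L"] by simp
  qed
  ultimately show ?thesis using L(1) by simp
 qed
 let ?L = "{x. \<forall>i<s. v i x = b Z0 i}"
 have finL: "finite (Y \<inter> ?L)"
 proof -
  have "finite (Z \<inter> ?L)" if "Z : \<Z>" for Z
  proof -
   have "finite {y:Z. \<forall>i<s. (v i - cfun (b Z0 i)) y = 0}"
    by (rule finite_cover.fibre_finite[OF finite_cover.translate[OF fc[OF that]]])
   moreover have "{y:Z. \<forall>i<s. (v i - cfun (b Z0 i)) y = 0} = Z \<inter> ?L" by (auto simp: ev)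
   ultimately show ?thesis by simp
  qed
  then have "finite (\<Union>Z\<in>\<Z>. Z \<inter> ?L)" using fin(1) by blast
  moreover have "Y \<inter> ?L = (\<Union>Z\<in>\<Z>. Z \<inter> ?L)" unfolding Y by blast
  ultimately show ?thesis by (simp only:)
 qed
 have "?N Z0 = card (Z0 \<inter> ?L)" by (rule arg_cong[of _ _ card]) blast
 also have "... <= card (Y \<inter> ?L)" using finL Y Z0 by (intro card_mono) auto
 also have "... <= Sup ?S"
  by (rule cSup_upper) (use linear_section[OF v ai[OF Z0], of "b Z0"] finL bdd in "auto simp: bdd_above_def")
 also have "Sup ?S = irr_degree Y" by (simp add: irr_degree_def var_dim_eq[OF fin Z Y])
 finally show ?thesis by (rule degree_bound_mono[OF b[OF Z0]])
qed

section \<open>Counting rational points\<close>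

lemma finite_Fq_points: "finite (Fq_points :: ('n::finite => 'k::{finite,field} alg_closure) set)"
proof -
 have "Fq_points <= range (%f :: 'n => 'k. %i. to_ac (f i))"
 proof
  fix x :: "'n => 'k alg_closure" assume "x : Fq_points"
  then have "\<forall>i. \<exists>c. x i = to_ac c" by (auto simp: Fq_points_def)
  from choice[OF this] obtain f where "!!i. x i = to_ac (f i)" by blast
  then have "x = (%i. to_ac (f i))" by (rule ext)
  then show "x : range (%f :: 'n => 'k. %i. to_ac (f i))" by blast
 qed
 then show ?thesis by (rule finite_subset) simp
qed

lemma Fq_points_diff: "x : Fq_points ==> y : Fq_points ==> (%i. x i - y i) : Fq_points"
 by (simp add: Fq_points_iff fro_def frob_diff fun_eq_iff)

text \<open>\<open>None\<close> carries an additional equation of degree at most \<open>q\<close>;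
  with \<open>f = 0\<close> all rational points of \<open>Z\<close> are obtained.\<close>

lemma Fq_section:
 fixes Z :: "('n::finite => 'k::{finite,field} alg_closure) set"
 assumes Z: "irr zclosed Z" "dim_is Z s" and f: "f : pfun UNIV {..card (UNIV :: 'k set)}"
 shows "section_points Z s UNIV (%j. case j of None => f | Some i => coord i ^ card (UNIV :: 'k set) - coord i)
  (card (UNIV :: 'k set)) {x : Z \<inter> Fq_points. f x = 0}"
proof
 let ?q = "card (UNIV :: 'k set)"
 fix j :: "'n option"
 have "coord i ^ ?q : pfun UNIV {..?q * 1}" for i :: 'n by (intro pfun_power_le pfun_coord) auto
 then have "coord i ^ ?q - coord i : pfun UNIV {..?q}" for i :: 'n
  using field_card[where 'k = 'k] by (intro pfun_diff pfun_coord) auto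
 then show "(case j of None => f | Some i => coord i ^ ?q - coord i) : pfun UNIV {..?q}"
  using f by (cases j) auto
next
 have "(\<forall>j\<in>UNIV. (case j of None => f | Some i => coord i ^ card (UNIV :: 'k set) - coord i) x = 0) \<longleftrightarrow> f x = 0 \<and> x : Fq_points" for x
  by (simp add: split_option_all ev Fq_points_iff fro_def frob_def fun_eq_iff)
 then show "{x : Z \<inter> Fq_points. f x = 0} = {p : Z. \<forall>j\<in>UNIV. (case j of None => f | Some i => coord i ^ card (UNIV :: 'k set) - coord i) p = 0}"
  by blast
 show "finite {x : Z \<inter> Fq_points. f x = 0}" using finite_Fq_points by (rule rev_finite_subset) blast
qed (use Z char_prime in "auto simp: irr_zclosed_iff")

lemma points_bound:
 fixes Z :: "('n::finite => 'k::{finite,field} alg_closure) set"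
 assumes Z: "irr zclosed Z" "dim_is Z s" "degree_bound Z s N"
 shows "card (Z \<inter> Fq_points) <= N * card (UNIV :: 'k set) ^ s"
proof -
 obtain c where c: "!!t. hle (pfun UNIV {..t}) (van Z) (N * ((s + (t + c)) choose s))" using Z(3) by (auto simp: degree_bound_def)
 show ?thesis using section_points.bezout_points[OF Fq_section[OF Z(1,2) pfun_zero] c] by (simp add: ev Int_def)
qed

text \<open>A hypersurface of degree at most \<open>M\<close> contains the shifted \<open>W\<close>
  but not \<open>Z\<close>, and \<open>M <= q\<close> lets its equation join those of the rational
  points. The factor \<open>q\<close> on the left replaces \<open>q ^ (s - 1)\<close> on the right
  and keeps \<open>s = 0\<close> meaningful.\<close>

lemma intersection_bound:
 fixes Z W :: "('n::finite => 'k::{finite,field} alg_closure) set"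
 assumes Z: "irr zclosed Z" "dim_is Z s" "degree_bound Z s N" and W: "irr zclosed W" "dim_is W s'" "degree_bound W s' M"
  and M: "M <= card (UNIV :: 'k set)" and not: "\<not> Z <= shift u W"
 shows "card (Z \<inter> Fq_points \<inter> shift u W) * card (UNIV :: 'k set) <= N * M * card (UNIV :: 'k set) ^ s"
proof -
 let ?q = "card (UNIV :: 'k set)"
 obtain x0 where x0: "x0 : Z" "x0 ~: shift u W" using not by blast
 have W0: "(%i. x0 i - u i) ~: W"
 proof
  assume "(%i. x0 i - u i) : W"
  then have "(%i. (x0 i - u i) + u i) : shift u W" unfolding shift_def by (rule imageI)
  then show False using x0(2) by simp
 qed
 obtain c where c: "!!t. hle (pfun UNIV {..t}) (van W) (M * ((s' + (t + c)) choose s'))" using W(3) by (auto simp: degree_bound_def)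
 obtain f where f: "f : pfun UNIV {..M}" "f : van W" "f (%i. x0 i - u i) ~= 0"
  by (rule separating_hypersurface[OF char_prime _ _ W(2) W0 c]) (use W(1) in "auto simp: irr_zclosed_iff")
 let ?g = "trans (%i. - u i) f"
 have g: "?g x = f (%i. x i - u i)" for x by (simp add: trans_apply)
 have gp: "?g : pfun UNIV {..M}" by (rule trans_pfun_le[OF f(1)])
 obtain c' where c': "!!t. hle (pfun UNIV {..t}) (van Z) (N * ((s + (t + c')) choose s))" using Z(3) by (auto simp: degree_bound_def)
 have "?g ~: van Z" using x0(1) f(3) by (auto simp: van_def g)
 from section_points.bezout_hypersurface[OF Fq_section[OF Z(1,2)] c' gp this] gp M
 have "card {x : Z \<inter> Fq_points. ?g x = 0} * ?q <= N * M * ?q ^ s" by (auto intro: pfun_mono)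
 moreover have "Z \<inter> Fq_points \<inter> shift u W <= {x : Z \<inter> Fq_points. ?g x = 0}"
  using f(2) by (auto simp: shift_def van_def g)
 then have "card (Z \<inter> Fq_points \<inter> shift u W) <= card {x : Z \<inter> Fq_points. ?g x = 0}"
  by (rule card_mono[rotated]) (rule finite_subset[OF _ finite_Fq_points], blast)
 ultimately show ?thesis by (meson le_trans mult_le_mono1)
qed

lemma irr_degree_bound_single:
 fixes Y :: "('n::finite => 'k::{finite,field} alg_closure) set"
 assumes "irr zclosed Y"
 obtains s where "dim_is Y s" "var_dim Y = int s" "degree_bound Y s (irr_degree Y)"
proof -
 have "zprime Y" using assms by (simp add: irr_zclosed_iff)
 then obtain s where s: "dim_is Y s" by (rule dim_exists[OF char_prime])
 show thesis
  by (rule that[OF s var_dim_eq[of "{Y}"] irr_degree_bound[of "{Y}"]]) (use assms s in auto)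
qed

text \<open>The rational points of a component that is not absolutely irreducible lie on two of its geometric components.\<close>
lemma small_component:
 fixes Y :: "('n::finite => 'k::{finite,field} alg_closure) set"
 assumes Y: "irr Fq_variety Y" and r: "var_dim Y <= int r" "irr zclosed Y ==> var_dim Y < int r"
  and d: "irr_degree Y <= card (UNIV :: 'k set)"
 shows "card (Y \<inter> Fq_points) * card (UNIV :: 'k set) <= irr_degree Y ^ 2 * card (UNIV :: 'k set) ^ r"
proof (cases "irr zclosed Y")
 let ?q = "card (UNIV :: 'k set)" and ?d = "irr_degree Y"
 have q: "1 <= ?q" using field_card[where 'k = 'k] by simp
 case True
 obtain s where s: "dim_is Y s" "var_dim Y = int s" "degree_bound Y s ?d" by (rule irr_degree_bound_single[OF True])
 have "card (Y \<inter> Fq_points) * ?q <= ?d * ?q ^ s * ?q" using points_bound[OF True s(1,3)] by (rule mult_le_mono1)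
 also have "... = ?d * ?q ^ Suc s" by simp
 also have "... <= ?d ^ 2 * ?q ^ r"
  using s(2) r(2)[OF True] q by (intro mult_le_mono power_increasing) (auto simp: power2_eq_square)
 finally show ?thesis .
next
 let ?q = "card (UNIV :: 'k set)" and ?d = "irr_degree Y" and ?\<Z> = "comps zclosed Y"
 have q: "1 <= ?q" using field_card[where 'k = 'k] by simp
 case False
 have zY: "zclosed Y" using Y by (auto simp: irr_def Fq_variety_iff)
 have fin: "finite ?\<Z>" and un: "\<Union>?\<Z> = Y" by (rule zc.components[OF zY])+
 obtain s where ne: "?\<Z> ~= {}" and s: "!!Z. Z : ?\<Z> ==> dim_is Z s" "!!Z. Z : ?\<Z> ==> Y \<inter> Fq_points <= Z"
  by (rule geometric_components[OF Y]) blast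
 have irr: "irr zclosed Z" if "Z : ?\<Z>" for Z using that by (simp add: comps_def)
 obtain Z where Z: "Z : ?\<Z>" using ne by blast
 have "?\<Z> ~= {Z}" using un irr[OF Z] False by auto
 then obtain W where W: "W : ?\<Z>" "W ~= Z" using Z by blast
 have s0: "shift (%i. 0) V = V" for V :: "('n => 'k alg_closure) set" by (simp add: shift_def)
 have "\<not> Z <= shift (%i. 0) W" using Z W unfolding comps_def s0 by blast
 from intersection_bound[OF irr[OF Z] s(1)[OF Z] _ irr[OF W(1)] s(1)[OF W(1)] _ d this]
 have "card (Z \<inter> Fq_points \<inter> W) * ?q <= ?d * ?d * ?q ^ s"
  using irr_degree_bound[OF fin ne irr s(1) un[symmetric]] Z W(1) by (simp add: s0)
 moreover have "card (Y \<inter> Fq_points) <= card (Z \<inter> Fq_points \<inter> W)"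
  using s(2)[OF Z] s(2)[OF W(1)] finite_Fq_points by (intro card_mono) auto
 moreover have "?q ^ s <= ?q ^ r"
  using r(1) var_dim_eq[OF fin ne irr s(1) un[symmetric]] q by (intro power_increasing) auto
 ultimately show ?thesis unfolding power2_eq_square by (blast intro: order.trans[OF mult_le_mono1] order.trans mult_le_mono2)
qed

text \<open>If \<open>Y\<close> lies in the shift of \<open>W\<close> without being equal to it,
  then \<open>W\<close> does not lie in \<open>Y\<close> shifted back, and the estimate applies with
  the roles exchanged.\<close>

lemma large_pair:
 fixes Y W :: "('n::finite => 'k::{finite,field} alg_closure) set"
 assumes Y: "irr zclosed Y" "var_dim Y = int r" and W: "irr zclosed W" "var_dim W = int r"
  and d: "irr_degree Y <= card (UNIV :: 'k set)" "irr_degree W <= card (UNIV :: 'k set)"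
  and u: "u : Fq_points" and ne: "Y ~= shift u W"
 shows "card (Y \<inter> Fq_points \<inter> (shift u W \<inter> Fq_points)) * card (UNIV :: 'k set)
  <= irr_degree Y * irr_degree W * card (UNIV :: 'k set) ^ r"
proof (cases "Y <= shift u W")
 let ?q = "card (UNIV :: 'k set)"
 obtain s where s: "dim_is Y s" "var_dim Y = int s" "degree_bound Y s (irr_degree Y)" by (rule irr_degree_bound_single[OF Y(1)])
 obtain t where t: "dim_is W t" "var_dim W = int t" "degree_bound W t (irr_degree W)" by (rule irr_degree_bound_single[OF W(1)])
 have st: "s = r" "t = r" using s(2) t(2) Y(2) W(2) by auto
 {
  case False
  have "Y \<inter> Fq_points \<inter> (shift u W \<inter> Fq_points) = Y \<inter> Fq_points \<inter> shift u W" by blast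
  then show ?thesis using intersection_bound[OF Y(1) s(1,3) W(1) t(1,3) d(2) False] st by simp
 next
  case True
  let ?v = "%i. - u i"
  obtain w where w: "w : W" "(%i. w i + u i) ~: Y" using True ne unfolding shift_def by blast
  have "w ~: shift ?v Y"
  proof
   assume "w : shift ?v Y"
   then obtain y where "y : Y" "w = (%i. y i + - u i)" unfolding shift_def by blast
   then show False using w(2) by simp
  qed
  then have "\<not> W <= shift ?v Y" using w(1) by blast
  note bound = intersection_bound[OF W(1) t(1,3) Y(1) s(1,3) d(1) this]
  have "Y \<inter> Fq_points \<inter> (shift u W \<inter> Fq_points) <= shift u (W \<inter> Fq_points \<inter> shift ?v Y)"
  proof
   fix x assume x: "x : Y \<inter> Fq_points \<inter> (shift u W \<inter> Fq_points)"
   then obtain b where b: "b : W" "x = (%i. b i + u i)" unfolding shift_def by blast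
   have bx: "b = (%i. x i - u i)" by (simp add: b(2))
   have "b : Fq_points" unfolding bx by (rule Fq_points_diff) (use x u in auto)
   moreover have "(%i. x i + - u i) : shift ?v Y" unfolding shift_def using x by blast
   then have "b : shift ?v Y" unfolding bx by simp
   ultimately show "x : shift u (W \<inter> Fq_points \<inter> shift ?v Y)" unfolding shift_def[of u] b(2) using b(1) by blast
  qed
  then have "card (Y \<inter> Fq_points \<inter> (shift u W \<inter> Fq_points)) <= card (W \<inter> Fq_points \<inter> shift ?v Y)"
   using finite_Fq_points unfolding shift_def[of u] by (intro surj_card_le) auto
  from le_trans[OF mult_le_mono1[OF this] bound] show ?thesis unfolding st by (simp only: mult.commute[of "irr_degree W"])
 }
qed

text \<open>A new element either enlarges the image or creates at least two ordered collisions; this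
  is the origin of the factor 2.\<close>

lemma collision_count:
 assumes "finite A"
 shows "2 * card A <= 2 * card (f ` A) + card {(x, y). x : A \<and> y : A \<and> x ~= y \<and> f x = f y}"
 using assms
proof (induction A rule: finite_induct)
 case (insert a A)
 let ?T = "%A. {(x, y). x : A \<and> y : A \<and> x ~= y \<and> f x = f y}"
 have finT: "finite (?T B)" if "finite B" for B
  by (rule finite_subset[of _ "B \<times> B"]) (use that in auto)
 have sub: "card (?T A) <= card (?T (insert a A))" by (rule card_mono[OF finT]) (use insert in auto)
 show ?case
 proof (cases "f a : f ` A")
  case True
  then obtain b where b: "b : A" "f a = f b" by blast
  have "card (?T A \<union> {(a, b), (b, a)}) = card (?T A) + 2"
  proof (subst card_Un_disjoint)
   show "?T A \<inter> {(a, b), (b, a)} = {}" using insert.hyps by auto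
   have "a ~= b" using insert.hyps b(1) by blast
   then show "card (?T A) + card {(a, b), (b, a)} = card (?T A) + 2" by simp
  qed (use finT insert.hyps in auto)
  moreover have "card (?T A \<union> {(a, b), (b, a)}) <= card (?T (insert a A))"
   by (rule card_mono[OF finT]) (use insert.hyps b in auto)
  ultimately show ?thesis using insert True by (simp add: insert_absorb)
 next
  case False
  then show ?thesis using insert sub by simp
 qed
qed simp

lemma finite_diffset: "finite U ==> finite (diffset U)"
proof -
 assume "finite U"
 moreover have "diffset U = (%(v, w) i. v i - w i) ` (U \<times> U)" by (force simp: diffset_def)
 ultimately show ?thesis by simp
qed

text \<open>A collision \<open>a + u = b + v\<close> is determined by \<open>v\<close>, the nonzero
  difference \<open>w = v - u\<close> and \<open>a\<close>, which lies in \<open>P\<close> and in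
  its shift by \<open>w\<close>.\<close>

lemma representation_count:
 fixes P U :: "('n => 'a::ab_group_add) set"
 assumes "finite P" "finite U"
 shows "2 * (card P * card U) <= 2 * card (sumset P U) + card U * (\<Sum>w\<in>diffset U - {%i. 0}. card (P \<inter> shift w P))"
proof -
 let ?f = "%(a, u) i. a i + u i :: 'a" and ?W = "diffset U - {%i. 0}"
 let ?T = "{(x, y). x : P \<times> U \<and> y : P \<times> U \<and> x ~= y \<and> ?f x = ?f y}"
 let ?g = "%(v, w, a). ((a, %i. v i - w i), (%i. a i - w i, v))"
 let ?R = "U \<times> (SIGMA w:?W. P \<inter> shift w P)"
 have finR: "finite ?R" using assms finite_diffset[OF assms(2)] by (intro finite_cartesian_product finite_SigmaI) auto
 have "?T <= ?g ` ?R"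
 proof
  fix z assume "z : ?T"
  then obtain a u b v where z: "z = ((a, u), (b, v))" "a : P" "u : U" "b : P" "v : U" "(a, u) ~= (b, v)"
   and e: "(%i. a i + u i) = (%i. b i + v i)" by auto
  define w where "w = (%i. v i - u i)"
  have e': "a i + u i = b i + v i" for i using e by (rule fun_cong)
  have a: "a = (%i. b i + w i)" using e' by (simp add: w_def fun_eq_iff algebra_simps eq_diff_eq)
  have "w ~= (%i. 0)"
  proof
   assume "w = (%i. 0)"
   then have "a = b" "u = v" using a by (auto simp: w_def fun_eq_iff)
   then show False using z(6) by simp
  qed
  then have "w : ?W" using z(3,5) by (auto simp: w_def diffset_def)
  moreover have "a : P \<inter> shift w P" using z(2,4) a by (auto simp: shift_def)
  ultimately have "(v, w, a) : ?R" using z(5) by blast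
  moreover have "z = ?g (v, w, a)" by (simp add: z(1) a) (simp add: w_def)
  ultimately show "z : ?g ` ?R" by (rule rev_image_eqI)
 qed
 then have "card ?T <= card ?R" using finR by (rule surj_card_le[rotated])
 also have "card ?R = card U * (\<Sum>w\<in>?W. card (P \<inter> shift w P))"
  using assms finite_diffset[OF assms(2)] by (simp add: card_cartesian_product)
 finally have "card ?T <= card U * (\<Sum>w\<in>?W. card (P \<inter> shift w P))" .
 moreover have "?f ` (P \<times> U) = sumset P U" by (force simp: sumset_def)
 ultimately show ?thesis using collision_count[of "P \<times> U" ?f] assms by (simp add: card_cartesian_product)
qed

text \<open>For \<open>x = a + w\<close> with rational points \<open>x\<close> and \<open>a\<close>
  of \<open>XX\<close>, either one of them lies on a component in \<open>B\<close>, or both lie on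
  components in \<open>A\<close>; the two exceptional cases give the factor 2.\<close>

lemma final_bound:
 fixes XX U :: "('n::finite => 'k::{finite,field} alg_closure) set"
 defines "XF == XX \<inter> Fq_points" and "A == top_abs_components XX" and "B == Fq_components XX - top_abs_components XX"
 assumes var: "Fq_variety XX" and U: "U <= Fq_points" and w: "w : diffset U"
 shows "card (XF \<inter> shift w XF) <= (\<Sum>Y\<in>A. \<Sum>Z\<in>A. card (Y \<inter> Fq_points \<inter> (shift w Z \<inter> Fq_points))) + 2 * (\<Sum>Y\<in>B. card (Y \<inter> Fq_points))"
proof -
 let ?I = "%Y Z. Y \<inter> Fq_points \<inter> (shift w Z \<inter> Fq_points)"
 have C: "finite (Fq_components XX)" "\<Union>(Fq_components XX) = XX"
  unfolding Fq_components_eq by (rule fq.components[OF var])+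
 have AB: "A <= Fq_components XX" "Fq_components XX = A \<union> B" "finite A" "finite B"
  using C(1) by (auto simp: A_def B_def top_abs_components_def)
 let ?SB = "\<Union>Y\<in>B. Y \<inter> Fq_points"
 have "XF \<inter> shift w XF <= (\<Union>Y\<in>A. \<Union>Z\<in>A. ?I Y Z) \<union> (?SB \<union> shift w ?SB)"
 proof
  fix x assume x: "x : XF \<inter> shift w XF"
  then obtain a where a: "a : XF" "x = (%i. a i + w i)" unfolding shift_def by blast
  obtain Y where Y: "Y : Fq_components XX" "x : Y" using x C(2) unfolding XF_def by blast
  obtain Z where Z: "Z : Fq_components XX" "a : Z" using a(1) C(2) unfolding XF_def by blast
  have xa: "x : Fq_points" "a : Fq_points" using x a(1) by (auto simp: XF_def)
  consider "Y : B" | "Z : B" | "Y : A" "Z : A" using Y(1) Z(1) AB(2) by blast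
  then show "x : (\<Union>Y\<in>A. \<Union>Z\<in>A. ?I Y Z) \<union> (?SB \<union> shift w ?SB)"
  proof cases
   case 1 then show ?thesis using Y(2) xa by blast
  next
   case 2 then have "a : ?SB" using Z(2) xa by blast
   then have "x : shift w ?SB" unfolding a(2) shift_def by (rule imageI)
   then show ?thesis by blast
  next
   case 3
   have "x : shift w Z" using Z(2) unfolding a(2) shift_def by (rule imageI)
   then show ?thesis using 3 Y(2) xa by blast
  qed
 qed
 then have "card (XF \<inter> shift w XF) <= card ((\<Union>Y\<in>A. \<Union>Z\<in>A. ?I Y Z) \<union> (?SB \<union> shift w ?SB))"
  by (rule card_mono[rotated]) (use AB finite_Fq_points in "auto simp: shift_def")
 also have "... <= card (\<Union>Y\<in>A. \<Union>Z\<in>A. ?I Y Z) + (card ?SB + card (shift w ?SB))"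
  by (meson add_le_mono card_Un_le le_trans order_refl)
 also have "card (shift w ?SB) <= card ?SB" unfolding shift_def by (rule card_image_le) (use AB finite_Fq_points in auto)
 also have "card ?SB <= (\<Sum>Y\<in>B. card (Y \<inter> Fq_points))" by (rule card_UN_le[OF AB(4)])
 also have "card (\<Union>Y\<in>A. \<Union>Z\<in>A. ?I Y Z) <= (\<Sum>Y\<in>A. \<Sum>Z\<in>A. card (?I Y Z))"
  by (rule order.trans[OF card_UN_le[OF AB(3)] sum_mono[OF card_UN_le[OF AB(3)]]])
 finally show ?thesis by simp
qed

theorem theorem3p3:
  fixes XX U :: "('n::finite \<Rightarrow> 'k::{finite,field} alg_closure) set"
  defines "XF \<equiv> XX \<inter> Fq_points"
  defines "Delta \<equiv> int (card XF * card U) - int (card (sumset XF U))"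
  defines "A \<equiv> top_abs_components XX"
  defines "B \<equiv> Fq_components XX - top_abs_components XX"
  assumes var: "Fq_variety XX"
    and deg: "var_degree XX < card (UNIV :: 'k set)"
    and Une: "U \<noteq> {}"
    and Usub: "U \<subseteq> Fq_points"
  shows "(Delta \<le> int (card U) *
           ((\<Sum>u\<in>diffset U - {\<lambda>i. 0}. \<Sum>Yi\<in>A. \<Sum>Yj\<in>A.
                int (card (Yi \<inter> Fq_points \<inter> (shift u Yj \<inter> Fq_points))))
            + 2 * (int (card (diffset U)) - 1) * (\<Sum>Y\<in>B. int (card (Y \<inter> Fq_points)))))
         \<and> (ess_shift_free XX (diffset U) \<longrightarrow>
         real_of_int Delta \<le> real (card U) * (real (card (diffset U)) - 1)
            * real (var_degree XX) ^ 2 * real (card (UNIV :: 'k set)) powi (var_dim XX - 1))"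
proof -
 let ?W = "diffset U - {%i. 0}" and ?q = "card (UNIV :: 'k set)" and ?d = "irr_degree" and ?D = "var_degree XX"
 let ?I = "%u Y Z. card (Y \<inter> Fq_points \<inter> (shift u Z \<inter> Fq_points))" and ?P = "%Y. card (Y \<inter> Fq_points)"
 let ?S = "%u. (\<Sum>Y\<in>A. \<Sum>Z\<in>A. ?I u Y Z) + 2 * (\<Sum>Y\<in>B. ?P Y)"
 have finU: "finite U" using finite_subset[OF Usub finite_Fq_points] .
 have finF: "finite XF" by (simp add: XF_def finite_Fq_points)
 have finW: "finite (diffset U)" by (rule finite_diffset[OF finU])
 obtain u0 where "u0 : U" using Une by blast
 then have "(%i. u0 i - u0 i) : diffset U" unfolding diffset_def by blast
 then have "(%i. 0) : diffset U" by simp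
 then have cW: "card (diffset U) = Suc (card ?W)" using finW by (metis card_Suc_Diff1)
 have "2 * (card XF * card U) <= 2 * card (sumset XF U) + card U * (\<Sum>u\<in>?W. card (XF \<inter> shift u XF))"
  by (rule representation_count[OF finF finU])
 also have "(\<Sum>u\<in>?W. card (XF \<inter> shift u XF)) <= (\<Sum>u\<in>?W. ?S u)"
  unfolding A_def B_def XF_def by (intro sum_mono final_bound[OF var Usub]) blast
 finally have main: "2 * (card XF * card U) <= 2 * card (sumset XF U) + card U * (\<Sum>u\<in>?W. ?S u)" by simp
 have "2 * a <= 2 * b + c ==> 2 * (int a - int b) <= int c" for a b c :: nat by simp
 \<comment> \<open>Part (i) gives the factor 2 away, part (ii) needs it.\<close>
 from this[OF main] have i: "2 * Delta <= int (card U * (\<Sum>u\<in>?W. ?S u))" by (simp only: Delta_def)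
 then have "Delta <= int (card U * (\<Sum>u\<in>?W. ?S u))" by linarith
 also have "int (card U * (\<Sum>u\<in>?W. ?S u)) = int (card U) * ((\<Sum>u\<in>?W. \<Sum>Yi\<in>A. \<Sum>Yj\<in>A. int (?I u Yi Yj))
      + 2 * (int (card (diffset U)) - 1) * (\<Sum>Y\<in>B. int (?P Y)))"
  by (simp add: cW sum.distrib algebra_simps)
 finally have part1: "Delta <= ..." .
 have part2: "real_of_int Delta <= real (card U) * (real (card (diffset U)) - 1) * real ?D ^ 2 * real ?q powi (var_dim XX - 1)"
  if free: "ess_shift_free XX (diffset U)"
 proof (cases "XX = {}")
  \<comment> \<open>Here the dimension is -1, and the defect is 0.\<close>
  case True
  then have "Delta = 0" by (simp add: Delta_def XF_def sumset_def)
  then show ?thesis by (simp add: cW)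
 next
  case False
  define r where "r = nat (var_dim XX)"
  have r: "var_dim XX = int r" using False by (simp add: r_def var_dim_def)
  have C: "finite (Fq_components XX)" "\<Union>(Fq_components XX) = XX"
   unfolding Fq_components_eq by (rule fq.components[OF var])+
  have AB: "Fq_components XX = A \<union> B" "A \<inter> B = {}" "finite A" "finite B"
   using C(1) by (auto simp: A_def B_def top_abs_components_def)
  have D: "?D = (\<Sum>Y\<in>A. ?d Y) + (\<Sum>Y\<in>B. ?d Y)"
   unfolding var_degree_def AB(1) by (rule sum.union_disjoint[OF AB(3,4,2)])
  have dq: "?d Y <= ?q" if "Y : A \<union> B" for Y
  proof -
   have "?d Y <= ?D" unfolding var_degree_def by (rule member_le_sum) (use that AB(1) C(1) in auto)
   then show ?thesis using deg by simp
  qed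
  have pair: "?I u Y Z * ?q <= ?d Y * ?d Z * ?q ^ r" if u: "u : ?W" and YZ: "Y : A" "Z : A" for u Y Z
  proof (rule large_pair)
   show "Y ~= shift u Z" using free u YZ unfolding ess_shift_free_def A_def by blast
   show "u : Fq_points" using u Usub by (auto simp: diffset_def intro: Fq_points_diff)
  qed (use YZ dq in "auto simp: A_def top_abs_components_def abs_irreducible_iff r")
  have single: "?P Y * ?q <= ?d Y ^ 2 * ?q ^ r" if Y: "Y : B" for Y
  proof (rule small_component)
   have Yc: "Y : comps Fq_variety XX" using Y by (simp add: B_def Fq_components_eq)
   then show Yi: "irr Fq_variety Y" by (simp add: comps_def)
   then have zY: "zclosed Y" by (simp add: irr_def Fq_variety_iff)
   obtain s where ne: "comps zclosed Y ~= {}" and s: "!!Z. Z : comps zclosed Y ==> dim_is Z s"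
    by (rule geometric_components[OF Yi]) blast
   have un: "\<Union>(comps zclosed Y) = Y" and fin: "finite (comps zclosed Y)" by (rule zc.components[OF zY])+
   have irr: "irr zclosed Z" if "Z : comps zclosed Y" for Z using that by (simp add: comps_def)
   obtain Z where Z: "Z : comps zclosed Y" using ne by blast
   have "Z <= XX" using Z Yc by (auto simp: comps_def)
   from var_dim_ge(1)[OF irr[OF Z] s[OF Z] this] have "int s <= int r" using r by simp
   then show le: "var_dim Y <= int r" using var_dim_eq[OF fin ne irr s un[symmetric]] by simp
   show "var_dim Y < int r" if "irr zclosed Y"
    using le that Y r by (auto simp: B_def top_abs_components_def abs_irreducible_iff)
   show "?d Y <= ?q" using dq Y by blast
  qed
  have S: "?S u * ?q <= 2 * ?D ^ 2 * ?q ^ r" if u: "u : ?W" for u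
  proof -
   have "(\<Sum>Y\<in>A. \<Sum>Z\<in>A. ?I u Y Z) * ?q = (\<Sum>Y\<in>A. \<Sum>Z\<in>A. ?I u Y Z * ?q)" by (simp add: sum_distrib_right)
   also have "... <= (\<Sum>Y\<in>A. \<Sum>Z\<in>A. ?d Y * ?d Z * ?q ^ r)" by (intro sum_mono pair[OF u])
   also have "... = (\<Sum>Y\<in>A. ?d Y) ^ 2 * ?q ^ r"
    unfolding power2_eq_square sum_product by (simp only: sum_distrib_right)
   finally have 1: "(\<Sum>Y\<in>A. \<Sum>Z\<in>A. ?I u Y Z) * ?q <= (\<Sum>Y\<in>A. ?d Y) ^ 2 * ?q ^ r" .
   have "(\<Sum>Y\<in>B. ?P Y) * ?q <= (\<Sum>Y\<in>B. ?d Y ^ 2) * ?q ^ r"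
    unfolding sum_distrib_right by (intro sum_mono single)
   also have "(\<Sum>Y\<in>B. ?d Y ^ 2) <= (\<Sum>Y\<in>B. ?d Y) ^ 2"
    unfolding power2_eq_square sum_distrib_right
    by (intro sum_mono mult_le_mono2 member_le_sum) (use AB(4) in auto)
   finally have 2: "(\<Sum>Y\<in>B. ?P Y) * ?q <= (\<Sum>Y\<in>B. ?d Y) ^ 2 * ?q ^ r" by simp
   have "?S u * ?q <= ((\<Sum>Y\<in>A. ?d Y) ^ 2 + 2 * (\<Sum>Y\<in>B. ?d Y) ^ 2) * ?q ^ r" using 1 2 by (simp add: distrib_right)
   \<comment> \<open>With \<open>a\<close> and \<open>b\<close> the degree sums over
     \<open>A\<close> and \<open>B\<close>: \<open>a ^ 2 + 2 * b ^ 2 <= 2 * (a + b) ^ 2\<close>. The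
     2 cancels against the one in \<open>2 * Delta\<close>.\<close>
   also have "... <= 2 * ?D ^ 2 * ?q ^ r" unfolding D by (intro mult_le_mono1) (simp add: power2_sum)
   finally show ?thesis .
  qed
  have "(\<Sum>u\<in>?W. ?S u) * ?q <= (\<Sum>u\<in>?W. 2 * ?D ^ 2 * ?q ^ r)" unfolding sum_distrib_right by (intro sum_mono S)
  then have "card U * ((\<Sum>u\<in>?W. ?S u) * ?q) <= card U * (card ?W * (2 * ?D ^ 2 * ?q ^ r))" by simp
  then have "int (card U * (\<Sum>u\<in>?W. ?S u)) * int ?q <= int (card U * (card ?W * (2 * ?D ^ 2 * ?q ^ r)))"
   unfolding of_nat_mult[symmetric] of_nat_le_iff by (simp only: mult.assoc)
  moreover have "2 * Delta * int ?q <= int (card U * (\<Sum>u\<in>?W. ?S u)) * int ?q" using i by (intro mult_right_mono) auto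
  ultimately have "2 * Delta * int ?q <= int (card U * (card ?W * (2 * ?D ^ 2 * ?q ^ r)))" by (rule order.trans[rotated])
  then have "real_of_int (2 * Delta * int ?q) <= real_of_int (int (card U * (card ?W * (2 * ?D ^ 2 * ?q ^ r))))"
   by (simp only: of_int_le_iff)
  \<comment> \<open>All estimates carry a factor \<open>q\<close> on the left, so that the exponent
    \<open>r - 1\<close>, which is negative for \<open>r = 0\<close>, appears only at the
    end.\<close>
  then have le: "real_of_int Delta * real ?q <= real (card U) * real (card ?W) * real ?D ^ 2 * real ?q ^ r" by simp
  have q: "real ?q > 0" using field_card[where 'k = 'k] by simp
  then have "real ?q powi (var_dim XX - 1) = real ?q ^ r / real ?q" by (simp add: r power_int_diff)
  moreover have "real (card (diffset U)) - 1 = real (card ?W)" by (simp add: cW)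
  ultimately show ?thesis using le q by (simp add: pos_le_divide_eq)
 qed
 show ?thesis using part1 part2 by blast
qed

end
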